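(* Let $N\ge2$, let $\Omega\subset\mathbb{R}^N$ be a bounded Lipschitz domain and let $s\in(0,1)$. Let $p\in C(\mathbb{R}^N\times\mathbb{R}^N)$ be symmetric (i.e. $p(x,y)=p(y,x)$ for all $x,y\in\mathbb{R}^N$) with $$1<p^-:=\inf_{(x,y)\in\mathbb{R}^N\times\mathbb{R}^N}p(x,y)\le\sup_{(x,y)\in\mathbb{R}^N\times\mathbb{R}^N}p(x,y)<\frac Ns,$$ and write $p(x):=p(x,x)$ and $p_s^*(x):=\frac{Np(x)}{N-sp(x)}$. Assume that $$\inf_{\epsilon>0}\ \sup_{\substack{(x,y)\in\mathbb{R}^N\times\mathbb{R}^N\\0<|x-y|<1/2}}\Big|p(x,y)-p^-_{B_\epsilon(x,y)}\Big|\log\frac1{|x-y|}<\infty,\qquad\text{where } p^-_{B_\epsilon(x,y)}:=\inf_{(x',y')\in B_\epsilon(x,y)}p(x',y').$$ Let $f:\Omega\times\mathbb{R}\to\mathbb{R}$ be a Carathéodory function and $F(x,t):=\int_0^tf(x,\tau)\,d\tau$. Assume: (F1) there exist a constant $C>0$ and $q\in C_+(\overline\Omega)$ with $q(x)<p_s^*(x)$ for all $x\in\overline\Omega$ such that $|f(x,t)|\le C(1+|t|^{q(x)-1})$ for a.e. $x\in\Omega$ and all $t\in\mathbb{R}$; (F2) there exists a constant $t_0>0$ such that for a.e. $x\in\Omega$ and all $t$ with $0<|t|<t_0$, $f$ is odd in $t$ (i.e. $f(x,-t)=-f(x,t)$) and $p^-F(x,t)-f(x,t)t>0$; (F3) $\displaystyle\lim_{t\to0}\frac{f(x,t)}{|t|^{p^--2}t}=+\infty$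 uniformly for a.e. $x\in\Omega$. Then the problem $$(-\Delta)^s_{p(x)}u+|u|^{p(x)-2}u=f(x,u)\ \text{ in }\Omega,\qquad u=0\ \text{ in }\mathbb{R}^N\setminus\Omega,$$ has a sequence of weak solutions $\{u_n\}$ satisfying $\|u_n\|_{L^\infty(\Omega)}\to0$ as $n\to\infty$.
   Context: $B_\epsilon(x,y)$ is the open ball of radius $\epsilon$ centered at $(x,y)$ in $\mathbb{R}^N\times\mathbb{R}^N=\mathbb{R}^{2N}$, and $B_\varepsilon(x)$ is the open ball of radius $\varepsilon$ centered at $x$ in $\mathbb{R}^N$. $C_+(\overline\Omega)$ is the set of $h\in C(\overline\Omega)$ with $1<\inf_{\overline\Omega}h\le\sup_{\overline\Omega}h<\infty$. $W^{s,p(\cdot,\cdot)}(\mathbb{R}^N)$ is the space of measurable $u:\mathbb{R}^N\to\mathbb{R}$ with $\int_{\mathbb{R}^N}|u(x)|^{p(x,x)}\,dx<\infty$ and $\int_{\mathbb{R}^N}\int_{\mathbb{R}^N}\frac{|u(x)-u(y)|^{p(x,y)}}{|x-y|^{N+sp(x,y)}}\,dx\,dy<\infty$. It is endowed with the norm $\|u\|_{s,p}=\inf\{\lambda>0:\int_{\mathbb{R}^N}|u/\lambda|^{p(x,x)}dx\le1\}+\inf\{\lambda>0:\int_{\mathbb{R}^N}\int_{\mathbb{R}^N}\frac{|u(x)-u(y)|^{p(x,y)}}{\lambda^{p(x,y)}|x-y|^{N+sp(x,y)}}dx\,dy<1\}$, and $$W_0^{s,p(\cdot,\cdot)}(\Omega):=\{u\in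 W^{s,p(\cdot,\cdot)}(\mathbb{R}^N):u=0\text{ in }\mathbb{R}^N\setminus\Omega\}.$$ The fractional $p(\cdot)$-Laplacian is $$(-\Delta)^s_{p(x)}u(x)=2\lim_{\varepsilon\searrow0}\int_{\mathbb{R}^N\setminus B_\varepsilon(x)}\frac{|u(x)-u(y)|^{p(x,y)-2}(u(x)-u(y))}{|x-y|^{N+sp(x,y)}}\,dy,\quad x\in\mathbb{R}^N.$$ A weak solution of the problem is a function $u\in W_0^{s,p(\cdot,\cdot)}(\Omega)$ such that for all $v\in W_0^{s,p(\cdot,\cdot)}(\Omega)$ $$\int_{\mathbb{R}^N}\int_{\mathbb{R}^N}\frac{|u(x)-u(y)|^{p(x,y)-2}(u(x)-u(y))(v(x)-v(y))}{|x-y|^{N+sp(x,y)}}\,dx\,dy+\int_\Omega|u|^{p(x)-2}uv\,dx=\int_\Omega f(x,u)v\,dx.$$ *)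

theory Defs
  imports "HOL-Analysis.Analysis" "HOL-Probability.Essential_Supremum"
begin

text \<open>Near each boundary point the domain is, after choosing a unit vector \<open>e\<close> as the
  vertical direction, the strict epigraph of a Lipschitz function defined on the hyperplane
  orthogonal to \<open>e\<close>.\<close>

definition lipschitz_boundary :: "(real^'n) set \<Rightarrow> bool" where
  "lipschitz_boundary \<Omega> \<longleftrightarrow>
     (\<forall>z\<in>frontier \<Omega>. \<exists>r>0. \<exists>e L. \<exists>\<gamma> :: real^'n \<Rightarrow> real.
        norm e = 1 \<and> L-lipschitz_on {y. y \<bullet> e = 0} \<gamma> \<and>
        \<Omega> \<inter> ball z r = {x \<in> ball z r. \<gamma> (x - (x \<bullet> e) *\<^sub>R e) < x \<bullet> e})"

definition bounded_lipschitz_domain :: "(real^'n) set \<Rightarrow> bool" where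
  "bounded_lipschitz_domain \<Omega> \<longleftrightarrow>
     open \<Omega> \<and> connected \<Omega> \<and> \<Omega> \<noteq> {} \<and> bounded \<Omega> \<and> lipschitz_boundary \<Omega>"

definition C_plus :: "(real^'n) set \<Rightarrow> (real^'n \<Rightarrow> real) set" where
  "C_plus S = {h. continuous_on S h \<and> 1 < (INF x\<in>S. ereal (h x)) \<and> (SUP x\<in>S. ereal (h x)) < \<infinity>}"

definition crit_exp :: "real \<Rightarrow> ((real^'n) \<times> (real^'n) \<Rightarrow> real) \<Rightarrow> real^'n \<Rightarrow> real" where
  "crit_exp s p x = real CARD('n) * p (x, x) / (real CARD('n) - s * p (x, x))"

text \<open>The infimum and the supremum are taken in \<open>ereal\<close>, so that an infinite supremum
  is really infinite. The inner \<open>INF\<close> is real and is meaningful because this condition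
  is only used for \<open>p\<close> bounded below.\<close>

definition log_holder_cond :: "((real^'n) \<times> (real^'n) \<Rightarrow> real) \<Rightarrow> bool" where
  "log_holder_cond p \<longleftrightarrow>
     (INF \<epsilon>\<in>{0<..}. SUP (x, y)\<in>{(x, y). 0 < norm (x - y) \<and> norm (x - y) < 1/2}.
        ereal (\<bar>p (x, y) - (INF z\<in>ball (x, y) \<epsilon>. p z)\<bar> * ln (1 / norm (x - y)))) < \<infinity>"

definition caratheodory :: "(real^'n) set \<Rightarrow> (real^'n \<Rightarrow> real \<Rightarrow> real) \<Rightarrow> bool" where
  "caratheodory \<Omega> f \<longleftrightarrow>
     (\<forall>t. (\<lambda>x. f x t) \<in> borel_measurable (lebesgue_on \<Omega>)) \<and>
     (AE x in lebesgue_on \<Omega>. continuous_on UNIV (f x))"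

text \<open>The interval integral is oriented, i.e. it changes sign for \<open>t < 0\<close>.\<close>

definition primitive :: "(real^'n \<Rightarrow> real \<Rightarrow> real) \<Rightarrow> real^'n \<Rightarrow> real \<Rightarrow> real" where
  "primitive f x t = (LBINT \<tau>=0..t. f x \<tau>)"

text \<open>On the null set \<open>x = y\<close> the quotients below are \<open>0\<close> by
  the convention \<open>a / 0 = 0\<close>.\<close>

definition frac_sobolev :: "real \<Rightarrow> ((real^'n) \<times> (real^'n) \<Rightarrow> real) \<Rightarrow> (real^'n \<Rightarrow> real) set" where
  "frac_sobolev s p = {u. u \<in> borel_measurable lebesgue \<and>
     (\<integral>\<^sup>+ x. ennreal (\<bar>u x\<bar> powr p (x, x)) \<partial>lebesgue) < \<infinity> \<and>
     (\<integral>\<^sup>+ (x, y). ennreal (\<bar>u x - u y\<bar> powr p (x, y)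
          / norm (x - y) powr (real CARD('n) + s * p (x, y))) \<partial>(lebesgue \<Otimes>\<^sub>M lebesgue)) < \<infinity>}"

definition frac_sobolev0 ::
  "(real^'n) set \<Rightarrow> real \<Rightarrow> ((real^'n) \<times> (real^'n) \<Rightarrow> real) \<Rightarrow> (real^'n \<Rightarrow> real) set" where
  "frac_sobolev0 \<Omega> s p = {u \<in> frac_sobolev s p. AE x in lebesgue. x \<notin> \<Omega> \<longrightarrow> u x = 0}"

definition weak_form_integrand ::
  "real \<Rightarrow> ((real^'n) \<times> (real^'n) \<Rightarrow> real) \<Rightarrow> (real^'n \<Rightarrow> real) \<Rightarrow> (real^'n \<Rightarrow> real)
    \<Rightarrow> (real^'n) \<times> (real^'n) \<Rightarrow> real" where
  "weak_form_integrand s p u v = (\<lambda>(x, y).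
     \<bar>u x - u y\<bar> powr (p (x, y) - 2) * (u x - u y) * (v x - v y)
       / norm (x - y) powr (real CARD('n) + s * p (x, y)))"

text \<open>Bochner integrals of non-integrable functions are \<open>0\<close>, so the existence of the three
  integrals in the weak formulation is required explicitly.\<close>

definition weak_solution ::
  "(real^'n) set \<Rightarrow> real \<Rightarrow> ((real^'n) \<times> (real^'n) \<Rightarrow> real) \<Rightarrow> (real^'n \<Rightarrow> real \<Rightarrow> real)
    \<Rightarrow> (real^'n \<Rightarrow> real) \<Rightarrow> bool" where
  "weak_solution \<Omega> s p f u \<longleftrightarrow> u \<in> frac_sobolev0 \<Omega> s p \<and>
     (\<forall>v \<in> frac_sobolev0 \<Omega> s p.
        integrable (lebesgue \<Otimes>\<^sub>M lebesgue) (weak_form_integrand s p u v) \<and>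
        integrable (lebesgue_on \<Omega>) (\<lambda>x. \<bar>u x\<bar> powr (p (x, x) - 2) * u x * v x) \<and>
        integrable (lebesgue_on \<Omega>) (\<lambda>x. f x (u x) * v x) \<and>
        (\<integral>z. weak_form_integrand s p u v z \<partial>(lebesgue \<Otimes>\<^sub>M lebesgue))
          + (\<integral>x. \<bar>u x\<bar> powr (p (x, x) - 2) * u x * v x \<partial>(lebesgue_on \<Omega>))
        = (\<integral>x. f x (u x) * v x \<partial>(lebesgue_on \<Omega>)))"

definition Linf_norm :: "(real^'n) set \<Rightarrow> (real^'n \<Rightarrow> real) \<Rightarrow> ereal" where
  "Linf_norm \<Omega> u = esssup (lebesgue_on \<Omega>) (\<lambda>x. ereal \<bar>u x\<bar>)"

end

theory Submission
  imports Defs "HOL-Homology.Homology"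
begin

text \<open>
  Weak solutions are the critical points of \<open>J(u) = E(u) - \<integral>F(x,u)\<close>, where \<open>E\<close> is the convex
  energy formed by the two modulars \<open>|u(x) - u(y)|\<^sup>p/p\<close> (with the singular weight) and
  \<open>|u|\<^sup>p/p\<close>. A solution with small supremum only sees \<open>f\<close> near \<open>t = 0\<close>, so \<open>f\<close> is multiplied
  by an even cutoff that decreases in \<open>|t|\<close>. The result \<open>g\<close> is bounded and odd, and its primitive
  \<open>G\<close> satisfies \<open>p\<^sup>- G - g t > 0\<close> for \<^emph>\<open>every\<close> \<open>t \<noteq> 0\<close> (\<open>truncated_subhomogeneous\<close>).
  Since \<open>E'(u)u \<ge> p\<^sup>- E(u)\<close>, a critical point at level \<open>0\<close> must vanish. Critical points whose
  negative levels tend to \<open>0\<close> therefore tend to \<open>0\<close>, and it suffices to find, for every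
  \<open>\<delta> > 0\<close>, a critical point with \<open>-\<delta> \<le> J < 0\<close>
  (\<open>small_negative_critical_point\<close>, \<open>vanishing_critical_sequence\<close>).

  Such levels come from a minimax argument. On the one hand \<open>\<integral>G(x,tv)\<close> beats \<open>t\<close> to the power
  \<open>p\<^sup>-\<close> as \<open>t \<rightarrow> 0\<close>, so \<open>J\<close> is negative on suitable spheres of every dimension
  (\<open>negative_spheres\<close>). On the other hand \<open>J(u) \<le> -\<delta>\<close> keeps \<open>u\<close> away from \<open>0\<close>, and by
  compactness one of \<open>k = k(\<delta>)\<close> fixed averages of \<open>u\<close> is then nonzero
  (\<open>J_low_separation\<close>). By the Borsuk--Ulam theorem no odd image of the \<open>k\<close>-sphere lies in
  \<open>{J \<le> -\<delta>}\<close>, so the minimax value of \<open>J\<close> over odd images of the \<open>k\<close>-sphere lies in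
  \<open>[-\<delta>,0)\<close>. The minimax is carried out on finite dimensional Galerkin spaces, where the
  deformation is a single explicit gradient step (\<open>minimax_critical_point\<close>). The dimension then
  tends to infinity along a countable family that is dense for the \<open>L\<^sup>1\<close> distance together with
  the value of \<open>E\<close>. This passage uses only the tangent inequality
  \<open>E(u) + \<integral>g(x,u)(w - u) \<le> E(w)\<close>, which survives weak limits because \<open>E\<close> is convex
  (\<open>limit_weakly_critical\<close>).

  Compactness and regularity both rest on one elementary inequality: for \<open>|x - y| \<le> r\<close>,
  a difference \<open>a\<close> satisfies
  \<open>|a| \<le> r\<^bsup>N+s\<^esup> |a|\<^sup>p / |x - y|\<^bsup>N+sp\<^esup> + r\<^sup>s\<close>, whatever the exponent (\<open>osc_pointwise\<close>).
  Averaged over the cells of a grid it bounds the \<open>L\<^sup>1\<close> norm by finitely many cell averages and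
  a small multiple of the energy (\<open>finite_rank_estimate\<close>). Averaged over balls of twice the
  measure of the support it gives a gain for functions of small support
  (\<open>small_support_estimate\<close>), and De Giorgi's iteration turns this into the statement that a critical
  point with small mean has small supremum (\<open>small_mean_small_sup\<close>). The critical points found
  above are then so small that \<open>g\<close> and \<open>f\<close> agree on their values.
\<close>

section \<open>The Borsuk--Ulam theorem\<close>

definition unit_sphere :: "nat \<Rightarrow> (nat \<Rightarrow> real) set" where
  "unit_sphere n = {x. (\<Sum>i\<le>n. (x i)\<^sup>2) = 1 \<and> (\<forall>i>n. x i = 0)}"

lemma nsphere_eq: "nsphere n = top_of_set (unit_sphere n)"
  by (simp add: nsphere unit_sphere_def euclidean_product_topology)

lemma topspace_nsphere_eq: "topspace (nsphere n) = unit_sphere n"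
  by (simp add: nsphere_eq)

lemma abs_unit_sphere_le: "x \<in> unit_sphere n \<Longrightarrow> \<bar>x i\<bar> \<le> 1"
proof (cases "i \<le> n")
  case True
  assume x: "x \<in> unit_sphere n"
  have "(x i)\<^sup>2 \<le> (\<Sum>i\<le>n. (x i)\<^sup>2)"
    using True by (intro member_le_sum) auto
  then show ?thesis using x by (simp add: unit_sphere_def abs_square_le_1)
qed (auto simp: unit_sphere_def)

lemma uminus_unit_sphere: "x \<in> unit_sphere n \<Longrightarrow> (\<lambda>i. - x i) \<in> unit_sphere n"
  by (simp add: unit_sphere_def)

lemma closed_unit_sphere: "closed (unit_sphere n)"
proof -
  have "unit_sphere n = {x. (\<Sum>i\<le>n. (x i)\<^sup>2) = 1} \<inter> (\<Inter>i\<in>{n<..}. {x. x i = 0})"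
    by (auto simp: unit_sphere_def)
  moreover have "closed {x::nat\<Rightarrow>real. (\<Sum>i\<le>n. (x i)\<^sup>2) = 1}"
    by (intro closed_Collect_eq continuous_intros continuous_on_product_coordinates)
  moreover have "closed {x::nat\<Rightarrow>real. x i = 0}" for i
    by (intro closed_Collect_eq continuous_intros continuous_on_product_coordinates)
  ultimately show ?thesis by (auto intro!: closed_Int closed_INT)
qed

lemma compact_box: "compact {x::nat\<Rightarrow>real. \<forall>i. x i \<in> {a i..b i}}"
proof -
  have "compactin (powertop_real UNIV) (PiE UNIV (\<lambda>i. {a i..b i}))"
    unfolding compactin_PiE by (auto simp: compactin_euclidean_iff)
  moreover have "PiE UNIV (\<lambda>i. {a i..b i}) = {x::nat\<Rightarrow>real. \<forall>i. x i \<in> {a i..b i}}"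
    by (auto simp: PiE_def Pi_def)
  ultimately show ?thesis
    by (simp add: euclidean_product_topology compactin_euclidean_iff)
qed

lemma compact_unit_sphere: "compact (unit_sphere n)"
proof -
  have "unit_sphere n \<subseteq> {x. \<forall>i. x i \<in> {- 1..1}}"
    using abs_unit_sphere_le by (force simp: abs_le_iff)
  then have "unit_sphere n = {x. \<forall>i. x i \<in> {- 1..1}} \<inter> unit_sphere n" by auto
  then show ?thesis
    by (metis compact_box[of "\<lambda>_. -1" "\<lambda>_. 1"] compact_Int_closed closed_unit_sphere)
qed

definition radial_proj :: "nat \<Rightarrow> (nat \<Rightarrow> real) \<Rightarrow> nat \<Rightarrow> real" where
  "radial_proj n y = (\<lambda>i. if i \<le> n then y i / sqrt (\<Sum>j\<le>n. (y j)\<^sup>2) else 0)"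

lemma sum_sq_pos:
  fixes y :: "nat \<Rightarrow> real"
  assumes "\<exists>i\<le>n. y i \<noteq> 0"
  shows "(\<Sum>j\<le>n. (y j)\<^sup>2) > 0"
proof -
  obtain i where "i \<le> n" "y i \<noteq> 0" using assms by auto
  then have "0 < (y i)\<^sup>2" "(y i)\<^sup>2 \<le> (\<Sum>j\<le>n. (y j)\<^sup>2)"
    by (auto intro!: member_le_sum)
  then show ?thesis by linarith
qed

lemma radial_proj_in: "\<exists>i\<le>n. y i \<noteq> 0 \<Longrightarrow> radial_proj n y \<in> unit_sphere n"
proof -
  assume "\<exists>i\<le>n. y i \<noteq> 0"
  then have pos: "(\<Sum>j\<le>n. (y j)\<^sup>2) > 0" by (rule sum_sq_pos)
  have "(\<Sum>i\<le>n. (radial_proj n y i)\<^sup>2) = (\<Sum>i\<le>n. (y i)\<^sup>2 / (\<Sum>j\<le>n. (y j)\<^sup>2))"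
    using pos by (intro sum.cong) (auto simp: radial_proj_def power_divide)
  also have "\<dots> = 1" using pos by (simp add: sum_divide_distrib[symmetric])
  finally show ?thesis by (simp add: unit_sphere_def radial_proj_def)
qed

lemma radial_proj_id: "x \<in> unit_sphere n \<Longrightarrow> radial_proj n x = x"
  by (auto simp: radial_proj_def unit_sphere_def fun_eq_iff)

lemma radial_proj_uminus: "radial_proj n (\<lambda>i. - y i) = (\<lambda>i. - radial_proj n y i)"
  by (auto simp: radial_proj_def)

lemma continuous_on_radial_proj:
  assumes "continuous_on A F" "\<And>x. x \<in> A \<Longrightarrow> \<exists>i\<le>n. F x i \<noteq> 0"
  shows "continuous_on A (\<lambda>x. radial_proj n (F x))"
  unfolding radial_proj_def
proof (rule continuous_on_coordinatewise_then_product)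
  fix i
  have c: "continuous_on A (\<lambda>x. F x j)" for j
    using continuous_on_product_then_coordinatewise[OF assms(1)] .
  show "continuous_on A (\<lambda>x. if i \<le> n then F x i / sqrt (\<Sum>j\<le>n. (F x j)\<^sup>2) else 0)"
    using sum_sq_pos[OF assms(2)] by (cases "i \<le> n") (auto intro!: continuous_intros c simp: less_imp_neq[symmetric] order.strict_implies_not_eq[symmetric])
qed

lemma continuous_map_radial_proj:
  assumes "continuous_on (unit_sphere n) F" "\<And>x. x \<in> unit_sphere n \<Longrightarrow> \<exists>i\<le>n. F x i \<noteq> 0"
  shows "continuous_map (nsphere n) (nsphere n) (\<lambda>x. radial_proj n (F x))"
  unfolding nsphere_eq continuous_map_subtopology_eu
  using continuous_on_radial_proj[OF assms] radial_proj_in[OF assms(2)] by auto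

lemma degree_homotopy:
  assumes c: "continuous_on ({0..1} \<times> unit_sphere n) (\<lambda>(t,x). H t x)"
    and nz: "\<And>t x. t \<in> {0..1::real} \<Longrightarrow> x \<in> unit_sphere n \<Longrightarrow> \<exists>i\<le>n. H t x i \<noteq> 0"
  shows "Brouwer_degree2 n (\<lambda>x. radial_proj n (H 0 x)) = Brouwer_degree2 n (\<lambda>x. radial_proj n (H 1 x))"
proof (rule Brouwer_degree2_homotopic)
  have "continuous_on ({0..1} \<times> unit_sphere n) (\<lambda>z. radial_proj n (case z of (t,x) \<Rightarrow> H t x))"
    using nz by (intro continuous_on_radial_proj c) auto
  then show "homotopic_with (\<lambda>x. True) (nsphere n) (nsphere n) (\<lambda>x. radial_proj n (H 0 x)) (\<lambda>x. radial_proj n (H 1 x))"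
    unfolding homotopic_with_def nsphere_eq
    using radial_proj_in[OF nz]
    by (intro exI[of _ "\<lambda>z. radial_proj n (case z of (t,x) \<Rightarrow> H t x)"]) auto
qed

text \<open>A Lipschitz image of the \<open>n\<close>-sphere in \<open>n + 1\<close> dimensions has no interior, by counting. If the
  image contained a cube, it would contain a grid of \<open>K^(n+1)\<close> points at mutual distance of order
  \<open>1/K\<close>, hence the sphere would contain as many points at mutual distance of order \<open>1/K\<close>. But a point of the
  sphere is determined up to an error \<open>1/M\<close> by the index and sign of one coordinate that is bounded
  away from zero, together with the integer parts of \<open>M\<close> times the other \<open>n\<close> coordinates, and for \<open>M\<close>
  proportional to \<open>K\<close> there are only \<open>O(K^n)\<close> such codes.\<close>

lemma lipschitz_image_misses:
  fixes H :: "(nat \<Rightarrow> real) \<Rightarrow> nat \<Rightarrow> real"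
  assumes S: "S \<subseteq> unit_sphere n" and e: "0 < e"
    and lip: "\<And>j x y. j \<le> n \<Longrightarrow> x \<in> S \<Longrightarrow> y \<in> S \<Longrightarrow> \<bar>H x j - H y j\<bar> \<le> L * (\<Sum>i\<le>n. \<bar>x i - y i\<bar>)"
  shows "\<exists>d. (\<forall>j. \<bar>d j\<bar> \<le> e) \<and> (\<forall>x\<in>S. \<exists>j\<le>n. H x j \<noteq> d j)"
proof (rule ccontr)
  assume neg: "\<not> ?thesis"
  define L' where "L' = max L 1"
  have L': "L' > 0" and lip': "\<And>j x y. j \<le> n \<Longrightarrow> x \<in> S \<Longrightarrow> y \<in> S \<Longrightarrow> \<bar>H x j - H y j\<bar> \<le> L' * (\<Sum>i\<le>n. \<bar>x i - y i\<bar>)"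
  proof -
    show "L' > 0" by (auto simp: L'_def)
    fix j x y assume "j \<le> n" "x \<in> S" "y \<in> S"
    then show "\<bar>H x j - H y j\<bar> \<le> L' * (\<Sum>i\<le>n. \<bar>x i - y i\<bar>)"
      by (rule order_trans[OF lip]) (auto simp: L'_def intro!: mult_right_mono sum_nonneg)
  qed
  \<comment> \<open>\<open>M = B * K\<close> makes points with the same code closer than preimages of distinct grid points; \<open>K\<close> then outgrows the codes\<close>
  obtain B :: nat where B: "real B > (real n + 1)^2 * L' / e"
    using reals_Archimedean2 by blast
  have B0: "B > 0"
    using B L' e by (metis divide_nonneg_pos gr0I less_eq_real_def mult_nonneg_nonneg not_less of_nat_0 zero_le_power2)
  define K :: nat where "K = 2 * (n+1) * (3*B)^n + 1"
  have K0: "K > 0" by (simp add: K_def)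
  define M :: nat where "M = B * K"
  have M0: "M > 0" using B0 K0 by (simp add: M_def)
  define G where "G = PiE {..n} (\<lambda>_. {..<K})"
  have cardG: "card G = K^(n+1)" by (simp add: G_def card_PiE)
  have ex: "\<exists>x\<in>S. \<forall>j\<le>n. H x j = e * real (a j) / K" if "a \<in> G" for a
  proof -
    define d where "d j = (if j \<le> n then e * real (a j) / K else 0)" for j
    have "\<bar>d j\<bar> \<le> e" for j
    proof -
      have "j \<le> n \<Longrightarrow> real (a j) \<le> real K"
        using that by (auto simp: G_def PiE_def Pi_def intro: less_imp_le)
      then show "\<bar>d j\<bar> \<le> e"
        using e K0 by (auto simp: d_def field_simps)
    qed
    then have "\<not> (\<forall>x\<in>S. \<exists>j\<le>n. H x j \<noteq> d j)"
      using neg by blast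
    then obtain x where "x \<in> S" "\<forall>j\<le>n. H x j = d j"
      by blast
    then have "\<forall>j\<le>n. H x j = e * real (a j) / K"
      by (simp add: d_def)
    with \<open>x \<in> S\<close> show ?thesis by blast
  qed
  then obtain X where X: "\<And>a. a \<in> G \<Longrightarrow> X a \<in> S" "\<And>a j. a \<in> G \<Longrightarrow> j \<le> n \<Longrightarrow> H (X a) j = e * real (a j) / K"
    by metis
  define I where "I x = (SOME i. i \<le> n \<and> \<bar>x i\<bar> \<ge> 1 / (real n + 1))" for x :: "nat \<Rightarrow> real"
  have I: "I x \<le> n \<and> \<bar>x (I x)\<bar> \<ge> 1 / (real n + 1)" if x: "x \<in> unit_sphere n" for x
    unfolding I_def
  proof (rule someI_ex, rule ccontr)
    assume "\<nexists>i. i \<le> n \<and> 1 / (real n + 1) \<le> \<bar>x i\<bar>"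
    then have *: "\<bar>x i\<bar> < 1 / (real n + 1)" if "i \<le> n" for i using that by force
    have "(x i)\<^sup>2 < 1 / (real n + 1)" if "i \<le> n" for i
    proof -
      have "(x i)\<^sup>2 = \<bar>x i\<bar> * \<bar>x i\<bar>" by (simp add: power2_eq_square)
      also have "\<dots> \<le> 1 * \<bar>x i\<bar>" by (intro mult_right_mono abs_unit_sphere_le[OF x]) auto
      finally show ?thesis using *[OF that] by simp
    qed
    then have "(\<Sum>i\<le>n. (x i)\<^sup>2) < (\<Sum>i\<le>n. 1 / (real n + 1))"
      by (intro sum_strict_mono) auto
    then show False using x by (simp add: unit_sphere_def field_simps)
  qed
  define code where "code x = (I x, x (I x) > 0, restrict (\<lambda>j. if j = I x then 0 else \<lfloor>real M * x j\<rfloor>) {..n})"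
    for x :: "nat \<Rightarrow> real"
  define Codes where "Codes = (SIGMA i:{..n}. (UNIV::bool set) \<times> PiE {..n} (\<lambda>j. if j = i then {0} else {- int M..int M}))"
  have finC: "finite Codes"
    unfolding Codes_def by (intro finite_SigmaI finite_cartesian_product finite_PiE) auto
  have cardC: "card Codes = (n+1) * (2 * (2*M+1)^n)"
  proof -
    have "card (PiE {..n} (\<lambda>j. if j = i then {0} else {- int M..int M})) = (2*M+1)^n" if "i \<le> n" for i
    proof -
      have "card (PiE {..n} (\<lambda>j. if j = i then {0} else {- int M..int M}))
          = (\<Prod>j\<in>{..n}. if j = i then 1 else 2*M+1)"
        by (subst card_PiE) (auto intro!: prod.cong)
      also have "\<dots> = (\<Prod>j\<in>{..n}-{i}. 2*M+1)"
        using that by (subst prod.remove[of _ i]) (auto intro!: prod.cong)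
      also have "\<dots> = (2*M+1)^n" using that by simp
      finally show ?thesis .
    qed
    then show ?thesis
      unfolding Codes_def
      by (subst card_SigmaI) (auto simp: card_cartesian_product finite_PiE)
  qed
  have codein: "code x \<in> Codes" if "x \<in> unit_sphere n" for x
  proof -
    have "- real M \<le> real M * x j \<and> real M * x j \<le> real M" for j
      using abs_unit_sphere_le[OF that, of j] mult_left_mono[of "x j" 1 "real M"] mult_left_mono[of "-1" "x j" "real M"]
      by (auto simp: abs_le_iff)
    then have "\<lfloor>real M * x j\<rfloor> \<in> {- int M..int M}" for j
      by (simp add: le_floor_iff) (metis floor_mono floor_of_nat)
    then show ?thesis using I[OF that] by (auto simp: code_def Codes_def)
  qed
  have close: "(\<Sum>j\<le>n. \<bar>x j - y j\<bar>) \<le> (real n + 1)^2 / M"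
    if x: "x \<in> unit_sphere n" and y: "y \<in> unit_sphere n" and eq: "code x = code y" for x y
  proof -
    define i where "i = I x"
    have iy: "I y = i" using eq by (simp add: code_def i_def)
    have sg: "x i > 0 \<longleftrightarrow> y i > 0" using eq iy by (simp add: code_def i_def)
    have i: "i \<le> n" "\<bar>x i\<bar> \<ge> 1 / (real n + 1)" "\<bar>y i\<bar> \<ge> 1 / (real n + 1)"
      using I[OF x] I[OF y] iy by (auto simp: i_def)
    have d: "\<bar>x j - y j\<bar> \<le> 1 / M" if "j \<le> n" "j \<noteq> i" for j
    proof -
      have "snd (snd (code x)) j = snd (snd (code y)) j" using eq by simp
      then have "(if j = I x then 0 else \<lfloor>real M * x j\<rfloor>) = (if j = I y then 0 else \<lfloor>real M * y j\<rfloor>)"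
        using that(1) by (simp add: code_def)
      then have "\<lfloor>real M * x j\<rfloor> = \<lfloor>real M * y j\<rfloor>" using that iy by (simp add: i_def)
      then have "\<bar>real M * x j - real M * y j\<bar> \<le> 1" by linarith
      then have "real M * \<bar>x j - y j\<bar> \<le> 1" by (simp add: abs_mult right_diff_distrib[symmetric])
      then show ?thesis using M0 by (simp add: field_simps)
    qed
    have sq: "\<bar>(y j)\<^sup>2 - (x j)\<^sup>2\<bar> \<le> 2 / M" if "j \<le> n" "j \<noteq> i" for j
    proof -
      have "(y j)\<^sup>2 - (x j)\<^sup>2 = (y j - x j) * (y j + x j)" by (simp add: power2_eq_square algebra_simps)
      then have "\<bar>(y j)\<^sup>2 - (x j)\<^sup>2\<bar> = \<bar>x j - y j\<bar> * \<bar>y j + x j\<bar>" by (simp add: abs_mult abs_minus_commute)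
      also have "\<dots> \<le> (1/M) * 2"
        using abs_unit_sphere_le[OF x, of j] abs_unit_sphere_le[OF y, of j] d[OF that]
        by (intro mult_mono) auto
      finally show ?thesis by simp
    qed
    have cardm: "real (card ({..n} - {i})) = n" using i by simp
    have xi: "(x i)\<^sup>2 = 1 - (\<Sum>j\<in>{..n}-{i}. (x j)\<^sup>2)" and yi: "(y i)\<^sup>2 = 1 - (\<Sum>j\<in>{..n}-{i}. (y j)\<^sup>2)"
      using x y i(1) by (auto simp: unit_sphere_def sum.remove)
    have "\<bar>x i - y i\<bar> * \<bar>x i + y i\<bar> = \<bar>(x i)\<^sup>2 - (y i)\<^sup>2\<bar>"
      by (simp add: abs_mult[symmetric] power2_eq_square algebra_simps)
    also have "\<dots> = \<bar>\<Sum>j\<in>{..n}-{i}. (y j)\<^sup>2 - (x j)\<^sup>2\<bar>" by (simp add: xi yi sum_subtractf)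
    also have "\<dots> \<le> (\<Sum>j\<in>{..n}-{i}. 2 / M)" by (rule order_trans[OF sum_abs]) (intro sum_mono sq, auto)
    also have "\<dots> = 2 * n / M" using cardm by simp
    finally have A: "\<bar>x i - y i\<bar> * \<bar>x i + y i\<bar> \<le> 2 * n / M" .
    have "\<bar>x i + y i\<bar> \<ge> 2 / (real n + 1)" using i(2,3) sg by (auto simp: abs_if split: if_splits)
    then have "\<bar>x i - y i\<bar> * (2 / (real n + 1)) \<le> 2 * n / M"
      using A by (meson abs_ge_zero mult_left_mono order_trans)
    then have "\<bar>x i - y i\<bar> * 2 \<le> (2 * n / M) * (real n + 1)"
      by (simp add: pos_divide_le_eq)
    then have B': "\<bar>x i - y i\<bar> \<le> n * (real n + 1) / M" by simp
    have "(\<Sum>j\<le>n. \<bar>x j - y j\<bar>) = \<bar>x i - y i\<bar> + (\<Sum>j\<in>{..n}-{i}. \<bar>x j - y j\<bar>)"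
      using i(1) by (simp add: sum.remove)
    also have "\<dots> \<le> n * (real n + 1) / M + (\<Sum>j\<in>{..n}-{i}. 1/M)"
      by (intro add_mono B' sum_mono d) auto
    also have "\<dots> = (n * (real n + 1) + n) / M" using cardm by (simp add: add_divide_distrib)
    also have "\<dots> \<le> (real n + 1)^2 / M" by (intro divide_right_mono) (auto simp: power2_eq_square algebra_simps)
    finally show ?thesis .
  qed
  have "inj_on (code \<circ> X) G"
  proof (rule inj_onI, rule ccontr)
    fix a b assume ab: "a \<in> G" "b \<in> G" "(code \<circ> X) a = (code \<circ> X) b" "a \<noteq> b"
    then obtain j where j: "j \<le> n" "a j \<noteq> b j" unfolding G_def by (metis PiE_ext atMost_iff)
    have "1 \<le> \<bar>real (a j) - real (b j)\<bar>" using j by linarith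
    then have "e / K * 1 \<le> e / K * \<bar>real (a j) - real (b j)\<bar>" using e by (intro mult_left_mono) auto
    also have "\<dots> = \<bar>H (X a) j - H (X b) j\<bar>"
      using X(2)[OF ab(1) j(1)] X(2)[OF ab(2) j(1)] e
      by (simp add: abs_mult diff_divide_distrib[symmetric] right_diff_distrib[symmetric])
    also have "\<dots> \<le> L' * (\<Sum>i\<le>n. \<bar>X a i - X b i\<bar>)" using X(1) ab j by (intro lip') auto
    also have "\<dots> \<le> L' * ((real n + 1)^2 / M)"
      using X(1) ab S L' by (intro mult_left_mono close) auto
    finally have "e / K \<le> L' * (real n + 1)^2 / (B * K)" by (simp add: M_def)
    then have "e * B \<le> L' * (real n + 1)^2" using K0 B0 by (simp add: field_simps)
    moreover have "e * B > L' * (real n + 1)^2" using B e by (simp add: field_simps)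
    ultimately show False by simp
  qed
  moreover have "(code \<circ> X) ` G \<subseteq> Codes"
    by (rule image_subsetI) (simp only: comp_apply codein[OF subsetD[OF S X(1)]])
  ultimately have "K^(n+1) \<le> (n+1) * (2 * (2*M+1)^n)"
    using card_inj_on_le[OF _ _ finC] cardG cardC by metis
  also have "\<dots> \<le> (n+1) * (2 * (3*M)^n)" using M0 by (intro mult_left_mono power_mono) auto
  also have "\<dots> = 2 * (n+1) * (3*B)^n * K^n" by (simp add: M_def power_mult_distrib algebra_simps)
  also have "\<dots> < K * K^n" using K0 by (intro mult_strict_right_mono) (auto simp: K_def)
  finally show False by simp
qed

text \<open>The Lipschitz condition is stated for the \<open>\<ell>\<^sup>1\<close> distance of the first coordinates, because the metric
  of the function space \<open>nat \<Rightarrow> real\<close> is not a norm.\<close>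

definition lipschitz_coord :: "(nat \<Rightarrow> real) set \<Rightarrow> nat \<Rightarrow> ((nat \<Rightarrow> real) \<Rightarrow> real) \<Rightarrow> bool" where
  "lipschitz_coord S n g \<longleftrightarrow> (\<exists>L\<ge>0. \<forall>x\<in>S. \<forall>y\<in>S. \<bar>g x - g y\<bar> \<le> L * (\<Sum>i\<le>n. \<bar>x i - y i\<bar>))"

lemma lipschitz_coordI:
  "0 \<le> L \<Longrightarrow> (\<And>x y. x \<in> S \<Longrightarrow> y \<in> S \<Longrightarrow> \<bar>g x - g y\<bar> \<le> L * (\<Sum>i\<le>n. \<bar>x i - y i\<bar>)) \<Longrightarrow> lipschitz_coord S n g"
  by (auto simp: lipschitz_coord_def)

lemma lipschitz_coord_continuous:
  assumes "lipschitz_coord S n g"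
  shows "continuous_on S g"
  unfolding continuous_on_def
proof
  fix x assume x: "x \<in> S"
  obtain L where L: "\<forall>x\<in>S. \<forall>y\<in>S. \<bar>g x - g y\<bar> \<le> L * (\<Sum>i\<le>n. \<bar>x i - y i\<bar>)"
    using assms by (auto simp: lipschitz_coord_def)
  have c: "continuous_on S (\<lambda>y. L * (\<Sum>i\<le>n. \<bar>y i - x i\<bar>))"
    by (intro continuous_intros continuous_on_subset[OF continuous_on_product_coordinates]) auto
  then have "((\<lambda>y. L * (\<Sum>i\<le>n. \<bar>y i - x i\<bar>)) \<longlongrightarrow> L * (\<Sum>i\<le>n. \<bar>x i - x i\<bar>)) (at x within S)"
    using x unfolding continuous_on_def by blast
  then have "((\<lambda>y. L * (\<Sum>i\<le>n. \<bar>y i - x i\<bar>)) \<longlongrightarrow> 0) (at x within S)" by simp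
  moreover have "\<forall>\<^sub>F y in at x within S. norm (g y - g x) \<le> L * (\<Sum>i\<le>n. \<bar>y i - x i\<bar>)"
    using L x by (auto simp: eventually_at_filter)
  ultimately have "((\<lambda>y. g y - g x) \<longlongrightarrow> 0) (at x within S)"
    by (rule Lim_null_comparison[rotated])
  then show "(g \<longlongrightarrow> g x) (at x within S)"
    by (simp add: LIM_zero_iff)
qed

text \<open>Lipschitz functions form an algebra that contains the coordinates, so the Stone--Weierstrass theorem
  applies.\<close>

lemma lipschitz_approximation:
  assumes f: "continuous_on (unit_sphere n) f" and e: "0 < e"
  shows "\<exists>g. lipschitz_coord (unit_sphere n) n g \<and> (\<forall>x\<in>unit_sphere n. \<bar>f x - g x\<bar> < e)"
proof -
  define S where "S = unit_sphere n"
  interpret function_ring_on "{g. lipschitz_coord S n g}" S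
  proof
    show "compact S" by (simp add: S_def compact_unit_sphere)
    show "continuous_on S g" if "g \<in> {g. lipschitz_coord S n g}" for g
      using that lipschitz_coord_continuous by auto
    show "(\<lambda>x. f x + g x) \<in> {g. lipschitz_coord S n g}"
      if fg: "f \<in> {g. lipschitz_coord S n g}" "g \<in> {g. lipschitz_coord S n g}" for f g
    proof -
      obtain L1 where L1: "L1 \<ge> 0" "\<And>x y. x\<in>S \<Longrightarrow> y\<in>S \<Longrightarrow> \<bar>f x - f y\<bar> \<le> L1 * (\<Sum>i\<le>n. \<bar>x i - y i\<bar>)"
        using fg by (auto simp: lipschitz_coord_def)
      obtain L2 where L2: "L2 \<ge> 0" "\<And>x y. x\<in>S \<Longrightarrow> y\<in>S \<Longrightarrow> \<bar>g x - g y\<bar> \<le> L2 * (\<Sum>i\<le>n. \<bar>x i - y i\<bar>)"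
        using fg by (auto simp: lipschitz_coord_def)
      have "\<bar>(f x + g x) - (f y + g y)\<bar> \<le> (L1 + L2) * (\<Sum>i\<le>n. \<bar>x i - y i\<bar>)" if "x \<in> S" "y \<in> S" for x y
        using L1(2)[OF that] L2(2)[OF that] by (simp add: distrib_right)
      then show ?thesis using L1(1) L2(1) by (auto intro!: lipschitz_coordI[of "L1+L2"])
    qed
    show "(\<lambda>x. f x * g x) \<in> {g. lipschitz_coord S n g}"
      if fg: "f \<in> {g. lipschitz_coord S n g}" "g \<in> {g. lipschitz_coord S n g}" for f g
    proof -
      obtain L1 where L1: "L1 \<ge> 0" "\<And>x y. x\<in>S \<Longrightarrow> y\<in>S \<Longrightarrow> \<bar>f x - f y\<bar> \<le> L1 * (\<Sum>i\<le>n. \<bar>x i - y i\<bar>)"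
        using fg by (auto simp: lipschitz_coord_def)
      obtain L2 where L2: "L2 \<ge> 0" "\<And>x y. x\<in>S \<Longrightarrow> y\<in>S \<Longrightarrow> \<bar>g x - g y\<bar> \<le> L2 * (\<Sum>i\<le>n. \<bar>x i - y i\<bar>)"
        using fg by (auto simp: lipschitz_coord_def)
      have "continuous_on S f" "continuous_on S g" using fg lipschitz_coord_continuous by auto
      then have "bounded (f ` S)" "bounded (g ` S)"
        by (auto intro!: compact_imp_bounded compact_continuous_image simp: S_def compact_unit_sphere)
      then obtain A B where "\<forall>x\<in>S. \<bar>f x\<bar> \<le> A" "\<forall>x\<in>S. \<bar>g x\<bar> \<le> B"
        by (auto simp: bounded_iff)
      then have A: "\<And>x. x \<in> S \<Longrightarrow> \<bar>f x\<bar> \<le> max A 0" and B: "\<And>x. x \<in> S \<Longrightarrow> \<bar>g x\<bar> \<le> max B 0"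
        by force+
      have "\<bar>f x * g x - f y * g y\<bar> \<le> (max A 0 * L2 + max B 0 * L1) * (\<Sum>i\<le>n. \<bar>x i - y i\<bar>)"
        if "x \<in> S" "y \<in> S" for x y
      proof -
        have "f x * g x - f y * g y = f x * (g x - g y) + g y * (f x - f y)" by (simp add: algebra_simps)
        then have "\<bar>f x * g x - f y * g y\<bar> \<le> \<bar>f x\<bar> * \<bar>g x - g y\<bar> + \<bar>g y\<bar> * \<bar>f x - f y\<bar>"
          by (metis abs_mult abs_triangle_ineq)
        also have "\<dots> \<le> max A 0 * (L2 * (\<Sum>i\<le>n. \<bar>x i - y i\<bar>)) + max B 0 * (L1 * (\<Sum>i\<le>n. \<bar>x i - y i\<bar>))"
          using that by (intro add_mono mult_mono A B L1 L2) auto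
        finally show ?thesis by (simp add: algebra_simps)
      qed
      then show ?thesis using L1(1) L2(1) by (auto intro!: lipschitz_coordI[of "max A 0 * L2 + max B 0 * L1"])
    qed
    show "(\<lambda>_. c) \<in> {g. lipschitz_coord S n g}" for c
      by (auto intro!: lipschitz_coordI[of 0])
    show "\<exists>f\<in>{g. lipschitz_coord S n g}. f x \<noteq> f y" if xy: "x \<in> S" "y \<in> S" "x \<noteq> y" for x y
    proof -
      obtain i where i: "x i \<noteq> y i" using xy(3) by auto
      then have "i \<le> n" using xy(1,2) by (metis (mono_tags, lifting) S_def linorder_not_less mem_Collect_eq unit_sphere_def)
      then have "lipschitz_coord S n (\<lambda>x. x i)"
        by (intro lipschitz_coordI[of 1]) (auto intro!: member_le_sum[of i "{..n}" "\<lambda>i. \<bar>_ i - _ i\<bar>"])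
      then show ?thesis using i by auto
    qed
  qed
  show ?thesis using Stone_Weierstrass_basic[of f e] f e by (auto simp: S_def)
qed

lemma degree_odd_map_base:
  assumes f: "f \<in> unit_sphere 0 \<rightarrow> unit_sphere 0" and odd: "\<And>x. x \<in> unit_sphere 0 \<Longrightarrow> f (\<lambda>i. - x i) = (\<lambda>i. - f x i)"
  shows "odd (Brouwer_degree2 0 f)"
proof -
  define a where "a = (\<lambda>i::nat. if i = 0 then 1 else 0::real)"
  have S: "unit_sphere 0 = {a, \<lambda>i. - a i}"
    by (auto simp: unit_sphere_def a_def fun_eq_iff power2_eq_1_iff)
  have a: "a \<in> unit_sphere 0" by (simp add: S)
  have agree: "Brouwer_degree2 0 f = Brouwer_degree2 0 g" if "\<And>x. x \<in> unit_sphere 0 \<Longrightarrow> f x = g x" for g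
    by (rule Brouwer_degree2_eq) (simp add: that topspace_nsphere_eq)
  from f a have "f a = a \<or> f a = (\<lambda>i. - a i)" using S by blast
  then show ?thesis
  proof
    assume *: "f a = a"
    then have "Brouwer_degree2 0 f = Brouwer_degree2 0 id"
      using odd[OF a] by (intro agree) (auto simp: S)
    then show ?thesis by (metis Brouwer_degree2_id id_def odd_one)
  next
    assume *: "f a = (\<lambda>i. - a i)"
    then have "Brouwer_degree2 0 f = Brouwer_degree2 0 (\<lambda>x i. if i = 0 then - x i else x i)"
      using odd[OF a] by (intro agree) (auto simp: S, auto simp: a_def)
    then show ?thesis by (simp add: Brouwer_degree2_reflection)
  qed
qed

text \<open>Borsuk's theorem for maps given by a nowhere vanishing field \<open>F\<close>. The inductive step compares the
  degree with that of the restriction to the equator, which requires the equator to be mapped into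
  itself. A generic Lipschitz perturbation achieves this: after a small shear the first \<open>n + 1\<close> coordinates have
  no common zero on the equator (here the equator is too thin to meet every direction,
  \<open>lipschitz_image_misses\<close>), and then the last coordinate can be multiplied by \<open>|x\<^sub>n\<^sub>+\<^sub>1|\<close> through a
  homotopy without creating zeros.\<close>

theorem odd_map_odd_degree:
  assumes "continuous_on (unit_sphere n) F"
    and "\<And>x. x \<in> unit_sphere n \<Longrightarrow> F (\<lambda>i. - x i) = (\<lambda>i. - F x i)"
    and "\<And>x. x \<in> unit_sphere n \<Longrightarrow> \<exists>i\<le>n. F x i \<noteq> 0"
  shows "odd (Brouwer_degree2 n (\<lambda>x. radial_proj n (F x)))"
  using assms
proof (induction n arbitrary: F)
  case 0
  show ?case
  proof (rule degree_odd_map_base)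
    show "(\<lambda>x. radial_proj 0 (F x)) \<in> unit_sphere 0 \<rightarrow> unit_sphere 0"
      using radial_proj_in[OF 0(3)] by auto
    show "radial_proj 0 (F (\<lambda>i. - x i)) = (\<lambda>i. - radial_proj 0 (F x) i)" if "x \<in> unit_sphere 0" for x
      using 0(2)[OF that] by (simp add: radial_proj_uminus)
  qed
next
  case (Suc n)
  let ?S = "unit_sphere (Suc n)"
  define f where "f x = radial_proj (Suc n) (F x)" for x
  have fc: "continuous_on ?S f" unfolding f_def by (intro continuous_on_radial_proj Suc.prems)
  have fS: "f x \<in> ?S" if "x \<in> ?S" for x unfolding f_def by (intro radial_proj_in Suc.prems that)
  have fodd: "f (\<lambda>i. - x i) = (\<lambda>i. - f x i)" if "x \<in> ?S" for x
    using Suc.prems(2)[OF that] by (simp add: f_def radial_proj_uminus)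
  \<comment> \<open>small enough for \<open>n + 2\<close> coordinates of size \<open>3 e\<close> not to reach the unit sphere\<close>
  define e where "e = 1 / (8 * (real n + 2))"
  have e0: "e > 0" by (simp add: e_def)
  have "\<exists>g. lipschitz_coord ?S (Suc n) g \<and> (\<forall>x\<in>?S. \<bar>f x i - g x\<bar> < e)" for i
    by (rule lipschitz_approximation[OF continuous_on_product_then_coordinatewise[OF fc] e0])
  then obtain g where g: "\<And>i. lipschitz_coord ?S (Suc n) (g i)" "\<And>i x. x \<in> ?S \<Longrightarrow> \<bar>f x i - g i x\<bar> < e"
    by metis
  define G where "G x i = (g i x - g i (\<lambda>j. - x j)) / 2" for x i
  have Godd: "G (\<lambda>j. - x j) i = - G x i" for x i
    unfolding G_def minus_minus by argo
  have Gf: "\<bar>f x i - G x i\<bar> < e" if x: "x \<in> ?S" for x i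
  proof -
    have "f x i - G x i = ((f x i - g i x) - (f (\<lambda>j. - x j) i - g i (\<lambda>j. - x j))) / 2"
      using fun_cong[OF fodd[OF x], of i] unfolding G_def by argo
    then show ?thesis using g(2)[OF x, of i] g(2)[OF uminus_unit_sphere[OF x], of i] by (simp add: abs_if split: if_splits)
  qed
  have Glip: "\<exists>L\<ge>0. \<forall>x\<in>?S. \<forall>y\<in>?S. \<bar>G x i - G y i\<bar> \<le> L * (\<Sum>i\<le>Suc n. \<bar>x i - y i\<bar>)" for i
  proof -
    obtain L where L: "L \<ge> 0" "\<And>x y. x\<in>?S \<Longrightarrow> y\<in>?S \<Longrightarrow> \<bar>g i x - g i y\<bar> \<le> L * (\<Sum>i\<le>Suc n. \<bar>x i - y i\<bar>)"
      using g(1)[of i] unfolding lipschitz_coord_def by blast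
    have "\<bar>G x i - G y i\<bar> \<le> L * (\<Sum>i\<le>Suc n. \<bar>x i - y i\<bar>)" if "x \<in> ?S" "y \<in> ?S" for x y
    proof -
      have "(\<Sum>i\<le>Suc n. \<bar>- x i - - y i\<bar>) = (\<Sum>i\<le>Suc n. \<bar>x i - y i\<bar>)" by (intro sum.cong) auto
      then show ?thesis
        using L(2)[OF that] L(2)[OF uminus_unit_sphere uminus_unit_sphere, OF that]
        by (simp add: G_def abs_if field_simps split: if_splits)
    qed
    then show ?thesis using L(1) by blast
  qed
  have Gc: "continuous_on ?S (\<lambda>x. G x i)" for i
    using Glip[of i] by (intro lipschitz_coord_continuous[of _ "Suc n"]) (auto simp: lipschitz_coord_def)
  have Gb: "\<bar>G x i\<bar> \<le> 2" if "x \<in> ?S" for x i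
  proof -
    have "e \<le> 1" by (simp add: e_def)
    then show ?thesis using Gf[OF that, of i] abs_unit_sphere_le[OF fS[OF that], of i] by linarith
  qed
  \<comment> \<open>elsewhere on the equator the first \<open>n + 1\<close> coordinates cannot all be small, because \<open>G\<close> is close to the unit vector \<open>f\<close>\<close>
  define S' where "S' = {x \<in> unit_sphere n. \<bar>G x (Suc n)\<bar> \<ge> 1/2}"
  have sub: "x \<in> ?S \<and> x (Suc n) = 0" if "x \<in> unit_sphere n" for x
    using that by (auto simp: unit_sphere_def)
  have S'S: "S' \<subseteq> ?S" using sub by (auto simp: S'_def)
  obtain L where L: "\<And>i. L i \<ge> 0" "\<And>i x y. x\<in>?S \<Longrightarrow> y\<in>?S \<Longrightarrow> \<bar>G x i - G y i\<bar> \<le> L i * (\<Sum>i\<le>Suc n. \<bar>x i - y i\<bar>)"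
    using Glip by metis
  define L0 where "L0 = (\<Sum>i\<le>Suc n. L i)"
  have L0: "\<bar>G x i - G y i\<bar> \<le> L0 * (\<Sum>i\<le>n. \<bar>x i - y i\<bar>)" if "x \<in> S'" "y \<in> S'" "i \<le> Suc n" for x y i
  proof -
    have "L i \<le> L0" unfolding L0_def using that L(1) by (intro member_le_sum) auto
    moreover have "(\<Sum>i\<le>Suc n. \<bar>x i - y i\<bar>) = (\<Sum>i\<le>n. \<bar>x i - y i\<bar>)"
      using that sub[of x] sub[of y] by (simp add: S'_def)
    moreover have "\<bar>G x i - G y i\<bar> \<le> L i * (\<Sum>i\<le>Suc n. \<bar>x i - y i\<bar>)"
      using that S'S by (intro L(2)) auto
    ultimately show ?thesis
      by (metis (no_types, lifting) abs_ge_zero mult_right_mono order_trans sum_nonneg)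
  qed
  have "\<exists>d. (\<forall>j. \<bar>d j\<bar> \<le> e) \<and> (\<forall>x\<in>S'. \<exists>j\<le>n. G x j / G x (Suc n) \<noteq> d j)"
  proof (rule lipschitz_image_misses[of S' n e "\<lambda>x j. G x j / G x (Suc n)" "16 * L0"])
    show "S' \<subseteq> unit_sphere n" by (auto simp: S'_def)
    fix j x y assume j: "j \<le> n" and xy: "x \<in> S'" "y \<in> S'"
    let ?b = "G x (Suc n)" and ?d = "G y (Suc n)" and ?s = "\<Sum>i\<le>n. \<bar>x i - y i\<bar>"
    have b: "\<bar>?b\<bar> \<ge> 1/2" "\<bar>?d\<bar> \<ge> 1/2" using xy by (auto simp: S'_def)
    then have nz: "?b \<noteq> 0" "?d \<noteq> 0" by auto
    have "G x j / ?b - G y j / ?d = ((G x j - G y j) * ?d + G y j * (?d - ?b)) / (?b * ?d)"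
      using nz by (simp add: field_simps)
    then have "\<bar>G x j / ?b - G y j / ?d\<bar> = \<bar>(G x j - G y j) * ?d + G y j * (?d - ?b)\<bar> / (\<bar>?b\<bar> * \<bar>?d\<bar>)"
      by (simp add: abs_mult)
    also have "\<dots> \<le> (L0 * ?s * 2 + 2 * (L0 * ?s)) / (1/2 * (1/2))"
    proof (intro frac_le mult_mono)
      have "\<bar>(G x j - G y j) * ?d + G y j * (?d - ?b)\<bar> \<le> \<bar>G x j - G y j\<bar> * \<bar>?d\<bar> + \<bar>G y j\<bar> * \<bar>?b - ?d\<bar>"
        by (metis abs_minus_commute abs_mult abs_triangle_ineq)
      also have "\<dots> \<le> L0 * ?s * 2 + 2 * (L0 * ?s)"
        using xy j S'S by (intro add_mono mult_mono L0 Gb) (auto intro: order_trans[OF abs_ge_zero L0])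
      finally show "\<bar>(G x j - G y j) * ?d + G y j * (?d - ?b)\<bar> \<le> L0 * ?s * 2 + 2 * (L0 * ?s)" .
      then show "0 \<le> L0 * ?s * 2 + 2 * (L0 * ?s)" by linarith
    qed (use b in auto)
    also have "\<dots> = 16 * L0 * ?s" by simp
    finally show "\<bar>G x j / ?b - G y j / ?d\<bar> \<le> 16 * L0 * ?s" .
  qed (rule e0)
  then obtain d where d: "\<And>j. \<bar>d j\<bar> \<le> e" "\<And>x. x \<in> S' \<Longrightarrow> \<exists>j\<le>n. G x j / G x (Suc n) \<noteq> d j" by blast
  \<comment> \<open>the shear: on \<open>S'\<close> a common zero of its first \<open>n + 1\<close> coordinates would make all quotients \<open>G x j / G x (Suc n)\<close> equal to \<open>d j\<close>\<close>
  define G1 where "G1 x i = (if i \<le> n then G x i - d i * G x (Suc n) else G x (Suc n))" for x i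
  have G1c: "continuous_on ?S (\<lambda>x. G1 x i)" for i
    unfolding G1_def by (cases "i \<le> n") (auto intro!: continuous_intros Gc)
  have G1odd: "G1 (\<lambda>j. - x j) i = - G1 x i" for x i by (simp add: G1_def Godd)
  have G1f: "\<bar>f x i - G1 x i\<bar> < 3 * e" if x: "x \<in> ?S" and i: "i \<le> Suc n" for x i
  proof (cases "i \<le> n")
    case True
    have "\<bar>d i * G x (Suc n)\<bar> \<le> e * 2" unfolding abs_mult using d Gb[OF x] e0 by (intro mult_mono) auto
    then show ?thesis using True Gf[OF x, of i] by (simp add: G1_def)
  next
    case False
    then show ?thesis using Gf[OF x, of "Suc n"] e0 i by (simp add: G1_def le_Suc_eq)
  qed
  have small: "\<not> (\<forall>i\<le>Suc n. \<bar>f x i\<bar> \<le> 3 * e)" if "x \<in> ?S" for x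
  proof
    assume *: "\<forall>i\<le>Suc n. \<bar>f x i\<bar> \<le> 3 * e"
    have "1 = (\<Sum>i\<le>Suc n. (f x i)\<^sup>2)" using fS[OF that] by (simp add: unit_sphere_def)
    also have "\<dots> \<le> (\<Sum>i\<le>Suc n. 3 * e)"
    proof (rule sum_mono)
      fix i assume i: "i \<in> {..Suc n}"
      have "(f x i)\<^sup>2 = \<bar>f x i\<bar> * \<bar>f x i\<bar>" by (simp add: power2_eq_square)
      also have "\<dots> \<le> 1 * (3 * e)"
        using * i abs_unit_sphere_le[OF fS[OF that]] e0 by (intro mult_mono) auto
      finally show "(f x i)\<^sup>2 \<le> 3 * e" by simp
    qed
    also have "\<dots> = 3/8" by (simp add: e_def field_simps)
    finally show False by simp
  qed
  have nz1: "\<exists>i\<le>Suc n. (1 - t) * f x i + t * G1 x i \<noteq> 0" if t: "t \<in> {0..1}" and x: "x \<in> ?S" for t x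
  proof (rule ccontr)
    assume "\<not> ?thesis"
    then have "(1 - t) * f x i + t * G1 x i = 0" if "i \<le> Suc n" for i using that by blast
    then have "f x i = t * (f x i - G1 x i)" if "i \<le> Suc n" for i using that by (simp add: algebra_simps)
    then have "\<bar>f x i\<bar> \<le> 1 * \<bar>f x i - G1 x i\<bar>" if "i \<le> Suc n" for i
      using that t by (metis abs_ge_zero abs_mult abs_of_nonneg atLeastAtMost_iff mult_right_mono)
    then have "\<forall>i\<le>Suc n. \<bar>f x i\<bar> \<le> 3 * e" using G1f[OF x] by fastforce
    then show False using small[OF x] by blast
  qed
  have G1nz: "\<exists>i\<le>Suc n. G1 x i \<noteq> 0" if "x \<in> ?S" for x using nz1[of 1 x] that by auto
  have equator: "\<exists>i\<le>n. G1 x i \<noteq> 0" if x: "x \<in> unit_sphere n" for x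
  proof (cases "\<bar>G x (Suc n)\<bar> \<ge> 1/2")
    case True
    then have "x \<in> S'" using x by (simp add: S'_def)
    then obtain j where j: "j \<le> n" "G x j / G x (Suc n) \<noteq> d j" using d(2) by blast
    then have "G1 x j \<noteq> 0" using True by (auto simp: G1_def field_simps)
    then show ?thesis using j by blast
  next
    case False
    show ?thesis
    proof (rule ccontr)
      assume "\<not> ?thesis"
      then have z: "G1 x i = 0" if "i \<le> n" for i using that by blast
      have xS: "x \<in> ?S" using sub[OF x] by simp
      have f1: "\<bar>f x i\<bar> \<le> 3 * e" if "i \<le> n" for i using G1f[OF xS, of i] z[OF that] that by simp
      have e1: "e \<le> 1/16" by (simp add: e_def)
      have f2: "\<bar>f x (Suc n)\<bar> \<le> 9/16" using Gf[OF xS, of "Suc n"] False e1 by linarith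
      have "1 = (\<Sum>i\<le>n. (f x i)\<^sup>2) + (f x (Suc n))\<^sup>2" using fS[OF xS] by (simp add: unit_sphere_def)
      also have "\<dots> \<le> (\<Sum>i\<le>n. 3 * e) + 9/16"
      proof (intro add_mono sum_mono)
        fix i assume i: "i \<in> {..n}"
        have "(f x i)\<^sup>2 = \<bar>f x i\<bar> * \<bar>f x i\<bar>" by (simp add: power2_eq_square)
        also have "\<dots> \<le> 1 * (3 * e)"
          using f1 i abs_unit_sphere_le[OF fS[OF xS]] e0 by (intro mult_mono) auto
        finally show "(f x i)\<^sup>2 \<le> 3 * e" by simp
      next
        have "(f x (Suc n))\<^sup>2 = \<bar>f x (Suc n)\<bar> * \<bar>f x (Suc n)\<bar>" by (simp add: power2_eq_square)
        also have "\<dots> \<le> 1 * (9/16)"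
          using f2 abs_unit_sphere_le[OF fS[OF xS]] by (intro mult_mono) auto
        finally show "(f x (Suc n))\<^sup>2 \<le> 9/16" by simp
      qed
      also have "\<dots> < 1" by (simp add: e_def field_simps)
      finally show False by simp
    qed
  qed
  define G2 where "G2 t x i = (if i \<le> n then G1 x i else (1 - t + t * \<bar>x (Suc n)\<bar>) * G1 x i)" for t x i
  have G2nz: "\<exists>i\<le>Suc n. G2 t x i \<noteq> 0" if t: "t \<in> {0..1}" and x: "x \<in> ?S" for t x
  proof (cases "1 - t + t * \<bar>x (Suc n)\<bar> = 0")
    case False
    obtain i where "i \<le> Suc n" "G1 x i \<noteq> 0" using G1nz[OF x] by blast
    then show ?thesis using False by (intro exI[of _ i]) (auto simp: G2_def)
  next
    case True
    have "t * \<bar>x (Suc n)\<bar> \<ge> 0" using t by auto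
    then have "t = 1" using True t by auto
    then have "x (Suc n) = 0" using True by simp
    then have "x \<in> unit_sphere n"
      using x by (auto simp: unit_sphere_def) (metis Suc_lessI)
    then obtain i where "i \<le> n" "G1 x i \<noteq> 0" using equator by blast
    then show ?thesis by (intro exI[of _ i]) (auto simp: G2_def)
  qed
  have deg: "Brouwer_degree2 (Suc n) (\<lambda>x. radial_proj (Suc n) (F x)) = Brouwer_degree2 (Suc n) (\<lambda>x. radial_proj (Suc n) (G2 1 x))"
  proof -
    have c2: "continuous_on ({0..1} \<times> ?S) (\<lambda>z. h (snd z))" if "continuous_on ?S h" for h :: "(nat \<Rightarrow> real) \<Rightarrow> real"
      by (rule continuous_on_compose2[OF that]) (auto intro: continuous_intros)
    have cx: "continuous_on ?S (\<lambda>x. x i)" for i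
      by (rule continuous_on_subset[OF continuous_on_product_coordinates]) auto
    have "Brouwer_degree2 (Suc n) (\<lambda>x. radial_proj (Suc n) (F x)) = Brouwer_degree2 (Suc n) (\<lambda>x. radial_proj (Suc n) (\<lambda>i. (1 - 0) * f x i + 0 * G1 x i))"
      by (rule Brouwer_degree2_eq) (auto simp: f_def topspace_nsphere_eq radial_proj_id[OF radial_proj_in] Suc.prems(3))
    also have "\<dots> = Brouwer_degree2 (Suc n) (\<lambda>x. radial_proj (Suc n) (\<lambda>i. (1 - 1) * f x i + 1 * G1 x i))"
    proof (rule degree_homotopy[where H = "\<lambda>t x i. (1 - t) * f x i + t * G1 x i"])
      show "continuous_on ({0..1} \<times> ?S) (\<lambda>(t, x) i. (1 - t) * f x i + t * G1 x i)"
        unfolding case_prod_unfold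
        by (intro continuous_on_coordinatewise_then_product continuous_intros c2 G1c continuous_on_product_then_coordinatewise[OF fc])
    qed (rule nz1)
    also have "\<dots> = Brouwer_degree2 (Suc n) (\<lambda>x. radial_proj (Suc n) (G2 0 x))"
      by (rule Brouwer_degree2_eq) (auto simp: radial_proj_def G2_def fun_eq_iff intro!: arg_cong[where f = sqrt] sum.cong)
    also have "\<dots> = Brouwer_degree2 (Suc n) (\<lambda>x. radial_proj (Suc n) (G2 1 x))"
    proof (rule degree_homotopy)
      show "continuous_on ({0..1} \<times> ?S) (\<lambda>(t, x). G2 t x)"
        unfolding case_prod_unfold
      proof (rule continuous_on_coordinatewise_then_product)
        fix i show "continuous_on ({0..1} \<times> ?S) (\<lambda>z. G2 (fst z) (snd z) i)"
          unfolding G2_def by (cases "i \<le> n") (auto intro!: continuous_intros c2 G1c cx)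
      qed
    qed (rule G2nz)
    finally show ?thesis .
  qed
  have c21: "continuous_on ?S (G2 1)"
  proof (rule continuous_on_coordinatewise_then_product)
    have cx: "continuous_on ?S (\<lambda>x. x i)" for i
      by (rule continuous_on_subset[OF continuous_on_product_coordinates]) auto
    fix i show "continuous_on ?S (\<lambda>z. G2 1 z i)"
      unfolding G2_def by (cases "i \<le> n") (auto intro!: continuous_intros G1c cx)
  qed
  have nz21: "\<exists>i\<le>Suc n. G2 1 x i \<noteq> 0" if "x \<in> ?S" for x using G2nz[of 1 x] that by auto
  have odd2: "G2 1 (\<lambda>i. - x i) = (\<lambda>i. - G2 1 x i)" for x by (auto simp: G2_def G1odd)
  have eqn: "radial_proj (Suc n) (G2 1 x) = radial_proj n (G2 1 x)" if "x \<in> unit_sphere n" for x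
    using sub[OF that] by (auto simp: radial_proj_def G2_def fun_eq_iff)
  have eqnz: "\<exists>i\<le>n. G2 1 x i \<noteq> 0" if "x \<in> unit_sphere n" for x
    using equator[OF that] by (auto simp: G2_def)
  have "even (Brouwer_degree2 (Suc n) (\<lambda>x. radial_proj (Suc n) (G2 1 x))
     - Brouwer_degree2 (Suc n - Suc 0) (\<lambda>x. radial_proj (Suc n) (G2 1 x)))"
  proof (rule Borsuk_odd_mapping_degree_step)
    show "continuous_map (nsphere (Suc n)) (nsphere (Suc n)) (\<lambda>x. radial_proj (Suc n) (G2 1 x))"
      by (rule continuous_map_radial_proj[OF c21 nz21])
    show "((\<lambda>x. radial_proj (Suc n) (G2 1 x)) \<circ> (\<lambda>x i. - x i)) u = ((\<lambda>x i. - x i) \<circ> (\<lambda>x. radial_proj (Suc n) (G2 1 x))) u" for u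
      by (simp add: odd2 radial_proj_uminus)
    show "(\<lambda>x. radial_proj (Suc n) (G2 1 x)) \<in> topspace (nsphere (Suc n - Suc 0)) \<rightarrow> topspace (nsphere (Suc n - Suc 0))"
      using eqn radial_proj_in[OF eqnz] by (auto simp: topspace_nsphere_eq)
  qed
  moreover have "Brouwer_degree2 (Suc n - Suc 0) (\<lambda>x. radial_proj (Suc n) (G2 1 x)) = Brouwer_degree2 n (\<lambda>x. radial_proj n (G2 1 x))"
    using eqn by simp (rule Brouwer_degree2_eq, simp add: topspace_nsphere_eq)
  moreover have "odd (Brouwer_degree2 n (\<lambda>x. radial_proj n (G2 1 x)))"
    using sub by (intro Suc.IH continuous_on_subset[OF c21] odd2 eqnz) auto
  ultimately show ?case using deg by simp
qed

text \<open>A field without zeros would take values in \<open>n\<close> coordinates, hence give an odd self-map of the \<open>n\<close>-sphere that misses the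
  pole; such a map has degree \<open>0\<close>, which is even.\<close>

theorem borsuk_ulam_zero:
  fixes F :: "(nat \<Rightarrow> real) \<Rightarrow> nat \<Rightarrow> real"
  assumes c: "\<And>i. i < n \<Longrightarrow> continuous_on (unit_sphere n) (\<lambda>x. F x i)"
    and odd: "\<And>x i. x \<in> unit_sphere n \<Longrightarrow> i < n \<Longrightarrow> F (\<lambda>i. - x i) i = - F x i"
  shows "\<exists>x\<in>unit_sphere n. \<forall>i<n. F x i = 0"
proof (rule ccontr)
  assume neg: "\<not> ?thesis"
  define G where "G x = (\<lambda>i. if i < n then F x i else 0)" for x
  have nz: "\<exists>i\<le>n. G x i \<noteq> 0" if x: "x \<in> unit_sphere n" for x
  proof -
    obtain i where "i < n" "F x i \<noteq> 0" using neg x by blast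
    then show ?thesis by (intro exI[of _ i]) (auto simp: G_def)
  qed
  have Gc: "continuous_on (unit_sphere n) G"
  proof (rule continuous_on_coordinatewise_then_product)
    show "continuous_on (unit_sphere n) (\<lambda>x. G x i)" for i
      by (cases "i < n") (auto simp: G_def c)
  qed
  have "odd (Brouwer_degree2 n (\<lambda>x. radial_proj n (G x)))"
  proof (rule odd_map_odd_degree[OF Gc _ nz])
    fix x assume "x \<in> unit_sphere n"
    then show "G (\<lambda>i. - x i) = (\<lambda>i. - G x i)"
      using odd[of x] by (auto simp: G_def fun_eq_iff)
  qed
  moreover have "Brouwer_degree2 n (\<lambda>x. radial_proj n (G x)) = 0"
  proof (rule Brouwer_degree2_nonsurjective)
    show "continuous_map (nsphere n) (nsphere n) (\<lambda>x. radial_proj n (G x))"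
      by (rule continuous_map_radial_proj[OF Gc nz])
    define a where "a = (\<lambda>i. if i = n then 1 else 0::real)"
    have "(\<Sum>i\<le>n. (a i)\<^sup>2) = (\<Sum>i\<in>{n}. (a i)\<^sup>2)"
      by (rule sum.mono_neutral_right) (auto simp: a_def)
    then have "a \<in> unit_sphere n" by (simp add: unit_sphere_def a_def)
    moreover have "a \<noteq> radial_proj n (G x)" for x
    proof
      assume "a = radial_proj n (G x)"
      then have "a n = radial_proj n (G x) n" by simp
      then show False by (simp add: a_def radial_proj_def G_def)
    qed
    ultimately show "(\<lambda>x. radial_proj n (G x)) ` topspace (nsphere n) \<noteq> topspace (nsphere n)"
      unfolding topspace_nsphere_eq by blast
  qed
  ultimately show False by simp
qed

section \<open>A minimax critical point in finite dimensions\<close>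

lemma tendsto_fun_iff:
  fixes f :: "'a \<Rightarrow> nat \<Rightarrow> real"
  shows "(f \<longlongrightarrow> l) F \<longleftrightarrow> (\<forall>i. ((\<lambda>x. f x i) \<longlongrightarrow> l i) F)"
  using limitin_componentwise[of "\<lambda>_. euclidean" UNIV f l F]
  by (simp add: euclidean_product_topology)

definition coords_below :: "nat \<Rightarrow> (nat \<Rightarrow> real) set" where
  "coords_below m = {c. \<forall>i\<ge>m. c i = 0}"

lemma bounded_coords_subsequence:
  fixes x :: "nat \<Rightarrow> nat \<Rightarrow> real"
  assumes "\<And>n i. \<bar>x n i\<bar> \<le> R i"
  shows "\<exists>l r. strict_mono (r::nat\<Rightarrow>nat) \<and> (\<forall>i. (\<lambda>n. x (r n) i) \<longlonglongrightarrow> l i)"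
proof -
  have "seq_compact {x::nat\<Rightarrow>real. \<forall>i. x i \<in> {- R i..R i}}"
    by (rule compact_imp_seq_compact[OF compact_box])
  moreover have "\<forall>n. x n \<in> {x::nat\<Rightarrow>real. \<forall>i. x i \<in> {- R i..R i}}"
    using assms by (auto simp: abs_le_iff minus_le_iff)
  ultimately obtain l r where "strict_mono r" "(x \<circ> r) \<longlonglongrightarrow> l"
    by (rule seq_compactE)
  then show ?thesis by (auto simp: tendsto_fun_iff)
qed

text \<open>The value \<open>c\<close> of the minimax is at most \<open>b\<close> because of \<open>B\<^sub>0\<close>, and at least \<open>a\<close> because by
  Borsuk--Ulam every admissible image contains a zero of \<open>Q\<close>. If \<open>c\<close> were not critical, then by
  compactness one gradient step of fixed small length would push \<open>{J \<le> c + \<epsilon>}\<close> below \<open>c - \<epsilon>\<close>. Since the step is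
  odd and continuous, it maps admissible maps to admissible maps, which contradicts the choice of \<open>c\<close>.\<close>

theorem minimax_critical_point:
  fixes J :: "(nat \<Rightarrow> real) \<Rightarrow> real" and D Q B\<^sub>0 :: "(nat \<Rightarrow> real) \<Rightarrow> nat \<Rightarrow> real"
  assumes Jc: "continuous_on (coords_below m) J"
    and Dc: "\<And>i. i < m \<Longrightarrow> continuous_on (coords_below m) (\<lambda>c. D c i)"
    and Dodd: "\<And>c i. c \<in> coords_below m \<Longrightarrow> i < m \<Longrightarrow> D (\<lambda>i. - c i) i = - D c i"
    and deriv: "\<And>c h t. c \<in> coords_below m \<Longrightarrow> h \<in> coords_below m \<Longrightarrow>
       ((\<lambda>t. J (\<lambda>i. c i + t * h i)) has_real_derivative (\<Sum>i<m. D (\<lambda>i. c i + t * h i) i * h i)) (at t)"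
    and coercive: "\<And>b. \<exists>R. \<forall>c\<in>coords_below m. J c \<le> b \<longrightarrow> (\<forall>i. \<bar>c i\<bar> \<le> R)"
    and B0: "\<And>i. continuous_on (unit_sphere k) (\<lambda>y. B\<^sub>0 y i)"
      "\<And>y. y \<in> unit_sphere k \<Longrightarrow> B\<^sub>0 y \<in> coords_below m"
      "\<And>y. y \<in> unit_sphere k \<Longrightarrow> B\<^sub>0 (\<lambda>i. - y i) = (\<lambda>i. - B\<^sub>0 y i)"
      "\<And>y. y \<in> unit_sphere k \<Longrightarrow> J (B\<^sub>0 y) \<le> b"
    and Q: "\<And>i. i < k \<Longrightarrow> continuous_on (coords_below m) (\<lambda>c. Q c i)"
      "\<And>c i. c \<in> coords_below m \<Longrightarrow> i < k \<Longrightarrow> Q (\<lambda>i. - c i) i = - Q c i"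
      "\<And>c. c \<in> coords_below m \<Longrightarrow> J c \<le> a \<Longrightarrow> \<exists>i<k. Q c i \<noteq> 0"
  shows "\<exists>c\<in>coords_below m. a \<le> J c \<and> J c \<le> b \<and> (\<forall>i<m. D c i = 0)"
proof -
  let ?E = "coords_below m" and ?S = "unit_sphere k"
  define adm where "adm B \<longleftrightarrow> (\<forall>i. continuous_on ?S (\<lambda>y. B y i)) \<and> (\<forall>y\<in>?S. B y \<in> ?E)
      \<and> (\<forall>y\<in>?S. B (\<lambda>i. - y i) = (\<lambda>i. - B y i))" for B :: "(nat \<Rightarrow> real) \<Rightarrow> nat \<Rightarrow> real"
  define V where "V = {v. \<exists>B. adm B \<and> (\<forall>y\<in>?S. J (B y) \<le> v)}"
  have bV: "b \<in> V" unfolding V_def adm_def using B0 by blast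
  have Va: "a \<le> v" if v: "v \<in> V" for v
  proof -
    obtain B where B: "adm B" "\<forall>y\<in>?S. J (B y) \<le> v" using v unfolding V_def by blast
    have Bc: "continuous_on ?S B" 
      using B(1) by (intro continuous_on_coordinatewise_then_product) (auto simp: adm_def)
    have "\<exists>y\<in>?S. \<forall>i<k. Q (B y) i = 0"
    proof (rule borsuk_ulam_zero[of k "\<lambda>y. Q (B y)"])
      show "continuous_on ?S (\<lambda>y. Q (B y) i)" if "i < k" for i
        using B(1) by (intro continuous_on_compose2[OF Q(1)[OF that] Bc]) (auto simp: adm_def)
      show "Q (B (\<lambda>i. - y i)) i = - Q (B y) i" if "y \<in> ?S" "i < k" for y i
        using B(1) that Q(2)[of "B y" i] by (simp add: adm_def)
    qed
    then obtain y where y: "y \<in> ?S" "\<forall>i<k. Q (B y) i = 0" by blast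
    then have "\<not> J (B y) \<le> a" using Q(3)[of "B y"] B(1) by (auto simp: adm_def)
    then show ?thesis using B(2) y(1) by force
  qed
  define cs where "cs = Inf V"
  have bdd: "bdd_below V" using Va by (auto intro!: bdd_belowI)
  have csa: "a \<le> cs" unfolding cs_def using bV Va by (intro cInf_greatest) auto
  have csb: "cs \<le> b" unfolding cs_def using bV bdd by (intro cInf_lower)
  define Dm where "Dm c i = (if i < m then D c i else 0)" for c i
  define step where "step \<tau> c = (\<lambda>i. c i + \<tau> * (- Dm c i))" for \<tau> :: real and c
  have DmE: "Dm c \<in> ?E" "(\<lambda>i. - Dm c i) \<in> ?E" for c by (auto simp: Dm_def coords_below_def)
  have stepE: "step \<tau> c \<in> ?E" if "c \<in> ?E" for \<tau> c
    using that by (auto simp: step_def Dm_def coords_below_def)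
  have Dmc: "continuous_on ?E (\<lambda>c. Dm c i)" for i
    unfolding Dm_def using Dc by (cases "i < m") auto
  have "\<exists>c\<in>?E. J c = cs \<and> (\<forall>i<m. D c i = 0)"
  proof (rule ccontr)
    assume nocrit: "\<not> ?thesis"
    have "\<exists>\<tau>>0. \<exists>\<epsilon>>0. \<forall>c\<in>?E. J c \<le> cs + \<epsilon> \<longrightarrow> J (step \<tau> c) \<le> cs - \<epsilon>"
    proof (rule ccontr)
      assume neg: "\<not> ?thesis"
      \<comment> \<open>step lengths \<open>T n\<close> against gains \<open>(T n)\<^sup>2\<close>: a failing step forces the squared gradient below \<open>2 * T n\<close>\<close>
      define T where "T n = 1 / real (Suc n)" for n
      have T0: "T n > 0" for n by (simp add: T_def)
      have Tlim: "T \<longlonglongrightarrow> 0" unfolding T_def using LIMSEQ_inverse_real_of_nat by (simp add: inverse_eq_divide)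
      have "\<exists>c\<in>?E. J c \<le> cs + (T n)\<^sup>2 \<and> J (step (T n) c) > cs - (T n)\<^sup>2" for n
        using neg T0[of n] by (meson not_le zero_less_power)
      then obtain c where c: "\<And>n. c n \<in> ?E" "\<And>n. J (c n) \<le> cs + (T n)\<^sup>2" "\<And>n. J (step (T n) (c n)) > cs - (T n)\<^sup>2"
        by metis
      obtain R where R: "\<And>c. c \<in> ?E \<Longrightarrow> J c \<le> cs + 1 \<Longrightarrow> (\<forall>i. \<bar>c i\<bar> \<le> R)" using coercive by blast
      have T1: "(T n)\<^sup>2 \<le> 1" for n by (auto simp: T_def power_le_one_iff)
      have "\<bar>c n i\<bar> \<le> R" for n i using R[OF c(1)[of n]] c(2)[of n] T1[of n] by force
      then obtain l r where lr: "strict_mono (r::nat\<Rightarrow>nat)" "\<And>i. (\<lambda>n. c (r n) i) \<longlonglongrightarrow> l i"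
        using bounded_coords_subsequence[of c "\<lambda>_. R"] by blast
      have lE: "l \<in> ?E" unfolding coords_below_def
      proof safe
        fix i assume "m \<le> i"
        then have "(\<lambda>n. c (r n) i) = (\<lambda>n. 0)" using c(1) by (auto simp: coords_below_def)
        then show "l i = 0" using lr(2)[of i] LIMSEQ_unique tendsto_const by metis
      qed
      have cl: "(\<lambda>n. c (r n)) \<longlonglongrightarrow> l" using lr(2) by (simp add: tendsto_fun_iff)
      have lim: "(\<lambda>n. g (x n)) \<longlonglongrightarrow> g l" if "continuous_on ?E g" "\<And>n. x n \<in> ?E" "x \<longlonglongrightarrow> l" for g :: "(nat \<Rightarrow> real) \<Rightarrow> real" and x
        using continuous_on_tendsto_compose[OF that(1,3) lE] that(2) by simp
      have Tr: "(\<lambda>n. T (r n)) \<longlonglongrightarrow> 0" using LIMSEQ_subseq_LIMSEQ[OF Tlim lr(1)] by (simp add: o_def)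
      have Jl1: "(\<lambda>n. J (c (r n))) \<longlonglongrightarrow> J l" by (rule lim[OF Jc c(1) cl])
      have mid: "(\<lambda>n. step (\<theta> n * T (r n)) (c (r n))) \<longlonglongrightarrow> l" if \<theta>: "\<And>n. \<bar>\<theta> n\<bar> \<le> 1" for \<theta> :: "nat \<Rightarrow> real"
      proof -
        have "(\<lambda>n. \<theta> n * T (r n)) \<longlonglongrightarrow> 0"
        proof (rule Lim_null_comparison[OF _ Tr])
          show "\<forall>\<^sub>F n in sequentially. norm (\<theta> n * T (r n)) \<le> T (r n)"
            using \<theta> T0 by (intro always_eventually allI) (simp add: abs_mult less_imp_le mult_left_le_one_le)
        qed
        then have "(\<lambda>n. c (r n) i + \<theta> n * T (r n) * (- Dm (c (r n)) i)) \<longlonglongrightarrow> l i + 0 * (- Dm l i)" for i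
          by (intro tendsto_intros lr(2) lim[OF Dmc c(1) cl])
        then show ?thesis by (simp add: tendsto_fun_iff step_def)
      qed
      have Jl2: "(\<lambda>n. J (step (T (r n)) (c (r n)))) \<longlonglongrightarrow> J l"
        using lim[OF Jc stepE[OF c(1)] mid[of "\<lambda>_. 1"]] by simp
      have T2: "(\<lambda>n. (T (r n))\<^sup>2) \<longlonglongrightarrow> 0" using tendsto_power[OF Tr, of 2] by simp
      have "J l \<le> cs"
        using LIMSEQ_le[OF Jl1 tendsto_add[OF tendsto_const[of cs] T2]] c(2) by auto
      moreover have "J l \<ge> cs"
        using LIMSEQ_le[OF tendsto_diff[OF tendsto_const[of cs] T2] Jl2] c(3) less_imp_le by auto
      ultimately have "J l = cs" by simp
      then obtain i0 where i0: "i0 < m" "D l i0 \<noteq> 0" using nocrit lE by blast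
      have "\<exists>\<theta>. \<bar>\<theta>\<bar> \<le> 1 \<and> (\<Sum>i<m. D (step (\<theta> * T (r n)) (c (r n))) i * Dm (c (r n)) i) \<le> 2 * T (r n)" for n
      proof -
        let ?c = "c (r n)" and ?T = "T (r n)" and ?h = "\<lambda>i. - Dm (c (r n)) i"
        have "\<exists>z. 0 < z \<and> z < ?T \<and> J (\<lambda>i. ?c i + ?T * ?h i) - J (\<lambda>i. ?c i + 0 * ?h i)
            = (?T - 0) * (\<Sum>i<m. D (\<lambda>i. ?c i + z * ?h i) i * ?h i)"
          by (rule MVT2[of 0 ?T "\<lambda>t. J (\<lambda>i. ?c i + t * ?h i)"]) (use T0 deriv[OF c(1) DmE(2)] in auto)
        then obtain z where z: "0 < z" "z < ?T"
          "J (step ?T ?c) - J ?c = ?T * (\<Sum>i<m. D (step z ?c) i * ?h i)"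
          by (auto simp: step_def)
        have "J (step ?T ?c) - J ?c \<ge> - 2 * ?T\<^sup>2" using c(2,3)[of "r n"] by linarith
        then have "?T * (\<Sum>i<m. D (step z ?c) i * Dm ?c i) \<le> ?T * (2 * ?T)"
          using z(3) by (simp add: sum_negf power2_eq_square)
        then have "(\<Sum>i<m. D (step z ?c) i * Dm ?c i) \<le> 2 * ?T"
          using T0[of "r n"] by (simp add: mult_le_cancel_left_pos)
        moreover have "z = (z / ?T) * ?T" "\<bar>z / ?T\<bar> \<le> 1" using z T0[of "r n"] by (auto simp: field_simps)
        ultimately show ?thesis by metis
      qed
      then obtain \<theta> where th: "\<And>n. \<bar>\<theta> n\<bar> \<le> 1"
        "\<And>n. (\<Sum>i<m. D (step (\<theta> n * T (r n)) (c (r n))) i * Dm (c (r n)) i) \<le> 2 * T (r n)"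
        by metis
      have "(\<lambda>n. \<Sum>i<m. D (step (\<theta> n * T (r n)) (c (r n))) i * Dm (c (r n)) i) \<longlonglongrightarrow> (\<Sum>i<m. D l i * Dm l i)"
        by (intro tendsto_sum tendsto_mult lim[OF Dc stepE[OF c(1)] mid[OF th(1)]] lim[OF Dmc c(1) cl]) auto
      moreover have "(\<lambda>n. 2 * T (r n)) \<longlonglongrightarrow> 2 * 0" by (intro tendsto_intros Tr)
      ultimately have "(\<Sum>i<m. D l i * Dm l i) \<le> 2 * 0"
        by (rule LIMSEQ_le) (use th(2) in blast)
      then have "(\<Sum>i<m. D l i * Dm l i) \<le> 0" by simp
      moreover have "(\<Sum>i<m. D l i * Dm l i) \<ge> D l i0 * Dm l i0"
        using i0 by (intro member_le_sum[of i0 "{..<m}" "\<lambda>i. D l i * Dm l i"]) (auto simp: Dm_def)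
      moreover have "D l i0 * Dm l i0 > 0" using i0 by (auto simp: Dm_def zero_less_mult_iff)
      ultimately show False by linarith
    qed
    then obtain \<tau> \<epsilon> where te: "\<epsilon> > 0" "\<And>c. c \<in> ?E \<Longrightarrow> J c \<le> cs + \<epsilon> \<Longrightarrow> J (step \<tau> c) \<le> cs - \<epsilon>"
      by blast
    obtain v where v: "v \<in> V" "v < cs + \<epsilon>"
      using cInf_lessD[of V "cs + \<epsilon>"] bV te(1) by (auto simp: cs_def)
    then obtain B where B: "adm B" "\<forall>y\<in>?S. J (B y) \<le> v" using v(1) unfolding V_def by blast
    have Bc: "continuous_on ?S B" 
      using B(1) by (intro continuous_on_coordinatewise_then_product) (auto simp: adm_def)
    have "adm (\<lambda>y. step \<tau> (B y))"
      unfolding adm_def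
    proof (intro conjI ballI allI)
      fix i
      have "continuous_on ?S (\<lambda>y. Dm (B y) i)"
        using B(1) by (intro continuous_on_compose2[OF Dmc Bc]) (auto simp: adm_def)
      then show "continuous_on ?S (\<lambda>y. step \<tau> (B y) i)"
        unfolding step_def using B(1) by (intro continuous_intros) (auto simp: adm_def)
    next
      fix y assume y: "y \<in> ?S"
      then show "step \<tau> (B y) \<in> ?E" using B(1) by (intro stepE) (auto simp: adm_def)
      have "B (\<lambda>i. - y i) = (\<lambda>i. - B y i)" "B y \<in> ?E" using B(1) y by (auto simp: adm_def)
      then show "step \<tau> (B (\<lambda>i. - y i)) = (\<lambda>i. - step \<tau> (B y) i)"
        by (auto simp: step_def Dm_def Dodd)
    qed
    moreover have "\<forall>y\<in>?S. J (step \<tau> (B y)) \<le> cs - \<epsilon>"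
      using B v(2) by (auto intro!: te(2) simp: adm_def)
    ultimately have "cs - \<epsilon> \<in> V" unfolding V_def by blast
    then have "cs \<le> cs - \<epsilon>" unfolding cs_def using bdd by (intro cInf_lower)
    then show False using te(1) by simp
  qed
  then show ?thesis using csa csb by auto
qed

section \<open>Modulars with a variable exponent\<close>

definition signed_power :: "real \<Rightarrow> real \<Rightarrow> real" where
  "signed_power q a = \<bar>a\<bar> powr (q - 2) * a"

lemma abs_signed_power: "\<bar>signed_power q a\<bar> = \<bar>a\<bar> powr (q - 1)"
proof (cases "a = 0")
  case False
  then have "\<bar>a\<bar> powr (q - 2) * \<bar>a\<bar> powr 1 = \<bar>a\<bar> powr (q - 1)"
    by (subst powr_add[symmetric]) simp
  then show ?thesis using False by (simp add: signed_power_def abs_mult)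
qed (simp add: signed_power_def)

lemma signed_power_self: "signed_power q a * a = \<bar>a\<bar> powr q"
proof (cases "a = 0")
  case False
  then have "\<bar>a\<bar> powr (q - 2) * \<bar>a\<bar> powr 2 = \<bar>a\<bar> powr q"
    by (subst powr_add[symmetric]) simp
  then show ?thesis using False by (simp add: signed_power_def power2_eq_square mult.assoc)
qed (simp add: signed_power_def)

lemma signed_power_minus [simp]: "signed_power q (- a) = - signed_power q a"
  by (simp add: signed_power_def)

lemma signed_power_0 [simp]: "signed_power q 0 = 0"
  by (simp add: signed_power_def)

lemma powr_mult_le_sum:
  assumes "1 < q"
  shows "\<bar>signed_power q a * b\<bar> \<le> \<bar>a\<bar> powr q + \<bar>b\<bar> powr q"
proof -
  define m where "m = max \<bar>a\<bar> \<bar>b\<bar>"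
  have "\<bar>signed_power q a * b\<bar> \<le> m powr (q - 1) * m"
    unfolding abs_mult abs_signed_power using assms
    by (intro mult_mono powr_mono2) (auto simp: m_def)
  also have "\<dots> = m powr q"
  proof (cases "m = 0")
    case False
    then have "m > 0" by (auto simp: m_def)
    then show ?thesis using powr_add[of m "q - 1" 1] by simp
  qed auto
  also have "\<dots> \<le> \<bar>a\<bar> powr q + \<bar>b\<bar> powr q" by (auto simp: m_def max_def)
  finally show ?thesis .
qed

text \<open>The tangent inequality of the convex function \<open>|a|\<^sup>q/q\<close>; it reduces to Young's inequality for
  \<open>|a| powr (q - 1) * |b|\<close>.\<close>

lemma powr_convex_ineq:
  assumes q: "1 < q"
  shows "\<bar>a\<bar> powr q / q + signed_power q a * (b - a) \<le> \<bar>b\<bar> powr q / q"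
proof -
  have "signed_power q a * b \<le> \<bar>b\<bar> powr q / q + (1 - 1/q) * \<bar>a\<bar> powr q"
  proof (cases "a = 0 \<or> b = 0")
    case False
    have "signed_power q a * b \<le> \<bar>b\<bar> * \<bar>a\<bar> powr (q - 1)"
      using abs_signed_power[of q a] by (metis abs_ge_self abs_mult mult.commute)
    also have "\<dots> = (\<bar>b\<bar> powr q) powr (1/q) * (\<bar>a\<bar> powr q) powr (1 - 1/q)"
      using q False by (simp add: powr_powr right_diff_distrib)
    also have "\<dots> \<le> (1/q) * \<bar>b\<bar> powr q + (1 - 1/q) * \<bar>a\<bar> powr q"
      using q False by (intro Youngs_inequality_0) auto
    finally show ?thesis by simp
  qed (use q in \<open>auto simp: signed_power_def\<close>)
  then have "\<bar>a\<bar> powr q / q + (signed_power q a * b - signed_power q a * a) \<le> \<bar>b\<bar> powr q / q"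
    unfolding signed_power_self by (simp add: algebra_simps)
  then show ?thesis by (simp add: right_diff_distrib)
qed

lemma powr_sum_le:
  fixes a b q P :: real
  assumes "0 \<le> q" "q \<le> P"
  shows "\<bar>a + b\<bar> powr q \<le> 2 powr P * (\<bar>a\<bar> powr q + \<bar>b\<bar> powr q)"
proof -
  define m where "m = max \<bar>a\<bar> \<bar>b\<bar>"
  have "\<bar>a + b\<bar> powr q \<le> (2 * m) powr q" using assms by (intro powr_mono2) (auto simp: m_def)
  also have "\<dots> = 2 powr q * m powr q" by (auto simp: powr_mult m_def)
  also have "\<dots> \<le> 2 powr P * (\<bar>a\<bar> powr q + \<bar>b\<bar> powr q)"
    using assms by (intro mult_mono powr_mono) (auto simp: m_def max_def)
  finally show ?thesis .
qed

text \<open>Testing with a truncation: truncating a function replaces each difference \<open>d\<close> by some \<open>e\<close> between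
  \<open>0\<close> and \<open>d\<close>.\<close>

lemma signed_power_between:
  assumes q: "1 < q" and e: "0 \<le> e \<and> e \<le> d \<or> d \<le> e \<and> e \<le> 0"
  shows "\<bar>e\<bar> powr q \<le> signed_power q d * e"
proof -
  have "\<bar>e\<bar> powr q = \<bar>signed_power q e\<bar> * \<bar>e\<bar>"
    using signed_power_self[of q e] by (metis abs_ge_zero abs_mult abs_of_nonneg powr_ge_zero)
  also have "\<dots> \<le> \<bar>signed_power q d\<bar> * \<bar>e\<bar>"
    unfolding abs_signed_power using q e by (intro mult_right_mono powr_mono2) auto
  also have "\<dots> = signed_power q d * e"
  proof -
    have "0 \<le> d * e" using e by (auto simp: zero_le_mult_iff)
    then have "0 \<le> \<bar>d\<bar> powr (q - 2) * (d * e)" by simp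
    then show ?thesis unfolding abs_mult[symmetric] signed_power_def
      by (intro abs_of_nonneg) (simp add: mult.assoc)
  qed
  finally show ?thesis .
qed

lemma tendsto_signed_power:
  assumes q: "1 < q" and x: "(x \<longlongrightarrow> a) F"
  shows "((\<lambda>n. signed_power q (x n)) \<longlongrightarrow> signed_power q a) F"
proof (cases "a = 0")
  case False
  then show ?thesis unfolding signed_power_def using x by (intro tendsto_intros) auto
next
  case True
  have "((\<lambda>n. \<bar>x n\<bar> powr (q - 1)) \<longlongrightarrow> \<bar>a\<bar> powr (q - 1)) F"
    using q x by (intro tendsto_powr' tendsto_rabs tendsto_const) auto
  then have "((\<lambda>n. \<bar>x n\<bar> powr (q - 1)) \<longlongrightarrow> 0) F" using True by simp
  then have "((\<lambda>n. signed_power q (x n)) \<longlongrightarrow> 0) F"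
    by (rule Lim_null_comparison[rotated]) (simp add: abs_signed_power)
  then show ?thesis using True by simp
qed

lemma tendsto_abs_powr:
  fixes x :: "'a \<Rightarrow> real"
  assumes "0 < q" "(x \<longlongrightarrow> a) F"
  shows "((\<lambda>n. \<bar>x n\<bar> powr q) \<longlongrightarrow> \<bar>a\<bar> powr q) F"
  using assms by (intro tendsto_powr' tendsto_rabs tendsto_const) auto

text \<open>The energy is the sum of two modulars of this kind: one on pairs of points with the singular weight,
  and one on points with weight \<open>1\<close>.\<close>

locale weighted_modular =
  fixes M :: "'a measure" and q k :: "'a \<Rightarrow> real" and pl pu :: real
  assumes pl: "1 < pl" and q_bounds: "\<And>z. pl \<le> q z" "\<And>z. q z \<le> pu"
    and q_meas [measurable]: "q \<in> borel_measurable M"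
    and k_meas [measurable]: "k \<in> borel_measurable M"
    and k_nonneg: "\<And>z. 0 \<le> k z"
begin

definition fin :: "('a \<Rightarrow> real) \<Rightarrow> bool" where
  "fin \<phi> \<longleftrightarrow> \<phi> \<in> borel_measurable M \<and> integrable M (\<lambda>z. \<bar>\<phi> z\<bar> powr q z * k z)"

definition modular :: "('a \<Rightarrow> real) \<Rightarrow> real" where
  "modular \<phi> = (\<integral>z. \<bar>\<phi> z\<bar> powr q z / q z * k z \<partial>M)"

definition dmodular :: "('a \<Rightarrow> real) \<Rightarrow> ('a \<Rightarrow> real) \<Rightarrow> real" where
  "dmodular \<phi> \<psi> = (\<integral>z. signed_power (q z) (\<phi> z) * \<psi> z * k z \<partial>M)"

lemma q1: "1 < q z" "0 < q z" "0 \<le> q z" "q z \<noteq> 0" and pu: "1 < pu"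
  using pl q_bounds[of z] q_bounds[of undefined] by linarith+

lemma finD [measurable_dest]: "fin \<phi> \<Longrightarrow> \<phi> \<in> borel_measurable M"
  by (simp add: fin_def)

lemma signed_power_measurable [measurable (raw)]:
  assumes [measurable]: "f \<in> borel_measurable M" "g \<in> borel_measurable M"
  shows "(\<lambda>z. signed_power (f z) (g z)) \<in> borel_measurable M"
  unfolding signed_power_def by measurable

lemma fin_mono:
  assumes "fin \<psi>" "\<phi> \<in> borel_measurable M" "\<And>z. \<bar>\<phi> z\<bar> \<le> \<bar>\<psi> z\<bar>"
  shows "fin \<phi>"
  unfolding fin_def
proof
  have [measurable]: "\<phi> \<in> borel_measurable M" by fact
  show "integrable M (\<lambda>z. \<bar>\<phi> z\<bar> powr q z * k z)"
  proof (rule Bochner_Integration.integrable_bound)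
    show "integrable M (\<lambda>z. \<bar>\<psi> z\<bar> powr q z * k z)" using assms by (simp add: fin_def)
    show "AE z in M. norm (\<bar>\<phi> z\<bar> powr q z * k z) \<le> norm (\<bar>\<psi> z\<bar> powr q z * k z)"
      using assms(3) k_nonneg q1 by (intro AE_I2) (auto intro!: mult_right_mono powr_mono2)
  qed measurable
qed fact

lemma fin_add:
  assumes "fin \<phi>" "fin \<psi>"
  shows "fin (\<lambda>z. \<phi> z + \<psi> z)"
  unfolding fin_def
proof
  have [measurable]: "\<phi> \<in> borel_measurable M" "\<psi> \<in> borel_measurable M" using assms by (auto simp: fin_def)
  show "(\<lambda>z. \<phi> z + \<psi> z) \<in> borel_measurable M" by measurable
  show "integrable M (\<lambda>z. \<bar>\<phi> z + \<psi> z\<bar> powr q z * k z)"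
  proof (rule Bochner_Integration.integrable_bound)
    show "integrable M (\<lambda>z. 2 powr pu * (\<bar>\<phi> z\<bar> powr q z * k z + \<bar>\<psi> z\<bar> powr q z * k z))"
      using assms by (auto simp: fin_def)
    have "\<bar>\<phi> z + \<psi> z\<bar> powr q z * k z \<le> 2 powr pu * (\<bar>\<phi> z\<bar> powr q z * k z + \<bar>\<psi> z\<bar> powr q z * k z)" for z
      using mult_right_mono[OF powr_sum_le[of "q z" pu "\<phi> z" "\<psi> z"] k_nonneg[of z]] q1[of z] q_bounds[of z]
      by (simp add: algebra_simps)
    then show "AE z in M. norm (\<bar>\<phi> z + \<psi> z\<bar> powr q z * k z) \<le> norm (2 powr pu * (\<bar>\<phi> z\<bar> powr q z * k z + \<bar>\<psi> z\<bar> powr q z * k z))"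
      using k_nonneg by (intro AE_I2) (simp add: order_trans[OF _ abs_ge_self])
  qed measurable
qed

lemma fin_scale:
  assumes "fin \<phi>"
  shows "fin (\<lambda>z. c * \<phi> z)"
  unfolding fin_def
proof
  have [measurable]: "\<phi> \<in> borel_measurable M" using assms by (auto simp: fin_def)
  show "(\<lambda>z. c * \<phi> z) \<in> borel_measurable M" by measurable
  show "integrable M (\<lambda>z. \<bar>c * \<phi> z\<bar> powr q z * k z)"
  proof (rule Bochner_Integration.integrable_bound)
    show "integrable M (\<lambda>z. max 1 \<bar>c\<bar> powr pu * (\<bar>\<phi> z\<bar> powr q z * k z))"
      using assms by (auto simp: fin_def)
    have "\<bar>c * \<phi> z\<bar> powr q z \<le> max 1 \<bar>c\<bar> powr pu * \<bar>\<phi> z\<bar> powr q z" for z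
    proof -
      have "\<bar>c\<bar> powr q z \<le> max 1 \<bar>c\<bar> powr q z" using q1[of z] by (intro powr_mono2) auto
      also have "\<dots> \<le> max 1 \<bar>c\<bar> powr pu" using q_bounds by (intro powr_mono) auto
      finally show ?thesis by (simp add: abs_mult powr_mult mult_right_mono)
    qed
    then have "\<bar>c * \<phi> z\<bar> powr q z * k z \<le> max 1 \<bar>c\<bar> powr pu * (\<bar>\<phi> z\<bar> powr q z * k z)" for z
      using k_nonneg by (simp add: mult_right_mono mult.assoc[symmetric])
    then show "AE z in M. norm (\<bar>c * \<phi> z\<bar> powr q z * k z) \<le> norm (max 1 \<bar>c\<bar> powr pu * (\<bar>\<phi> z\<bar> powr q z * k z))"
      using k_nonneg by (intro AE_I2) (simp add: order_trans[OF _ abs_ge_self])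
  qed measurable
qed

lemma fin_zero [simp]: "fin (\<lambda>_. 0)"
  by (simp add: fin_def)

lemma fin_diff: "fin \<phi> \<Longrightarrow> fin \<psi> \<Longrightarrow> fin (\<lambda>z. \<phi> z - \<psi> z)"
  using fin_add[OF _ fin_scale[of \<psi> "-1"]] by simp

lemma fin_abs: "fin \<phi> \<Longrightarrow> fin (\<lambda>z. \<bar>\<phi> z\<bar>)"
  by (auto simp: fin_def)

lemma integrable_modular: "fin \<phi> \<Longrightarrow> integrable M (\<lambda>z. \<bar>\<phi> z\<bar> powr q z / q z * k z)"
proof (rule Bochner_Integration.integrable_bound[of M "\<lambda>z. \<bar>\<phi> z\<bar> powr q z * k z"])
  assume f: "fin \<phi>"
  then have [measurable]: "\<phi> \<in> borel_measurable M" by (auto simp: fin_def)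
  show "integrable M (\<lambda>z. \<bar>\<phi> z\<bar> powr q z * k z)" using f by (simp add: fin_def)
  show "(\<lambda>z. \<bar>\<phi> z\<bar> powr q z / q z * k z) \<in> borel_measurable M" by measurable
  have "\<bar>\<phi> z\<bar> powr q z / q z * k z \<le> \<bar>\<phi> z\<bar> powr q z * k z" for z
    using q1[of z] k_nonneg[of z] by (intro mult_right_mono) (auto simp: divide_le_eq mult_le_cancel_left1)
  then show "AE z in M. norm (\<bar>\<phi> z\<bar> powr q z / q z * k z) \<le> norm (\<bar>\<phi> z\<bar> powr q z * k z)"
    using k_nonneg q1 by (intro AE_I2) (simp add: abs_mult)
qed

lemma modular_nonneg: "0 \<le> modular \<phi>"
  unfolding modular_def using k_nonneg q1 by (intro Bochner_Integration.integral_nonneg mult_nonneg_nonneg divide_nonneg_pos) auto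

lemma integral_powr_le_modular: "fin \<phi> \<Longrightarrow> (\<integral>z. \<bar>\<phi> z\<bar> powr q z * k z \<partial>M) \<le> pu * modular \<phi>"
  unfolding modular_def integral_mult_right_zero[symmetric]
proof (rule integral_mono)
  assume f: "fin \<phi>"
  then show "integrable M (\<lambda>z. \<bar>\<phi> z\<bar> powr q z * k z)" by (simp add: fin_def)
  show "integrable M (\<lambda>z. pu * (\<bar>\<phi> z\<bar> powr q z / q z * k z))" by (intro integrable_mult_right integrable_modular f)
  fix z
  have "q z * (\<bar>\<phi> z\<bar> powr q z / q z * k z) \<le> pu * (\<bar>\<phi> z\<bar> powr q z / q z * k z)"
    using q_bounds[of z] q1[of z] k_nonneg[of z] by (intro mult_right_mono) auto
  then show "\<bar>\<phi> z\<bar> powr q z * k z \<le> pu * (\<bar>\<phi> z\<bar> powr q z / q z * k z)" using q1[of z] by simp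
qed

lemma integrable_dmodular:
  assumes "fin \<phi>" "fin \<psi>"
  shows "integrable M (\<lambda>z. signed_power (q z) (\<phi> z) * \<psi> z * k z)"
proof (rule Bochner_Integration.integrable_bound)
  have [measurable]: "\<phi> \<in> borel_measurable M" "\<psi> \<in> borel_measurable M" using assms by (auto simp: fin_def)
  show "integrable M (\<lambda>z. \<bar>\<phi> z\<bar> powr q z * k z + \<bar>\<psi> z\<bar> powr q z * k z)"
    using assms by (auto simp: fin_def)
  show "(\<lambda>z. signed_power (q z) (\<phi> z) * \<psi> z * k z) \<in> borel_measurable M" by measurable
  have "\<bar>signed_power (q z) (\<phi> z) * \<psi> z * k z\<bar> \<le> \<bar>\<phi> z\<bar> powr q z * k z + \<bar>\<psi> z\<bar> powr q z * k z" for z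
    using mult_right_mono[OF powr_mult_le_sum[of "q z" "\<phi> z" "\<psi> z"] k_nonneg[of z]] q1[of z] k_nonneg[of z]
    by (simp add: abs_mult algebra_simps)
  then show "AE z in M. norm (signed_power (q z) (\<phi> z) * \<psi> z * k z) \<le> norm (\<bar>\<phi> z\<bar> powr q z * k z + \<bar>\<psi> z\<bar> powr q z * k z)"
    by (intro AE_I2) (simp add: order_trans[OF _ abs_ge_self])
qed

lemma dmodular_linear:
  assumes "fin \<phi>" "fin \<psi>" "fin \<xi>"
  shows "dmodular \<phi> (\<lambda>z. a * \<psi> z + b * \<xi> z) = a * dmodular \<phi> \<psi> + b * dmodular \<phi> \<xi>"
proof -
  have "dmodular \<phi> (\<lambda>z. a * \<psi> z + b * \<xi> z)
      = (\<integral>z. a * (signed_power (q z) (\<phi> z) * \<psi> z * k z) + b * (signed_power (q z) (\<phi> z) * \<xi> z * k z) \<partial>M)"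
    unfolding dmodular_def by (intro Bochner_Integration.integral_cong) (auto simp: algebra_simps)
  also have "\<dots> = a * dmodular \<phi> \<psi> + b * dmodular \<phi> \<xi>"
    unfolding dmodular_def using integrable_dmodular[OF assms(1,2)] integrable_dmodular[OF assms(1,3)] by simp
  finally show ?thesis .
qed

lemma dmodular_uminus_left: "dmodular (\<lambda>z. - \<phi> z) \<psi> = - dmodular \<phi> \<psi>"
  by (simp add: dmodular_def)

lemma dmodular_self: "dmodular \<phi> \<phi> = (\<integral>z. \<bar>\<phi> z\<bar> powr q z * k z \<partial>M)"
  by (simp add: dmodular_def signed_power_self)

lemma modular_convex:
  assumes "fin \<phi>" "fin \<psi>"
  shows "modular \<phi> + dmodular \<phi> (\<lambda>z. \<psi> z - \<phi> z) \<le> modular \<psi>"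
proof -
  have "modular \<phi> + dmodular \<phi> (\<lambda>z. \<psi> z - \<phi> z)
    = (\<integral>z. \<bar>\<phi> z\<bar> powr q z / q z * k z + signed_power (q z) (\<phi> z) * (\<psi> z - \<phi> z) * k z \<partial>M)"
    unfolding modular_def dmodular_def
    by (intro Bochner_Integration.integral_add[symmetric] integrable_modular integrable_dmodular fin_diff assms)
  also have "\<dots> \<le> modular \<psi>"
    unfolding modular_def
  proof (rule integral_mono)
    show "integrable M (\<lambda>z. \<bar>\<phi> z\<bar> powr q z / q z * k z + signed_power (q z) (\<phi> z) * (\<psi> z - \<phi> z) * k z)"
      by (intro Bochner_Integration.integrable_add integrable_modular integrable_dmodular fin_diff assms)
    show "integrable M (\<lambda>z. \<bar>\<psi> z\<bar> powr q z / q z * k z)" by (intro integrable_modular assms)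
    show "\<bar>\<phi> z\<bar> powr q z / q z * k z + signed_power (q z) (\<phi> z) * (\<psi> z - \<phi> z) * k z \<le> \<bar>\<psi> z\<bar> powr q z / q z * k z" for z
      using mult_right_mono[OF powr_convex_ineq[OF q1(1)[of z], of "\<phi> z" "\<psi> z"] k_nonneg[of z]]
      by (simp add: distrib_right)
  qed
  finally show ?thesis .
qed

lemma tendsto_modular:
  assumes \<psi>: "fin \<psi>" and \<phi>: "\<And>n. \<phi>n n \<in> borel_measurable M" "\<And>n z. \<bar>\<phi>n n z\<bar> \<le> \<psi> z" "\<And>z. (\<lambda>n. \<phi>n n z) \<longlonglongrightarrow> \<phi> z"
  shows "(\<lambda>n. modular (\<phi>n n)) \<longlonglongrightarrow> modular \<phi>"
  unfolding modular_def
proof (rule integral_dominated_convergence[where w = "\<lambda>z. \<bar>\<psi> z\<bar> powr q z / q z * k z"])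
  have [measurable]: "\<And>n. \<phi>n n \<in> borel_measurable M" by fact
  have [measurable]: "\<phi> \<in> borel_measurable M" by (rule borel_measurable_LIMSEQ_real[OF \<phi>(3) \<phi>(1)])
  show "(\<lambda>z. \<bar>\<phi> z\<bar> powr q z / q z * k z) \<in> borel_measurable M" by measurable
  show "(\<lambda>z. \<bar>\<phi>n n z\<bar> powr q z / q z * k z) \<in> borel_measurable M" for n by measurable
  show "integrable M (\<lambda>z. \<bar>\<psi> z\<bar> powr q z / q z * k z)" by (rule integrable_modular[OF \<psi>])
  show "AE z in M. (\<lambda>n. \<bar>\<phi>n n z\<bar> powr q z / q z * k z) \<longlonglongrightarrow> \<bar>\<phi> z\<bar> powr q z / q z * k z"
    using q1 by (intro AE_I2 tendsto_intros tendsto_abs_powr \<phi>(3)) auto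
  have "\<bar>\<bar>\<phi>n n z\<bar> powr q z / q z * k z\<bar> \<le> \<bar>\<psi> z\<bar> powr q z / q z * k z" for n z
    using q1[of z] k_nonneg[of z] \<phi>(2)[of n z]
    by (simp add: abs_mult) (intro mult_right_mono divide_right_mono powr_mono2, auto)
  then show "AE z in M. norm (\<bar>\<phi>n n z\<bar> powr q z / q z * k z) \<le> \<bar>\<psi> z\<bar> powr q z / q z * k z" for n
    by (intro AE_I2) simp
qed

lemma tendsto_dmodular:
  assumes \<psi>: "fin \<psi>" and \<phi>: "\<And>n. \<phi>n n \<in> borel_measurable M" "\<And>n z. \<bar>\<phi>n n z\<bar> \<le> \<psi> z" "\<And>z. (\<lambda>n. \<phi>n n z) \<longlonglongrightarrow> \<phi> z"
    and \<xi>: "fin \<xi>"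
  shows "(\<lambda>n. dmodular (\<phi>n n) \<xi>) \<longlonglongrightarrow> dmodular \<phi> \<xi>"
  unfolding dmodular_def
proof (rule integral_dominated_convergence[where w = "\<lambda>z. \<bar>\<psi> z\<bar> powr q z * k z + \<bar>\<xi> z\<bar> powr q z * k z"])
  have [measurable]: "\<And>n. \<phi>n n \<in> borel_measurable M" by fact
  have [measurable]: "\<phi> \<in> borel_measurable M" by (rule borel_measurable_LIMSEQ_real[OF \<phi>(3) \<phi>(1)])
  have [measurable]: "\<xi> \<in> borel_measurable M" using \<xi> by (simp add: fin_def)
  show "(\<lambda>z. signed_power (q z) (\<phi> z) * \<xi> z * k z) \<in> borel_measurable M" by measurable
  show "(\<lambda>z. signed_power (q z) (\<phi>n n z) * \<xi> z * k z) \<in> borel_measurable M" for n by measurable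
  show "integrable M (\<lambda>z. \<bar>\<psi> z\<bar> powr q z * k z + \<bar>\<xi> z\<bar> powr q z * k z)" using \<psi> \<xi> by (simp add: fin_def)
  show "AE z in M. (\<lambda>n. signed_power (q z) (\<phi>n n z) * \<xi> z * k z) \<longlonglongrightarrow> signed_power (q z) (\<phi> z) * \<xi> z * k z"
    using q1 by (intro AE_I2 tendsto_intros tendsto_signed_power \<phi>(3)) auto
  have "\<bar>signed_power (q z) (\<phi>n n z) * \<xi> z * k z\<bar> \<le> \<bar>\<psi> z\<bar> powr q z * k z + \<bar>\<xi> z\<bar> powr q z * k z" for n z
  proof -
    have "\<bar>signed_power (q z) (\<phi>n n z) * \<xi> z\<bar> \<le> \<bar>\<phi>n n z\<bar> powr q z + \<bar>\<xi> z\<bar> powr q z"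
      using q1(1) by (rule powr_mult_le_sum)
    also have "\<dots> \<le> \<bar>\<psi> z\<bar> powr q z + \<bar>\<xi> z\<bar> powr q z"
      using q1[of z] \<phi>(2)[of n z] by (intro add_mono powr_mono2) auto
    finally have "\<bar>signed_power (q z) (\<phi>n n z) * \<xi> z\<bar> * k z \<le> (\<bar>\<psi> z\<bar> powr q z + \<bar>\<xi> z\<bar> powr q z) * k z"
      using k_nonneg by (rule mult_right_mono)
    then show ?thesis using k_nonneg[of z] by (simp add: abs_mult distrib_right)
  qed
  then show "AE z in M. norm (signed_power (q z) (\<phi>n n z) * \<xi> z * k z) \<le> \<bar>\<psi> z\<bar> powr q z * k z + \<bar>\<xi> z\<bar> powr q z * k z" for n
    by (intro AE_I2) simp
qed

lemma modular_Fatou: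
  assumes \<phi>n: "\<And>n. fin (\<phi>n n)" and \<phi>: "\<phi> \<in> borel_measurable M"
    and lim: "AE z in M. (\<lambda>n. \<phi>n n z) \<longlonglongrightarrow> \<phi> z" and e: "(\<lambda>n. modular (\<phi>n n)) \<longlonglongrightarrow> e"
  shows "fin \<phi>" "modular \<phi> \<le> e"
proof -
  have [measurable]: "\<And>n. \<phi>n n \<in> borel_measurable M" "\<phi> \<in> borel_measurable M" using \<phi>n \<phi> by (auto simp: fin_def)
  have nonneg: "0 \<le> \<bar>f z\<bar> powr q z / q z * k z" for f z using q1[of z] k_nonneg[of z] by auto
  have e0: "e \<ge> 0" by (rule LIMSEQ_le_const[OF e]) (auto intro: modular_nonneg)
  have "(\<integral>\<^sup>+z. ennreal (\<bar>\<phi> z\<bar> powr q z / q z * k z) \<partial>M)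
      = (\<integral>\<^sup>+z. liminf (\<lambda>n. ennreal (\<bar>\<phi>n n z\<bar> powr q z / q z * k z)) \<partial>M)"
  proof (rule nn_integral_cong_AE, use lim in eventually_elim)
    fix z assume "(\<lambda>n. \<phi>n n z) \<longlonglongrightarrow> \<phi> z"
    then have "(\<lambda>n. ennreal (\<bar>\<phi>n n z\<bar> powr q z / q z * k z)) \<longlonglongrightarrow> ennreal (\<bar>\<phi> z\<bar> powr q z / q z * k z)"
      using q1 by (intro tendsto_ennrealI tendsto_intros tendsto_abs_powr) auto
    then show "ennreal (\<bar>\<phi> z\<bar> powr q z / q z * k z) = liminf (\<lambda>n. ennreal (\<bar>\<phi>n n z\<bar> powr q z / q z * k z))"
      using lim_imp_Liminf[OF trivial_limit_sequentially] by metis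
  qed
  also have "\<dots> \<le> liminf (\<lambda>n. \<integral>\<^sup>+z. ennreal (\<bar>\<phi>n n z\<bar> powr q z / q z * k z) \<partial>M)"
    by (rule nn_integral_liminf) measurable
  also have "(\<lambda>n. \<integral>\<^sup>+z. ennreal (\<bar>\<phi>n n z\<bar> powr q z / q z * k z) \<partial>M) = (\<lambda>n. ennreal (modular (\<phi>n n)))"
    unfolding modular_def using nonneg by (intro ext nn_integral_eq_integral integrable_modular \<phi>n) auto
  also have "liminf \<dots> = ennreal e"
    by (rule lim_imp_Liminf) (auto intro: tendsto_ennrealI e)
  finally have *: "(\<integral>\<^sup>+z. ennreal (\<bar>\<phi> z\<bar> powr q z / q z * k z) \<partial>M) \<le> ennreal e" .
  have int: "integrable M (\<lambda>z. \<bar>\<phi> z\<bar> powr q z / q z * k z)"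
    using * nonneg[of \<phi>] by (intro integrableI_nonneg) (auto simp: le_less_trans)
  then show "modular \<phi> \<le> e"
    using * nonneg[of \<phi>] e0 by (simp add: modular_def nn_integral_eq_integral)
  show "fin \<phi>"
    unfolding fin_def
  proof
    show "integrable M (\<lambda>z. \<bar>\<phi> z\<bar> powr q z * k z)"
    proof (rule Bochner_Integration.integrable_bound)
      show "integrable M (\<lambda>z. pu * (\<bar>\<phi> z\<bar> powr q z / q z * k z))" by (intro integrable_mult_right int)
      have *: "q z * (\<bar>\<phi> z\<bar> powr q z / q z * k z) \<le> pu * (\<bar>\<phi> z\<bar> powr q z / q z * k z)" for z
        using q_bounds[of z] nonneg[of \<phi> z] by (intro mult_right_mono) auto
      have "\<bar>\<phi> z\<bar> powr q z * k z \<le> pu * (\<bar>\<phi> z\<bar> powr q z / q z * k z)" for z using *[of z] q1[of z] by simp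
      then have "norm (\<bar>\<phi> z\<bar> powr q z * k z) \<le> norm (pu * (\<bar>\<phi> z\<bar> powr q z / q z * k z))" for z
        unfolding real_norm_def using k_nonneg[of z] by (metis abs_ge_self abs_of_nonneg order_trans mult_nonneg_nonneg powr_ge_zero)
      then show "AE z in M. norm (\<bar>\<phi> z\<bar> powr q z * k z) \<le> norm (pu * (\<bar>\<phi> z\<bar> powr q z / q z * k z))"
        by (intro AE_I2)
    qed measurable
  qed fact
qed

lemma modular_scale_le:
  assumes "fin \<phi>" "0 \<le> t" "t \<le> 1"
  shows "modular (\<lambda>z. t * \<phi> z) \<le> t powr pl * modular \<phi>"
  unfolding modular_def integral_mult_right_zero[symmetric]
proof (rule integral_mono)
  show "integrable M (\<lambda>z. \<bar>t * \<phi> z\<bar> powr q z / q z * k z)" by (intro integrable_modular fin_scale assms)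
  show "integrable M (\<lambda>z. t powr pl * (\<bar>\<phi> z\<bar> powr q z / q z * k z))" by (intro integrable_mult_right integrable_modular assms)
  fix z
  have "t powr q z \<le> t powr pl" using assms q_bounds[of z] by (cases "t = 0") (auto intro!: powr_mono')
  then have "t powr q z * (\<bar>\<phi> z\<bar> powr q z / q z * k z) \<le> t powr pl * (\<bar>\<phi> z\<bar> powr q z / q z * k z)"
    using q1[of z] k_nonneg[of z] by (intro mult_right_mono) auto
  then show "\<bar>t * \<phi> z\<bar> powr q z / q z * k z \<le> t powr pl * (\<bar>\<phi> z\<bar> powr q z / q z * k z)"
    using assms by (simp add: abs_mult powr_mult)
qed

end

section \<open>Oscillation of functions of finite fractional energy\<close>

text \<open>This makes Fubini's theorem available for the product of two completed measures, over which the double integrals are taken.\<close>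

lemma sigma_finite_lebesgue: "sigma_finite_measure (lebesgue :: 'a::euclidean_space measure)"
proof
  obtain A :: "'a set set" where A: "countable A" "A \<subseteq> sets lborel" "\<Union>A = space lborel" "\<forall>a\<in>A. emeasure lborel a \<noteq> \<infinity>"
    using sigma_finite_measure.sigma_finite_countable[OF sigma_finite_lborel] by blast
  have "A \<subseteq> sets lebesgue" using A(2) by auto
  moreover have "\<forall>a\<in>A. emeasure lebesgue a \<noteq> \<infinity>" using A(2,4) by auto
  ultimately show "\<exists>A. countable A \<and> A \<subseteq> sets lebesgue \<and> \<Union>A = space lebesgue \<and> (\<forall>a\<in>A. emeasure (lebesgue :: 'a measure) a \<noteq> \<infinity>)"
    using A(1,3) by auto
qed

interpretation lebesgue: sigma_finite_measure "lebesgue :: 'a::euclidean_space measure"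
  by (rule sigma_finite_lebesgue)

interpretation lebesgue_pair: pair_sigma_finite "lebesgue :: 'a::euclidean_space measure" "lebesgue :: 'b::euclidean_space measure"
  by unfold_locales

lemma borel_measurable_lebesgue_pair:
  assumes "f \<in> borel_measurable (borel :: ('a::euclidean_space \<times> 'b::euclidean_space) measure)"
  shows "f \<in> borel_measurable (lebesgue \<Otimes>\<^sub>M lebesgue)"
proof -
  have "(\<lambda>z. z) \<in> (lebesgue \<Otimes>\<^sub>M lebesgue) \<rightarrow>\<^sub>M (borel \<Otimes>\<^sub>M borel :: ('a \<times> 'b) measure)"
    by (rule measurable_pair) (auto simp: comp_def intro!: measurable_compose[OF measurable_fst] measurable_compose[OF measurable_snd] measurable_completion)
  then have "(\<lambda>z. z) \<in> (lebesgue \<Otimes>\<^sub>M lebesgue) \<rightarrow>\<^sub>M (borel :: ('a \<times> 'b) measure)"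
    by (simp add: borel_prod)
  then show ?thesis using assms by (rule measurable_compose)
qed

lemma measurable_component [measurable]:
  assumes "u \<in> borel_measurable (lebesgue :: 'a::euclidean_space measure)"
  shows "(\<lambda>z. u (fst z)) \<in> borel_measurable (lebesgue \<Otimes>\<^sub>M (lebesgue :: 'b::euclidean_space measure))"
    and "(\<lambda>z. u (snd z)) \<in> borel_measurable ((lebesgue :: 'b::euclidean_space measure) \<Otimes>\<^sub>M lebesgue)"
  using assms by (auto intro: measurable_compose[OF measurable_fst] measurable_compose[OF measurable_snd])

lemma emeasure_lborel_cball:
  "0 \<le> r \<Longrightarrow> emeasure lborel (cball (x::real^'n) r) = ennreal (unit_ball_vol (real CARD('n)) * r ^ CARD('n))"
  by (simp add: emeasure_cball)

text \<open>With \<open>b = |a| / \<tau>\<^sup>s\<close> this is \<open>b \<le> b\<^sup>q + 1\<close>. The exponent \<open>q\<close> does not enter the powers of \<open>r\<close>,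
  so the estimate can be integrated although \<open>q\<close> varies from point to point.\<close>

lemma osc_pointwise:
  fixes a \<tau> r s q N :: real
  assumes "0 < \<tau>" "\<tau> \<le> r" "0 < s" "1 \<le> q" "0 \<le> N"
  shows "\<bar>a\<bar> \<le> r powr (N + s) * (\<bar>a\<bar> powr q * (1 / \<tau> powr (N + s * q))) + r powr s"
proof -
  define b where "b = \<bar>a\<bar> / \<tau> powr s"
  have tp: "\<tau> powr s > 0" using assms by simp
  have b0: "b \<ge> 0" by (simp add: b_def)
  have "b \<le> b powr q + 1"
  proof (cases "b \<le> 1")
    case False
    then have "b powr 1 \<le> b powr q" using assms by (intro powr_mono) auto
    then show ?thesis using False by simp
  qed (simp add: add_increasing)
  moreover have "\<bar>a\<bar> = \<tau> powr s * b" using tp by (simp add: b_def)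
  ultimately have "\<bar>a\<bar> \<le> \<tau> powr s * b powr q + \<tau> powr s"
    using tp by (metis distrib_left less_imp_le mult.right_neutral mult_left_mono)
  also have "b powr q = \<bar>a\<bar> powr q / \<tau> powr (s * q)"
    by (simp add: b_def powr_divide powr_powr)
  also have "\<tau> powr s * (\<bar>a\<bar> powr q / \<tau> powr (s * q)) = \<tau> powr (N + s) * (\<bar>a\<bar> powr q * (1 / \<tau> powr (N + s * q)))"
    using assms by (simp add: powr_add)
  also have "\<dots> \<le> r powr (N + s) * (\<bar>a\<bar> powr q * (1 / \<tau> powr (N + s * q)))"
    using assms by (intro mult_right_mono powr_mono2) auto
  also have "\<tau> powr s \<le> r powr s" using assms by (intro powr_mono2) auto
  finally show ?thesis by simp
qed

lemma ennreal_combine: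
  assumes "0 \<le> A" "0 \<le> B" "0 \<le> m" "0 \<le> a" "0 \<le> b"
  shows "ennreal A * ennreal m + ennreal B * (2 * (ennreal a * ennreal b)) = ennreal (A * m + B * (2 * (a * b)))"
  using assms by (simp add: ennreal_mult)

locale frac_kernel =
  fixes s :: real and p :: "(real^'n) \<times> (real^'n) \<Rightarrow> real" and pl pu :: real
  assumes s: "0 < s" and p_cont: "continuous_on UNIV p"
    and pl: "1 < pl" and p_bounds: "\<And>z. pl \<le> p z" "\<And>z. p z \<le> pu"
begin

definition kern :: "(real^'n) \<times> (real^'n) \<Rightarrow> real" where
  "kern z = 1 / norm (fst z - snd z) powr (real CARD('n) + s * p z)"

definition diff :: "(real^'n \<Rightarrow> real) \<Rightarrow> (real^'n) \<times> (real^'n) \<Rightarrow> real" where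
  "diff u z = u (fst z) - u (snd z)"

lemma p1: "1 < p z" "1 \<le> p z" "0 < p z"
  using pl p_bounds(1)[of z] by linarith+

lemma kern_nonneg: "0 \<le> kern z"
  by (simp add: kern_def)

lemma p_borel [measurable]: "p \<in> borel_measurable (lebesgue \<Otimes>\<^sub>M lebesgue)"
  by (intro borel_measurable_lebesgue_pair borel_measurable_continuous_onI p_cont)

lemma norm_diff_borel [measurable]: "(\<lambda>z. norm (fst z - snd z :: real^'n)) \<in> borel_measurable (lebesgue \<Otimes>\<^sub>M lebesgue)"
  by (intro borel_measurable_lebesgue_pair borel_measurable_continuous_onI continuous_intros)

lemma kern_borel [measurable]: "kern \<in> borel_measurable (lebesgue \<Otimes>\<^sub>M lebesgue)"
  unfolding kern_def by measurable

lemma diff_borel [measurable]: "u \<in> borel_measurable lebesgue \<Longrightarrow> diff u \<in> borel_measurable (lebesgue \<Otimes>\<^sub>M lebesgue)"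
  unfolding diff_def by (intro borel_measurable_diff measurable_component)

abbreviation near :: "real \<Rightarrow> ((real^'n) \<times> (real^'n)) set" where
  "near r \<equiv> {z. norm (fst z - snd z) \<le> r}"

lemma near_sets [measurable]: "near r \<in> sets (lebesgue \<Otimes>\<^sub>M lebesgue)"
proof -
  have "near r = {z \<in> space (lebesgue \<Otimes>\<^sub>M lebesgue). norm (fst z - snd z) \<le> r}"
    by (auto simp: space_pair_measure)
  also have "\<dots> \<in> sets (lebesgue \<Otimes>\<^sub>M lebesgue)" by measurable
  finally show ?thesis .
qed

definition modulus :: "(real^'n \<Rightarrow> real) \<Rightarrow> ennreal" where
  "modulus w = (\<integral>\<^sup>+z. ennreal (\<bar>diff w z\<bar> powr p z * kern z) \<partial>(lebesgue \<Otimes>\<^sub>M lebesgue))"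

text \<open>A difference vanishes unless one of the two points lies in the support \<open>A\<close>; this is why the constant term
  of \<open>osc_pointwise\<close> contributes only the measure of \<open>A\<close> times that of a ball.\<close>

lemma local_oscillation:
  assumes w [measurable]: "w \<in> borel_measurable lebesgue" and r: "0 < r"
  defines "A \<equiv> {x. w x \<noteq> 0}"
  shows "(\<integral>\<^sup>+z. ennreal \<bar>diff w z\<bar> * indicator (near r) z \<partial>(lebesgue \<Otimes>\<^sub>M lebesgue))
    \<le> ennreal (r powr (real CARD('n) + s)) * modulus w
      + ennreal (r powr s) * (2 * (emeasure lebesgue A * ennreal (unit_ball_vol (real CARD('n)) * r ^ CARD('n))))"
proof -
  let ?N = "real CARD('n)" and ?L = "lebesgue :: (real^'n) measure"
  let ?P = "?L \<Otimes>\<^sub>M ?L"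
  have A_eq: "A = {x \<in> space ?L. w x \<noteq> 0}" by (simp add: A_def)
  have A [measurable]: "A \<in> sets ?L" unfolding A_eq by measurable
  have cb [measurable]: "cball x r \<in> sets ?L" for x :: "real^'n" by simp
  let ?i1 = "\<lambda>z. indicator A (fst z) * indicator (near r) z :: ennreal"
  let ?i2 = "\<lambda>z. indicator A (snd z) * indicator (near r) z :: ennreal"
  have [measurable]: "(\<lambda>z. indicator A (fst z) :: ennreal) \<in> borel_measurable ?P" "(\<lambda>z. indicator A (snd z) :: ennreal) \<in> borel_measurable ?P"
    by (auto intro: measurable_compose[OF measurable_fst] measurable_compose[OF measurable_snd])
  have i1: "(\<integral>\<^sup>+z. ?i1 z \<partial>?P) = emeasure ?L A * ennreal (unit_ball_vol ?N * r ^ CARD('n))"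
  proof -
    have "(\<integral>\<^sup>+z. ?i1 z \<partial>?P) = (\<integral>\<^sup>+x. (\<integral>\<^sup>+y. ?i1 (x, y) \<partial>?L) \<partial>?L)"
      by (rule lebesgue.nn_integral_fst[symmetric]) measurable
    also have "\<dots> = (\<integral>\<^sup>+x. indicator A x * ennreal (unit_ball_vol ?N * r ^ CARD('n)) \<partial>?L)"
    proof (rule nn_integral_cong)
      fix x :: "real^'n"
      have "(\<integral>\<^sup>+y. ?i1 (x, y) \<partial>?L) = (\<integral>\<^sup>+y. indicator A x * indicator (cball x r) y \<partial>?L)"
        by (intro nn_integral_cong) (auto simp: indicator_def dist_norm)
      also have "\<dots> = indicator A x * emeasure ?L (cball x r)"
        by (simp add: nn_integral_cmult)
      finally show "(\<integral>\<^sup>+y. ?i1 (x, y) \<partial>?L) = indicator A x * ennreal (unit_ball_vol ?N * r ^ CARD('n))"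
        using r by (simp add: emeasure_lborel_cball)
    qed
    also have "\<dots> = emeasure ?L A * ennreal (unit_ball_vol ?N * r ^ CARD('n))"
      by (simp add: nn_integral_multc)
    finally show ?thesis .
  qed
  have i2: "(\<integral>\<^sup>+z. ?i2 z \<partial>?P) = emeasure ?L A * ennreal (unit_ball_vol ?N * r ^ CARD('n))"
  proof -
    have "(\<integral>\<^sup>+z. ?i2 z \<partial>?P) = (\<integral>\<^sup>+y. (\<integral>\<^sup>+x. ?i2 (x, y) \<partial>?L) \<partial>?L)"
      by (rule lebesgue_pair.nn_integral_snd[symmetric]) measurable
    also have "\<dots> = (\<integral>\<^sup>+y. indicator A y * ennreal (unit_ball_vol ?N * r ^ CARD('n)) \<partial>?L)"
    proof (rule nn_integral_cong)
      fix y :: "real^'n"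
      have "(\<integral>\<^sup>+x. ?i2 (x, y) \<partial>?L) = (\<integral>\<^sup>+x. indicator A y * indicator (cball y r) x \<partial>?L)"
        by (intro nn_integral_cong) (auto simp: indicator_def dist_norm norm_minus_commute)
      also have "\<dots> = indicator A y * emeasure ?L (cball y r)"
        by (simp add: nn_integral_cmult)
      finally show "(\<integral>\<^sup>+x. ?i2 (x, y) \<partial>?L) = indicator A y * ennreal (unit_ball_vol ?N * r ^ CARD('n))"
        using r by (simp add: emeasure_lborel_cball)
    qed
    also have "\<dots> = emeasure ?L A * ennreal (unit_ball_vol ?N * r ^ CARD('n))"
      by (simp add: nn_integral_multc)
    finally show ?thesis .
  qed
  have "(\<integral>\<^sup>+z. ennreal \<bar>diff w z\<bar> * indicator (near r) z \<partial>?P)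
     \<le> (\<integral>\<^sup>+z. ennreal (r powr (?N + s)) * ennreal (\<bar>diff w z\<bar> powr p z * kern z) + ennreal (r powr s) * (?i1 z + ?i2 z) \<partial>?P)"
  proof (rule nn_integral_mono)
    fix z :: "(real^'n) \<times> (real^'n)"
    show "ennreal \<bar>diff w z\<bar> * indicator (near r) z
      \<le> ennreal (r powr (?N + s)) * ennreal (\<bar>diff w z\<bar> powr p z * kern z) + ennreal (r powr s) * (?i1 z + ?i2 z)"
    proof (cases "z \<in> near r \<and> diff w z \<noteq> 0")
      case False
      then show ?thesis by (auto simp: indicator_def)
    next
      case True
      then have tau: "0 < norm (fst z - snd z)" "norm (fst z - snd z) \<le> r" by (auto simp: diff_def)
      have "fst z \<in> A \<or> snd z \<in> A" using True by (auto simp: A_def diff_def)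
      then have ge: "?i1 z + ?i2 z \<ge> 1" using True by (auto simp: indicator_def)
      have "ennreal \<bar>diff w z\<bar> \<le> ennreal (r powr (?N + s) * (\<bar>diff w z\<bar> powr p z * kern z) + r powr s)"
        unfolding kern_def using osc_pointwise[OF tau s p1(2)[of z], of ?N "diff w z"] by (intro ennreal_leI) simp
      also have "\<dots> = ennreal (r powr (?N + s)) * ennreal (\<bar>diff w z\<bar> powr p z * kern z) + ennreal (r powr s) * 1"
        using kern_nonneg by (simp add: ennreal_mult ennreal_plus)
      also have "\<dots> \<le> ennreal (r powr (?N + s)) * ennreal (\<bar>diff w z\<bar> powr p z * kern z) + ennreal (r powr s) * (?i1 z + ?i2 z)"
        using ge by (intro add_left_mono mult_left_mono) auto
      finally show ?thesis using True by simp
    qed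
  qed
  also have "\<dots> = ennreal (r powr (?N + s)) * modulus w + ennreal (r powr s) * ((\<integral>\<^sup>+z. ?i1 z \<partial>?P) + (\<integral>\<^sup>+z. ?i2 z \<partial>?P))"
    unfolding modulus_def
    by (subst nn_integral_add, measurable) (simp add: nn_integral_cmult nn_integral_add)
  finally show ?thesis unfolding i1 i2 by (simp add: mult_2)
qed

text \<open>The gain that drives De Giorgi's iteration. Choose \<open>r\<close> so that a ball of radius \<open>r\<close> has
  twice the measure of the support \<open>A\<close>. At least half of the ball around any \<open>x\<close> then lies outside \<open>A\<close>,
  where \<open>w\<close> vanishes, so \<open>|A| |w(x)|\<close> is bounded by the oscillation of \<open>w\<close> in the ball.\<close>

lemma small_support_estimate:
  assumes w [measurable]: "w \<in> borel_measurable lebesgue"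
  defines "A \<equiv> {x. w x \<noteq> 0}"
  assumes a: "emeasure lebesgue A = ennreal a" "0 < a" and m: "modulus w = ennreal m" "0 \<le> m"
  defines "c \<equiv> unit_ball_vol (real CARD('n))"
  shows "(\<integral>\<^sup>+x. ennreal \<bar>w x\<bar> \<partial>lebesgue) \<le> ennreal ((2 * a / c) powr (s / real CARD('n)) * (2 / c * m + 4 * a))"
proof -
  let ?N = "real CARD('n)" and ?L = "lebesgue :: (real^'n) measure"
  let ?P = "?L \<Otimes>\<^sub>M ?L"
  define r where "r = (2 * a / c) powr (1 / ?N)"
  have N0: "?N > 0" by simp
  have c0: "c > 0" by (simp add: c_def)
  have r0: "r > 0" using a c0 by (simp add: r_def)
  have rN: "r ^ CARD('n) = 2 * a / c"
    using a c0 N0 by (simp add: r_def powr_powr powr_realpow[symmetric])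
  have rs: "r powr s = (2 * a / c) powr (s / ?N)" by (simp add: r_def powr_powr)
  have A_eq: "A = {x \<in> space ?L. w x \<noteq> 0}" by (simp add: A_def)
  have A [measurable]: "A \<in> sets ?L" unfolding A_eq by measurable
  have inner: "ennreal a * ennreal \<bar>w x\<bar> \<le> (\<integral>\<^sup>+y. ennreal \<bar>diff w (x,y)\<bar> * indicator (near r) (x,y) \<partial>?L)" for x
  proof (cases "x \<in> A")
    case True
    have "emeasure ?L (cball x r) = ennreal (2 * a)"
      using r0 c0 rN by (simp add: emeasure_lborel_cball c_def[symmetric])
    moreover have "emeasure ?L (cball x r) \<le> emeasure ?L (cball x r - A) + emeasure ?L A"
    proof -
      have "emeasure ?L (cball x r) \<le> emeasure ?L ((cball x r - A) \<union> A)"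
        by (intro emeasure_mono) auto
      also have "\<dots> \<le> emeasure ?L (cball x r - A) + emeasure ?L A"
        by (intro emeasure_subadditive) auto
      finally show ?thesis .
    qed
    ultimately have "ennreal a + ennreal a \<le> emeasure ?L (cball x r - A) + ennreal a"
      using a by (simp add: ennreal_plus[symmetric])
    then have "ennreal a \<le> emeasure ?L (cball x r - A)"
      using a by (cases "emeasure ?L (cball x r - A)") (auto simp: ennreal_plus[symmetric] simp del: ennreal_plus)
    then have "ennreal a * ennreal \<bar>w x\<bar> \<le> (\<integral>\<^sup>+y. ennreal \<bar>w x\<bar> * indicator (cball x r - A) y \<partial>?L)"
      by (subst nn_integral_cmult_indicator) (auto simp del: emeasure_completion simp: mult.commute[of "ennreal a"] intro!: mult_left_mono)
    also have "\<dots> \<le> (\<integral>\<^sup>+y. ennreal \<bar>diff w (x,y)\<bar> * indicator (near r) (x,y) \<partial>?L)"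
      by (intro nn_integral_mono) (auto simp: indicator_def A_def diff_def dist_norm)
    finally show ?thesis .
  qed (simp add: A_def)
  have "ennreal a * (\<integral>\<^sup>+x. ennreal \<bar>w x\<bar> \<partial>?L) = (\<integral>\<^sup>+x. ennreal a * ennreal \<bar>w x\<bar> \<partial>?L)"
    by (simp add: nn_integral_cmult)
  also have "\<dots> \<le> (\<integral>\<^sup>+x. \<integral>\<^sup>+y. ennreal \<bar>diff w (x,y)\<bar> * indicator (near r) (x,y) \<partial>?L \<partial>?L)"
    by (intro nn_integral_mono inner)
  also have "\<dots> = (\<integral>\<^sup>+z. ennreal \<bar>diff w z\<bar> * indicator (near r) z \<partial>?P)"
    by (rule lebesgue.nn_integral_fst) measurable
  also have "\<dots> \<le> ennreal (r powr (?N + s)) * ennreal m + ennreal (r powr s) * (2 * (ennreal a * ennreal (c * r ^ CARD('n))))"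
    using local_oscillation[OF w r0] unfolding A_def[symmetric] a m c_def[symmetric] .
  also have "\<dots> = ennreal (r powr (?N + s) * m + r powr s * (2 * (a * (c * r ^ CARD('n)))))"
    using a(2) m(2) c0 r0 by (intro ennreal_combine) auto
  also have "r powr (?N + s) * m + r powr s * (2 * (a * (c * r ^ CARD('n)))) = a * (r powr s * (2 / c * m + 4 * a))"
    using r0 rN c0 by (simp add: powr_add powr_realpow algebra_simps)
  also have "ennreal \<dots> = ennreal a * ennreal (r powr s * (2 / c * m + 4 * a))"
    using a m c0 by (simp add: ennreal_mult)
  finally show ?thesis
    using a unfolding rs by (subst (asm) ennreal_mult_le_mult_iff) auto
qed

end

text \<open>The half-open cube of side \<open>h\<close> with corner \<open>h k\<close>, described as a fibre of the rounding map so
  that cells with different indices are visibly disjoint.\<close>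

definition grid_cell :: "real \<Rightarrow> (int^'n) \<Rightarrow> (real^'n) set" where
  "grid_cell h k = {x. (\<chi> i. \<lfloor>x $ i / h\<rfloor>) = k}"

lemma grid_cell_iff:
  assumes "0 < h"
  shows "x \<in> grid_cell h k \<longleftrightarrow> (\<forall>i. of_int (k $ i) * h \<le> x $ i \<and> x $ i < (of_int (k $ i) + 1) * h)"
  using assms by (simp add: grid_cell_def vec_eq_iff floor_eq_iff pos_le_divide_eq pos_divide_less_eq)

lemma grid_cell_sets [measurable]: "grid_cell h k \<in> sets borel"
proof -
  have [measurable]: "(\<lambda>x::real^'n. x $ i) \<in> borel_measurable borel" for i
    by (intro borel_measurable_continuous_onI continuous_intros)
  have "grid_cell h k = {x \<in> space borel. \<forall>i. real_of_int (k $ i) \<le> x $ i / h \<and> x $ i / h < real_of_int (k $ i) + 1}"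
    by (auto simp: grid_cell_def vec_eq_iff floor_eq_iff)
  also have "\<dots> \<in> sets borel" by measurable
  finally show ?thesis .
qed

lemma emeasure_grid_cell:
  fixes k :: "int^'n"
  assumes h: "0 < h"
  shows "emeasure lborel (grid_cell h k) = ennreal (h ^ CARD('n))"
proof (rule antisym)
  let ?l = "(\<chi> i. of_int (k $ i) * h) :: real^'n" and ?u = "(\<chi> i. (of_int (k $ i) + 1) * h) :: real^'n"
  have e: "\<And>b. b \<in> Basis \<Longrightarrow> ?l \<bullet> b \<le> ?u \<bullet> b"
    using h by (auto simp: Basis_vec_def inner_axis)
  have pr: "(\<Prod>b\<in>Basis. (?u - ?l) \<bullet> b) = h ^ CARD('n)"
  proof -
    have "(\<Prod>b\<in>Basis. (?u - ?l) \<bullet> b) = (\<Prod>b\<in>(Basis::(real^'n) set). h)"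
      by (intro prod.cong) (auto simp: Basis_vec_def inner_axis inner_diff_left algebra_simps)
    then show ?thesis by simp
  qed
  have "grid_cell h k \<subseteq> cbox ?l ?u" using h by (auto simp: grid_cell_iff mem_box_cart less_imp_le)
  then have "emeasure lborel (grid_cell h k) \<le> emeasure lborel (cbox ?l ?u)" by (intro emeasure_mono) auto
  also have "\<dots> = ennreal (h ^ CARD('n))" using e pr by (simp add: emeasure_lborel_cbox_eq)
  finally show "emeasure lborel (grid_cell h k) \<le> ennreal (h ^ CARD('n))" .
  have "box ?l ?u \<subseteq> grid_cell h k" using h by (auto simp: grid_cell_iff mem_box_cart less_imp_le)
  then have "emeasure lborel (box ?l ?u) \<le> emeasure lborel (grid_cell h k)" by (intro emeasure_mono) auto
  then show "ennreal (h ^ CARD('n)) \<le> emeasure lborel (grid_cell h k)" using e pr by simp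
qed

lemma grid_cell_diameter:
  fixes k :: "int^'n"
  assumes h: "0 < h" and "x \<in> grid_cell h k" "y \<in> grid_cell h k"
  shows "norm (x - y) \<le> real CARD('n) * h"
proof -
  have "\<bar>(x - y) $ i\<bar> \<le> h" for i
  proof -
    have "of_int (k $ i) * h \<le> x $ i" "x $ i < (of_int (k $ i) + 1) * h"
      "of_int (k $ i) * h \<le> y $ i" "y $ i < (of_int (k $ i) + 1) * h"
      using assms by (auto simp: grid_cell_iff)
    then show ?thesis by (simp add: algebra_simps)
  qed
  then have "(\<Sum>i\<in>UNIV. \<bar>(x - y) $ i\<bar>) \<le> (\<Sum>i\<in>(UNIV::'n set). h)" by (intro sum_mono)
  then show ?thesis using norm_le_l1_cart[of "x - y"] by simp
qed

lemma finite_grid_cells: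
  fixes \<Omega> :: "(real^'n) set"
  assumes h: "0 < h" and "bounded \<Omega>"
  shows "finite {k. grid_cell h k \<inter> \<Omega> \<noteq> {}}"
proof -
  obtain B where B: "\<And>x. x \<in> \<Omega> \<Longrightarrow> norm x \<le> B" using assms by (auto simp: bounded_iff)
  define m where "m = \<lceil>B / h\<rceil> + 1"
  have "{k. grid_cell h k \<inter> \<Omega> \<noteq> {}} \<subseteq> {k. \<forall>i. k $ i \<in> {-m..m}}"
  proof (intro subsetI CollectI allI)
    fix k i assume "k \<in> {k. grid_cell h k \<inter> \<Omega> \<noteq> {}}"
    then obtain x where x: "x \<in> grid_cell h k" "x \<in> \<Omega>" by blast
    have k: "k $ i = \<lfloor>x $ i / h\<rfloor>" using x(1) by (auto simp: grid_cell_def)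
    have "\<bar>x $ i\<bar> \<le> B" using component_le_norm_cart[of x i] B[OF x(2)] by simp
    then have "x $ i / h \<le> B / h" "- (B / h) \<le> x $ i / h"
      using h by (auto simp: abs_le_iff field_simps)
    then show "k $ i \<in> {-m..m}" unfolding k m_def atLeastAtMost_iff by linarith
  qed
  moreover have "finite {k::int^'n. \<forall>i. k $ i \<in> {-m..m}}"
  proof -
    have "{k::int^'n. \<forall>i. k $ i \<in> {-m..m}} \<subseteq> (\<lambda>f. \<chi> i. f i) ` (PiE UNIV (\<lambda>_. {-m..m}))"
    proof
      fix k :: "int^'n" assume "k \<in> {k. \<forall>i. k $ i \<in> {-m..m}}"
      then show "k \<in> (\<lambda>f. \<chi> i. f i) ` (PiE UNIV (\<lambda>_. {-m..m}))"
        by (intro image_eqI[of _ _ "\<lambda>i. k $ i"]) (auto simp: vec_eq_iff)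
    qed
    then show ?thesis by (rule finite_subset) (intro finite_imageI finite_PiE, auto)
  qed
  ultimately show ?thesis by (rule finite_subset)
qed

context frac_kernel
begin

text \<open>Integrate \<open>v |w(x)| \<le> |\<integral>\<^sub>Q w| + \<integral>\<^sub>Q |w(x) - w(y)| dy\<close> over \<open>x \<in> Q\<close>, where \<open>v = |Q|\<close>.\<close>

lemma cell_estimate:
  fixes w :: "real^'n \<Rightarrow> real"
  assumes w: "integrable lebesgue w" and Q: "Q \<in> sets lebesgue" "emeasure lebesgue Q = ennreal v" "0 < v"
  shows "ennreal v * (\<integral>\<^sup>+x. ennreal \<bar>w x\<bar> * indicator Q x \<partial>lebesgue)
    \<le> ennreal v * ennreal \<bar>\<integral>x. w x * indicator Q x \<partial>lebesgue\<bar>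
      + (\<integral>\<^sup>+x. \<integral>\<^sup>+y. ennreal \<bar>diff w (x,y)\<bar> * indicator (Q \<times> Q) (x,y) \<partial>lebesgue \<partial>lebesgue)"
proof -
  let ?L = "lebesgue :: (real^'n) measure"
  let ?I = "\<integral>x. w x * indicator Q x \<partial>?L"
  have [measurable]: "w \<in> borel_measurable ?L" "Q \<in> sets ?L" using w Q by auto
  have wQ: "integrable ?L (\<lambda>y. w y * indicator Q y)"
    by (intro integrable_real_mult_indicator w Q)
  have cQ: "integrable ?L (\<lambda>y. c * indicator Q y)" for c :: real
    using Q by (intro integrable_mult_right) (auto simp: less_top[symmetric])
  have pt: "ennreal v * (ennreal \<bar>w x\<bar> * indicator Q x)
     \<le> ennreal \<bar>?I\<bar> * indicator Q x + (\<integral>\<^sup>+y. ennreal \<bar>diff w (x,y)\<bar> * indicator (Q \<times> Q) (x,y) \<partial>?L)" for x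
  proof (cases "x \<in> Q")
    case True
    have int: "integrable ?L (\<lambda>y. (w x - w y) * indicator Q y)"
      using Bochner_Integration.integrable_diff[OF cQ[of "w x"] wQ] by (simp add: left_diff_distrib)
    have mQ: "measure ?L Q = v" using Q by (simp add: measure_def)
    have "(\<integral>y. (w x - w y) * indicator Q y \<partial>?L) = (\<integral>y. w x * indicator Q y \<partial>?L) - ?I"
      using Bochner_Integration.integral_diff[OF cQ[of "w x"] wQ] by (simp add: left_diff_distrib)
    also have "(\<integral>y. w x * indicator Q y \<partial>?L) = w x * v" using mQ by simp
    finally have "w x * v = ?I + (\<integral>y. (w x - w y) * indicator Q y \<partial>?L)" by simp
    then have "v * \<bar>w x\<bar> \<le> \<bar>?I\<bar> + \<bar>\<integral>y. (w x - w y) * indicator Q y \<partial>?L\<bar>"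
      using Q(3) abs_triangle_ineq[of ?I "\<integral>y. (w x - w y) * indicator Q y \<partial>?L"]
      by (metis abs_mult abs_of_pos mult.commute)
    also have "\<bar>\<integral>y. (w x - w y) * indicator Q y \<partial>?L\<bar> \<le> (\<integral>y. \<bar>(w x - w y) * indicator Q y\<bar> \<partial>?L)"
      by (rule integral_abs_bound)
    finally have "ennreal (v * \<bar>w x\<bar>) \<le> ennreal (\<bar>?I\<bar> + (\<integral>y. \<bar>(w x - w y) * indicator Q y\<bar> \<partial>?L))"
      by (intro ennreal_leI) simp
    also have "\<dots> = ennreal \<bar>?I\<bar> + ennreal (\<integral>y. \<bar>(w x - w y) * indicator Q y\<bar> \<partial>?L)"
      by (intro ennreal_plus) auto
    also have "ennreal (\<integral>y. \<bar>(w x - w y) * indicator Q y\<bar> \<partial>?L) = (\<integral>\<^sup>+y. ennreal \<bar>(w x - w y) * indicator Q y\<bar> \<partial>?L)"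
      by (intro nn_integral_eq_integral[symmetric] integrable_abs int) auto
    also have "\<dots> = (\<integral>\<^sup>+y. ennreal \<bar>diff w (x,y)\<bar> * indicator (Q \<times> Q) (x,y) \<partial>?L)"
      using True by (intro nn_integral_cong) (auto simp: diff_def indicator_def)
    finally show ?thesis using True Q(3) by (simp add: ennreal_mult)
  qed simp
  have "ennreal v * (\<integral>\<^sup>+x. ennreal \<bar>w x\<bar> * indicator Q x \<partial>?L) = (\<integral>\<^sup>+x. ennreal v * (ennreal \<bar>w x\<bar> * indicator Q x) \<partial>?L)"
    by (rule nn_integral_cmult[symmetric]) measurable
  also have "\<dots> \<le> (\<integral>\<^sup>+x. ennreal \<bar>?I\<bar> * indicator Q x + (\<integral>\<^sup>+y. ennreal \<bar>diff w (x,y)\<bar> * indicator (Q \<times> Q) (x,y) \<partial>?L) \<partial>?L)"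
    by (intro nn_integral_mono pt)
  also have "\<dots> = (\<integral>\<^sup>+x. ennreal \<bar>?I\<bar> * indicator Q x \<partial>?L) + (\<integral>\<^sup>+x. \<integral>\<^sup>+y. ennreal \<bar>diff w (x,y)\<bar> * indicator (Q \<times> Q) (x,y) \<partial>?L \<partial>?L)"
    by (intro nn_integral_add lebesgue.borel_measurable_nn_integral_fst) (measurable)
  also have "(\<integral>\<^sup>+x. ennreal \<bar>?I\<bar> * indicator Q x \<partial>?L) = ennreal v * ennreal \<bar>?I\<bar>"
    unfolding nn_integral_cmult_indicator[OF Q(1)] Q(2) by (rule mult.commute)
  finally show ?thesis .
qed

text \<open>An inequality of Ehrling type. On a cell, \<open>w\<close> differs from its average by at most its mean oscillation there, and the cells of a
  grid of mesh \<open>r/N\<close> have diameter at most \<open>r\<close>, so \<open>local_oscillation\<close> bounds the total error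
  by a multiple of \<open>r\<^sup>s\<close>.\<close>

lemma finite_rank_estimate:
  fixes \<Omega> :: "(real^'n) set"
  assumes bnd: "bounded \<Omega>" and op: "open \<Omega>" and e: "0 < e"
  shows "\<exists>\<Q>. finite \<Q> \<and> \<Q> \<subseteq> sets lebesgue \<and> 
    (\<forall>w m. integrable lebesgue w \<longrightarrow> (AE x in lebesgue. x \<notin> \<Omega> \<longrightarrow> w x = 0) \<longrightarrow> modulus w \<le> ennreal m \<longrightarrow> 0 \<le> m \<longrightarrow>
       (\<integral>x. \<bar>w x\<bar> \<partial>lebesgue) \<le> (\<Sum>Q\<in>\<Q>. \<bar>\<integral>x. w x * indicator Q x \<partial>lebesgue\<bar>) + e * (m + 1))"
proof -
  let ?N = "real CARD('n)" and ?L = "lebesgue :: (real^'n) measure"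
  define c where "c = unit_ball_vol ?N"
  have c0: "c > 0" by (simp add: c_def)
  define a where "a = measure ?L \<Omega>"
  have a: "emeasure ?L \<Omega> = ennreal a" unfolding a_def
    using emeasure_bounded_finite[OF bnd] op by (intro emeasure_eq_ennreal_measure) auto
  have a0: "a \<ge> 0" by (simp add: a_def)
  \<comment> \<open>the factor \<open>?N ^ CARD('n)\<close> is the quotient of \<open>r ^ CARD('n)\<close> by the measure of a cell of side \<open>r / ?N\<close>\<close>
  define C where "C = ?N ^ CARD('n) * (1 + 2 * a * c)"
  have C0: "C > 0" using a0 c0 by (auto simp: C_def intro!: mult_pos_pos add_pos_nonneg)
  define r where "r = (e / C) powr (1 / s)"
  have r0: "r > 0" using e C0 by (simp add: r_def)
  have rs: "r powr s = e / C" using e C0 s by (simp add: r_def powr_powr)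
  define h where "h = r / ?N"
  have h0: "h > 0" using r0 by (simp add: h_def)
  define v where "v = h ^ CARD('n)"
  have v0: "v > 0" using h0 by (simp add: v_def)
  have rv: "r ^ CARD('n) / v = ?N ^ CARD('n)" using r0 by (simp add: v_def h_def power_divide)
  define Z where "Z = {k::int^'n. grid_cell h k \<inter> \<Omega> \<noteq> {}}"
  have finZ: "finite Z" unfolding Z_def by (rule finite_grid_cells[OF h0 bnd])
  have Qs [measurable]: "grid_cell h k \<in> sets ?L" for k :: "int^'n"
    using grid_cell_sets by simp
  have inj: "inj_on (grid_cell h) Z"
  proof (rule inj_onI)
    fix k l assume "k \<in> Z" and eq: "grid_cell h k = grid_cell h l"
    then obtain x where "x \<in> grid_cell h k" by (auto simp: Z_def)
    moreover from this have "x \<in> grid_cell h l" using eq by simp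
    ultimately show "k = l" by (simp add: grid_cell_def)
  qed
  have main: "(\<integral>x. \<bar>w x\<bar> \<partial>?L) \<le> (\<Sum>k\<in>Z. \<bar>\<integral>x. w x * indicator (grid_cell h k) x \<partial>?L\<bar>) + e * (m + 1)"
    if w: "integrable ?L w" and w0: "AE x in ?L. x \<notin> \<Omega> \<longrightarrow> w x = 0" and m: "modulus w \<le> ennreal m" "0 \<le> m" for w m
  proof -
    have [measurable]: "w \<in> borel_measurable ?L" using w by auto
    let ?I = "\<lambda>k. \<bar>\<integral>x. w x * indicator (grid_cell h k) x \<partial>?L\<bar>"
    have A: "emeasure ?L {x. w x \<noteq> 0} \<le> ennreal a"
    proof -
      have "AE x in ?L. x \<in> {x. w x \<noteq> 0} \<longrightarrow> x \<in> \<Omega>" using w0 by eventually_elim auto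
      moreover have "\<Omega> \<in> sets ?L" using op by auto
      ultimately have "emeasure ?L {x. w x \<noteq> 0} \<le> emeasure ?L \<Omega>" by (rule emeasure_mono_AE)
      then show ?thesis unfolding a .
    qed
    have one: "(\<Sum>k\<in>Z. indicator (grid_cell h k) x) = (1::ennreal)" if "x \<in> \<Omega>" for x
    proof -
      have "(\<Sum>k\<in>Z. indicator (grid_cell h k) x) = (\<Sum>k\<in>Z. if k = (\<chi> i. \<lfloor>x $ i / h\<rfloor>) then 1 else (0::ennreal))"
        by (intro sum.cong) (auto simp: grid_cell_def indicator_def)
      also have "\<dots> = 1" using finZ that by (auto simp: Z_def grid_cell_def)
      finally show ?thesis .
    qed
    have le1: "(\<Sum>k\<in>Z. indicator (grid_cell h k \<times> grid_cell h k) z) \<le> (indicator (near r) z :: ennreal)" for z :: "(real^'n) \<times> (real^'n)"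
    proof -
      obtain x y where z: "z = (x, y)" by fastforce
      have "(\<Sum>k\<in>Z. indicator (grid_cell h k \<times> grid_cell h k) z) \<le> (\<Sum>k\<in>Z. if k = (\<chi> i. \<lfloor>x $ i / h\<rfloor>) then indicator (near r) z else (0::ennreal))"
      proof (intro sum_mono)
        fix k assume "k \<in> Z"
        show "indicator (grid_cell h k \<times> grid_cell h k) z \<le> (if k = (\<chi> i. \<lfloor>x $ i / h\<rfloor>) then indicator (near r) z else (0::ennreal))"
        proof (cases "x \<in> grid_cell h k \<and> y \<in> grid_cell h k")
          case True
          then have "norm (x - y) \<le> r" using grid_cell_diameter[OF h0, of x k y] by (simp add: h_def)
          then show ?thesis using True by (auto simp: z grid_cell_def)
        qed (auto simp: z indicator_def)
      qed
      also have "\<dots> \<le> indicator (near r) z" using finZ by simp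
      finally show ?thesis .
    qed
    have osc: "(\<Sum>k\<in>Z. \<integral>\<^sup>+z. ennreal \<bar>diff w z\<bar> * indicator (grid_cell h k \<times> grid_cell h k) z \<partial>(?L \<Otimes>\<^sub>M ?L))
      \<le> ennreal (r powr (?N + s) * m + r powr s * (2 * (a * (c * r ^ CARD('n)))))"
    proof -
      have "(\<Sum>k\<in>Z. \<integral>\<^sup>+z. ennreal \<bar>diff w z\<bar> * indicator (grid_cell h k \<times> grid_cell h k) z \<partial>(?L \<Otimes>\<^sub>M ?L))
      = (\<integral>\<^sup>+z. ennreal \<bar>diff w z\<bar> * (\<Sum>k\<in>Z. indicator (grid_cell h k \<times> grid_cell h k) z) \<partial>(?L \<Otimes>\<^sub>M ?L))"
      unfolding sum_distrib_left by (rule nn_integral_sum[symmetric]) measurable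
      also have "\<dots> \<le> (\<integral>\<^sup>+z. ennreal \<bar>diff w z\<bar> * indicator (near r) z \<partial>(?L \<Otimes>\<^sub>M ?L))"
      by (intro nn_integral_mono mult_left_mono le1) auto
      also have "\<dots> \<le> ennreal (r powr (?N + s)) * modulus w
      + ennreal (r powr s) * (2 * (emeasure ?L {x. w x \<noteq> 0} * ennreal (c * r ^ CARD('n))))"
      unfolding c_def by (rule local_oscillation[OF _ r0]) measurable
      also have "\<dots> \<le> ennreal (r powr (?N + s)) * ennreal m + ennreal (r powr s) * (2 * (ennreal a * ennreal (c * r ^ CARD('n))))"
      by (intro add_mono mult_left_mono mult_right_mono A m(1)) simp_all
      also have "\<dots> = ennreal (r powr (?N + s) * m + r powr s * (2 * (a * (c * r ^ CARD('n)))))"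
      using a0 m(2) c0 r0 by (intro ennreal_combine) auto
      finally show ?thesis .
    qed
    have "ennreal v * (\<integral>\<^sup>+x. ennreal \<bar>w x\<bar> \<partial>?L) = ennreal v * (\<integral>\<^sup>+x. (\<Sum>k\<in>Z. ennreal \<bar>w x\<bar> * indicator (grid_cell h k) x) \<partial>?L)"
    proof (intro arg_cong2[where f = "(*)"] refl nn_integral_cong_AE, use w0 in eventually_elim)
      fix x assume "x \<notin> \<Omega> \<longrightarrow> w x = 0"
      then show "ennreal \<bar>w x\<bar> = (\<Sum>k\<in>Z. ennreal \<bar>w x\<bar> * indicator (grid_cell h k) x)"
        using one[of x] by (cases "x \<in> \<Omega>") (auto simp: sum_distrib_left[symmetric])
    qed
    also have "\<dots> = (\<Sum>k\<in>Z. ennreal v * (\<integral>\<^sup>+x. ennreal \<bar>w x\<bar> * indicator (grid_cell h k) x \<partial>?L))"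
      by (subst nn_integral_sum) (auto simp: sum_distrib_left)
    also have "\<dots> \<le> (\<Sum>k\<in>Z. ennreal v * ennreal (?I k)
      + (\<integral>\<^sup>+x. \<integral>\<^sup>+y. ennreal \<bar>diff w (x,y)\<bar> * indicator (grid_cell h k \<times> grid_cell h k) (x,y) \<partial>?L \<partial>?L))"
      using emeasure_grid_cell[OF h0] v0 by (intro sum_mono cell_estimate w Qs) (auto simp: v_def)
    also have "\<dots> = (\<Sum>k\<in>Z. ennreal v * ennreal (?I k))
      + (\<Sum>k\<in>Z. \<integral>\<^sup>+z. ennreal \<bar>diff w z\<bar> * indicator (grid_cell h k \<times> grid_cell h k) z \<partial>(?L \<Otimes>\<^sub>M ?L))"
      unfolding sum.distrib by (subst lebesgue.nn_integral_fst) measurable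
    also have "\<dots> \<le> (\<Sum>k\<in>Z. ennreal v * ennreal (?I k)) + ennreal (r powr (?N + s) * m + r powr s * (2 * (a * (c * r ^ CARD('n)))))"
      by (intro add_left_mono osc)
    also have "(\<integral>\<^sup>+x. ennreal \<bar>w x\<bar> \<partial>?L) = ennreal (\<integral>x. \<bar>w x\<bar> \<partial>?L)"
      by (intro nn_integral_eq_integral integrable_abs w) auto
    also have "(\<Sum>k\<in>Z. ennreal v * ennreal (?I k)) = ennreal (v * (\<Sum>k\<in>Z. ?I k))"
    proof -
      have "(\<Sum>k\<in>Z. ennreal v * ennreal (?I k)) = (\<Sum>k\<in>Z. ennreal (v * ?I k))"
        using v0 by (intro sum.cong refl ennreal_mult[symmetric]) auto
      also have "\<dots> = ennreal (\<Sum>k\<in>Z. v * ?I k)"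
        using v0 by (intro sum_ennreal) auto
      finally show ?thesis by (simp add: sum_distrib_left)
    qed
    also have "ennreal v * ennreal (\<integral>x. \<bar>w x\<bar> \<partial>?L) = ennreal (v * (\<integral>x. \<bar>w x\<bar> \<partial>?L))"
      using v0 by (intro ennreal_mult[symmetric]) auto
    also have "ennreal (v * (\<Sum>k\<in>Z. ?I k)) + ennreal (r powr (?N + s) * m + r powr s * (2 * (a * (c * r ^ CARD('n)))))
      = ennreal (v * (\<Sum>k\<in>Z. ?I k) + (r powr (?N + s) * m + r powr s * (2 * (a * (c * r ^ CARD('n))))))"
      using v0 a0 m c0 r0 by (intro ennreal_plus[symmetric] add_nonneg_nonneg mult_nonneg_nonneg sum_nonneg) auto
    finally have "ennreal (v * (\<integral>x. \<bar>w x\<bar> \<partial>?L)) \<le> ennreal (v * (\<Sum>k\<in>Z. ?I k) + (r powr (?N + s) * m + r powr s * (2 * (a * (c * r ^ CARD('n))))))"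
      .
    then have "v * (\<integral>x. \<bar>w x\<bar> \<partial>?L) \<le> v * (\<Sum>k\<in>Z. ?I k) + (r powr (?N + s) * m + r powr s * (2 * (a * (c * r ^ CARD('n)))))"
      using v0 a0 m c0 r0 by (subst (asm) ennreal_le_iff) (auto intro!: add_nonneg_nonneg mult_nonneg_nonneg sum_nonneg)
    also have "r powr (?N + s) * m + r powr s * (2 * (a * (c * r ^ CARD('n)))) = v * ((r ^ CARD('n) / v) * (r powr s * (m + 2 * a * c)))"
      using v0 r0 by (simp add: powr_add powr_realpow algebra_simps)
    also have "v * (\<Sum>k\<in>Z. ?I k) + \<dots> = v * ((\<Sum>k\<in>Z. ?I k) + (r ^ CARD('n) / v) * (r powr s * (m + 2 * a * c)))"
      by (simp add: distrib_left)
    finally have "(\<integral>x. \<bar>w x\<bar> \<partial>?L) \<le> (\<Sum>k\<in>Z. ?I k) + (r ^ CARD('n) / v) * (r powr s * (m + 2 * a * c))"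
      using v0 by simp
    also have "(r ^ CARD('n) / v) * (r powr s * (m + 2 * a * c)) \<le> e * (m + 1)"
    proof -
      have "m + 2 * a * c \<le> (1 + 2 * a * c) * (m + 1)" using m a0 c0 by (simp add: algebra_simps)
      then have "(r ^ CARD('n) / v) * (r powr s * (m + 2 * a * c)) \<le> ?N ^ CARD('n) * (e / C * ((1 + 2 * a * c) * (m + 1)))"
        unfolding rv rs using e C0 by (intro mult_left_mono) auto
      also have "\<dots> = e / C * C * (m + 1)" by (simp add: C_def)
      finally show ?thesis using C0 by simp
    qed
    finally show ?thesis by simp
  qed
  show ?thesis
  proof (intro exI[of _ "grid_cell h ` Z"] conjI allI impI)
    show "finite (grid_cell h ` Z)" using finZ by simp
    show "grid_cell h ` Z \<subseteq> sets ?L" using Qs by auto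
    fix w m assume "integrable ?L w" "AE x in ?L. x \<notin> \<Omega> \<longrightarrow> w x = 0" "modulus w \<le> ennreal m" "0 \<le> m"
    from main[OF this] show "(\<integral>x. \<bar>w x\<bar> \<partial>?L) \<le> (\<Sum>Q\<in>grid_cell h ` Z. \<bar>\<integral>x. w x * indicator Q x \<partial>?L\<bar>) + e * (m + 1)"
      by (simp add: sum.reindex[OF inj])
  qed
qed

end

section \<open>The energy space\<close>

text \<open>The proof of completeness of \<open>L\<^sup>1\<close>, with the integrable majorant that it produces along the way: this
  majorant is what later licenses dominated convergence.\<close>

lemma L1_Cauchy_subsequence:
  fixes u :: "nat \<Rightarrow> 'a \<Rightarrow> real"
  assumes u: "\<And>n. integrable M (u n)"
    and cauchy: "\<And>e. 0 < e \<Longrightarrow> \<exists>N. \<forall>m\<ge>N. \<forall>n\<ge>N. (\<integral>x. \<bar>u m x - u n x\<bar> \<partial>M) < e"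
  shows "\<exists>r f h. strict_mono (r::nat\<Rightarrow>nat) \<and> f \<in> borel_measurable M \<and> integrable M h
     \<and> (AE x in M. (\<lambda>n. u (r n) x) \<longlonglongrightarrow> f x) \<and> (AE x in M. \<forall>n. \<bar>u (r n) x\<bar> \<le> h x)"
proof -
  have "\<exists>N. \<forall>m\<ge>N. \<forall>n\<ge>N. (\<integral>x. \<bar>u m x - u n x\<bar> \<partial>M) < (1/2)^k" for k :: nat
    by (rule cauchy) simp
  then obtain N where N: "\<And>k m n. m \<ge> N k \<Longrightarrow> n \<ge> N k \<Longrightarrow> (\<integral>x. \<bar>u m x - u n x\<bar> \<partial>M) < (1/2)^k" by metis
  define r where "r k = k + (\<Sum>j\<le>k. N j)" for k
  have r: "strict_mono r" by (auto simp: strict_mono_Suc_iff r_def)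
  have rN: "N k \<le> r j" if "k \<le> j" for k j
  proof -
    have "N k \<le> (\<Sum>j\<le>j. N j)" using that by (intro member_le_sum) auto
    then show ?thesis by (simp add: r_def)
  qed
  define g where "g k x = u (r (Suc k)) x - u (r k) x" for k x
  have [measurable]: "\<And>n. u n \<in> borel_measurable M" using u by auto
  have gi: "integrable M (g k)" for k unfolding g_def by (intro Bochner_Integration.integrable_diff u)
  have [measurable]: "\<And>n. g n \<in> borel_measurable M" using gi by auto
  have gn: "(\<integral>x. \<bar>g k x\<bar> \<partial>M) \<le> (1/2)^k" for k
    unfolding g_def by (rule less_imp_le[OF N]) (auto intro!: rN)
  have sumg: "summable (\<lambda>k. \<integral>x. norm (g k x) \<partial>M)"
    by (rule summable_comparison_test[of _ "\<lambda>k. (1/2)^k"]) (use gn in \<open>auto intro!: exI[of _ 0] summable_geometric simp: integral_nonneg_AE\<close>)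
  have "(\<integral>\<^sup>+x. suminf (\<lambda>k. ennreal \<bar>g k x\<bar>) \<partial>M) = suminf (\<lambda>k. \<integral>\<^sup>+x. ennreal \<bar>g k x\<bar> \<partial>M)"
    by (rule nn_integral_suminf) measurable
  also have "\<dots> = suminf (\<lambda>k. ennreal (\<integral>x. norm (g k x) \<partial>M))"
    by (intro suminf_cong) (simp add: nn_integral_eq_integral integrable_abs gi)
  also have "\<dots> = ennreal (suminf (\<lambda>k. \<integral>x. norm (g k x) \<partial>M))"
    by (rule suminf_ennreal2) (use sumg in auto)
  finally have "(\<integral>\<^sup>+x. suminf (\<lambda>k. ennreal \<bar>g k x\<bar>) \<partial>M) \<noteq> \<infinity>" by simp
  then have "AE x in M. suminf (\<lambda>k. ennreal \<bar>g k x\<bar>) \<noteq> \<infinity>"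
    by (intro nn_integral_PInf_AE) measurable
  then have AEs: "AE x in M. summable (\<lambda>k. norm (g k x))"
    by eventually_elim (auto intro: summable_suminf_not_top)
  define h where "h x = \<bar>u (r 0) x\<bar> + suminf (\<lambda>k. norm (g k x))" for x
  define f where "f x = u (r 0) x + suminf (\<lambda>k. g k x)" for x
  have tel: "u (r n) x = u (r 0) x + (\<Sum>k<n. g k x)" for n x
    by (induction n) (auto simp: g_def)
  have "integrable M (\<lambda>x. suminf (\<lambda>k. norm (g k x)))"
    by (rule integrable_suminf[OF integrable_norm[OF gi]]) (simp_all add: AEs[unfolded real_norm_def] sumg[unfolded real_norm_def])
  then have h: "integrable M h" unfolding h_def by (intro Bochner_Integration.integrable_add integrable_abs u)
  have "AE x in M. (\<lambda>n. u (r n) x) \<longlonglongrightarrow> f x"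
    using AEs
  proof eventually_elim
    fix x assume "summable (\<lambda>k. norm (g k x))"
    then have "(\<lambda>n. \<Sum>k<n. g k x) \<longlonglongrightarrow> suminf (\<lambda>k. g k x)" by (rule summable_LIMSEQ[OF summable_norm_cancel])
    then show "(\<lambda>n. u (r n) x) \<longlonglongrightarrow> f x" unfolding f_def by (subst tel) (intro tendsto_add tendsto_const)
  qed
  moreover have "AE x in M. \<forall>n. \<bar>u (r n) x\<bar> \<le> h x"
    using AEs
  proof eventually_elim
    fix x assume s: "summable (\<lambda>k. norm (g k x))"
    show "\<forall>n. \<bar>u (r n) x\<bar> \<le> h x"
    proof
      fix n
      have "\<bar>u (r n) x\<bar> \<le> \<bar>u (r 0) x\<bar> + \<bar>\<Sum>k<n. g k x\<bar>" by (subst tel) (rule abs_triangle_ineq)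
      also have "\<bar>\<Sum>k<n. g k x\<bar> \<le> (\<Sum>k<n. norm (g k x))" by (simp add: sum_abs)
      also have "\<dots> \<le> suminf (\<lambda>k. norm (g k x))" using s by (intro sum_le_suminf) auto
      finally show "\<bar>u (r n) x\<bar> \<le> h x" by (simp add: h_def)
    qed
  qed
  moreover have "f \<in> borel_measurable M" unfolding f_def by measurable
  ultimately show ?thesis using r h by blast
qed

definition comb :: "(nat \<Rightarrow> 'a \<Rightarrow> real) \<Rightarrow> nat \<Rightarrow> (nat \<Rightarrow> real) \<Rightarrow> 'a \<Rightarrow> real" where
  "comb w m c x = (\<Sum>i<m. c i * w i x)"

lemma comb_0 [simp]: "comb w 0 c = (\<lambda>_. 0)" and comb_Suc: "comb w (Suc m) c = (\<lambda>x. comb w m c x + c m * w m x)"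
  by (auto simp: comb_def fun_eq_iff)

lemma comb_uminus: "comb w m (\<lambda>i. - c i) = (\<lambda>x. - comb w m c x)"
  by (auto simp: comb_def sum_negf fun_eq_iff)

lemma comb_add: "comb w m (\<lambda>i. c i + t * h i) = (\<lambda>x. comb w m c x + t * comb w m h x)"
  by (auto simp: comb_def sum.distrib sum_distrib_left algebra_simps fun_eq_iff)

locale frac_space = frac_kernel s p pl pu for s :: real and p :: "(real^'n) \<times> (real^'n) \<Rightarrow> real" and pl pu +
  fixes \<Omega> :: "(real^'n) set"
  assumes open_Omega: "open \<Omega>" and bounded_Omega: "bounded \<Omega>"
begin

lemma p_diag_borel [measurable]: "(\<lambda>x. p (x, x)) \<in> borel_measurable lebesgue"
proof -
  have "continuous_on UNIV (\<lambda>x. p (x, x))"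
    by (intro continuous_on_compose2[OF p_cont]) (auto intro!: continuous_intros)
  then show ?thesis by (intro measurable_completion) (simp add: borel_measurable_continuous_onI)
qed

sublocale G: weighted_modular "lebesgue \<Otimes>\<^sub>M (lebesgue :: (real^'n) measure)" p kern pl pu
  by unfold_locales (auto simp: pl p_bounds kern_nonneg)

sublocale L: weighted_modular "lebesgue :: (real^'n) measure" "\<lambda>x. p (x, x)" "\<lambda>_. 1" pl pu
  by unfold_locales (auto simp: pl p_bounds)

definition X :: "(real^'n \<Rightarrow> real) set" where
  "X = {u. u \<in> borel_measurable lebesgue \<and> G.fin (diff u) \<and> L.fin u \<and> (AE x in lebesgue. x \<notin> \<Omega> \<longrightarrow> u x = 0)}"

definition E :: "(real^'n \<Rightarrow> real) \<Rightarrow> real" where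
  "E u = G.modular (diff u) + L.modular u"

definition dE :: "(real^'n \<Rightarrow> real) \<Rightarrow> (real^'n \<Rightarrow> real) \<Rightarrow> real" where
  "dE u v = G.dmodular (diff u) (diff v) + L.dmodular u v"

lemma XD [measurable_dest]: "u \<in> X \<Longrightarrow> u \<in> borel_measurable lebesgue"
  by (simp add: X_def)

lemma XI: "G.fin (diff u) \<Longrightarrow> L.fin u \<Longrightarrow> (AE x in lebesgue. x \<notin> \<Omega> \<longrightarrow> u x = 0) \<Longrightarrow> u \<in> X"
  by (simp add: X_def L.fin_def)

lemma X_fin: "u \<in> X \<Longrightarrow> G.fin (diff u)" "u \<in> X \<Longrightarrow> L.fin u"
  by (simp_all add: X_def)

lemma X_AE: "u \<in> X \<Longrightarrow> AE x in lebesgue. x \<notin> \<Omega> \<longrightarrow> u x = 0"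
  by (simp add: X_def)

text \<open>The two formulations differ only in how finiteness of a nonnegative integral is expressed.\<close>

lemma X_eq_frac_sobolev0: "X = frac_sobolev0 \<Omega> s p"
proof -
  have *: "integrable M f \<longleftrightarrow> (\<integral>\<^sup>+x. ennreal (f x) \<partial>M) < \<infinity>"
    if "f \<in> borel_measurable M" "\<And>x. 0 \<le> f x" for M :: "'z measure" and f
    using that by (simp add: integrable_iff_bounded)
  have 1: "G.fin (diff u) \<longleftrightarrow> (\<integral>\<^sup>+ (x, y). ennreal (\<bar>u x - u y\<bar> powr p (x, y)
          / norm (x - y) powr (real CARD('n) + s * p (x, y))) \<partial>(lebesgue \<Otimes>\<^sub>M lebesgue)) < \<infinity>"
    if [measurable]: "u \<in> borel_measurable lebesgue" for u
    unfolding G.fin_def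
    by (subst *) (auto simp: kern_nonneg diff_def kern_def case_prod_unfold)
  have 2: "L.fin u \<longleftrightarrow> (\<integral>\<^sup>+ x. ennreal (\<bar>u x\<bar> powr p (x, x)) \<partial>lebesgue) < \<infinity>"
    if [measurable]: "u \<in> borel_measurable lebesgue" for u
    unfolding L.fin_def by (subst *) auto
  show ?thesis unfolding X_def frac_sobolev0_def frac_sobolev_def using 1 2 by auto
qed

lemma diff_add: "diff (\<lambda>x. u x + v x) = (\<lambda>z. diff u z + diff v z)"
  and diff_scale: "diff (\<lambda>x. c * u x) = (\<lambda>z. c * diff u z)"
  and diff_minus: "diff (\<lambda>x. u x - v x) = (\<lambda>z. diff u z - diff v z)"
  and diff_uminus: "diff (\<lambda>x. - u x) = (\<lambda>z. - diff u z)"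
  by (auto simp: diff_def fun_eq_iff algebra_simps)

lemma diff_comb: "diff (comb w m c) = comb (\<lambda>i. diff (w i)) m c"
  by (auto simp: diff_def comb_def fun_eq_iff sum_subtractf algebra_simps)

lemma X_zero [simp]: "(\<lambda>_. 0) \<in> X"
proof -
  have "diff (\<lambda>_. 0) = (\<lambda>_. 0)" by (auto simp: diff_def)
  then show ?thesis by (simp add: X_def)
qed

lemma X_add:
  assumes "u \<in> X" "v \<in> X"
  shows "(\<lambda>x. u x + v x) \<in> X"
proof (rule XI)
  show "G.fin (diff (\<lambda>x. u x + v x))" unfolding diff_add by (intro G.fin_add X_fin assms)
  show "L.fin (\<lambda>x. u x + v x)" by (intro L.fin_add X_fin assms)
  show "AE x in lebesgue. x \<notin> \<Omega> \<longrightarrow> u x + v x = 0"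
    using X_AE[OF assms(1)] X_AE[OF assms(2)] by eventually_elim simp
qed

lemma X_scale:
  assumes "u \<in> X"
  shows "(\<lambda>x. c * u x) \<in> X"
proof (rule XI)
  show "G.fin (diff (\<lambda>x. c * u x))" unfolding diff_scale by (intro G.fin_scale X_fin assms)
  show "L.fin (\<lambda>x. c * u x)" by (intro L.fin_scale X_fin assms)
  show "AE x in lebesgue. x \<notin> \<Omega> \<longrightarrow> c * u x = 0"
    using X_AE[OF assms] by eventually_elim simp
qed

lemma X_uminus: "u \<in> X \<Longrightarrow> (\<lambda>x. - u x) \<in> X"
  using X_scale[of u "-1"] by simp

lemma X_diff: "u \<in> X \<Longrightarrow> v \<in> X \<Longrightarrow> (\<lambda>x. u x - v x) \<in> X"
  using X_add[of u "\<lambda>x. - v x"] X_uminus[of v] by simp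

lemma X_comb: "(\<And>i. i < m \<Longrightarrow> w i \<in> X) \<Longrightarrow> comb w m c \<in> X"
  by (induction m) (simp_all add: comb_Suc X_add X_scale)

lemma X_mono:
  assumes "u \<in> X" "v \<in> borel_measurable lebesgue" "\<And>x. \<bar>v x\<bar> \<le> \<bar>u x\<bar>" "\<And>x y. \<bar>v x - v y\<bar> \<le> \<bar>u x - u y\<bar>"
  shows "v \<in> X"
proof -
  have "G.fin (diff v)"
    by (rule G.fin_mono[OF X_fin(1)[OF assms(1)] diff_borel[OF assms(2)]]) (simp add: diff_def assms(4))
  moreover have "L.fin v" by (rule L.fin_mono[OF X_fin(2)[OF assms(1)]]) (use assms in auto)
  moreover have "AE x in lebesgue. x \<notin> \<Omega> \<longrightarrow> v x = 0"
    using X_AE[OF assms(1)]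
  proof eventually_elim
    case (elim x)
    then show ?case using assms(3)[of x] by auto
  qed
  ultimately show ?thesis using assms by (simp add: X_def)
qed

lemma E_nonneg: "0 \<le> E u"
  by (simp add: E_def G.modular_nonneg L.modular_nonneg)

lemma E_convex: "u \<in> X \<Longrightarrow> v \<in> X \<Longrightarrow> E u + dE u (\<lambda>x. v x - u x) \<le> E v"
  using G.modular_convex[of "diff u" "diff v"] L.modular_convex[of u v] X_fin[of u] X_fin[of v]
  by (simp add: E_def dE_def diff_minus)

lemma dE_linear:
  assumes "u \<in> X" "v \<in> X" "w \<in> X"
  shows "dE u (\<lambda>x. a * v x + b * w x) = a * dE u v + b * dE u w"
  using G.dmodular_linear[of "diff u" "diff v" "diff w" a b] L.dmodular_linear[of u v w a b] assms X_fin
  by (simp add: dE_def diff_add diff_scale algebra_simps)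

lemma dE_diff: "u \<in> X \<Longrightarrow> v \<in> X \<Longrightarrow> w \<in> X \<Longrightarrow> dE u (\<lambda>x. v x - w x) = dE u v - dE u w"
  using dE_linear[of u v w 1 "-1"] by simp

lemma dE_scale: "u \<in> X \<Longrightarrow> v \<in> X \<Longrightarrow> dE u (\<lambda>x. c * v x) = c * dE u v"
  using dE_linear[of u v v c 0] by simp

lemma dE_uminus_left: "dE (\<lambda>x. - u x) v = - dE u v"
  by (simp add: dE_def diff_uminus G.dmodular_uminus_left L.dmodular_uminus_left)

lemma dE_comb: "u \<in> X \<Longrightarrow> (\<And>i. i < m \<Longrightarrow> w i \<in> X) \<Longrightarrow> dE u (comb w m c) = (\<Sum>i<m. c i * dE u (w i))"
proof (induction m)
  case 0
  then show ?case using dE_scale[of u "\<lambda>_. 0" 0] by simp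
next
  case (Suc m)
  then show ?case using dE_linear[of u "comb w m c" "w m" 1 "c m"] X_comb[of m w c]
    by (simp add: comb_Suc)
qed

lemma E_scale_le:
  assumes "u \<in> X" "0 \<le> t" "t \<le> 1"
  shows "E (\<lambda>x. t * u x) \<le> t powr pl * E u"
  using G.modular_scale_le[of "diff u" t] L.modular_scale_le[of u t] X_fin[OF assms(1)] assms
  by (simp add: E_def diff_scale algebra_simps)

text \<open>A majorant that does not depend on the coefficients, so that energies of linear combinations depend continuously on them.\<close>

lemma comb_dominated:
  fixes w :: "nat \<Rightarrow> 'a \<Rightarrow> real"
  assumes "\<And>i. \<bar>c i\<bar> \<le> K"
  shows "\<bar>comb w m c x\<bar> \<le> K * comb (\<lambda>i x. \<bar>w i x\<bar>) m (\<lambda>_. 1) x"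
proof -
  have "\<bar>comb w m c x\<bar> \<le> (\<Sum>i<m. \<bar>c i * w i x\<bar>)" unfolding comb_def by (rule sum_abs)
  also have "\<dots> \<le> (\<Sum>i<m. K * \<bar>w i x\<bar>)" using assms by (intro sum_mono) (auto simp: abs_mult intro: mult_right_mono)
  finally show ?thesis by (simp add: comb_def sum_distrib_left)
qed

lemma G_fin_comb: "(\<And>i. i < m \<Longrightarrow> G.fin (w i)) \<Longrightarrow> G.fin (comb w m c)"
  by (induction m) (simp_all add: comb_Suc G.fin_add G.fin_scale)

lemma L_fin_comb: "(\<And>i. i < m \<Longrightarrow> L.fin (w i)) \<Longrightarrow> L.fin (comb w m c)"
  by (induction m) (simp_all add: comb_Suc L.fin_add L.fin_scale)

lemma tendsto_comb: "(\<And>i. i < m \<Longrightarrow> ((\<lambda>n. c n i) \<longlongrightarrow> l i) F) \<Longrightarrow> ((\<lambda>n. comb w m (c n) x) \<longlongrightarrow> comb w m l x) F"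
  unfolding comb_def by (intro tendsto_sum tendsto_mult tendsto_const) auto

lemma tendsto_E_comb:
  assumes w: "\<And>i. i < m \<Longrightarrow> w i \<in> X" and c: "\<And>i. (\<lambda>n. c n i) \<longlonglongrightarrow> l i" and K: "\<And>n i. \<bar>c n i\<bar> \<le> K"
  shows "(\<lambda>n. E (comb w m (c n))) \<longlonglongrightarrow> E (comb w m l)"
    and "v \<in> X \<Longrightarrow> (\<lambda>n. dE (comb w m (c n)) v) \<longlonglongrightarrow> dE (comb w m l) v"
proof -
  let ?h1 = "\<lambda>z. K * comb (\<lambda>i z. \<bar>diff (w i) z\<bar>) m (\<lambda>_. 1) z"
  let ?h2 = "\<lambda>z. K * comb (\<lambda>i z. \<bar>w i z\<bar>) m (\<lambda>_. 1) z"
  have h: "G.fin ?h1" "L.fin ?h2"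
    by (intro G.fin_scale L.fin_scale G_fin_comb L_fin_comb G.fin_abs L.fin_abs X_fin w; assumption)+
  have m1: "comb (\<lambda>i. diff (w i)) m (c n) \<in> borel_measurable (lebesgue \<Otimes>\<^sub>M lebesgue)" for n
    by (intro G.finD G_fin_comb X_fin(1) w)
  have m2: "comb w m (c n) \<in> borel_measurable lebesgue" for n
    by (intro L.finD L_fin_comb X_fin(2) w)
  have G1: "(\<lambda>n. G.modular (diff (comb w m (c n)))) \<longlonglongrightarrow> G.modular (diff (comb w m l))"
    unfolding diff_comb by (rule G.tendsto_modular[OF h(1) m1 comb_dominated[OF K] tendsto_comb[OF c]])
  have L1: "(\<lambda>n. L.modular (comb w m (c n))) \<longlonglongrightarrow> L.modular (comb w m l)"
    by (rule L.tendsto_modular[OF h(2) m2 comb_dominated[OF K] tendsto_comb[OF c]])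
  show "(\<lambda>n. E (comb w m (c n))) \<longlonglongrightarrow> E (comb w m l)"
    unfolding E_def by (intro tendsto_add G1 L1)
  assume v: "v \<in> X"
  have G2: "(\<lambda>n. G.dmodular (diff (comb w m (c n))) (diff v)) \<longlonglongrightarrow> G.dmodular (diff (comb w m l)) (diff v)"
    unfolding diff_comb by (rule G.tendsto_dmodular[OF h(1) m1 comb_dominated[OF K] tendsto_comb[OF c] X_fin(1)[OF v]])
  have L2: "(\<lambda>n. L.dmodular (comb w m (c n)) v) \<longlonglongrightarrow> L.dmodular (comb w m l) v"
    by (rule L.tendsto_dmodular[OF h(2) m2 comb_dominated[OF K] tendsto_comb[OF c] X_fin(2)[OF v]])
  show "(\<lambda>n. dE (comb w m (c n)) v) \<longlonglongrightarrow> dE (comb w m l) v"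
    unfolding dE_def by (intro tendsto_add G2 L2)
qed

lemma X_integrable:
  assumes u: "u \<in> X"
  shows "integrable lebesgue u" and "(\<integral>x. \<bar>u x\<bar> \<partial>lebesgue) \<le> pu * E u + measure lebesgue \<Omega>"
proof -
  have [measurable]: "u \<in> borel_measurable lebesgue" using u by (simp add: X_def)
  have [measurable]: "\<Omega> \<in> sets lebesgue" using open_Omega by auto
  have fO: "emeasure lebesgue \<Omega> < \<infinity>" using emeasure_bounded_finite[OF bounded_Omega] open_Omega by simp
  have iO: "integrable lebesgue (indicator \<Omega> :: _ \<Rightarrow> real)" using fO by (simp add: integrable_indicator_iff)
  have ip: "integrable lebesgue (\<lambda>x. \<bar>u x\<bar> powr p (x, x))" using X_fin(2)[OF u] by (simp add: L.fin_def)
  have le: "AE x in lebesgue. \<bar>u x\<bar> \<le> \<bar>u x\<bar> powr p (x, x) + indicator \<Omega> x"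
    using X_AE[OF u]
  proof eventually_elim
    fix x assume x: "x \<notin> \<Omega> \<longrightarrow> u x = 0"
    show "\<bar>u x\<bar> \<le> \<bar>u x\<bar> powr p (x, x) + indicator \<Omega> x"
    proof (cases "\<bar>u x\<bar> \<le> 1")
      case True
      then show ?thesis using x by (cases "x \<in> \<Omega>") (auto simp: add_increasing)
    next
      case False
      then have "\<bar>u x\<bar> powr 1 \<le> \<bar>u x\<bar> powr p (x, x)" using p1 by (intro powr_mono) auto
      then show ?thesis using False by (simp add: add_increasing2)
    qed
  qed
  show iu: "integrable lebesgue u"
    by (rule Bochner_Integration.integrable_bound[OF Bochner_Integration.integrable_add[OF ip iO]])
      (use le in \<open>auto elim!: eventually_mono simp: order_trans[OF _ abs_ge_self]\<close>)
  have "(\<integral>x. \<bar>u x\<bar> \<partial>lebesgue) \<le> (\<integral>x. \<bar>u x\<bar> powr p (x, x) + indicator \<Omega> x \<partial>lebesgue)"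
    by (rule integral_mono_AE) (use ip iO iu le in auto)
  also have "\<dots> = (\<integral>x. \<bar>u x\<bar> powr p (x, x) \<partial>lebesgue) + measure lebesgue \<Omega>"
    using ip iO by simp
  also have "(\<integral>x. \<bar>u x\<bar> powr p (x, x) \<partial>lebesgue) \<le> pu * L.modular u"
    using L.integral_powr_le_modular[OF X_fin(2)[OF u]] by simp
  also have "\<dots> \<le> pu * E u" using G.pu G.modular_nonneg by (intro mult_left_mono) (auto simp: E_def)
  finally show "(\<integral>x. \<bar>u x\<bar> \<partial>lebesgue) \<le> pu * E u + measure lebesgue \<Omega>" by simp
qed

lemma modulus_eq: "u \<in> X \<Longrightarrow> modulus u = ennreal (\<integral>z. \<bar>diff u z\<bar> powr p z * kern z \<partial>(lebesgue \<Otimes>\<^sub>M lebesgue))"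
  unfolding modulus_def using X_fin(1)[of u]
  by (intro nn_integral_eq_integral) (auto simp: G.fin_def kern_nonneg)

lemma integral_modulus_diff_le:
  assumes "u \<in> X" "v \<in> X"
  shows "(\<integral>z. \<bar>diff (\<lambda>x. u x - v x) z\<bar> powr p z * kern z \<partial>(lebesgue \<Otimes>\<^sub>M lebesgue)) \<le> 2 powr pu * (pu * (E u + E v))"
proof -
  let ?P = "lebesgue \<Otimes>\<^sub>M (lebesgue :: (real^'n) measure)"
  let ?d = "\<lambda>u z. \<bar>diff u z\<bar> powr p z * kern z"
  have i: "integrable ?P (?d u)" if "u \<in> X" for u using X_fin(1)[OF that] by (simp add: G.fin_def)
  have "(\<integral>z. ?d (\<lambda>x. u x - v x) z \<partial>?P) \<le> (\<integral>z. 2 powr pu * (?d u z + ?d v z) \<partial>?P)"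
  proof (rule integral_mono)
    show "integrable ?P (?d (\<lambda>x. u x - v x))" by (intro i X_diff assms)
    show "integrable ?P (\<lambda>z. 2 powr pu * (?d u z + ?d v z))" by (intro integrable_mult_right Bochner_Integration.integrable_add i assms)
    fix z
    have "\<bar>diff u z + - diff v z\<bar> powr p z \<le> 2 powr pu * (\<bar>diff u z\<bar> powr p z + \<bar>- diff v z\<bar> powr p z)"
      using p1[of z] p_bounds[of z] by (intro powr_sum_le) auto
    from mult_right_mono[OF this kern_nonneg[of z]]
    show "?d (\<lambda>x. u x - v x) z \<le> 2 powr pu * (?d u z + ?d v z)"
      by (simp add: diff_minus algebra_simps)
  qed
  also have "\<dots> = 2 powr pu * ((\<integral>z. ?d u z \<partial>?P) + (\<integral>z. ?d v z \<partial>?P))"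
    using i assms by simp
  also have "\<dots> \<le> 2 powr pu * (pu * E u + pu * E v)"
  proof (intro mult_left_mono add_mono)
    have "(\<integral>z. ?d u z \<partial>?P) \<le> pu * E u" if "u \<in> X" for u
    proof -
      have "pu * G.modular (diff u) \<le> pu * E u" using G.pu L.modular_nonneg[of u] by (intro mult_left_mono) (auto simp: E_def)
      then show ?thesis using G.integral_powr_le_modular[OF X_fin(1)[OF that]] by linarith
    qed
    then show "(\<integral>z. ?d u z \<partial>?P) \<le> pu * E u" "(\<integral>z. ?d v z \<partial>?P) \<le> pu * E v" using assms by auto
  qed simp
  finally show ?thesis by (simp add: algebra_simps)
qed

text \<open>\<open>finite_rank_estimate\<close> applied to a difference, whose modular is controlled by the two energies because the
  exponent is bounded.\<close>

lemma L1_distance_estimate: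
  assumes e: "0 < e"
  shows "\<exists>\<Q>. finite \<Q> \<and> \<Q> \<subseteq> sets lebesgue \<and> (\<forall>u\<in>X. \<forall>v\<in>X.
    (\<integral>x. \<bar>u x - v x\<bar> \<partial>lebesgue) \<le> (\<Sum>Q\<in>\<Q>. \<bar>(\<integral>x. u x * indicator Q x \<partial>lebesgue) - (\<integral>x. v x * indicator Q x \<partial>lebesgue)\<bar>) + e * (E u + E v + 1))"
proof -
  define C where "C = 2 powr pu * pu + 1"
  have C: "C \<ge> 1" using G.pu by (simp add: C_def)
  obtain \<Q> where Q: "finite \<Q>" "\<Q> \<subseteq> sets lebesgue" 
    "\<And>w m. integrable lebesgue w \<Longrightarrow> (AE x in lebesgue. x \<notin> \<Omega> \<longrightarrow> w x = 0) \<Longrightarrow> modulus w \<le> ennreal m \<Longrightarrow> 0 \<le> m \<Longrightarrow>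
       (\<integral>x. \<bar>w x\<bar> \<partial>lebesgue) \<le> (\<Sum>Q\<in>\<Q>. \<bar>\<integral>x. w x * indicator Q x \<partial>lebesgue\<bar>) + (e / C) * (m + 1)"
    using finite_rank_estimate[OF bounded_Omega open_Omega, of "e / C"] e C by auto
  show ?thesis
  proof (intro exI[of _ \<Q>] conjI ballI)
    fix u v assume uv: "u \<in> X" "v \<in> X"
    define m where "m = 2 powr pu * (pu * (E u + E v))"
    have E0: "0 \<le> E u + E v" using E_nonneg[of u] E_nonneg[of v] by simp
    have m0: "0 \<le> m" using G.pu E0 by (simp add: m_def)
    have d: "(\<lambda>x. u x - v x) \<in> X" by (intro X_diff uv)
    have "modulus (\<lambda>x. u x - v x) \<le> ennreal m"
      unfolding modulus_eq[OF d] m_def by (intro ennreal_leI integral_modulus_diff_le uv)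
    then have "(\<integral>x. \<bar>u x - v x\<bar> \<partial>lebesgue) \<le> (\<Sum>Q\<in>\<Q>. \<bar>\<integral>x. (u x - v x) * indicator Q x \<partial>lebesgue\<bar>) + (e / C) * (m + 1)"
      by (intro Q(3) X_integrable X_AE d m0)
    also have "(\<Sum>Q\<in>\<Q>. \<bar>\<integral>x. (u x - v x) * indicator Q x \<partial>lebesgue\<bar>)
      = (\<Sum>Q\<in>\<Q>. \<bar>(\<integral>x. u x * indicator Q x \<partial>lebesgue) - (\<integral>x. v x * indicator Q x \<partial>lebesgue)\<bar>)"
    proof (intro sum.cong refl arg_cong[where f = abs])
      fix Q assume "Q \<in> \<Q>"
      then have "Q \<in> sets lebesgue" using Q(2) by auto
      then show "(\<integral>x. (u x - v x) * indicator Q x \<partial>lebesgue) = (\<integral>x. u x * indicator Q x \<partial>lebesgue) - (\<integral>x. v x * indicator Q x \<partial>lebesgue)"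
        unfolding left_diff_distrib using uv
        by (intro Bochner_Integration.integral_diff integrable_real_mult_indicator X_integrable)
    qed
    also have "(e / C) * (m + 1) \<le> (e / C) * (C * (E u + E v + 1))"
      using e C E0 by (intro mult_left_mono) (auto simp: m_def C_def algebra_simps)
    also have "\<dots> = e * (E u + E v + 1)" using C by simp
    finally show "(\<integral>x. \<bar>u x - v x\<bar> \<partial>lebesgue) \<le> (\<Sum>Q\<in>\<Q>. \<bar>(\<integral>x. u x * indicator Q x \<partial>lebesgue) - (\<integral>x. v x * indicator Q x \<partial>lebesgue)\<bar>) + e * (E u + E v + 1)"
      by simp
  qed (use Q in auto)
qed

end

section \<open>Compactness and separability of the energy space\<close>

text \<open>This transfers almost everywhere convergence of functions to that of their differences, which is where
  Fatou's lemma is applied.\<close>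

lemma AE_lebesgue_pair:
  assumes "AE x in (lebesgue :: 'a::euclidean_space measure). P x"
  shows "AE z in lebesgue \<Otimes>\<^sub>M (lebesgue :: 'a measure). P (fst z) \<and> P (snd z)"
proof -
  let ?L = "lebesgue :: 'a measure"
  obtain N where N: "{x \<in> space ?L. \<not> P x} \<subseteq> N" "N \<in> null_sets ?L"
    using assms unfolding eventually_ae_filter by blast
  have "N \<times> UNIV \<in> null_sets (?L \<Otimes>\<^sub>M ?L)" "UNIV \<times> N \<in> null_sets (?L \<Otimes>\<^sub>M ?L)"
    using N(2) sets.top[of ?L] by (auto simp: null_sets_def lebesgue.emeasure_pair_measure_Times)
  then have "N \<times> UNIV \<union> UNIV \<times> N \<in> null_sets (?L \<Otimes>\<^sub>M ?L)" by auto
  then show ?thesis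
    unfolding eventually_ae_filter using N(1)
    by (intro bexI[of _ "N \<times> UNIV \<union> UNIV \<times> N"]) (auto simp: space_pair_measure)
qed

context frac_space
begin

lemma abs_integral_indicator_le:
  assumes "u \<in> X" "Q \<in> sets lebesgue"
  shows "\<bar>\<integral>x. u x * indicator Q x \<partial>lebesgue\<bar> \<le> (\<integral>x. \<bar>u x\<bar> \<partial>lebesgue)"
proof -
  have "\<bar>\<integral>x. u x * indicator Q x \<partial>lebesgue\<bar> \<le> (\<integral>x. \<bar>u x * indicator Q x\<bar> \<partial>lebesgue)"
    by (rule integral_abs_bound)
  also have "\<dots> \<le> (\<integral>x. \<bar>u x\<bar> \<partial>lebesgue)"
    using X_integrable(1)[OF assms(1)] assms(2)
    by (intro integral_mono integrable_abs integrable_real_mult_indicator) (auto simp: indicator_def)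
  finally show ?thesis .
qed

text \<open>One finite set of test cells for each accuracy \<open>1/(l+1)\<close> in \<open>L1_distance_estimate\<close>.\<close>

definition L1_family :: "(nat \<Rightarrow> (real^'n) set set) \<Rightarrow> bool" where
  "L1_family \<Q> \<longleftrightarrow> (\<forall>l. finite (\<Q> l) \<and> \<Q> l \<subseteq> sets lebesgue \<and> (\<forall>u\<in>X. \<forall>v\<in>X.
    (\<integral>x. \<bar>u x - v x\<bar> \<partial>lebesgue) \<le> (\<Sum>Q\<in>\<Q> l. \<bar>(\<integral>x. u x * indicator Q x \<partial>lebesgue) - (\<integral>x. v x * indicator Q x \<partial>lebesgue)\<bar>) + (1 / (real l + 1)) * (E u + E v + 1)))"

lemma L1_family_exists: "\<exists>\<Q>. L1_family \<Q>"
  unfolding L1_family_def by (intro choice allI L1_distance_estimate) simp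

text \<open>Choose a subsequence along which the two modulars and all the countably many cell averages converge.
  \<open>L1_distance_estimate\<close> makes it Cauchy in \<open>L\<^sup>1\<close>, and the energy is lower semicontinuous by Fatou's lemma.
  The limit \<open>e\<close> of the energies may exceed the energy of the limit.\<close>

theorem X_compactness:
  assumes u: "\<And>n. u n \<in> X" and K: "\<And>n. E (u n) \<le> K"
  shows "\<exists>r v e h. strict_mono (r::nat\<Rightarrow>nat) \<and> v \<in> X \<and> integrable lebesgue h
    \<and> (AE x in lebesgue. (\<lambda>n. u (r n) x) \<longlonglongrightarrow> v x) \<and> (AE x in lebesgue. \<forall>n. \<bar>u (r n) x\<bar> \<le> h x)
    \<and> (\<lambda>n. E (u (r n))) \<longlonglongrightarrow> e \<and> E v \<le> e"
proof -
  have K0: "0 \<le> K" using E_nonneg[of "u 0"] K[of 0] by linarith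
  obtain \<Q> where fam: "L1_family \<Q>" using L1_family_exists by blast
  have Q: "\<And>l::nat. finite (\<Q> l)" "\<And>l. \<Q> l \<subseteq> sets lebesgue" 
    "\<And>l u v. u \<in> X \<Longrightarrow> v \<in> X \<Longrightarrow> (\<integral>x. \<bar>u x - v x\<bar> \<partial>lebesgue) \<le> (\<Sum>Q\<in>\<Q> l. \<bar>(\<integral>x. u x * indicator Q x \<partial>lebesgue) - (\<integral>x. v x * indicator Q x \<partial>lebesgue)\<bar>) + (1 / (real l + 1)) * (E u + E v + 1)"
    using fam unfolding L1_family_def by blast+
  define A where "A = insert {} (\<Union>l. \<Q> l)"
  have A: "countable A" "A \<noteq> {}" "A \<subseteq> sets lebesgue" using Q(1,2) by (auto simp: A_def intro: countable_finite)
  define q where "q = from_nat_into A"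
  have qA: "q i \<in> A" for i unfolding q_def using A by (intro from_nat_into)
  define B where "B = K + (pu * K + measure lebesgue \<Omega>)"
  have pK: "0 \<le> pu * K + measure lebesgue \<Omega>" using K0 G.pu by simp
  define x where "x n i = (if i = 0 then G.modular (diff (u n)) else if i = 1 then L.modular (u n)
      else \<integral>y. u n y * indicator (q (i - 2)) y \<partial>lebesgue)" for n i
  have "\<bar>x n i\<bar> \<le> B" for n i
  proof -
    have "\<bar>\<integral>y. u n y * indicator (q (i - 2)) y \<partial>lebesgue\<bar> \<le> pu * K + measure lebesgue \<Omega>"
    proof -
      have "q (i - 2) \<in> sets lebesgue" using qA[of "i - 2"] A(3) by blast
      then have "\<bar>\<integral>y. u n y * indicator (q (i - 2)) y \<partial>lebesgue\<bar> \<le> (\<integral>y. \<bar>u n y\<bar> \<partial>lebesgue)"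
        by (rule abs_integral_indicator_le[OF u])
      moreover have "pu * E (u n) \<le> pu * K" using K G.pu by (intro mult_left_mono) auto
      ultimately show ?thesis using X_integrable(2)[OF u, of n] by linarith
    qed
    then show ?thesis
      using K[of n] G.modular_nonneg[of "diff (u n)"] L.modular_nonneg[of "u n"] pK K0
      by (auto simp: x_def B_def E_def)
  qed
  then obtain l r1 where r1: "strict_mono (r1::nat\<Rightarrow>nat)" "\<And>i. (\<lambda>n. x (r1 n) i) \<longlonglongrightarrow> l i"
    using bounded_coords_subsequence[of x "\<lambda>_. B"] by blast
  have limQ: "\<exists>a. (\<lambda>n. \<integral>y. u (r1 n) y * indicator P y \<partial>lebesgue) \<longlonglongrightarrow> a" if PA: "P \<in> A" for P
  proof -
    obtain j where "q j = P" using from_nat_into_surj[OF A(1) PA] by (auto simp: q_def)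
    then have "(\<lambda>n. x (r1 n) (j + 2)) = (\<lambda>n. \<integral>y. u (r1 n) y * indicator P y \<partial>lebesgue)"
      by (auto simp: x_def)
    then show ?thesis using r1(2)[of "j + 2"] by auto
  qed
  have cauchy: "\<exists>N. \<forall>m\<ge>N. \<forall>n\<ge>N. (\<integral>x. \<bar>u (r1 m) x - u (r1 n) x\<bar> \<partial>lebesgue) < e" if e: "0 < e" for e
  proof -
    obtain k :: nat where k: "2 * (2 * K + 1) / e < real k" using reals_Archimedean2 by blast
    then have ke: "(1 / (real k + 1)) * (2 * K + 1) \<le> e / 2"
      using e K0 by (simp add: field_simps)
    define a where "a P = (SOME a. (\<lambda>n. \<integral>y. u (r1 n) y * indicator P y \<partial>lebesgue) \<longlonglongrightarrow> a)" for P
    have a: "(\<lambda>n. \<integral>y. u (r1 n) y * indicator P y \<partial>lebesgue) \<longlonglongrightarrow> a P" if "P \<in> \<Q> k" for P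
      unfolding a_def by (rule someI_ex[OF limQ]) (use that in \<open>auto simp: A_def\<close>)
    have "(\<lambda>n. \<Sum>P\<in>\<Q> k. \<bar>(\<integral>y. u (r1 n) y * indicator P y \<partial>lebesgue) - a P\<bar>) \<longlonglongrightarrow> (\<Sum>P\<in>\<Q> k. \<bar>a P - a P\<bar>)"
      by (intro tendsto_intros a)
    then have "\<forall>\<^sub>F n in sequentially. (\<Sum>P\<in>\<Q> k. \<bar>(\<integral>y. u (r1 n) y * indicator P y \<partial>lebesgue) - a P\<bar>) < e / 4"
      using e by (intro order_tendstoD(2)) auto
    then obtain N where N: "\<And>n. n \<ge> N \<Longrightarrow> (\<Sum>P\<in>\<Q> k. \<bar>(\<integral>y. u (r1 n) y * indicator P y \<partial>lebesgue) - a P\<bar>) < e / 4"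
      by (auto simp: eventually_sequentially)
    show ?thesis
    proof (intro exI[of _ N] allI impI)
      fix m n assume mn: "N \<le> m" "N \<le> n"
      let ?I = "\<lambda>n P. \<integral>y. u (r1 n) y * indicator P y \<partial>lebesgue"
      have "(\<integral>x. \<bar>u (r1 m) x - u (r1 n) x\<bar> \<partial>lebesgue)
        \<le> (\<Sum>P\<in>\<Q> k. \<bar>?I m P - ?I n P\<bar>) + (1 / (real k + 1)) * (E (u (r1 m)) + E (u (r1 n)) + 1)"
        by (rule Q(3)[OF u u])
      also have "(\<Sum>P\<in>\<Q> k. \<bar>?I m P - ?I n P\<bar>) \<le> (\<Sum>P\<in>\<Q> k. \<bar>?I m P - a P\<bar> + \<bar>?I n P - a P\<bar>)"
        by (intro sum_mono) linarith
      also have "\<dots> < e / 4 + e / 4"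
        unfolding sum.distrib by (intro add_strict_mono N mn)
      also have "(1 / (real k + 1)) * (E (u (r1 m)) + E (u (r1 n)) + 1) \<le> (1 / (real k + 1)) * (2 * K + 1)"
        using K[of "r1 m"] K[of "r1 n"] by (intro mult_left_mono) auto
      also note ke
      finally show "(\<integral>x. \<bar>u (r1 m) x - u (r1 n) x\<bar> \<partial>lebesgue) < e" by simp
    qed
  qed
  obtain r2 v h where r2: "strict_mono (r2::nat\<Rightarrow>nat)" "v \<in> borel_measurable lebesgue" "integrable lebesgue h"
     "AE x in lebesgue. (\<lambda>n. u (r1 (r2 n)) x) \<longlonglongrightarrow> v x" "AE x in lebesgue. \<forall>n. \<bar>u (r1 (r2 n)) x\<bar> \<le> h x"
    using L1_Cauchy_subsequence[of lebesgue "\<lambda>n. u (r1 n)", OF X_integrable(1)[OF u] cauchy] by blast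
  have M1: "(\<lambda>n. G.modular (diff (u (r1 (r2 n))))) \<longlonglongrightarrow> l 0"
    using LIMSEQ_subseq_LIMSEQ[OF r1(2)[of 0] r2(1)] by (simp add: x_def o_def)
  have M2: "(\<lambda>n. L.modular (u (r1 (r2 n)))) \<longlonglongrightarrow> l 1"
    using LIMSEQ_subseq_LIMSEQ[OF r1(2)[of 1] r2(1)] by (simp add: x_def o_def)
  have AEd: "AE z in lebesgue \<Otimes>\<^sub>M lebesgue. (\<lambda>n. diff (u (r1 (r2 n))) z) \<longlonglongrightarrow> diff v z"
    using AE_lebesgue_pair[OF r2(4)] by eventually_elim (auto simp: diff_def intro: tendsto_diff)
  have G: "G.fin (diff v)" "G.modular (diff v) \<le> l 0"
    using G.modular_Fatou[OF X_fin(1)[OF u] diff_borel[OF r2(2)] AEd M1] by auto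
  have L: "L.fin v" "L.modular v \<le> l 1"
    using L.modular_Fatou[OF X_fin(2)[OF u] r2(2) r2(4) M2] by auto
  have "AE x in lebesgue. \<forall>n. x \<notin> \<Omega> \<longrightarrow> u (r1 (r2 n)) x = 0"
    unfolding AE_all_countable using X_AE[OF u] by blast
  then have "AE x in lebesgue. x \<notin> \<Omega> \<longrightarrow> v x = 0"
    using r2(4)
  proof eventually_elim
    case (elim x)
    show ?case
    proof
      assume "x \<notin> \<Omega>"
      then have "(\<lambda>n. u (r1 (r2 n)) x) = (\<lambda>n. 0)" using elim(1) by auto
      then show "v x = 0" using elim(2) LIMSEQ_unique[OF tendsto_const[of 0]] by metis
    qed
  qed
  then have vX: "v \<in> X" using G L by (intro XI)
  have "(\<lambda>n. E (u ((r1 \<circ> r2) n))) \<longlonglongrightarrow> l 0 + l 1" unfolding E_def o_def by (intro tendsto_add M1 M2)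
  moreover have "E v \<le> l 0 + l 1" using G L by (simp add: E_def)
  moreover have "strict_mono (r1 \<circ> r2)" using r1 r2 by (intro strict_mono_o)
  ultimately show ?thesis using vX r2 by (intro exI[of _ "r1 \<circ> r2"] exI[of _ v] exI[of _ "l 0 + l 1"] exI[of _ h]) auto
qed

text \<open>Round the energy and the finitely many test averages of a function to a grid and pick one representative for
  every value of the resulting integer code. There are countably many codes, and two functions with the
  same fine code are close in energy and, by \<open>L1_distance_estimate\<close>, in \<open>L\<^sup>1\<close>.\<close>

theorem X_countable_dense:
  "\<exists>d::nat \<Rightarrow> real^'n \<Rightarrow> real. (\<forall>i. d i \<in> X) \<and>
     (\<forall>u\<in>X. \<forall>\<epsilon>>0. \<exists>i. (\<integral>x. \<bar>u x - d i x\<bar> \<partial>lebesgue) < \<epsilon> \<and> \<bar>E u - E (d i)\<bar> < \<epsilon>)"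
proof -
  obtain \<Q> where fam: "L1_family \<Q>" using L1_family_exists by blast
  have Q: "\<And>l::nat. finite (\<Q> l)" "\<And>l. \<Q> l \<subseteq> sets lebesgue" 
    "\<And>l u v. u \<in> X \<Longrightarrow> v \<in> X \<Longrightarrow> (\<integral>x. \<bar>u x - v x\<bar> \<partial>lebesgue) \<le> (\<Sum>Q\<in>\<Q> l. \<bar>(\<integral>x. u x * indicator Q x \<partial>lebesgue) - (\<integral>x. v x * indicator Q x \<partial>lebesgue)\<bar>) + (1 / (real l + 1)) * (E u + E v + 1)"
    using fam unfolding L1_family_def by blast+
  have "\<forall>l. \<exists>qs. set qs = \<Q> l \<and> distinct qs" using finite_distinct_list[OF Q(1)] by blast
  then obtain qs where qs: "\<And>l. set (qs l) = \<Q> l" "\<And>l. distinct (qs l)" by metis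
  have card: "length (qs l) = card (\<Q> l)" for l using qs distinct_card by metis
  \<comment> \<open>the factor \<open>card + 1\<close> makes the rounding errors of the averages add up to at most \<open>1/(l+1)\<close>\<close>
  define code where "code l u = \<lfloor>(real l + 1) * E u\<rfloor> #
     map (\<lambda>Q. \<lfloor>(real l + 1) * (real (card (\<Q> l)) + 1) * (\<integral>x. u x * indicator Q x \<partial>lebesgue)\<rfloor>) (qs l)" for l :: nat and u
  define rep where "rep z = (if \<exists>u\<in>X. code (fst z) u = snd z then SOME u. u \<in> X \<and> code (fst z) u = snd z else (\<lambda>_. 0))" for z
  have rep1: "rep z \<in> X" for z
  proof (cases "\<exists>u\<in>X. code (fst z) u = snd z")
    case True
    then have "\<exists>u. u \<in> X \<and> code (fst z) u = snd z" by blast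
    from someI_ex[OF this] show ?thesis using True by (simp add: rep_def)
  qed (simp add: rep_def)
  have rep2: "code l (rep (l, code l u)) = code l u" if "u \<in> X" for l u
  proof -
    have ex: "\<exists>v. v \<in> X \<and> code l v = code l u" using that by blast
    then have "\<exists>v\<in>X. code (fst (l, code l u)) v = snd (l, code l u)" by auto
    then have "rep (l, code l u) = (SOME v. v \<in> X \<and> code l v = code l u)" unfolding rep_def by simp
    then show ?thesis using someI_ex[OF ex] by simp
  qed
  have fl: "\<bar>a - b\<bar> \<le> 1 / c" if "\<lfloor>c * a\<rfloor> = \<lfloor>c * b\<rfloor>" "0 < c" for a b c :: real
  proof -
    have "\<bar>c * a - c * b\<bar> \<le> 1" using that(1) by linarith
    then have "c * \<bar>a - b\<bar> \<le> 1" using that(2) by (simp add: abs_mult right_diff_distrib[symmetric])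
    then show ?thesis using that(2) by (simp add: field_simps)
  qed
  show ?thesis
  proof (intro exI[of _ "\<lambda>i. rep (from_nat i)"] conjI ballI allI impI)
    fix i show "rep (from_nat i) \<in> X" by (rule rep1)
  next
    fix u and \<epsilon> :: real assume u: "u \<in> X" and "0 < \<epsilon>"
    obtain l :: nat where l: "(2 * E u + 4) / \<epsilon> < real l" using reals_Archimedean2 by blast
    define w where "w = rep (l, code l u)"
    have wX: "w \<in> X" unfolding w_def by (rule rep1)
    have cw: "code l w = code l u" unfolding w_def by (rule rep2[OF u])
    have lp: "0 < real l + 1" by simp
    have E1: "\<bar>E u - E w\<bar> \<le> 1 / (real l + 1)"
      by (rule fl) (use cw in \<open>auto simp: code_def\<close>)
    have I1: "\<bar>(\<integral>x. u x * indicator Q x \<partial>lebesgue) - (\<integral>x. w x * indicator Q x \<partial>lebesgue)\<bar> \<le> 1 / ((real l + 1) * (real (card (\<Q> l)) + 1))"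
      if "Q \<in> \<Q> l" for Q
      by (rule fl) (use cw that qs in \<open>auto simp: code_def\<close>)
    have "(\<Sum>Q\<in>\<Q> l. \<bar>(\<integral>x. u x * indicator Q x \<partial>lebesgue) - (\<integral>x. w x * indicator Q x \<partial>lebesgue)\<bar>)
        \<le> (\<Sum>Q\<in>\<Q> l. 1 / ((real l + 1) * (real (card (\<Q> l)) + 1)))"
      by (intro sum_mono I1)
    also have "\<dots> = (1 / (real l + 1)) * (real (card (\<Q> l)) / (real (card (\<Q> l)) + 1))" by simp
    also have "\<dots> \<le> (1 / (real l + 1)) * 1" by (intro mult_left_mono) auto
    also have "\<dots> = 1 / (real l + 1)" by simp
    finally have S: "(\<Sum>Q\<in>\<Q> l. \<bar>(\<integral>x. u x * indicator Q x \<partial>lebesgue) - (\<integral>x. w x * indicator Q x \<partial>lebesgue)\<bar>) \<le> 1 / (real l + 1)" .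
    have "1 / (real l + 1) \<le> 1" by simp
    then have "E w \<le> E u + 1" using E1 by linarith
    then have "(1 / (real l + 1)) * (E u + E w + 1) \<le> (1 / (real l + 1)) * (2 * E u + 2)"
      by (intro mult_left_mono) auto
    then have "(\<integral>x. \<bar>u x - w x\<bar> \<partial>lebesgue) \<le> 1 / (real l + 1) + (1 / (real l + 1)) * (2 * E u + 2)"
      using Q(3)[OF u wX, of l] S by linarith
    also have "\<dots> = (2 * E u + 3) / (real l + 1)" by (simp add: add_divide_distrib[symmetric])
    also have "\<dots> < \<epsilon>" using l \<open>0 < \<epsilon>\<close> lp E_nonneg[of u] by (simp add: field_simps)
    finally have 1: "(\<integral>x. \<bar>u x - w x\<bar> \<partial>lebesgue) < \<epsilon>" .
    have "1 / (real l + 1) < \<epsilon>" using l \<open>0 < \<epsilon>\<close> lp E_nonneg[of u]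
      by (smt (verit, best) divide_less_eq mult.commute pos_divide_less_eq pos_less_divide_eq)
    then have 2: "\<bar>E u - E w\<bar> < \<epsilon>" using E1 by linarith
    have "rep (from_nat (to_nat (l, code l u))) = w" by (simp add: w_def)
    then show "\<exists>i. (\<integral>x. \<bar>u x - rep (from_nat i) x\<bar> \<partial>lebesgue) < \<epsilon> \<and> \<bar>E u - E (rep (from_nat i))\<bar> < \<epsilon>"
      using 1 2 by metis
  qed
qed

end

section \<open>The truncated functional and its Galerkin approximation\<close>

text \<open>Round the second argument down to a multiple of \<open>1/(n+1)\<close>; the rounded function is measurable because it takes
  countably many forms, and it converges by continuity.\<close>

lemma caratheodory_joint_measurable:
  fixes f :: "'a \<Rightarrow> real \<Rightarrow> real"
  assumes m: "\<And>t. (\<lambda>x. f x t) \<in> borel_measurable M" and c: "\<And>x. continuous_on UNIV (f x)"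
  shows "(\<lambda>z. f (fst z) (snd z)) \<in> borel_measurable (M \<Otimes>\<^sub>M borel)"
proof (rule borel_measurable_LIMSEQ_real)
  fix n :: nat
  have [measurable]: "(\<lambda>z. f (fst z) (real_of_int i / real (Suc n))) \<in> borel_measurable (M \<Otimes>\<^sub>M borel)" for i
    by (rule measurable_compose[OF measurable_fst m])
  have "(\<lambda>z. \<lfloor>real (Suc n) * snd z\<rfloor>) \<in> (M \<Otimes>\<^sub>M (borel :: real measure)) \<rightarrow>\<^sub>M count_space UNIV"
    by measurable
  then show "(\<lambda>z. f (fst z) (real_of_int \<lfloor>real (Suc n) * snd z\<rfloor> / real (Suc n))) \<in> borel_measurable (M \<Otimes>\<^sub>M borel)"
    by (rule measurable_compose_countable[rotated]) measurable
next
  fix z :: "'a \<times> real"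
  have "(\<lambda>n. real_of_int \<lfloor>real (Suc n) * snd z\<rfloor> / real (Suc n)) \<longlonglongrightarrow> snd z"
  proof (rule tendsto_sandwich)
    show "\<forall>\<^sub>F n in sequentially. snd z - 1 / real (Suc n) \<le> real_of_int \<lfloor>real (Suc n) * snd z\<rfloor> / real (Suc n)"
    proof (intro always_eventually allI)
      fix n
      have "real (Suc n) * snd z - 1 \<le> real_of_int \<lfloor>real (Suc n) * snd z\<rfloor>" by linarith
      then have "(real (Suc n) * snd z - 1) / real (Suc n) \<le> real_of_int \<lfloor>real (Suc n) * snd z\<rfloor> / real (Suc n)"
        by (intro divide_right_mono) auto
      then show "snd z - 1 / real (Suc n) \<le> real_of_int \<lfloor>real (Suc n) * snd z\<rfloor> / real (Suc n)"
        by (simp add: diff_divide_distrib)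
    qed
    show "\<forall>\<^sub>F n in sequentially. real_of_int \<lfloor>real (Suc n) * snd z\<rfloor> / real (Suc n) \<le> snd z"
    proof (intro always_eventually allI)
      fix n
      have "real_of_int \<lfloor>real (Suc n) * snd z\<rfloor> \<le> real (Suc n) * snd z" by linarith
      then show "real_of_int \<lfloor>real (Suc n) * snd z\<rfloor> / real (Suc n) \<le> snd z"
        by (simp add: divide_le_eq mult.commute)
    qed
    have "(\<lambda>n. snd z - 1 / real (Suc n)) \<longlonglongrightarrow> snd z - 0"
      by (intro tendsto_intros LIMSEQ_Suc[OF lim_1_over_n])
    then show "(\<lambda>n. snd z - 1 / real (Suc n)) \<longlonglongrightarrow> snd z" by simp
  qed auto
  then show "(\<lambda>n. f (fst z) (real_of_int \<lfloor>real (Suc n) * snd z\<rfloor> / real (Suc n))) \<longlonglongrightarrow> f (fst z) (snd z)"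
    by (rule continuous_on_tendsto_compose[OF c]) auto
qed

lemma primitive_deriv:
  assumes "continuous_on UNIV (f x)"
  shows "(primitive f x has_real_derivative f x t) (at t)"
proof -
  let ?a = "- \<bar>t\<bar> - 1" and ?b = "\<bar>t\<bar> + 1"
  have "((\<lambda>u. LBINT y=ereal 0..u. f x y) has_vector_derivative f x t) (at t within {?a..?b})"
    by (rule interval_integral_FTC2) (auto intro: continuous_on_subset[OF assms])
  then have "((\<lambda>u. LBINT y=ereal 0..u. f x y) has_vector_derivative f x t) (at t)"
    by (subst (asm) at_within_interior) auto
  then show ?thesis by (simp add: has_real_derivative_iff_has_vector_derivative primitive_def[abs_def] zero_ereal_def)
qed

lemma primitive_0 [simp]: "primitive f x 0 = 0"
  by (simp add: primitive_def zero_ereal_def[symmetric])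

text \<open>The tangent inequalities at both ends squeeze the difference quotient between two values of \<open>d\<close>.\<close>

lemma convex_tangent_derivative:
  fixes F d :: "real \<Rightarrow> real"
  assumes tangent: "\<And>a b. F a + d a * (b - a) \<le> F b" and cont: "isCont d t"
  shows "(F has_real_derivative d t) (at t)"
proof -
  have "((\<lambda>y. (F y - F t) / (y - t)) \<longlongrightarrow> d t) (at t)"
  proof (rule tendsto_sandwich)
    have b: "min (d t) (d y) \<le> (F y - F t) / (y - t) \<and> (F y - F t) / (y - t) \<le> max (d t) (d y)" if "y \<noteq> t" for y
    proof -
      have 1: "d t * (y - t) \<le> F y - F t" using tangent[of t y] by simp
      have 2: "F y - F t \<le> d y * (y - t)" using tangent[of y t] by (simp add: algebra_simps)
      show ?thesis
      proof (cases "y > t")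
        case True
        then show ?thesis using 1 2 by (simp add: min_le_iff_disj le_max_iff_disj pos_le_divide_eq pos_divide_le_eq)
      next
        case False
        then have "y - t < 0" using that by simp
        then show ?thesis using 1 2 by (simp add: min_le_iff_disj le_max_iff_disj neg_le_divide_eq neg_divide_le_eq)
      qed
    qed
    show "\<forall>\<^sub>F y in at t. min (d t) (d y) \<le> (F y - F t) / (y - t)"
      using b by (auto simp: eventually_at_filter)
    show "\<forall>\<^sub>F y in at t. (F y - F t) / (y - t) \<le> max (d t) (d y)"
      using b by (auto simp: eventually_at_filter)
    have dt: "(d \<longlongrightarrow> d t) (at t)" using cont by (simp add: isCont_def)
    show "((\<lambda>y. min (d t) (d y)) \<longlongrightarrow> d t) (at t)" using tendsto_min[OF tendsto_const[of "d t"] dt] by simp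
    show "((\<lambda>y. max (d t) (d y)) \<longlongrightarrow> d t) (at t)" using tendsto_max[OF tendsto_const[of "d t"] dt] by simp
  qed
  then show ?thesis by (simp add: has_field_derivative_iff)
qed

text \<open>Here \<open>g\<close> is the nonlinearity after truncation. Continuity, bound and oddness are required at every point: a
  nonlinearity that has them almost everywhere may be set to \<open>0\<close> on the exceptional null set.\<close>

locale truncated = frac_space s p pl pu \<Omega>
  for s :: real and p :: "(real^'n) \<times> (real^'n) \<Rightarrow> real" and pl pu and \<Omega> :: "(real^'n) set" +
  fixes g :: "real^'n \<Rightarrow> real \<Rightarrow> real" and Cg T :: real
  assumes g_meas: "\<And>t. (\<lambda>x. g x t) \<in> borel_measurable lebesgue"
    and g_cont: "\<And>x. continuous_on UNIV (g x)"
    and g_bound: "\<And>x t. \<bar>g x t\<bar> \<le> Cg"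
    and g_odd: "\<And>x t. g x (- t) = - g x t"
    and T: "0 < T" and g_supp: "\<And>x t. T \<le> \<bar>t\<bar> \<Longrightarrow> g x t = 0"
    and g_out: "\<And>x t. x \<notin> \<Omega> \<Longrightarrow> g x t = 0"
begin

definition Gp :: "real^'n \<Rightarrow> real \<Rightarrow> real" where
  "Gp = primitive g"

definition Phi :: "(real^'n \<Rightarrow> real) \<Rightarrow> real" where
  "Phi u = (\<integral>x. Gp x (u x) \<partial>lebesgue)"

definition dPhi :: "(real^'n \<Rightarrow> real) \<Rightarrow> (real^'n \<Rightarrow> real) \<Rightarrow> real" where
  "dPhi u v = (\<integral>x. g x (u x) * v x \<partial>lebesgue)"

lemma Cg_nonneg: "0 \<le> Cg"
  using g_bound[of undefined undefined] by linarith

lemma Gp_deriv: "(Gp x has_real_derivative g x t) (at t)"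
  unfolding Gp_def using primitive_deriv[where f = g and x = x, OF g_cont] .

lemma Gp_0 [simp]: "Gp x 0 = 0"
  by (simp add: Gp_def)

lemma Gp_cont: "continuous_on UNIV (Gp x)"
  by (intro continuous_at_imp_continuous_on ballI DERIV_isCont[OF Gp_deriv])

lemma Gp_lipschitz: "\<bar>Gp x a - Gp x b\<bar> \<le> Cg * \<bar>a - b\<bar>"
proof -
  have *: "\<bar>Gp x a - Gp x b\<bar> \<le> Cg * \<bar>a - b\<bar>" if ab: "a < b" for a b
  proof -
    obtain z where "Gp x b - Gp x a = (b - a) * g x z" using MVT2[OF ab, of "Gp x" "g x"] Gp_deriv by blast
    then have "\<bar>Gp x a - Gp x b\<bar> = \<bar>a - b\<bar> * \<bar>g x z\<bar>" by (metis abs_minus_commute abs_mult)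
    also have "\<dots> \<le> \<bar>a - b\<bar> * Cg" by (intro mult_left_mono g_bound) auto
    finally show ?thesis by (simp add: mult.commute)
  qed
  show ?thesis using *[of a b] *[of b a] by (cases a b rule: linorder_cases) (auto simp: abs_minus_commute)
qed

lemma Gp_le: "\<bar>Gp x t\<bar> \<le> Cg * \<bar>t\<bar>"
  using Gp_lipschitz[of x t 0] by simp

lemma Gp_bounded: "\<bar>Gp x t\<bar> \<le> Cg * T"
proof -
  consider "\<bar>t\<bar> \<le> T" | "T < t" | "t < - T" by linarith
  then show ?thesis
  proof cases
    case 1
    then show ?thesis using Gp_le[of x t] mult_left_mono[OF 1 Cg_nonneg] by linarith
  next
    case 2
    obtain z where "T < z" "Gp x t - Gp x T = (t - T) * g x z" using MVT2[OF 2, of "Gp x" "g x"] Gp_deriv by blast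
    then have "Gp x t = Gp x T" using g_supp[of z x] by simp
    then show ?thesis using Gp_le[of x T] T by simp
  next
    case 3
    obtain z where "z < - T" "Gp x (- T) - Gp x t = (- T - t) * g x z" using MVT2[OF 3, of "Gp x" "g x"] Gp_deriv by blast
    then have "Gp x t = Gp x (- T)" using g_supp[of z x] by simp
    then show ?thesis using Gp_le[of x "- T"] T by simp
  qed
qed

lemma Gp_out: "x \<notin> \<Omega> \<Longrightarrow> Gp x t = 0"
  by (simp add: Gp_def primitive_def g_out)

lemma Gp_meas_x: "(\<lambda>x. Gp x t) \<in> borel_measurable lebesgue"
proof -
  have [measurable]: "(\<lambda>z. g (fst z) (snd z)) \<in> borel_measurable (lebesgue \<Otimes>\<^sub>M borel)"
    by (rule caratheodory_joint_measurable[OF g_meas g_cont])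
  have "(\<lambda>z. g (fst z) (snd z)) \<in> borel_measurable (lebesgue \<Otimes>\<^sub>M (lborel :: real measure))"
    by simp
  then have [measurable]: "(\<lambda>(x, \<tau>). g x \<tau>) \<in> borel_measurable (lebesgue \<Otimes>\<^sub>M (lborel :: real measure))"
    by (simp add: case_prod_unfold)
  have "(\<lambda>x. LINT \<tau>|lborel. indicator A \<tau> *\<^sub>R g x \<tau>) \<in> borel_measurable lebesgue" if [measurable]: "A \<in> sets borel" for A :: "real set"
    by measurable
  then show ?thesis
    unfolding Gp_def primitive_def interval_lebesgue_integral_def set_lebesgue_integral_def
    by (cases "0 \<le> ereal t") auto
qed

lemma g_comp_measurable [measurable (raw)]:
  assumes "u \<in> borel_measurable lebesgue"
  shows "(\<lambda>x. g x (u x)) \<in> borel_measurable lebesgue"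
proof -
  have "(\<lambda>x. (x, u x)) \<in> lebesgue \<rightarrow>\<^sub>M lebesgue \<Otimes>\<^sub>M borel" using assms by simp
  from measurable_compose[OF this caratheodory_joint_measurable[OF g_meas g_cont]] show ?thesis by simp
qed

lemma Gp_comp_measurable [measurable (raw)]:
  assumes "u \<in> borel_measurable lebesgue"
  shows "(\<lambda>x. Gp x (u x)) \<in> borel_measurable lebesgue"
proof -
  have "(\<lambda>x. (x, u x)) \<in> lebesgue \<rightarrow>\<^sub>M lebesgue \<Otimes>\<^sub>M borel" using assms by simp
  from measurable_compose[OF this caratheodory_joint_measurable[OF Gp_meas_x Gp_cont]] show ?thesis by simp
qed

lemma Gp_integrable:
  assumes "integrable lebesgue u"
  shows "integrable lebesgue (\<lambda>x. Gp x (u x))"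
proof (rule Bochner_Integration.integrable_bound)
  have [measurable]: "u \<in> borel_measurable lebesgue" using assms by auto
  show "integrable lebesgue (\<lambda>x. Cg * \<bar>u x\<bar>)" using assms by (intro integrable_mult_right integrable_abs)
  show "AE x in lebesgue. norm (Gp x (u x)) \<le> norm (Cg * \<bar>u x\<bar>)"
    using Gp_le Cg_nonneg by (intro AE_I2) (simp add: abs_mult)
qed (use assms in measurable)

lemma g_integrable:
  assumes "u \<in> borel_measurable lebesgue" "integrable lebesgue v"
  shows "integrable lebesgue (\<lambda>x. g x (u x) * v x)"
proof (rule Bochner_Integration.integrable_bound)
  have [measurable]: "u \<in> borel_measurable lebesgue" "v \<in> borel_measurable lebesgue" using assms by auto
  show "integrable lebesgue (\<lambda>x. Cg * \<bar>v x\<bar>)" using assms by (intro integrable_mult_right integrable_abs)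
  show "(\<lambda>x. g x (u x) * v x) \<in> borel_measurable lebesgue" by measurable
  show "AE x in lebesgue. norm (g x (u x) * v x) \<le> norm (Cg * \<bar>v x\<bar>)"
    using g_bound Cg_nonneg by (intro AE_I2) (auto simp: abs_mult intro: mult_right_mono)
qed

lemma Phi_le: 
  assumes "integrable lebesgue u" shows "Phi u \<le> Cg * (\<integral>x. \<bar>u x\<bar> \<partial>lebesgue)"
  unfolding Phi_def integral_mult_right_zero[symmetric]
  using Gp_le assms by (intro integral_mono Gp_integrable integrable_mult_right integrable_abs) (auto simp: abs_le_iff)

text \<open>The primitive is constant for \<open>|t| \<ge> T\<close>. The bound makes \<open>J\<close> bounded below, and it bounds the energy
  on \<open>{J \<le> 0}\<close>.\<close>

lemma Phi_bounded:
  assumes "integrable lebesgue u" shows "Phi u \<le> Cg * T * measure lebesgue \<Omega>"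
proof -
  have O: "\<Omega> \<in> sets lebesgue" "emeasure lebesgue \<Omega> < \<infinity>"
    using emeasure_bounded_finite[OF bounded_Omega] open_Omega by auto
  have "Phi u \<le> (\<integral>x. Cg * T * indicator \<Omega> x \<partial>lebesgue)"
    unfolding Phi_def
  proof (rule integral_mono)
    show "integrable lebesgue (\<lambda>x. Gp x (u x))" by (rule Gp_integrable[OF assms])
    show "integrable lebesgue (\<lambda>x. Cg * T * indicator \<Omega> x :: real)"
      using O by (intro integrable_mult_right) (simp add: integrable_indicator_iff)
    show "Gp x (u x) \<le> Cg * T * indicator \<Omega> x" for x
      using Gp_bounded[of x "u x"] Gp_out[of x "u x"] by (cases "x \<in> \<Omega>") auto
  qed
  also have "\<dots> = Cg * T * measure lebesgue \<Omega>" by simp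
  finally show ?thesis .
qed

lemma Phi_tendsto:
  assumes u: "\<And>n. u n \<in> borel_measurable lebesgue" "v \<in> borel_measurable lebesgue" and h: "integrable lebesgue h"
    and lim: "AE x in lebesgue. (\<lambda>n. u n x) \<longlonglongrightarrow> v x" and b: "\<And>n. AE x in lebesgue. \<bar>u n x\<bar> \<le> h x"
  shows "(\<lambda>n. Phi (u n)) \<longlonglongrightarrow> Phi v"
  unfolding Phi_def
proof (rule integral_dominated_convergence[where w = "\<lambda>x. Cg * h x"])
  have [measurable]: "u n \<in> borel_measurable lebesgue" "v \<in> borel_measurable lebesgue" for n using u by auto
  show "(\<lambda>x. Gp x (v x)) \<in> borel_measurable lebesgue" "(\<lambda>x. Gp x (u n x)) \<in> borel_measurable lebesgue" for n
    by measurable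
  show "integrable lebesgue (\<lambda>x. Cg * h x)" using h by (rule integrable_mult_right)
  show "AE x in lebesgue. (\<lambda>n. Gp x (u n x)) \<longlonglongrightarrow> Gp x (v x)"
    using lim by eventually_elim (auto intro: continuous_on_tendsto_compose[OF Gp_cont])
  show "AE x in lebesgue. norm (Gp x (u n x)) \<le> Cg * h x" for n
    using b[of n]
  proof eventually_elim
    case (elim x)
    then have "Cg * \<bar>u n x\<bar> \<le> Cg * h x" by (intro mult_left_mono Cg_nonneg)
    then show ?case using Gp_le[of x "u n x"] by simp
  qed
qed

lemma dPhi_tendsto:
  assumes u: "\<And>n. u n \<in> borel_measurable lebesgue" "v \<in> borel_measurable lebesgue" and h: "integrable lebesgue h"
    and w: "\<And>n. w n \<in> borel_measurable lebesgue" "w' \<in> borel_measurable lebesgue"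
    and lim: "AE x in lebesgue. (\<lambda>n. u n x) \<longlonglongrightarrow> v x" "AE x in lebesgue. (\<lambda>n. w n x) \<longlonglongrightarrow> w' x"
    and b: "\<And>n. AE x in lebesgue. \<bar>w n x\<bar> \<le> h x"
  shows "(\<lambda>n. dPhi (u n) (w n)) \<longlonglongrightarrow> dPhi v w'"
  unfolding dPhi_def
proof (rule integral_dominated_convergence[where w = "\<lambda>x. Cg * h x"])
  have [measurable]: "u n \<in> borel_measurable lebesgue" "v \<in> borel_measurable lebesgue" 
     "w n \<in> borel_measurable lebesgue" "w' \<in> borel_measurable lebesgue" for n using u w by auto
  show "(\<lambda>x. g x (v x) * w' x) \<in> borel_measurable lebesgue" "(\<lambda>x. g x (u n x) * w n x) \<in> borel_measurable lebesgue" for n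
    by measurable
  show "integrable lebesgue (\<lambda>x. Cg * h x)" using h by (rule integrable_mult_right)
  show "AE x in lebesgue. (\<lambda>n. g x (u n x) * w n x) \<longlonglongrightarrow> g x (v x) * w' x"
    using lim by eventually_elim (auto intro!: tendsto_mult intro: continuous_on_tendsto_compose[OF g_cont])
  show "AE x in lebesgue. norm (g x (u n x) * w n x) \<le> Cg * h x" for n
    using b[of n] by eventually_elim (auto simp: abs_mult Cg_nonneg intro!: mult_mono g_bound)
qed

lemma dPhi_diff:
  assumes "u \<in> borel_measurable lebesgue" "integrable lebesgue v" "integrable lebesgue w"
  shows "dPhi u (\<lambda>x. v x - w x) = dPhi u v - dPhi u w"
  unfolding dPhi_def using assms by (simp add: right_diff_distrib g_integrable)

lemma dPhi_comb:
  assumes "u \<in> borel_measurable lebesgue" "\<And>i. i < m \<Longrightarrow> integrable lebesgue (w i)"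
  shows "dPhi u (comb w m c) = (\<Sum>i<m. c i * dPhi u (w i))"
proof -
  have "dPhi u (comb w m c) = (\<integral>x. (\<Sum>i<m. c i * (g x (u x) * w i x)) \<partial>lebesgue)"
    unfolding dPhi_def comb_def by (intro Bochner_Integration.integral_cong) (auto simp: sum_distrib_left algebra_simps)
  also have "\<dots> = (\<Sum>i<m. \<integral>x. c i * (g x (u x) * w i x) \<partial>lebesgue)"
    using assms by (intro Bochner_Integration.integral_sum integrable_mult_right g_integrable) auto
  finally show ?thesis by (simp add: dPhi_def)
qed

lemma Phi_deriv:
  assumes u: "integrable lebesgue u" and v: "integrable lebesgue v"
  shows "((\<lambda>t. Phi (\<lambda>x. u x + t * v x)) has_real_derivative dPhi (\<lambda>x. u x + t * v x) v) (at t)"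
  unfolding has_field_derivative_iff tendsto_at_iff_sequentially
proof (intro allI impI)
  fix y :: "nat \<Rightarrow> real" assume y: "\<forall>i. y i \<in> UNIV - {t}" "y \<longlonglongrightarrow> t"
  have [measurable]: "u \<in> borel_measurable lebesgue" "v \<in> borel_measurable lebesgue" using u v by auto
  have i: "integrable lebesgue (\<lambda>x. Gp x (u x + r * v x))" for r
    by (intro Gp_integrable Bochner_Integration.integrable_add integrable_mult_right u v)
  have "(\<lambda>n. \<integral>x. (Gp x (u x + y n * v x) - Gp x (u x + t * v x)) / (y n - t) \<partial>lebesgue) \<longlonglongrightarrow> dPhi (\<lambda>x. u x + t * v x) v"
    unfolding dPhi_def
  proof (rule integral_dominated_convergence[where w = "\<lambda>x. Cg * \<bar>v x\<bar>"])
    show "(\<lambda>x. g x (u x + t * v x) * v x) \<in> borel_measurable lebesgue"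
      "(\<lambda>x. (Gp x (u x + y n * v x) - Gp x (u x + t * v x)) / (y n - t)) \<in> borel_measurable lebesgue" for n
      by measurable
    show "integrable lebesgue (\<lambda>x. Cg * \<bar>v x\<bar>)" using v by (intro integrable_mult_right integrable_abs)
    show "AE x in lebesgue. (\<lambda>n. (Gp x (u x + y n * v x) - Gp x (u x + t * v x)) / (y n - t)) \<longlonglongrightarrow> g x (u x + t * v x) * v x"
    proof (rule AE_I2)
      fix x
      have "((\<lambda>r. Gp x (u x + r * v x)) has_real_derivative g x (u x + t * v x) * v x) (at t)"
        by (rule DERIV_chain2[OF Gp_deriv]) (auto intro!: derivative_eq_intros)
      then have "((\<lambda>r. (Gp x (u x + r * v x) - Gp x (u x + t * v x)) / (r - t)) \<longlongrightarrow> g x (u x + t * v x) * v x) (at t)"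
        by (simp add: has_field_derivative_iff)
      then show "(\<lambda>n. (Gp x (u x + y n * v x) - Gp x (u x + t * v x)) / (y n - t)) \<longlonglongrightarrow> g x (u x + t * v x) * v x"
        using y unfolding tendsto_at_iff_sequentially by (auto simp: o_def)
    qed
    show "AE x in lebesgue. norm ((Gp x (u x + y n * v x) - Gp x (u x + t * v x)) / (y n - t)) \<le> Cg * \<bar>v x\<bar>" for n
    proof (rule AE_I2)
      fix x
      have nz: "\<bar>y n - t\<bar> > 0" using y(1) by auto
      have "\<bar>Gp x (u x + y n * v x) - Gp x (u x + t * v x)\<bar> \<le> Cg * \<bar>(y n - t) * v x\<bar>"
        using Gp_lipschitz[of x "u x + y n * v x" "u x + t * v x"] by (simp add: algebra_simps)
      also have "\<dots> = Cg * \<bar>v x\<bar> * \<bar>y n - t\<bar>" by (simp only: abs_mult mult_ac)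
      finally show "norm ((Gp x (u x + y n * v x) - Gp x (u x + t * v x)) / (y n - t)) \<le> Cg * \<bar>v x\<bar>"
        using nz by (simp only: real_norm_def abs_divide pos_divide_le_eq)
    qed
  qed
  then show "((\<lambda>y. (Phi (\<lambda>x. u x + y * v x) - Phi (\<lambda>x. u x + t * v x)) / (y - t)) \<circ> y) \<longlonglongrightarrow> dPhi (\<lambda>x. u x + t * v x) v"
    unfolding Phi_def o_def using i by (simp add: Bochner_Integration.integral_diff)
qed

definition J :: "(real^'n \<Rightarrow> real) \<Rightarrow> real" where
  "J u = E u - Phi u"

lemma E_line_deriv:
  assumes u: "u \<in> X" and v: "v \<in> X"
  shows "((\<lambda>t. E (\<lambda>x. u x + t * v x)) has_real_derivative dE (\<lambda>x. u x + t * v x) v) (at t)"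
    and "isCont (\<lambda>t. dE (\<lambda>x. u x + t * v x) v) t"
proof -
  define w where "w i = (if i = 0 then u else v)" for i :: nat
  have line: "(\<lambda>x. u x + t * v x) = comb w 2 (\<lambda>i. if i = 0 then 1 else if i = 1 then t else 0)" for t
    by (auto simp: comb_def w_def numeral_2_eq_2)
  have lX: "(\<lambda>x. u x + t * v x) \<in> X" for t by (intro X_add X_scale u v)
  have "dE (\<lambda>x. u x + a * v x) (\<lambda>x. (u x + b * v x) - (u x + a * v x)) = dE (\<lambda>x. u x + a * v x) v * (b - a)" for a b
    using dE_scale[OF lX[of a] v, of "b - a"] by (simp add: algebra_simps)
  then have tangent: "E (\<lambda>x. u x + a * v x) + dE (\<lambda>x. u x + a * v x) v * (b - a) \<le> E (\<lambda>x. u x + b * v x)" for a b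
    using E_convex[OF lX[of a] lX[of b]] by simp
  show c: "isCont (\<lambda>t. dE (\<lambda>x. u x + t * v x) v) t"
    unfolding isCont_def tendsto_at_iff_sequentially
  proof (intro allI impI)
    fix y :: "nat \<Rightarrow> real" assume y: "\<forall>i. y i \<in> UNIV - {t}" "y \<longlonglongrightarrow> t"
    obtain K where K: "\<And>n. \<bar>y n\<bar> \<le> K" using convergent_imp_Bseq[OF convergentI[OF y(2)]] by (auto simp: Bseq_def)
    let ?c = "\<lambda>t i. if i = (0::nat) then 1 else if i = 1 then t else 0"
    have "(\<lambda>n. dE (comb w 2 (?c (y n))) v) \<longlonglongrightarrow> dE (comb w 2 (?c t)) v"
    proof (rule tendsto_E_comb(2)[OF _ _ _ v])
      show "w i \<in> X" for i using u v by (simp add: w_def)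
      show "(\<lambda>n. ?c (y n) i) \<longlonglongrightarrow> ?c t i" for i using y(2) by auto
      show "\<bar>?c (y n) i\<bar> \<le> max 1 K" for n i using K[of n] by auto
    qed
    then show "((\<lambda>t. dE (\<lambda>x. u x + t * v x) v) \<circ> y) \<longlonglongrightarrow> dE (\<lambda>x. u x + t * v x) v"
      by (simp add: line o_def)
  qed
  show "((\<lambda>t. E (\<lambda>x. u x + t * v x)) has_real_derivative dE (\<lambda>x. u x + t * v x) v) (at t)"
    using convex_tangent_derivative[of "\<lambda>t. E (\<lambda>x. u x + t * v x)" "\<lambda>t. dE (\<lambda>x. u x + t * v x) v" t] tangent c
    by simp
qed

text \<open>Along a line, \<open>E\<close> minus its supporting linear function has a minimum at \<open>u\<close>.\<close>

lemma critical_pointI: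
  assumes u: "u \<in> X" and v: "v \<in> X"
    and ineq: "\<And>w. w \<in> X \<Longrightarrow> E u + dPhi u (\<lambda>x. w x - u x) \<le> E w"
  shows "dE u v = dPhi u v"
proof -
  have [measurable]: "u \<in> borel_measurable lebesgue" using u by (rule XD)
  have d: "((\<lambda>t. E (\<lambda>x. u x + t * v x) - E u - t * dPhi u v) has_real_derivative dE (\<lambda>x. u x + 0 * v x) v - dPhi u v) (at 0)"
    by (rule derivative_eq_intros E_line_deriv(1)[OF u v] refl | simp)+
  have "dE (\<lambda>x. u x + 0 * v x) v - dPhi u v = 0"
  proof (rule DERIV_local_min[OF d, of 1])
    show "\<forall>y. \<bar>0 - y\<bar> < 1 \<longrightarrow> E (\<lambda>x. u x + 0 * v x) - E u - 0 * dPhi u v \<le> E (\<lambda>x. u x + y * v x) - E u - y * dPhi u v"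
    proof (intro allI impI)
      fix y :: real
      have w: "(\<lambda>x. u x + y * v x) \<in> X" by (intro X_add X_scale u v)
      have "dPhi u (\<lambda>x. u x + y * v x - u x) = y * dPhi u v"
        unfolding dPhi_def by (simp add: algebra_simps flip: integral_mult_right_zero)
      then show "E (\<lambda>x. u x + 0 * v x) - E u - 0 * dPhi u v \<le> E (\<lambda>x. u x + y * v x) - E u - y * dPhi u v"
        using ineq[OF w] by simp
    qed
  qed simp
  then show ?thesis by simp
qed

text \<open>The small quadratic term makes the functional
  coercive even if the \<open>w\<^sub>i\<close> are linearly dependent; its contribution disappears in the limit \<open>\<epsilon> \<rightarrow> 0\<close>.\<close>

definition JG :: "(nat \<Rightarrow> real^'n \<Rightarrow> real) \<Rightarrow> nat \<Rightarrow> real \<Rightarrow> (nat \<Rightarrow> real) \<Rightarrow> real" where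
  "JG w m \<epsilon> c = J (comb w m c) + \<epsilon> * (\<Sum>i<m. (c i)\<^sup>2)"

definition DG :: "(nat \<Rightarrow> real^'n \<Rightarrow> real) \<Rightarrow> nat \<Rightarrow> real \<Rightarrow> (nat \<Rightarrow> real) \<Rightarrow> nat \<Rightarrow> real" where
  "DG w m \<epsilon> c i = dE (comb w m c) (w i) - dPhi (comb w m c) (w i) + 2 * \<epsilon> * c i"

lemma seq_continuous_fun:
  fixes F :: "(nat \<Rightarrow> real) \<Rightarrow> real"
  assumes "\<And>c l K. (\<And>n. c n \<in> coords_below m) \<Longrightarrow> (\<And>i. (\<lambda>n. c n i) \<longlonglongrightarrow> l i) \<Longrightarrow> (\<And>n i. \<bar>c n i\<bar> \<le> K) \<Longrightarrow> (\<lambda>n. F (c n)) \<longlonglongrightarrow> F l"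
  shows "continuous_on (coords_below m) F"
proof (rule continuous_on_sequentiallyI)
  fix c l assume c: "\<forall>n. c n \<in> coords_below m" "l \<in> coords_below m" "c \<longlonglongrightarrow> l"
  have ci: "(\<lambda>n. c n i) \<longlonglongrightarrow> l i" for i using c(3) by (simp add: tendsto_fun_iff)
  have "\<exists>K. \<forall>n. \<bar>c n i\<bar> \<le> K" for i using convergent_imp_Bseq[OF convergentI[OF ci[of i]]] by (auto simp: Bseq_def)
  then obtain K where K: "\<And>n i. \<bar>c n i\<bar> \<le> K i" by metis
  have "\<bar>c n i\<bar> \<le> (\<Sum>i<m. \<bar>K i\<bar>)" for n i
  proof (cases "i < m")
    case True
    have "\<bar>K i\<bar> \<le> (\<Sum>i<m. \<bar>K i\<bar>)" using True by (intro member_le_sum) auto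
    then show ?thesis using K[of n i] by linarith
  next
    case False
    then have "c n i = 0" using c(1) by (auto simp: coords_below_def)
    then show ?thesis by (simp add: sum_nonneg)
  qed
  then show "(\<lambda>n. F (c n)) \<longlonglongrightarrow> F l" using c(1) ci by (intro assms) auto
qed

context
  fixes w :: "nat \<Rightarrow> real^'n \<Rightarrow> real" and m :: nat
  assumes wX: "\<And>i. w i \<in> X"
begin

lemma comb_X: "comb w m c \<in> X"
  by (rule X_comb) (rule wX)

lemma tendsto_Phi_comb:
  assumes c: "\<And>i. (\<lambda>n. c n i) \<longlonglongrightarrow> l i" and K: "\<And>n i. \<bar>c n i\<bar> \<le> K"
  shows "(\<lambda>n. Phi (comb w m (c n))) \<longlonglongrightarrow> Phi (comb w m l)"
    and "v \<in> X \<Longrightarrow> (\<lambda>n. dPhi (comb w m (c n)) v) \<longlonglongrightarrow> dPhi (comb w m l) v"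
proof -
  have i: "integrable lebesgue (\<lambda>x. K * comb (\<lambda>i x. \<bar>w i x\<bar>) m (\<lambda>_. 1) x)"
    unfolding comb_def by (intro integrable_mult_right Bochner_Integration.integrable_sum integrable_abs X_integrable wX)
  have lim: "AE x in lebesgue. (\<lambda>n. comb w m (c n) x) \<longlonglongrightarrow> comb w m l x"
    by (intro AE_I2 tendsto_comb c)
  show "(\<lambda>n. Phi (comb w m (c n))) \<longlonglongrightarrow> Phi (comb w m l)"
    by (rule Phi_tendsto[OF XD XD i lim]) (auto intro!: AE_I2 comb_dominated K comb_X)
  assume v: "v \<in> X"
  show "(\<lambda>n. dPhi (comb w m (c n)) v) \<longlonglongrightarrow> dPhi (comb w m l) v"
    by (rule dPhi_tendsto[OF XD XD integrable_abs[OF X_integrable(1)[OF v]] _ _ lim]) (auto intro!: comb_X XD[OF v])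
qed

lemma JG_continuous: "continuous_on (coords_below m) (JG w m \<epsilon>)"
proof (rule seq_continuous_fun)
  fix c :: "nat \<Rightarrow> nat \<Rightarrow> real" and l and K :: real
  assume c: "\<And>i. (\<lambda>n. c n i) \<longlonglongrightarrow> l i" and K: "\<And>n i. \<bar>c n i\<bar> \<le> K"
  show "(\<lambda>n. JG w m \<epsilon> (c n)) \<longlonglongrightarrow> JG w m \<epsilon> l"
    unfolding JG_def J_def
    by (intro tendsto_intros tendsto_E_comb(1)[OF wX c K] tendsto_Phi_comb(1)[OF c K] c)
qed

lemma DG_continuous: "continuous_on (coords_below m) (\<lambda>c. DG w m \<epsilon> c i)"
proof (rule seq_continuous_fun)
  fix c :: "nat \<Rightarrow> nat \<Rightarrow> real" and l and K :: real
  assume c: "\<And>i. (\<lambda>n. c n i) \<longlonglongrightarrow> l i" and K: "\<And>n i. \<bar>c n i\<bar> \<le> K"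
  show "(\<lambda>n. DG w m \<epsilon> (c n) i) \<longlonglongrightarrow> DG w m \<epsilon> l i"
    unfolding DG_def
    by (intro tendsto_intros tendsto_E_comb(2)[OF wX c K wX] tendsto_Phi_comb(2)[OF c K wX] c)
qed

lemma DG_odd: "DG w m \<epsilon> (\<lambda>i. - c i) i = - DG w m \<epsilon> c i"
  by (simp add: DG_def comb_uminus dE_uminus_left dPhi_def g_odd)

lemma JG_deriv:
  "((\<lambda>t. JG w m \<epsilon> (\<lambda>i. c i + t * h i)) has_real_derivative (\<Sum>i<m. DG w m \<epsilon> (\<lambda>i. c i + t * h i) i * h i)) (at t)"
proof -
  let ?u = "comb w m c" and ?v = "comb w m h" and ?ct = "\<lambda>i. c i + t * h i"
  have q: "((\<lambda>t. \<epsilon> * (\<Sum>i<m. (c i + t * h i)\<^sup>2)) has_real_derivative \<epsilon> * (\<Sum>i<m. 2 * (h i * (c i + t * h i)))) (at t)"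
    by (rule derivative_eq_intros refl | simp)+
  have "((\<lambda>t. JG w m \<epsilon> (\<lambda>i. c i + t * h i)) has_real_derivative
      dE (\<lambda>x. ?u x + t * ?v x) ?v - dPhi (\<lambda>x. ?u x + t * ?v x) ?v + \<epsilon> * (\<Sum>i<m. 2 * (h i * (c i + t * h i)))) (at t)"
    unfolding JG_def J_def comb_add
    by (intro DERIV_add DERIV_diff q E_line_deriv(1) Phi_deriv comb_X X_integrable)
  moreover have "dE (\<lambda>x. ?u x + t * ?v x) ?v = (\<Sum>i<m. h i * dE (comb w m ?ct) (w i))"
    unfolding comb_add[symmetric] by (intro dE_comb comb_X wX)
  moreover have "dPhi (\<lambda>x. ?u x + t * ?v x) ?v = (\<Sum>i<m. h i * dPhi (comb w m ?ct) (w i))"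
    unfolding comb_add[symmetric] by (intro dPhi_comb XD[OF comb_X] X_integrable wX)
  moreover have "(\<Sum>i<m. DG w m \<epsilon> ?ct i * h i) = (\<Sum>i<m. h i * dE (comb w m ?ct) (w i)) - (\<Sum>i<m. h i * dPhi (comb w m ?ct) (w i))
      + \<epsilon> * (\<Sum>i<m. 2 * (h i * (c i + t * h i)))"
    unfolding DG_def sum_distrib_left sum_subtractf[symmetric] sum.distrib[symmetric]
    by (intro sum.cong) (auto simp: algebra_simps)
  ultimately show ?thesis by simp
qed

lemma JG_coercive:
  assumes "0 < \<epsilon>"
  shows "\<exists>R. \<forall>c\<in>coords_below m. JG w m \<epsilon> c \<le> b \<longrightarrow> (\<forall>i. \<bar>c i\<bar> \<le> R)"
proof -
  define B where "B = (b + Cg * T * measure lebesgue \<Omega>) / \<epsilon>"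
  have "\<bar>c i\<bar> \<le> 1 + \<bar>B\<bar>" if c: "c \<in> coords_below m" "JG w m \<epsilon> c \<le> b" for c i
  proof (cases "i < m")
    case False
    then show ?thesis using c by (auto simp: coords_below_def)
  next
    case True
    have "\<epsilon> * (\<Sum>i<m. (c i)\<^sup>2) \<le> b + Cg * T * measure lebesgue \<Omega>"
      using c(2) E_nonneg[of "comb w m c"] Phi_bounded[OF X_integrable(1)[OF comb_X[of c]]] unfolding JG_def J_def by linarith
    then have "(\<Sum>i<m. (c i)\<^sup>2) \<le> B" using assms by (simp add: B_def field_simps)
    moreover have "(c i)\<^sup>2 \<le> (\<Sum>i<m. (c i)\<^sup>2)" using True by (intro member_le_sum) auto
    ultimately have s: "(c i)\<^sup>2 \<le> B" by linarith
    show ?thesis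
    proof (rule ccontr)
      assume "\<not> ?thesis"
      then have g: "1 + \<bar>B\<bar> < \<bar>c i\<bar>" by simp
      then have "\<bar>c i\<bar> * 1 \<le> \<bar>c i\<bar> * \<bar>c i\<bar>" by (intro mult_left_mono) auto
      then have "\<bar>c i\<bar> \<le> (c i)\<^sup>2" by (simp add: power2_eq_square)
      then show False using s g by linarith
    qed
  qed
  then show ?thesis by blast
qed

end

end

section \<open>Critical points at small negative levels\<close>

lemma (in weighted_modular) modular_le_dmodular_self: "fin \<phi> \<Longrightarrow> pl * modular \<phi> \<le> dmodular \<phi> \<phi>"
  unfolding modular_def dmodular_self integral_mult_right_zero[symmetric]
proof (rule integral_mono)
  assume f: "fin \<phi>"
  then show "integrable M (\<lambda>z. \<bar>\<phi> z\<bar> powr q z * k z)" by (simp add: fin_def)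
  show "integrable M (\<lambda>z. pl * (\<bar>\<phi> z\<bar> powr q z / q z * k z))" by (intro integrable_mult_right integrable_modular f)
  fix z
  have "pl * (\<bar>\<phi> z\<bar> powr q z / q z * k z) \<le> q z * (\<bar>\<phi> z\<bar> powr q z / q z * k z)"
    using q_bounds[of z] q1[of z] k_nonneg[of z] by (intro mult_right_mono) auto
  then show "pl * (\<bar>\<phi> z\<bar> powr q z / q z * k z) \<le> \<bar>\<phi> z\<bar> powr q z * k z" using q1[of z] by simp
qed

context truncated
begin

text \<open>The derivative of \<open>Phi\<close> at \<open>u\<close> is a subgradient of the convex functional \<open>E\<close> at \<open>u\<close>. In contrast to the
  equation \<open>dE u v = dPhi u v\<close>, to which it is equivalent, this inequality passes to limits
  with bounded energy.\<close>

definition weakly_critical :: "(real^'n \<Rightarrow> real) \<Rightarrow> bool" where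
  "weakly_critical u \<longleftrightarrow> u \<in> X \<and> (\<forall>w\<in>X. E u + dPhi u (\<lambda>x. w x - u x) \<le> E w)"

lemma E_le_dE_self: "u \<in> X \<Longrightarrow> pl * E u \<le> dE u u"
  using G.modular_le_dmodular_self[OF X_fin(1)] L.modular_le_dmodular_self[OF X_fin(2)]
  by (simp add: E_def dE_def distrib_left add_mono)

lemma dPhi_bound:
  assumes "u \<in> borel_measurable lebesgue" "integrable lebesgue v"
  shows "\<bar>dPhi u v\<bar> \<le> Cg * (\<integral>x. \<bar>v x\<bar> \<partial>lebesgue)"
proof -
  have "\<bar>dPhi u v\<bar> \<le> (\<integral>x. \<bar>g x (u x) * v x\<bar> \<partial>lebesgue)" unfolding dPhi_def by (rule integral_abs_bound)
  also have "\<dots> \<le> (\<integral>x. Cg * \<bar>v x\<bar> \<partial>lebesgue)"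
    using g_bound assms by (intro integral_mono integrable_abs g_integrable integrable_mult_right) (auto simp: abs_mult intro: mult_right_mono)
  finally show ?thesis by simp
qed

text \<open>By compactness the inequalities pass to the limit with the limit \<open>e\<close> of the energies in place of \<open>E(v)\<close>; they extend from the
  dense family to all \<open>w\<close>. Testing with \<open>w = v\<close> gives \<open>e + 2\<kappa> \<le> E(v) \<le> e\<close>, where \<open>\<kappa>\<close> is the limit of
  the penalties \<open>\<rho>\<close>. Hence no energy is lost and the penalties vanish.\<close>

lemma limit_weakly_critical:
  assumes d: "\<And>i::nat. d i \<in> X"
    and dense: "\<And>u \<epsilon>. u \<in> X \<Longrightarrow> 0 < \<epsilon> \<Longrightarrow> \<exists>i. (\<integral>x. \<bar>u x - d i x\<bar> \<partial>lebesgue) < \<epsilon> \<and> \<bar>E u - E (d i)\<bar> < \<epsilon>"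
    and u: "\<And>n. u n \<in> X" "\<And>n. E (u n) \<le> K"
    and \<rho>: "\<And>n. 0 \<le> \<rho> n" "\<And>n. \<rho> n \<le> R"
    and err: "err \<longlonglongrightarrow> 0"
    and ineq: "\<And>i. \<exists>N. \<forall>n\<ge>N. E (u n) + dPhi (u n) (\<lambda>x. d i x - u n x) + 2 * \<rho> n - err n \<le> E (d i)"
  shows "\<exists>r v. strict_mono (r::nat\<Rightarrow>nat) \<and> weakly_critical v \<and> (\<lambda>n. E (u (r n))) \<longlonglongrightarrow> E v
    \<and> (\<lambda>n. Phi (u (r n))) \<longlonglongrightarrow> Phi v \<and> (\<lambda>n. \<rho> (r n)) \<longlonglongrightarrow> 0 \<and> (\<lambda>n. \<integral>x. \<bar>u (r n) x\<bar> \<partial>lebesgue) \<longlonglongrightarrow> (\<integral>x. \<bar>v x\<bar> \<partial>lebesgue)"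
proof -
  obtain r1 v e h where r1: "strict_mono (r1::nat\<Rightarrow>nat)" "v \<in> X" "integrable lebesgue h"
    "AE x in lebesgue. (\<lambda>n. u (r1 n) x) \<longlonglongrightarrow> v x" "AE x in lebesgue. \<forall>n. \<bar>u (r1 n) x\<bar> \<le> h x"
    "(\<lambda>n. E (u (r1 n))) \<longlonglongrightarrow> e" "E v \<le> e"
    using X_compactness[of u K, OF u] by blast
  have "\<bar>\<rho> (r1 n)\<bar> \<le> R" for n using \<rho>[of "r1 n"] by simp
  then obtain l r2 where r2: "strict_mono (r2::nat\<Rightarrow>nat)" "\<And>i::nat. (\<lambda>n. \<rho> (r1 (r2 n))) \<longlonglongrightarrow> l i"
    using bounded_coords_subsequence[of "\<lambda>n i. \<rho> (r1 n)" "\<lambda>_. R"] by blast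
  define r where "r = r1 \<circ> r2"
  define \<kappa> where "\<kappa> = l 0"
  have r: "strict_mono r" using r1(1) r2(1) by (auto simp: r_def intro: strict_mono_o)
  have rho: "(\<lambda>n. \<rho> (r n)) \<longlonglongrightarrow> \<kappa>" using r2(2) by (simp add: r_def \<kappa>_def)
  have k0: "0 \<le> \<kappa>" by (rule LIMSEQ_le_const[OF rho]) (use \<rho> in auto)
  have Ee: "(\<lambda>n. E (u (r n))) \<longlonglongrightarrow> e" using LIMSEQ_subseq_LIMSEQ[OF r1(6) r2(1)] by (simp add: r_def o_def)
  have lim: "AE x in lebesgue. (\<lambda>n. u (r n) x) \<longlonglongrightarrow> v x"
    using r1(4)
  proof eventually_elim
    case (elim x)
    from LIMSEQ_subseq_LIMSEQ[OF elim r2(1)] show ?case by (simp add: r_def o_def)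
  qed
  have b: "AE x in lebesgue. \<bar>u (r n) x\<bar> \<le> h x" for n
    using r1(5) by eventually_elim (simp add: r_def)
  have um: "u n \<in> borel_measurable lebesgue" "v \<in> borel_measurable lebesgue" for n using u(1) r1(2) by (auto intro: XD)
  have P: "(\<lambda>n. Phi (u (r n))) \<longlonglongrightarrow> Phi v"
    by (rule Phi_tendsto[OF um(1) um(2) r1(3) lim b])
  have A: "(\<lambda>n. \<integral>x. \<bar>u (r n) x\<bar> \<partial>lebesgue) \<longlonglongrightarrow> (\<integral>x. \<bar>v x\<bar> \<partial>lebesgue)"
  proof (rule integral_dominated_convergence[where w = h])
    show "AE x in lebesgue. (\<lambda>n. \<bar>u (r n) x\<bar>) \<longlonglongrightarrow> \<bar>v x\<bar>" using lim by eventually_elim (rule tendsto_rabs)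
    show "AE x in lebesgue. norm \<bar>u (r n) x\<bar> \<le> h x" for n using b[of n] by simp
  qed (use um r1(3) in auto)
  have lim1: "e + dPhi v (\<lambda>x. d i x - v x) + 2 * \<kappa> \<le> E (d i)" for i
  proof -
    have dP: "(\<lambda>n. dPhi (u (r n)) (\<lambda>x. d i x - u (r n) x)) \<longlonglongrightarrow> dPhi v (\<lambda>x. d i x - v x)"
    proof (rule dPhi_tendsto[OF um(1) um(2) _ _ _ lim, where h = "\<lambda>x. \<bar>d i x\<bar> + h x"])
      show "integrable lebesgue (\<lambda>x. \<bar>d i x\<bar> + h x)"
        by (intro Bochner_Integration.integrable_add integrable_abs X_integrable d r1(3))
      show "AE x in lebesgue. (\<lambda>n. d i x - u (r n) x) \<longlonglongrightarrow> d i x - v x"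
        using lim by eventually_elim (intro tendsto_diff tendsto_const)
      show "AE x in lebesgue. \<bar>d i x - u (r n) x\<bar> \<le> \<bar>d i x\<bar> + h x" for n
        using b[of n] by eventually_elim linarith
      show "(\<lambda>x. d i x - u (r n) x) \<in> borel_measurable lebesgue" "(\<lambda>x. d i x - v x) \<in> borel_measurable lebesgue" for n
        using XD[OF d[of i]] um by auto
    qed
    have er: "(\<lambda>n. err (r n)) \<longlonglongrightarrow> 0" using LIMSEQ_subseq_LIMSEQ[OF err r] by (simp add: o_def)
    have L: "(\<lambda>n. E (u (r n)) + dPhi (u (r n)) (\<lambda>x. d i x - u (r n) x) + 2 * \<rho> (r n) - err (r n))
        \<longlonglongrightarrow> e + dPhi v (\<lambda>x. d i x - v x) + 2 * \<kappa> - 0"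
      by (intro tendsto_intros Ee dP rho er)
    obtain N where N: "\<And>n. n \<ge> N \<Longrightarrow> E (u n) + dPhi (u n) (\<lambda>x. d i x - u n x) + 2 * \<rho> n - err n \<le> E (d i)"
      using ineq by blast
    have "e + dPhi v (\<lambda>x. d i x - v x) + 2 * \<kappa> - 0 \<le> E (d i)"
      by (rule LIMSEQ_le_const2[OF L]) (intro exI[of _ N] allI impI N, metis order_trans seq_suble[OF r])
    then show ?thesis by simp
  qed
  have lim2: "e + dPhi v (\<lambda>x. w x - v x) + 2 * \<kappa> \<le> E w" if w: "w \<in> X" for w
  proof (rule field_le_epsilon)
    fix \<epsilon> :: real assume "0 < \<epsilon>"
    define \<epsilon>' where "\<epsilon>' = \<epsilon> / (1 + Cg)"
    have e': "0 < \<epsilon>'" using \<open>0 < \<epsilon>\<close> Cg_nonneg by (simp add: \<epsilon>'_def)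
    obtain i where i: "(\<integral>x. \<bar>w x - d i x\<bar> \<partial>lebesgue) < \<epsilon>'" "\<bar>E w - E (d i)\<bar> < \<epsilon>'"
      using dense[OF w e'] by blast
    have "dPhi v (\<lambda>x. w x - v x) - dPhi v (\<lambda>x. d i x - v x) = dPhi v (\<lambda>x. w x - d i x)"
      using X_integrable(1)[OF w] X_integrable(1)[OF d] X_integrable(1)[OF r1(2)]
      by (simp add: dPhi_diff[OF um(2)])
    also have "\<dots> \<le> Cg * (\<integral>x. \<bar>w x - d i x\<bar> \<partial>lebesgue)"
      using dPhi_bound[OF um(2), of "\<lambda>x. w x - d i x"] X_integrable(1)[OF X_diff[OF w d]] by (simp add: abs_le_iff)
    also have "\<dots> \<le> Cg * \<epsilon>'" using i(1) Cg_nonneg by (intro mult_left_mono) auto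
    finally have 1: "dPhi v (\<lambda>x. w x - v x) \<le> dPhi v (\<lambda>x. d i x - v x) + Cg * \<epsilon>'" by simp
    have "(1 + Cg) * \<epsilon>' = \<epsilon>" using Cg_nonneg by (simp add: \<epsilon>'_def)
    then have "\<epsilon> = \<epsilon>' + Cg * \<epsilon>'" by (simp add: distrib_right)
    then show "e + dPhi v (\<lambda>x. w x - v x) + 2 * \<kappa> \<le> E w + \<epsilon>"
      using 1 i(2) lim1[of i] by linarith
  qed
  have "e + 2 * \<kappa> \<le> E v" using lim2[OF r1(2)] by (simp add: dPhi_def)
  then have "\<kappa> = 0" "e = E v" using k0 r1(7) by auto
  then show ?thesis
    using r r1(2) lim2 Ee P rho A unfolding weakly_critical_def by auto
qed

lemma weakly_critical_equation:
  assumes "weakly_critical u" "v \<in> X"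
  shows "dE u v = dPhi u v"
  using assms by (intro critical_pointI) (auto simp: weakly_critical_def)

lemma comb_shift_eq:
  assumes "\<And>i. i \<ge> k \<Longrightarrow> y i = 0" "k \<le> m" "\<And>i. i < k \<Longrightarrow> w i = b i"
  shows "comb w m y = comb b k y"
proof
  fix x
  have "(\<Sum>i<m. y i * w i x) = (\<Sum>i<k. y i * w i x)"
    using assms by (intro sum.mono_neutral_right) auto
  also have "\<dots> = (\<Sum>i<k. y i * b i x)" using assms(3) by (intro sum.cong) auto
  finally show "comb w m y x = comb b k y x" by (simp add: comb_def)
qed

lemma E_zero: "E (\<lambda>_. 0) = 0"
  by (simp add: E_def diff_def G.modular_def L.modular_def)

text \<open>If all test averages vanish, then \<open>u\<close> is small in \<open>L\<^sup>1\<close> compared with its (bounded) energy, so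
  \<open>Phi u < \<delta>\<close>.\<close>

lemma J_low_separation:
  assumes \<delta>: "0 < \<delta>"
  shows "\<exists>qs. set qs \<subseteq> sets lebesgue \<and> (\<forall>u\<in>X. J u \<le> - \<delta> \<longrightarrow> (\<exists>i<length qs. (\<integral>x. u x * indicator (qs ! i) x \<partial>lebesgue) \<noteq> 0))"
proof -
  define K where "K = Cg * T * measure lebesgue \<Omega>"
  have K0: "0 \<le> K" using Cg_nonneg T by (simp add: K_def)
  define e where "e = \<delta> / (2 * (Cg + 1) * (K + 1))"
  have e0: "0 < e" using \<delta> Cg_nonneg K0 by (simp add: e_def)
  obtain \<Q> where Q: "finite \<Q>" "\<Q> \<subseteq> sets lebesgue"
    "\<forall>u\<in>X. \<forall>v\<in>X. (\<integral>x. \<bar>u x - v x\<bar> \<partial>lebesgue) \<le> (\<Sum>Q\<in>\<Q>. \<bar>(\<integral>x. u x * indicator Q x \<partial>lebesgue) - (\<integral>x. v x * indicator Q x \<partial>lebesgue)\<bar>) + e * (E u + E v + 1)"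
    using L1_distance_estimate[OF e0] by blast
  obtain qs where qs: "set qs = \<Q>" using finite_list[OF Q(1)] by blast
  have "\<exists>i<length qs. (\<integral>x. u x * indicator (qs ! i) x \<partial>lebesgue) \<noteq> 0" if u: "u \<in> X" "J u \<le> - \<delta>" for u
  proof (rule ccontr)
    assume "\<not> ?thesis"
    then have z: "(\<integral>x. u x * indicator Q x \<partial>lebesgue) = 0" if "Q \<in> \<Q>" for Q
      using that qs by (metis in_set_conv_nth)
    have "(\<integral>x. \<bar>u x - (\<lambda>_. 0) x\<bar> \<partial>lebesgue) \<le> (\<Sum>Q\<in>\<Q>. \<bar>(\<integral>x. u x * indicator Q x \<partial>lebesgue) - (\<integral>x. (\<lambda>_. 0) x * indicator Q x \<partial>lebesgue)\<bar>) + e * (E u + E (\<lambda>_. 0) + 1)"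
      by (rule Q(3)[rule_format, OF u(1) X_zero])
    then have I: "(\<integral>x. \<bar>u x\<bar> \<partial>lebesgue) \<le> e * (E u + 1)" by (simp add: z E_zero)
    have iu: "integrable lebesgue u" using X_integrable u(1) by blast
    have "E u \<le> K" using u(2) Phi_bounded[OF iu] \<delta> by (simp add: J_def K_def)
    then have "e * (E u + 1) \<le> e * (K + 1)" using e0 by (intro mult_left_mono) auto
    then have "(\<integral>x. \<bar>u x\<bar> \<partial>lebesgue) \<le> e * (K + 1)" using I by linarith
    then have "Phi u \<le> Cg * (e * (K + 1))" using Phi_le[OF iu] Cg_nonneg by (meson mult_left_mono order_trans)
    also have "e * (K + 1) = \<delta> / (2 * (Cg + 1))" using K0 by (simp add: e_def)
    also have "Cg * (\<delta> / (2 * (Cg + 1))) = \<delta> / 2 * (Cg / (Cg + 1))" by simp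
    also have "\<dots> \<le> \<delta> / 2 * 1" using \<delta> Cg_nonneg by (intro mult_left_mono) auto
    finally have "Phi u \<le> \<delta> / 2" by simp
    then show False using u(2) E_nonneg[of u] \<delta> by (simp add: J_def)
  qed
  then show ?thesis using Q(2) qs by blast
qed

text \<open>The Galerkin basis consists of the \<open>k + 1\<close> functions spanning a negative sphere, followed by the dense
  sequence. The penalty \<open>\<epsilon> n\<close> is small enough to keep the sphere negative. A Galerkin critical point
  satisfies the tangent inequality tested with any basis element of smaller index, up to the error
  \<open>2 \<epsilon> |c\<^sub>j|\<close>; since \<open>\<epsilon> |c|\<^sup>2\<close> is bounded, the error is \<open>O(sqrt \<epsilon>)\<close>.\<close>

theorem small_negative_critical_point:
  assumes neg: "\<And>k. \<exists>b \<eta>. 0 < \<eta> \<and> (\<forall>i. b i \<in> X) \<and> (\<forall>y\<in>unit_sphere k. J (comb b (Suc k) y) \<le> - \<eta>)"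
    and \<delta>: "0 < \<delta>"
  shows "\<exists>v. weakly_critical v \<and> - \<delta> \<le> J v \<and> J v < 0"
proof -
  obtain qs where qs: "set qs \<subseteq> sets lebesgue" 
    "\<And>u. u \<in> X \<Longrightarrow> J u \<le> - \<delta> \<Longrightarrow> \<exists>i<length qs. (\<integral>x. u x * indicator (qs ! i) x \<partial>lebesgue) \<noteq> 0"
    using J_low_separation[OF \<delta>] by blast
  define k where "k = length qs"
  obtain b \<eta> where b: "0 < \<eta>" "\<And>i. b i \<in> X" "\<And>y. y \<in> unit_sphere k \<Longrightarrow> J (comb b (Suc k) y) \<le> - \<eta>"
    using neg[of k] by blast
  obtain d where d: "\<And>i::nat. d i \<in> X"
     "\<forall>u\<in>X. \<forall>\<epsilon>>0. \<exists>i. (\<integral>x. \<bar>u x - d i x\<bar> \<partial>lebesgue) < \<epsilon> \<and> \<bar>E u - E (d i)\<bar> < \<epsilon>"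
    using X_countable_dense by blast
  define w where "w i = (if i < Suc k then b i else d (i - Suc k))" for i
  have wX: "w i \<in> X" for i using b(2) d(1) by (simp add: w_def)
  define K where "K = Cg * T * measure lebesgue \<Omega>"
  have K0: "0 \<le> K" using Cg_nonneg T by (simp add: K_def)
  obtain M :: nat where M: "2 / \<eta> < real M" using reals_Archimedean2 by blast
  define m where "m n = M + Suc k + n" for n
  define \<epsilon> where "\<epsilon> n = 1 / (real (m n) + 1)" for n
  have eps0: "0 < \<epsilon> n" for n by (simp add: \<epsilon>_def)
  have eps1: "\<epsilon> n \<le> \<eta> / 2" for n
  proof -
    have "2 / \<eta> \<le> real (m n) + 1" using M by (simp add: m_def)
    then show ?thesis using b(1) by (simp add: \<epsilon>_def field_simps)
  qed
  have ex: "\<exists>c\<in>coords_below (m n). - \<delta> \<le> JG w (m n) (\<epsilon> n) c \<and> JG w (m n) (\<epsilon> n) c \<le> - \<eta> / 2 \<and> (\<forall>i<m n. DG w (m n) (\<epsilon> n) c i = 0)" for n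
  proof (rule minimax_critical_point[where B\<^sub>0 = "\<lambda>y. y" and k = k and Q = "\<lambda>c i. \<integral>x. comb w (m n) c x * indicator (qs ! i) x \<partial>lebesgue"])
    show "continuous_on (coords_below (m n)) (JG w (m n) (\<epsilon> n))" by (rule JG_continuous[OF wX])
    show "continuous_on (coords_below (m n)) (\<lambda>c. DG w (m n) (\<epsilon> n) c i)" for i by (rule DG_continuous[OF wX])
    show "DG w (m n) (\<epsilon> n) (\<lambda>i. - c i) i = - DG w (m n) (\<epsilon> n) c i" for c i by (rule DG_odd[OF wX])
    show "((\<lambda>t. JG w (m n) (\<epsilon> n) (\<lambda>i. c i + t * h i)) has_real_derivative
          (\<Sum>i<m n. DG w (m n) (\<epsilon> n) (\<lambda>i. c i + t * h i) i * h i)) (at t)" for c h t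
      by (rule JG_deriv[OF wX])
    show "\<exists>R. \<forall>c\<in>coords_below (m n). JG w (m n) (\<epsilon> n) c \<le> b \<longrightarrow> (\<forall>i. \<bar>c i\<bar> \<le> R)" for b
      by (rule JG_coercive[OF wX eps0])
    show "continuous_on (unit_sphere k) (\<lambda>y. y i)" for i
      by (rule continuous_on_subset[OF continuous_on_product_coordinates]) auto
    show "y \<in> coords_below (m n)" if "y \<in> unit_sphere k" for y
      using that by (auto simp: unit_sphere_def coords_below_def m_def)
    show "JG w (m n) (\<epsilon> n) y \<le> - \<eta> / 2" if y: "y \<in> unit_sphere k" for y
    proof -
      have yk: "y i = 0" if "i \<ge> Suc k" for i using y that by (auto simp: unit_sphere_def)
      have "comb w (m n) y = comb b (Suc k) y"
        by (rule comb_shift_eq[OF yk]) (auto simp: m_def w_def)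
      moreover have "(\<Sum>i<m n. (y i)\<^sup>2) = (\<Sum>i\<le>k. (y i)\<^sup>2)"
        using yk by (intro sum.mono_neutral_right) (auto simp: m_def)
      ultimately have "JG w (m n) (\<epsilon> n) y = J (comb b (Suc k) y) + \<epsilon> n"
        using y by (simp add: JG_def unit_sphere_def)
      then show ?thesis using b(3)[OF y] eps1[of n] by linarith
    qed
    show "continuous_on (coords_below (m n)) (\<lambda>c. \<integral>x. comb w (m n) c x * indicator (qs ! i) x \<partial>lebesgue)" if "i < k" for i
    proof -
      have "qs ! i \<in> sets lebesgue" using that qs(1) nth_mem unfolding k_def by blast
      then have i: "integrable lebesgue (\<lambda>x. w j x * indicator (qs ! i) x)" for j
        by (intro integrable_real_mult_indicator X_integrable wX)
      have "(\<integral>x. comb w (m n) c x * indicator (qs ! i) x \<partial>lebesgue) = (\<Sum>j<m n. c j * (\<integral>x. w j x * indicator (qs ! i) x \<partial>lebesgue))" for c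
      proof -
        have "(\<integral>x. comb w (m n) c x * indicator (qs ! i) x \<partial>lebesgue) = (\<integral>x. (\<Sum>j<m n. c j * (w j x * indicator (qs ! i) x)) \<partial>lebesgue)"
          by (intro Bochner_Integration.integral_cong refl) (simp add: comb_def sum_distrib_right mult.assoc)
        also have "\<dots> = (\<Sum>j<m n. \<integral>x. c j * (w j x * indicator (qs ! i) x) \<partial>lebesgue)"
          by (intro Bochner_Integration.integral_sum integrable_mult_right i)
        finally show ?thesis by simp
      qed
      then show ?thesis
        by (simp only:) (intro continuous_intros continuous_on_subset[OF continuous_on_product_coordinates subset_UNIV])
    qed
    show "(\<integral>x. comb w (m n) (\<lambda>i. - c i) x * indicator (qs ! i) x \<partial>lebesgue) = - (\<integral>x. comb w (m n) c x * indicator (qs ! i) x \<partial>lebesgue)" for c i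
      by (simp add: comb_uminus)
    show "\<exists>i<k. (\<integral>x. comb w (m n) c x * indicator (qs ! i) x \<partial>lebesgue) \<noteq> 0" if "JG w (m n) (\<epsilon> n) c \<le> - \<delta>" for c
    proof -
      have "0 \<le> \<epsilon> n * (\<Sum>i<m n. (c i)\<^sup>2)" using eps0[of n] by (intro mult_nonneg_nonneg sum_nonneg) auto
      then have "J (comb w (m n) c) \<le> - \<delta>" using that unfolding JG_def by linarith
      then show ?thesis unfolding k_def by (intro qs(2) comb_X[OF wX])
    qed
  qed auto
  have "\<exists>c. \<forall>n. c n \<in> coords_below (m n) \<and> - \<delta> \<le> JG w (m n) (\<epsilon> n) (c n) \<and> JG w (m n) (\<epsilon> n) (c n) \<le> - \<eta> / 2 \<and> (\<forall>i<m n. DG w (m n) (\<epsilon> n) (c n) i = 0)"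
    by (rule choice) (use ex in blast)
  then obtain c where c': "\<And>n. c n \<in> coords_below (m n) \<and> - \<delta> \<le> JG w (m n) (\<epsilon> n) (c n) \<and> JG w (m n) (\<epsilon> n) (c n) \<le> - \<eta> / 2 \<and> (\<forall>i<m n. DG w (m n) (\<epsilon> n) (c n) i = 0)"
    by blast
  define u where "u n = comb w (m n) (c n)" for n
  define \<rho> where "\<rho> n = \<epsilon> n * (\<Sum>i<m n. (c n i)\<^sup>2)" for n
  have uX: "u n \<in> X" for n unfolding u_def by (rule comb_X[OF wX])
  have um: "u n \<in> borel_measurable lebesgue" for n by (rule XD[OF uX])
  have rho0: "0 \<le> \<rho> n" for n unfolding \<rho>_def using eps0[of n] by (intro mult_nonneg_nonneg sum_nonneg) auto
  \<comment> \<open>the minimax level is that of the penalized functional\<close>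
  have lev: "- \<delta> \<le> J (u n) + \<rho> n" "J (u n) + \<rho> n \<le> - \<eta> / 2" for n
    using c'[of n] by (auto simp: JG_def u_def \<rho>_def)
  have PK: "Phi (u n) \<le> K" for n unfolding K_def by (rule Phi_bounded[OF X_integrable(1)[OF uX]])
  have EK: "E (u n) \<le> K" for n using lev(2)[of n] PK[of n] rho0[of n] b(1) by (simp add: J_def)
  have rK: "\<rho> n \<le> K" for n using lev(2)[of n] PK[of n] E_nonneg[of "u n"] b(1) by (simp add: J_def)
  define err where "err n = 2 * sqrt (\<epsilon> n * K)" for n
  have "\<epsilon> \<longlonglongrightarrow> 0"
  proof -
    have "(\<lambda>n. 1 / real (Suc n)) \<longlonglongrightarrow> 0" using LIMSEQ_Suc[OF lim_1_over_n] by simp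
    then show ?thesis
      by (rule Lim_null_comparison[rotated]) (auto intro!: always_eventually simp: \<epsilon>_def m_def frac_le)
  qed
  then have "err \<longlonglongrightarrow> 2 * sqrt (0 * K)" unfolding err_def by (intro tendsto_intros)
  then have err: "err \<longlonglongrightarrow> 0" by simp
  have dEi: "dE (u n) (w i) = dPhi (u n) (w i) - 2 * \<epsilon> n * c n i" if "i < m n" for n i
    using c'[of n] that by (auto simp: DG_def u_def algebra_simps)
  have dEu: "dE (u n) (u n) = dPhi (u n) (u n) - 2 * \<rho> n" for n
  proof -
    have "dE (u n) (comb w (m n) (c n)) = (\<Sum>i<m n. c n i * dE (u n) (w i))"
      by (rule dE_comb[OF uX wX])
    also have "\<dots> = (\<Sum>i<m n. c n i * dPhi (u n) (w i) - 2 * (\<epsilon> n * (c n i)\<^sup>2))"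
      by (intro sum.cong refl) (auto simp: dEi algebra_simps power2_eq_square)
    also have "\<dots> = (\<Sum>i<m n. c n i * dPhi (u n) (w i)) - 2 * \<rho> n"
      by (simp add: sum_subtractf \<rho>_def sum_distrib_left)
    also have "(\<Sum>i<m n. c n i * dPhi (u n) (w i)) = dPhi (u n) (comb w (m n) (c n))"
      by (rule dPhi_comb[OF um X_integrable(1)[OF wX], symmetric])
    finally show ?thesis by (simp only: u_def[symmetric])
  qed
  have dense: "\<exists>i. (\<integral>x. \<bar>u x - d i x\<bar> \<partial>lebesgue) < \<epsilon> \<and> \<bar>E u - E (d i)\<bar> < \<epsilon>" if "u \<in> X" "0 < \<epsilon>" for u \<epsilon>
    using d(2) that by blast
  have key: "\<exists>N. \<forall>n\<ge>N. E (u n) + dPhi (u n) (\<lambda>x. d i x - u n x) + 2 * \<rho> n - err n \<le> E (d i)" for i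
  proof (intro exI[of _ i] allI impI)
    fix n assume n: "i \<le> n"
    define j where "j = i + Suc k"
    have j: "j < m n" if "M > 0" using n that by (simp add: j_def m_def)
    have M0: "M > 0" using M b(1) by (metis divide_pos_pos gr0I less_asym of_nat_0 zero_less_numeral)
    have wj: "w j = d i" by (simp add: w_def j_def)
    have "E (u n) + (dE (u n) (w j) - dE (u n) (u n)) \<le> E (w j)"
      using E_convex[OF uX wX, of n j] dE_diff[OF uX wX uX, of n j n] by simp
    then have 1: "E (u n) + (dPhi (u n) (w j) - 2 * \<epsilon> n * c n j - dPhi (u n) (u n) + 2 * \<rho> n) \<le> E (w j)"
      using dEi[OF j[OF M0]] dEu[of n] by simp
    have "dPhi (u n) (\<lambda>x. w j x - u n x) = dPhi (u n) (w j) - dPhi (u n) (u n)"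
      by (intro dPhi_diff um X_integrable wX uX)
    moreover have "\<epsilon> n * c n j \<le> sqrt (\<epsilon> n * K)"
    proof (rule real_le_rsqrt)
      have "(c n j)\<^sup>2 \<le> (\<Sum>i<m n. (c n i)\<^sup>2)" using j[OF M0] by (intro member_le_sum) auto
      then have "\<epsilon> n * (c n j)\<^sup>2 \<le> \<rho> n" unfolding \<rho>_def using eps0[of n] by (intro mult_left_mono) auto
      then have "\<epsilon> n * (\<epsilon> n * (c n j)\<^sup>2) \<le> \<epsilon> n * K" using rK[of n] eps0[of n] by (intro mult_left_mono) auto
      then show "(\<epsilon> n * c n j)\<^sup>2 \<le> \<epsilon> n * K" by (simp add: power2_eq_square algebra_simps)
    qed
    ultimately show "E (u n) + dPhi (u n) (\<lambda>x. d i x - u n x) + 2 * \<rho> n - err n \<le> E (d i)"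
      using 1 unfolding wj err_def by linarith
  qed
  then obtain r v where rv: "strict_mono (r::nat\<Rightarrow>nat)" "weakly_critical v" "(\<lambda>n. E (u (r n))) \<longlonglongrightarrow> E v"
     "(\<lambda>n. Phi (u (r n))) \<longlonglongrightarrow> Phi v" "(\<lambda>n. \<rho> (r n)) \<longlonglongrightarrow> 0"
    using limit_weakly_critical[of d u K \<rho> K err, OF d(1) dense uX EK rho0 rK err key] by blast
  have L: "(\<lambda>n. J (u (r n)) + \<rho> (r n)) \<longlonglongrightarrow> J v + 0"
    unfolding J_def by (intro tendsto_intros rv)
  have "- \<delta> \<le> J v + 0" by (rule LIMSEQ_le_const[OF L]) (use lev in auto)
  moreover have "J v + 0 \<le> - \<eta> / 2" by (rule LIMSEQ_le_const2[OF L]) (use lev in auto)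
  ultimately show ?thesis using rv(2) b(1) by (intro exI[of _ v]) auto
qed

text \<open>A limit \<open>v\<close> of critical points with levels tending to \<open>0\<close> has \<open>E(v) = Phi(v)\<close> and
  \<open>p\<^sup>- E(v) \<le> E'(v)v = Phi'(v)v\<close>, so the integral of the nonnegative function \<open>p\<^sup>- G - g v\<close> is at most \<open>0\<close>.\<close>

theorem vanishing_critical_sequence:
  assumes neg: "\<And>k. \<exists>b \<eta>. 0 < \<eta> \<and> (\<forall>i. b i \<in> X) \<and> (\<forall>y\<in>unit_sphere k. J (comb b (Suc k) y) \<le> - \<eta>)"
    and AR: "AE x in lebesgue. x \<in> \<Omega> \<longrightarrow> (\<forall>t. t \<noteq> 0 \<longrightarrow> 0 < pl * Gp x t - g x t * t)"
  shows "\<exists>U. (\<forall>n. weakly_critical (U n) \<and> J (U n) < 0) \<and> (\<lambda>n. \<integral>x. \<bar>U n x\<bar> \<partial>lebesgue) \<longlonglongrightarrow> 0"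
proof -
  have "\<forall>n::nat. \<exists>v. weakly_critical v \<and> - (1 / real (Suc n)) \<le> J v \<and> J v < 0"
    by (intro allI small_negative_critical_point[OF neg]) auto
  then obtain U where U: "\<And>n. weakly_critical (U n)" "\<And>n. - (1 / real (Suc n)) \<le> J (U n)" "\<And>n. J (U n) < 0"
    by metis
  obtain d where d: "\<And>i::nat. d i \<in> X"
     "\<forall>u\<in>X. \<forall>\<epsilon>>0. \<exists>i. (\<integral>x. \<bar>u x - d i x\<bar> \<partial>lebesgue) < \<epsilon> \<and> \<bar>E u - E (d i)\<bar> < \<epsilon>"
    using X_countable_dense by blast
  define K where "K = Cg * T * measure lebesgue \<Omega>"
  have UX: "U n \<in> X" for n using U(1) by (simp add: weakly_critical_def)
  have EK: "E (U n) \<le> K" for n using U(3)[of n] Phi_bounded[OF X_integrable(1)[OF UX[of n]]] by (simp add: J_def K_def)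
  have JU: "(\<lambda>n. J (U n)) \<longlonglongrightarrow> 0"
  proof (rule tendsto_sandwich)
    show "(\<lambda>n. - (1 / real (Suc n))) \<longlonglongrightarrow> 0" using tendsto_minus[OF LIMSEQ_Suc[OF lim_1_over_n]] by simp
    show "(\<lambda>n. 0 :: real) \<longlonglongrightarrow> 0" by simp
  qed (use U(2,3) less_imp_le in \<open>auto intro!: always_eventually\<close>)
  have "(\<lambda>n. \<integral>x. \<bar>U n x\<bar> \<partial>lebesgue) \<longlonglongrightarrow> 0"
  proof (rule ccontr)
    assume "\<not> ?thesis"
    then obtain \<theta> where th: "0 < \<theta>" "\<And>N. \<exists>n\<ge>N. \<theta> \<le> (\<integral>x. \<bar>U n x\<bar> \<partial>lebesgue)"
      by (auto simp: LIMSEQ_iff not_less integral_nonneg_AE abs_of_nonneg)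
    then have "infinite {n. \<theta> \<le> (\<integral>x. \<bar>U n x\<bar> \<partial>lebesgue)}" by (auto simp: infinite_nat_iff_unbounded_le)
    then obtain \<sigma> where sg: "strict_mono (\<sigma>::nat\<Rightarrow>nat)" "\<And>n. \<theta> \<le> (\<integral>x. \<bar>U (\<sigma> n) x\<bar> \<partial>lebesgue)"
      using infinite_enumerate by blast
    have "\<exists>N. \<forall>n\<ge>N. E (U (\<sigma> n)) + dPhi (U (\<sigma> n)) (\<lambda>x. d i x - U (\<sigma> n) x) + 2 * 0 - 0 \<le> E (d i)" for i
      using U(1) d(1) by (auto simp: weakly_critical_def)
    then obtain r v where rv: "strict_mono (r::nat\<Rightarrow>nat)" "weakly_critical v" "(\<lambda>n. E (U (\<sigma> (r n)))) \<longlonglongrightarrow> E v"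
     "(\<lambda>n. Phi (U (\<sigma> (r n)))) \<longlonglongrightarrow> Phi v" "(\<lambda>n. \<integral>x. \<bar>U (\<sigma> (r n)) x\<bar> \<partial>lebesgue) \<longlonglongrightarrow> (\<integral>x. \<bar>v x\<bar> \<partial>lebesgue)"
      using limit_weakly_critical[of d "\<lambda>n. U (\<sigma> n)" K "\<lambda>_. 0" 0 "\<lambda>_. 0"] d UX EK by auto
    have "(\<lambda>n. J (U (\<sigma> (r n)))) \<longlonglongrightarrow> J v" unfolding J_def by (intro tendsto_intros rv)
    moreover have "(\<lambda>n. J (U (\<sigma> (r n)))) \<longlonglongrightarrow> 0"
      using LIMSEQ_subseq_LIMSEQ[OF JU strict_mono_o[OF sg(1) rv(1)]] by (simp add: o_def)
    ultimately have "J v = 0" by (rule LIMSEQ_unique)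
    then have Ev: "E v = Phi v" by (simp add: J_def)
    have vX: "v \<in> X" using rv(2) by (simp add: weakly_critical_def)
    have iv: "integrable lebesgue v" by (rule X_integrable(1)[OF vX])
    have "pl * Phi v \<le> dPhi v v" using E_le_dE_self[OF vX] weakly_critical_equation[OF rv(2) vX] Ev by simp
    moreover have i1: "integrable lebesgue (\<lambda>x. pl * Gp x (v x) - g x (v x) * v x)"
      using iv by (intro Bochner_Integration.integrable_diff integrable_mult_right Gp_integrable g_integrable) auto
    moreover have "(\<integral>x. pl * Gp x (v x) - g x (v x) * v x \<partial>lebesgue) = pl * Phi v - dPhi v v"
      using iv unfolding Phi_def dPhi_def by (simp add: Gp_integrable g_integrable)
    ultimately have le0: "(\<integral>x. pl * Gp x (v x) - g x (v x) * v x \<partial>lebesgue) \<le> 0" by simp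
    have pos: "AE x in lebesgue. 0 \<le> pl * Gp x (v x) - g x (v x) * v x \<and> (pl * Gp x (v x) - g x (v x) * v x = 0 \<longrightarrow> v x = 0)"
      using AR X_AE[OF vX]
    proof eventually_elim
      case (elim x)
      show ?case
      proof (cases "v x = 0")
        case False
        then have "0 < pl * Gp x (v x) - g x (v x) * v x" using elim by blast
        then show ?thesis by simp
      qed simp
    qed
    have "(\<integral>x. pl * Gp x (v x) - g x (v x) * v x \<partial>lebesgue) = 0"
      using le0 by (intro antisym integral_nonneg_AE) (use pos in \<open>auto elim: eventually_mono\<close>)
    then have "AE x in lebesgue. pl * Gp x (v x) - g x (v x) * v x = 0"
      using integral_nonneg_eq_0_iff_AE[OF i1] pos by (auto elim: eventually_mono)
    then have "AE x in lebesgue. v x = 0" using pos by eventually_elim blast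
    then have "(\<integral>x. \<bar>v x\<bar> \<partial>lebesgue) = 0" by (intro integral_eq_zero_AE) auto
    moreover have "\<theta> \<le> (\<integral>x. \<bar>v x\<bar> \<partial>lebesgue)" by (rule LIMSEQ_le_const[OF rv(5)]) (use sg(2) in auto)
    ultimately show False using th(1) by simp
  qed
  then show ?thesis using U by blast
qed

end

section \<open>Critical points with small mean are uniformly small\<close>

text \<open>The claim \<open>Y j \<le> \<theta> \<mu>^j\<close> is inductive once \<open>\<mu>\<close> and \<open>\<theta>\<close> are chosen so that \<open>B \<mu>\<^sup>\<sigma> = 1\<close> and
  \<open>C \<theta>\<^sup>\<sigma> = \<mu>\<close>.\<close>

lemma fast_geometric_decay:
  fixes Y :: "nat \<Rightarrow> real"
  assumes C: "0 < C" and B: "1 < B" and \<sigma>: "0 < \<sigma>"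
    and Y0: "\<And>j. 0 \<le> Y j" and step: "\<And>j. Y (Suc j) \<le> C * B ^ j * Y j powr (1 + \<sigma>)"
    and start: "Y 0 \<le> (B powr (- 1 / \<sigma>) / C) powr (1 / \<sigma>)"
  shows "Y \<longlonglongrightarrow> 0"
proof -
  define \<mu> where "\<mu> = B powr (- 1 / \<sigma>)"
  define \<theta> where "\<theta> = (\<mu> / C) powr (1 / \<sigma>)"
  have mu: "0 < \<mu>" "\<mu> < 1" using B \<sigma> by (auto simp: \<mu>_def powr_less_one)
  have th: "0 < \<theta>" using mu C by (simp add: \<theta>_def)
  have ths: "C * \<theta> powr \<sigma> = \<mu>" using \<sigma> mu C by (simp add: \<theta>_def powr_powr)
  have "\<mu> powr \<sigma> = B powr (- 1)" using \<sigma> by (simp add: \<mu>_def powr_powr)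
  then have Bmu: "B * \<mu> powr \<sigma> = 1" using B by (simp add: powr_minus_divide)
  have bound: "Y j \<le> \<theta> * \<mu> ^ j" for j
  proof (induction j)
    case 0
    then show ?case using start by (simp add: \<theta>_def \<mu>_def)
  next
    case (Suc j)
    have "Y (Suc j) \<le> C * B ^ j * Y j powr (1 + \<sigma>)" by (rule step)
    also have "\<dots> \<le> C * B ^ j * (\<theta> * \<mu> ^ j) powr (1 + \<sigma>)"
      using C B \<sigma> Y0 Suc by (intro mult_left_mono powr_mono2) auto
    also have "(\<theta> * \<mu> ^ j) powr (1 + \<sigma>) = \<theta> * \<mu> ^ j * (\<theta> powr \<sigma> * (\<mu> powr \<sigma>) ^ j)"
    proof -
      have "(\<mu> ^ j) powr \<sigma> = (\<mu> powr \<sigma>) ^ j"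
        using mu by (simp add: powr_realpow[symmetric] powr_powr mult.commute)
      then show ?thesis using th mu by (simp add: powr_add powr_mult)
    qed
    also have "C * B ^ j * (\<theta> * \<mu> ^ j * (\<theta> powr \<sigma> * (\<mu> powr \<sigma>) ^ j)) = (C * \<theta> powr \<sigma>) * (B * \<mu> powr \<sigma>) ^ j * (\<theta> * \<mu> ^ j)"
      by (simp add: power_mult_distrib algebra_simps)
    finally show ?case unfolding ths Bmu by (simp add: algebra_simps)
  qed
  have "(\<lambda>j. \<theta> * \<mu> ^ j) \<longlonglongrightarrow> \<theta> * 0" using mu by (intro tendsto_intros LIMSEQ_realpow_zero) auto
  then have "(\<lambda>j. \<theta> * \<mu> ^ j) \<longlonglongrightarrow> 0" by simp
  then show ?thesis by (rule Lim_null_comparison[rotated]) (use bound Y0 in auto)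
qed

context truncated
begin

lemma truncation_X:
  assumes "u \<in> X" "0 \<le> k"
  shows "(\<lambda>x. max (u x - k) 0) \<in> X"
proof (rule X_mono[OF assms(1)])
  have [measurable]: "u \<in> borel_measurable lebesgue" using assms by (auto intro: XD)
  show "(\<lambda>x. max (u x - k) 0) \<in> borel_measurable lebesgue" by measurable
qed (use assms in \<open>auto simp: max_def\<close>)

text \<open>Test the equation with the excess \<open>(u - k)\<^sup>+\<close>: its contribution to the second modular is nonnegative, and the right-hand
  side is bounded.\<close>

lemma caccioppoli:
  assumes u: "u \<in> X" and crit: "\<And>v. v \<in> X \<Longrightarrow> dE u v = dPhi u v" and k: "0 \<le> k"
  defines "w \<equiv> \<lambda>x. max (u x - k) 0"
  shows "(\<integral>z. \<bar>diff w z\<bar> powr p z * kern z \<partial>(lebesgue \<Otimes>\<^sub>M lebesgue)) \<le> Cg * (\<integral>x. w x \<partial>lebesgue)"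
proof -
  have w: "w \<in> X" unfolding w_def by (rule truncation_X[OF u k])
  have w0: "0 \<le> w x" for x by (simp add: w_def)
  have "(\<integral>z. \<bar>diff w z\<bar> powr p z * kern z \<partial>(lebesgue \<Otimes>\<^sub>M lebesgue)) \<le> G.dmodular (diff u) (diff w)"
    unfolding G.dmodular_def
  proof (rule integral_mono)
    show "integrable (lebesgue \<Otimes>\<^sub>M lebesgue) (\<lambda>z. \<bar>diff w z\<bar> powr p z * kern z)" using X_fin(1)[OF w] by (simp add: G.fin_def)
    show "integrable (lebesgue \<Otimes>\<^sub>M lebesgue) (\<lambda>z. signed_power (p z) (diff u z) * diff w z * kern z)"
      by (intro G.integrable_dmodular X_fin u w)
    show "\<bar>diff w z\<bar> powr p z * kern z \<le> signed_power (p z) (diff u z) * diff w z * kern z" for z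
      by (intro mult_right_mono kern_nonneg signed_power_between p1) (auto simp: w_def diff_def max_def)
  qed
  moreover have "0 \<le> L.dmodular u w"
    unfolding L.dmodular_def
    using k by (intro Bochner_Integration.integral_nonneg) (auto simp: w_def signed_power_def max_def)
  moreover have "dPhi u w \<le> Cg * (\<integral>x. w x \<partial>lebesgue)"
    unfolding dPhi_def integral_mult_right_zero[symmetric]
  proof (rule integral_mono)
    show "integrable lebesgue (\<lambda>x. g x (u x) * w x)" by (intro g_integrable XD u X_integrable w)
    show "integrable lebesgue (\<lambda>x. Cg * w x)" by (intro integrable_mult_right X_integrable w)
    show "g x (u x) * w x \<le> Cg * w x" for x using g_bound[of x "u x"] w0[of x] by (intro mult_right_mono) (auto simp: abs_le_iff)
  qed
  ultimately show ?thesis using crit[OF w] by (simp add: dE_def)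
qed

text \<open>The excess over \<open>l\<close> lives on a set on which the excess over \<open>k\<close> is at least \<open>l - k\<close>, so Chebyshev's inequality bounds its
  measure; \<open>small_support_estimate\<close> and \<open>caccioppoli\<close> give the rest.\<close>

lemma excess_step:
  assumes u: "u \<in> X" and crit: "\<And>v. v \<in> X \<Longrightarrow> dE u v = dPhi u v" and k: "0 \<le> k" "k < l"
  defines "Y \<equiv> \<lambda>k. \<integral>x. max (u x - k) 0 \<partial>lebesgue" and "c \<equiv> unit_ball_vol (real CARD('n))"
  shows "Y l \<le> (2 * (Y k / (l - k)) / c) powr (s / real CARD('n)) * (2 / c * (Cg * Y k) + 4 * (Y k / (l - k)))"
proof -
  define w where "w = (\<lambda>x. max (u x - l) 0)"
  define v where "v = (\<lambda>x. max (u x - k) 0)"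
  have wX: "w \<in> X" "v \<in> X" unfolding w_def v_def using k by (auto intro!: truncation_X u)
  have wi: "integrable lebesgue w" "integrable lebesgue v" using wX X_integrable by auto
  have [measurable]: "w \<in> borel_measurable lebesgue" "v \<in> borel_measurable lebesgue" using wX by (auto intro: XD)
  have c0: "0 < c" by (simp add: c_def)
  have Yk: "Y k = (\<integral>x. v x \<partial>lebesgue)" "Y l = (\<integral>x. w x \<partial>lebesgue)" by (simp_all add: Y_def v_def w_def)
  have Y0: "0 \<le> Y k" unfolding Yk by (rule Bochner_Integration.integral_nonneg) (simp add: v_def)
  have Yle: "Y l \<le> Y k" unfolding Yk using k by (intro integral_mono wi) (auto simp: w_def v_def)
  define A where "A = {x. w x \<noteq> 0}"
  have A: "A \<in> sets lebesgue"
  proof -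
    have "A = {x \<in> space lebesgue. w x \<noteq> 0}" by (simp add: A_def)
    also have "\<dots> \<in> sets lebesgue" by measurable
    finally show ?thesis .
  qed
  have sub: "(l - k) * indicator A x \<le> v x" for x using k by (auto simp: A_def w_def v_def indicator_def max_def split: if_splits)
  have "(\<integral>\<^sup>+x. ennreal ((l - k) * indicator A x) \<partial>lebesgue) \<le> (\<integral>\<^sup>+x. ennreal (v x) \<partial>lebesgue)"
    by (intro nn_integral_mono ennreal_leI sub)
  also have "\<dots> = ennreal (Y k)" unfolding Yk by (rule nn_integral_eq_integral[OF wi(2)]) (simp add: v_def)
  also have "(\<integral>\<^sup>+x. ennreal ((l - k) * indicator A x) \<partial>lebesgue) = (\<integral>\<^sup>+x. ennreal (l - k) * indicator A x \<partial>lebesgue)"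
    by (intro nn_integral_cong) (auto simp: indicator_def)
  also have "\<dots> = ennreal (l - k) * emeasure lebesgue A" by (rule nn_integral_cmult_indicator[OF A])
  finally have Aem: "ennreal (l - k) * emeasure lebesgue A \<le> ennreal (Y k)" .
  have "ennreal (l - k) * emeasure lebesgue A < \<infinity>"
    using Aem by (rule le_less_trans) simp
  then have "emeasure lebesgue A < \<infinity>"
    using k by (auto simp: ennreal_mult_less_top simp del: emeasure_completion)
  then obtain a where a: "emeasure lebesgue A = ennreal a" "0 \<le> a" by (cases "emeasure lebesgue A") auto
  have "ennreal ((l - k) * a) \<le> ennreal (Y k)" using Aem k a by (simp add: ennreal_mult)
  then have "(l - k) * a \<le> Y k" using Y0 by simp
  then have ale: "a \<le> Y k / (l - k)" using k by (simp add: field_simps)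
  show ?thesis
  proof (cases "a = 0")
    case True
    then have "AE x in lebesgue. x \<notin> A" using a A by (intro AE_not_in) (auto simp: null_sets_def)
    then have "AE x in lebesgue. w x = 0" by eventually_elim (simp add: A_def)
    then have "Y l = 0" unfolding Yk by (rule integral_eq_zero_AE)
    then show ?thesis using Y0 k c0 Cg_nonneg by (auto intro!: mult_nonneg_nonneg add_nonneg_nonneg)
  next
    case False
    define m where "m = (\<integral>z. \<bar>diff w z\<bar> powr p z * kern z \<partial>(lebesgue \<Otimes>\<^sub>M lebesgue))"
    have m0: "0 \<le> m" unfolding m_def by (rule Bochner_Integration.integral_nonneg) (simp add: kern_nonneg)
    have m1: "m \<le> Cg * Y l" unfolding m_def Yk(2) w_def using caccioppoli[OF u crit, of l] k by simp
    have mY: "m \<le> Cg * Y k" using m1 Yle Cg_nonneg by (meson mult_left_mono order_trans)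
    have "(\<integral>\<^sup>+x. ennreal \<bar>w x\<bar> \<partial>lebesgue) \<le> ennreal ((2 * a / c) powr (s / real CARD('n)) * (2 / c * m + 4 * a))"
      unfolding c_def
      by (rule small_support_estimate[OF XD[OF wX(1)] a(1)[unfolded A_def] _ modulus_eq[OF wX(1), folded m_def] m0])
        (use a(2) False in simp)
    also have "(\<integral>\<^sup>+x. ennreal \<bar>w x\<bar> \<partial>lebesgue) = ennreal (Y l)"
    proof -
      have "(\<integral>\<^sup>+x. ennreal \<bar>w x\<bar> \<partial>lebesgue) = (\<integral>\<^sup>+x. ennreal (w x) \<partial>lebesgue)" by (simp add: w_def)
      also have "\<dots> = ennreal (Y l)"
        unfolding Yk by (rule nn_integral_eq_integral[OF wi(1)]) (simp add: w_def)
      finally show ?thesis .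
    qed
    finally have "Y l \<le> (2 * a / c) powr (s / real CARD('n)) * (2 / c * m + 4 * a)"
      using a(2) m0 c0 by (subst (asm) ennreal_le_iff) (auto intro!: mult_nonneg_nonneg add_nonneg_nonneg)
    also have "\<dots> \<le> (2 * (Y k / (l - k)) / c) powr (s / real CARD('n)) * (2 / c * (Cg * Y k) + 4 * (Y k / (l - k)))"
      using a(2) m0 c0 ale mY s
      by (intro mult_mono powr_mono2 add_mono mult_left_mono divide_right_mono) (auto intro!: add_nonneg_nonneg)
    finally show ?thesis .
  qed
qed

text \<open>De Giorgi's iteration over the levels \<open>k j = \<epsilon> (1 - 2^(-j))\<close>: the excess over \<open>k j\<close> obeys the superlinear recursion of
  \<open>fast_geometric_decay\<close>, so the excess over \<open>\<epsilon>\<close> vanishes if the initial one is small.\<close>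

theorem small_mean_small_sup:
  assumes \<epsilon>: "0 < \<epsilon>"
  shows "\<exists>\<theta>>0. \<forall>u\<in>X. (\<forall>v\<in>X. dE u v = dPhi u v) \<longrightarrow> (\<integral>x. \<bar>u x\<bar> \<partial>lebesgue) \<le> \<theta> \<longrightarrow> (AE x in lebesgue. u x \<le> \<epsilon>)"
proof -
  define c where "c = unit_ball_vol (real CARD('n))"
  have c0: "0 < c" by (simp add: c_def)
  define \<sigma> where "\<sigma> = s / real CARD('n)"
  have sg: "0 < \<sigma>" using s by (simp add: \<sigma>_def)
  define B where "B = 2 powr (1 + \<sigma>)"
  have B: "1 < B" using sg by (simp add: B_def)
  define C where "C = (4 / (c * \<epsilon>)) powr \<sigma> * (2 / c * Cg + 8 / \<epsilon>)"
  have C: "0 < C" using c0 \<epsilon> Cg_nonneg by (auto simp: C_def intro!: mult_pos_pos add_nonneg_pos)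
  define \<theta> where "\<theta> = (B powr (- 1 / \<sigma>) / C) powr (1 / \<sigma>)"
  have th: "0 < \<theta>" using B C by (simp add: \<theta>_def)
  have "AE x in lebesgue. u x \<le> \<epsilon>" if u: "u \<in> X" and crit: "\<And>v. v \<in> X \<Longrightarrow> dE u v = dPhi u v"
    and small: "(\<integral>x. \<bar>u x\<bar> \<partial>lebesgue) \<le> \<theta>" for u
  proof -
    define Z where "Z k = (\<integral>x. max (u x - k) 0 \<partial>lebesgue)" for k
    define k where "k j = \<epsilon> * (1 - (1/2)^j)" for j :: nat
    have k0: "0 \<le> k j" for j using \<epsilon> by (auto simp: k_def power_le_one)
    have kd: "k (Suc j) - k j = \<epsilon> / 2 * (1/2)^j" for j by (simp add: k_def algebra_simps)
    have kl: "k j < k (Suc j)" for j using kd[of j] \<epsilon> by (smt (verit) mult_pos_pos half_gt_zero zero_less_power)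
    have ke: "k j \<le> \<epsilon>" for j using \<epsilon> by (simp add: k_def algebra_simps)
    have tX: "(\<lambda>x. max (u x - r) 0) \<in> X" if "0 \<le> r" for r by (rule truncation_X[OF u that])
    have ti: "integrable lebesgue (\<lambda>x. max (u x - r) 0)" if "0 \<le> r" for r by (rule X_integrable(1)[OF tX[OF that]])
    have Z0: "0 \<le> Z r" for r unfolding Z_def by (rule Bochner_Integration.integral_nonneg) simp
    have "(\<lambda>j. Z (k j)) \<longlonglongrightarrow> 0"
    proof (rule fast_geometric_decay[OF C B sg Z0])
      fix j
      let ?Y = "Z (k j)" and ?d = "k (Suc j) - k j"
      have d0: "0 < ?d" using kl[of j] by simp
      have rd: "1 / ?d = 2 ^ j * (2 / \<epsilon>)" using \<epsilon> unfolding kd by (simp add: field_simps power_divide)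
      have Yd: "?Y / ?d = 2 ^ j * (2 / \<epsilon>) * ?Y" using rd by (metis divide_inverse inverse_eq_divide mult.commute)
      have "Z (k (Suc j)) \<le> (2 * (?Y / ?d) / c) powr \<sigma> * (2 / c * (Cg * ?Y) + 4 * (?Y / ?d))"
        unfolding Z_def c_def \<sigma>_def by (rule excess_step[OF u crit k0 kl])
      also have "(2 * (?Y / ?d) / c) powr \<sigma> = (4 / (c * \<epsilon>)) powr \<sigma> * (2 powr \<sigma>) ^ j * ?Y powr \<sigma>"
      proof -
        have "2 * (?Y / ?d) / c = (4 / (c * \<epsilon>)) * 2 ^ j * ?Y" unfolding Yd by (simp add: mult_ac)
        moreover have "((2::real) ^ j) powr \<sigma> = (2 powr \<sigma>) ^ j"
          by (simp add: powr_realpow[symmetric] powr_powr mult.commute)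
        moreover have "(4 / (c * \<epsilon>) * 2 ^ j * ?Y) powr \<sigma> = (4 / (c * \<epsilon>)) powr \<sigma> * (2 ^ j) powr \<sigma> * ?Y powr \<sigma>"
          using c0 \<epsilon> Z0 by (simp only: powr_mult)
        ultimately show ?thesis by simp
      qed
      also have "2 / c * (Cg * ?Y) + 4 * (?Y / ?d) \<le> (2 / c * Cg + 8 / \<epsilon>) * 2 ^ j * ?Y"
      proof -
        have "2 / c * Cg * ?Y * 1 \<le> 2 / c * Cg * ?Y * 2 ^ j" using c0 Cg_nonneg Z0 by (intro mult_left_mono) auto
        then show ?thesis unfolding Yd by (simp add: algebra_simps)
      qed
      finally have "Z (k (Suc j)) \<le> (4 / (c * \<epsilon>)) powr \<sigma> * (2 powr \<sigma>) ^ j * ?Y powr \<sigma> * ((2 / c * Cg + 8 / \<epsilon>) * 2 ^ j * ?Y)"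
        by (simp add: mult_left_mono)
      also have "\<dots> = C * (2 * 2 powr \<sigma>) ^ j * (?Y * ?Y powr \<sigma>)"
        by (simp add: C_def power_mult_distrib algebra_simps)
      also have "?Y * ?Y powr \<sigma> = ?Y powr (1 + \<sigma>)" using Z0[of "k j"] by (cases "?Y = 0") (auto simp: powr_add)
      also have "2 * 2 powr \<sigma> = B" by (simp add: B_def powr_add)
      finally show "Z (k (Suc j)) \<le> C * B ^ j * ?Y powr (1 + \<sigma>)" .
    next
      have "Z (k 0) \<le> (\<integral>x. \<bar>u x\<bar> \<partial>lebesgue)"
        unfolding Z_def using ti[of 0] X_integrable(1)[OF u] by (intro integral_mono) (auto simp: k_def)
      then show "Z (k 0) \<le> (B powr (- 1 / \<sigma>) / C) powr (1 / \<sigma>)" using small by (simp add: \<theta>_def)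
    qed
    moreover have "Z \<epsilon> \<le> Z (k j)" for j
      unfolding Z_def using ti[OF k0[of j]] ti[of \<epsilon>] \<epsilon> ke[of j] by (intro integral_mono) auto
    ultimately have "Z \<epsilon> \<le> 0" by (intro LIMSEQ_le_const[of "\<lambda>j. Z (k j)"]) auto
    then have "Z \<epsilon> = 0" by (intro antisym Z0)
    then have "(\<integral>x. max (u x - \<epsilon>) 0 \<partial>lebesgue) = 0" unfolding Z_def .
    then have "AE x in lebesgue. max (u x - \<epsilon>) 0 = 0"
      using integral_nonneg_eq_0_iff_AE[OF ti[of \<epsilon>]] \<epsilon> by auto
    then show ?thesis by eventually_elim (auto simp: max_def split: if_splits)
  qed
  then show ?thesis using th by blast
qed

corollary small_mean_small_abs:
  assumes \<epsilon>: "0 < \<epsilon>"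
  shows "\<exists>\<theta>>0. \<forall>u\<in>X. (\<forall>v\<in>X. dE u v = dPhi u v) \<longrightarrow> (\<integral>x. \<bar>u x\<bar> \<partial>lebesgue) \<le> \<theta> \<longrightarrow> (AE x in lebesgue. \<bar>u x\<bar> \<le> \<epsilon>)"
proof -
  obtain \<theta> where th: "0 < \<theta>" "\<And>u. u \<in> X \<Longrightarrow> (\<forall>v\<in>X. dE u v = dPhi u v) \<Longrightarrow> (\<integral>x. \<bar>u x\<bar> \<partial>lebesgue) \<le> \<theta> \<Longrightarrow> AE x in lebesgue. u x \<le> \<epsilon>"
    using small_mean_small_sup[OF \<epsilon>] by blast
  have "AE x in lebesgue. \<bar>u x\<bar> \<le> \<epsilon>" if u: "u \<in> X" "\<forall>v\<in>X. dE u v = dPhi u v" "(\<integral>x. \<bar>u x\<bar> \<partial>lebesgue) \<le> \<theta>" for u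
  proof -
    have "AE x in lebesgue. u x \<le> \<epsilon>" by (rule th(2)[OF u])
    moreover have "AE x in lebesgue. - u x \<le> \<epsilon>"
    proof (rule th(2)[of "\<lambda>x. - u x"])
      show "(\<lambda>x. - u x) \<in> X" by (rule X_uminus[OF u(1)])
      show "\<forall>v\<in>X. dE (\<lambda>x. - u x) v = dPhi (\<lambda>x. - u x) v"
        using u(2) by (simp add: dE_uminus_left dPhi_def g_odd)
      show "(\<integral>x. \<bar>- u x\<bar> \<partial>lebesgue) \<le> \<theta>" using u(3) by simp
    qed
    ultimately show ?thesis by eventually_elim linarith
  qed
  then show ?thesis using th(1) by blast
qed

end

section \<open>Spheres of negative energy\<close>

lemma exists_dyadic_near:
  fixes \<tau> :: real
  assumes "0 < \<tau>" "\<tau> \<le> 1"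
  shows "\<exists>j::nat. \<tau> \<le> (1/2)^j \<and> (1/2)^(Suc j) < \<tau>"
proof -
  have "\<exists>n. (1/2)^n < \<tau>" using assms(1) by (intro real_arch_pow_inv) auto
  define n where "n = (LEAST n. (1/2)^n < \<tau>)"
  have n: "(1/2)^n < \<tau>" unfolding n_def using \<open>\<exists>n. (1/2)^n < \<tau>\<close> by (rule LeastI_ex)
  have "n \<noteq> 0" using n assms(2) by (intro notI) simp
  then obtain j where j: "n = Suc j" by (cases n) auto
  have "\<not> (1/2)^j < \<tau>" using not_less_Least[of j "\<lambda>n. (1/2)^n < \<tau>"] j unfolding n_def by simp
  then show ?thesis using n j by (intro exI[of _ j]) (simp add: not_less)
qed

lemma half_power_eq_powr: "(1/2::real) ^ n = 2 powr (- real n)"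
  by (simp add: powr_minus powr_realpow power_one_over inverse_eq_divide)

lemma exists_dyadic_far:
  fixes \<tau> :: real
  assumes "1 < \<tau>"
  shows "\<exists>j::nat. 2^j \<le> \<tau> \<and> \<tau> \<le> 2^(Suc j)"
proof -
  have "0 < 1 / \<tau>" "1 / \<tau> \<le> 1" using assms by auto
  from exists_dyadic_near[OF this] obtain j where j: "1 / \<tau> \<le> (1/2)^j" "(1/2)^(Suc j) < 1 / \<tau>" by blast
  then have "2^j \<le> \<tau>" "\<tau> < 2^(Suc j)" using assms by (auto simp: field_simps power_divide)
  then show ?thesis by (intro exI[of _ j]) auto
qed

text \<open>The weight \<open>|x - y|\<^bsup>-N-sp\<^esup>\<close> times \<open>min(|x - y|, 1)\<^sup>p\<close> is largest for \<open>p = 1\<close>, both near the diagonal and far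
  from it. The value at \<open>0\<close> reflects that differences vanish on the diagonal.\<close>

definition radial_majorant :: "real \<Rightarrow> real \<Rightarrow> real \<Rightarrow> real" where
  "radial_majorant N s \<tau> = (if \<tau> = 0 then 0 else if \<tau> \<le> 1 then \<tau> powr (1 - s - N) else \<tau> powr (- N - s))"

text \<open>The majorant is dominated by a sum over dyadic balls; the balls of radius \<open>2^(-j)\<close> contribute a geometric
  series of ratio \<open>2\<^bsup>s-1\<^esup>\<close>, those of radius \<open>2^(j+1)\<close> one of ratio \<open>2\<^bsup>-s\<^esup>\<close>.\<close>

lemma radial_majorant_integral:
  fixes x :: "real^'n"
  assumes s: "0 < s" "s < 1"
  defines "N \<equiv> real CARD('n)"
  shows "(\<integral>\<^sup>+y. ennreal (radial_majorant N s (norm (x - y))) \<partial>lebesgue)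
    \<le> ennreal (unit_ball_vol N * (2 powr N * (1 / (1 - 2 powr (s - 1)) + 1 / (1 - 2 powr (- s)))))"
proof -
  let ?L = "lebesgue :: (real^'n) measure"
  define c where "c = unit_ball_vol N"
  have c0: "0 < c" by (simp add: c_def N_def)
  have N1: "1 \<le> N" by (simp add: N_def Suc_le_eq)
  define A where "A j = 2 powr ((real j + 1) * (N - 1 + s))" for j :: nat
  define B where "B j = 2 powr (- (real j * (N + s)))" for j :: nat
  let ?f = "\<lambda>j y. ennreal (A j) * indicator (cball x ((1/2)^j)) y + ennreal (B j) * indicator (cball x (2^(Suc j))) y"
  have pt: "ennreal (radial_majorant N s (norm (x - y))) \<le> suminf (\<lambda>j. ?f j y)" for y
  proof -
    define \<tau> where "\<tau> = norm (x - y)"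
    consider "\<tau> = 0" | "0 < \<tau>" "\<tau> \<le> 1" | "1 < \<tau>" using norm_ge_zero[of "x - y"] unfolding \<tau>_def by linarith
    then have "\<exists>j. ennreal (radial_majorant N s \<tau>) \<le> ?f j y"
    proof cases
      case 1
      then show ?thesis by (simp add: radial_majorant_def)
    next
      case 2
      obtain j :: nat where j: "\<tau> \<le> (1/2)^j" "(1/2)^(Suc j) < \<tau>" using exists_dyadic_near[OF 2] by blast
      have "\<tau> powr (1 - s - N) \<le> ((1/2)^(Suc j)) powr (1 - s - N)"
        using j(2) s N1 by (intro powr_mono2') auto
      also have "\<dots> = A j"
      proof -
        have "((1/2)^(Suc j)) powr (1 - s - N) = 2 powr (- real (Suc j) * (1 - s - N))"
          unfolding half_power_eq_powr by (rule powr_powr)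
        also have "- real (Suc j) * (1 - s - N) = (real j + 1) * (N - 1 + s)" by (simp add: algebra_simps)
        finally show ?thesis by (simp only: A_def)
      qed
      finally have "radial_majorant N s \<tau> \<le> A j" using 2 by (simp add: radial_majorant_def)
      then have "ennreal (radial_majorant N s \<tau>) \<le> ennreal (A j) * indicator (cball x ((1/2)^j)) y"
        using j(1) by (simp add: \<tau>_def dist_norm ennreal_leI)
      also have "\<dots> \<le> ?f j y" by simp
      finally show ?thesis by blast
    next
      case 3
      obtain j :: nat where j: "2^j \<le> \<tau>" "\<tau> \<le> 2^(Suc j)" using exists_dyadic_far[OF 3] by blast
      have "\<tau> powr (- N - s) \<le> (2^j) powr (- N - s)"
        using j(1) s N1 by (intro powr_mono2') auto
      also have "\<dots> = 2 powr (real j * (- N - s))" by (simp only: powr_realpow[symmetric] zero_less_numeral powr_powr)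
      also have "\<dots> = B j" by (simp add: B_def algebra_simps)
      finally have "radial_majorant N s \<tau> \<le> B j" using 3 by (simp add: radial_majorant_def)
      then have "ennreal (radial_majorant N s \<tau>) \<le> ennreal (B j) * indicator (cball x (2^(Suc j))) y"
        using j(2) by (simp add: \<tau>_def dist_norm ennreal_leI)
      also have "\<dots> \<le> ?f j y" by simp
      finally show ?thesis by blast
    qed
    then obtain j where "ennreal (radial_majorant N s \<tau>) \<le> ?f j y" by blast
    also have "\<dots> \<le> (\<Sum>i<Suc j. ?f i y)" by (intro member_le_sum) auto
    also have "\<dots> \<le> suminf (\<lambda>j. ?f j y)" by (intro sum_le_suminf summableI) auto
    finally show ?thesis by (simp add: \<tau>_def)
  qed
  have cb: "cball x \<rho> \<in> sets ?L" for \<rho> by simp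
  have m: "(\<lambda>y. ennreal \<alpha> * indicator (cball x \<rho>) y) \<in> borel_measurable ?L" for \<alpha> \<rho>
    using cb by (intro borel_measurable_times_ennreal borel_measurable_indicator borel_measurable_const)
  have "(\<integral>\<^sup>+y. ennreal (radial_majorant N s (norm (x - y))) \<partial>?L) \<le> (\<integral>\<^sup>+y. suminf (\<lambda>j. ?f j y) \<partial>?L)"
    by (intro nn_integral_mono pt)
  also have "\<dots> = suminf (\<lambda>j. \<integral>\<^sup>+y. ?f j y \<partial>?L)"
    by (intro nn_integral_suminf borel_measurable_add m)
  also have "\<dots> \<le> suminf (\<lambda>j. ennreal (c * (2 powr N * ((2 powr (s - 1)) ^ j + (2 powr (- s)) ^ j))))"
  proof (intro suminf_le summableI)
    fix j
    have "(\<integral>\<^sup>+y. ?f j y \<partial>?L) = ennreal (A j) * emeasure ?L (cball x ((1/2)^j)) + ennreal (B j) * emeasure ?L (cball x (2^(Suc j)))"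
    proof -
      show ?thesis unfolding nn_integral_add[OF m m] nn_integral_cmult_indicator[OF cb] ..
    qed
    also have "emeasure ?L (cball x ((1/2)^j)) = ennreal (c * ((1/2)^j) ^ CARD('n))"
      using emeasure_lborel_cball[of "(1/2)^j" x] by (simp add: c_def N_def)
    also have "emeasure ?L (cball x (2^(Suc j))) = ennreal (c * (2^(Suc j)) ^ CARD('n))"
      using emeasure_lborel_cball[of "2^(Suc j)" x] by (simp add: c_def N_def del: power_Suc)
    also have "ennreal (A j) * ennreal (c * ((1/2)^j) ^ CARD('n)) + ennreal (B j) * ennreal (c * (2^(Suc j)) ^ CARD('n))
      = ennreal (A j * (c * ((1/2)^j) ^ CARD('n)) + B j * (c * (2^(Suc j)) ^ CARD('n)))"
    proof -
      have *: "ennreal a * ennreal b + ennreal a' * ennreal b' = ennreal (a * b + a' * b')"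
        if "0 \<le> a" "0 \<le> b" "0 \<le> a'" "0 \<le> b'" for a b a' b' :: real
        using that by (simp add: ennreal_mult)
      show ?thesis using c0 by (intro *) (auto simp: A_def B_def)
    qed
    also have le: "ennreal (A j * (c * ((1/2)^j) ^ CARD('n)) + B j * (c * (2^(Suc j)) ^ CARD('n))) \<le> ennreal (c * (2 powr N * ((2 powr (s - 1)) ^ j + (2 powr (- s)) ^ j)))"
    proof -
      have 1: "(((1/2)^j) ^ CARD('n) :: real) = 2 powr (- (real j * N))"
        unfolding half_power_eq_powr by (subst powr_power) (auto simp: N_def mult.commute)
      have 2: "((2^(Suc j)) ^ CARD('n) :: real) = 2 powr ((real j + 1) * N)"
      proof -
        have "((2^(Suc j)) ^ CARD('n) :: real) = 2 ^ (Suc j * CARD('n))" by (rule power_mult[symmetric])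
        also have "\<dots> = 2 powr (real (Suc j * CARD('n)))" by (rule powr_realpow[symmetric]) simp
        also have "real (Suc j * CARD('n)) = (real j + 1) * N" by (simp add: N_def algebra_simps)
        finally show ?thesis .
      qed
      have 3: "(2 powr r) ^ j = 2 powr (r * real j)" for r :: real
        by (subst powr_power) (auto simp: mult.commute)
      have "A j * 2 powr (- (real j * N)) = 2 powr (N - 1 + s) * 2 powr ((s - 1) * real j)"
        by (simp add: A_def powr_add[symmetric] algebra_simps)
      also have "\<dots> \<le> 2 powr N * 2 powr ((s - 1) * real j)" using s by (intro mult_right_mono powr_mono) auto
      finally have a: "A j * 2 powr (- (real j * N)) \<le> 2 powr N * (2 powr (s - 1)) ^ j" by (simp add: 3)
      have "B j * 2 powr ((real j + 1) * N) = 2 powr N * 2 powr (- s * real j)"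
        by (simp add: B_def powr_add[symmetric] algebra_simps)
      then have b: "B j * 2 powr ((real j + 1) * N) = 2 powr N * (2 powr (- s)) ^ j" by (simp add: 3)
      have "c * (A j * 2 powr (- (real j * N)) + B j * 2 powr ((real j + 1) * N)) \<le> c * (2 powr N * (2 powr (s - 1)) ^ j + 2 powr N * (2 powr (- s)) ^ j)"
        using a b c0 by (intro mult_left_mono) auto
      then show ?thesis unfolding 1 2 by (intro ennreal_leI) (simp add: algebra_simps)
    qed
    finally show "(\<integral>\<^sup>+y. ?f j y \<partial>?L) \<le> ennreal (c * (2 powr N * ((2 powr (s - 1)) ^ j + (2 powr (- s)) ^ j)))" .
  qed
  also have "\<dots> = ennreal (c * (2 powr N * (1 / (1 - 2 powr (s - 1)) + 1 / (1 - 2 powr (- s)))))"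
  proof (rule suminf_ennreal_eq)
    have "2 powr (s - 1) < (1::real)" "2 powr (- s) < (1::real)" using s by (auto intro!: powr_less_one)
    then show "(\<lambda>j. c * (2 powr N * ((2 powr (s - 1)) ^ j + (2 powr (- s)) ^ j))) sums (c * (2 powr N * (1 / (1 - 2 powr (s - 1)) + 1 / (1 - 2 powr (- s)))))"
      by (intro sums_mult sums_add geometric_sums) auto
  qed (use c0 in auto)
  finally show ?thesis by (simp add: c_def)
qed

definition tent :: "real^'n \<Rightarrow> real \<Rightarrow> real^'n \<Rightarrow> real" where
  "tent a r x = max (r - dist x a) 0"

lemma tent_measurable: "tent a r \<in> borel_measurable lebesgue"
proof -
  have "continuous_on UNIV (tent a r)" unfolding tent_def by (intro continuous_intros)
  then have "tent a r \<in> borel_measurable borel" by (rule borel_measurable_continuous_onI)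
  then show ?thesis by (intro measurable_completion) simp
qed

lemma tent_bounds: "0 \<le> tent a r x" "0 \<le> r \<Longrightarrow> tent a r x \<le> r" "x \<notin> ball a r \<Longrightarrow> tent a r x = 0"
  by (auto simp: tent_def dist_commute)

lemma tent_lipschitz: "\<bar>tent a r x - tent a r y\<bar> \<le> norm (x - y)"
  using dist_triangle[of x a y] dist_triangle[of y a x] by (auto simp: tent_def dist_norm norm_minus_commute max_def)

context frac_space
begin

text \<open>A tent is Lipschitz with constant \<open>1\<close> and takes values in \<open>[0,1]\<close>, so its differences are at most \<open>min(|x - y|, 1)\<close>, and they
  vanish unless one of the points lies in the ball. The double integral is therefore at most twice the measure of the ball times
  the integral of \<open>radial_majorant\<close>.\<close>

lemma tent_X:
  assumes s1: "s < 1" and r: "0 < r" "r \<le> 1" and sub: "ball a r \<subseteq> \<Omega>"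
  shows "tent a r \<in> X"
proof (rule XI)
  let ?L = "lebesgue :: (real^'n) measure" and ?N = "real CARD('n)"
  let ?P = "?L \<Otimes>\<^sub>M ?L"
  have [measurable]: "tent a r \<in> borel_measurable ?L" by (rule tent_measurable)
  have B [measurable]: "ball a r \<in> sets ?L" by simp
  have fB: "emeasure ?L (ball a r) < \<infinity>" using emeasure_bounded_finite[of "ball a r"] by simp
  show "AE x in ?L. x \<notin> \<Omega> \<longrightarrow> tent a r x = 0" using sub tent_bounds(3)[of _ a r] by (intro AE_I2) blast
  have t1: "\<bar>tent a r x\<bar> \<le> 1" for x using tent_bounds[where r = r and a = a and x = x] r by auto
  show "L.fin (tent a r)"
    unfolding L.fin_def
  proof
    show "integrable ?L (\<lambda>x. \<bar>tent a r x\<bar> powr p (x, x) * 1)"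
    proof (rule Bochner_Integration.integrable_bound)
      show "integrable ?L (indicator (ball a r) :: _ \<Rightarrow> real)" using fB by (simp add: integrable_indicator_iff)
      have "\<bar>tent a r x\<bar> powr p (x, x) \<le> indicator (ball a r) x" for x
      proof (cases "x \<in> ball a r")
        case True
        then show ?thesis using t1[of x] p1[of "(x, x)"] by (auto intro: powr_le1)
      next
        case False
        then show ?thesis using tent_bounds(3)[OF False] by simp
      qed
      then show "AE x in ?L. norm (\<bar>tent a r x\<bar> powr p (x, x) * 1) \<le> norm (indicator (ball a r) x :: real)"
        by (intro AE_I2) simp
    qed measurable
  qed (rule tent_measurable)
  define \<phi> where "\<phi> z = radial_majorant ?N s (norm (fst z - snd z))" for z :: "(real^'n) \<times> (real^'n)"
  have [measurable]: "\<phi> \<in> borel_measurable ?P" unfolding \<phi>_def radial_majorant_def by measurable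
  define C where "C = unit_ball_vol ?N * (2 powr ?N * (1 / (1 - 2 powr (s - 1)) + 1 / (1 - 2 powr (- s))))"
  have pt: "\<bar>diff (tent a r) z\<bar> powr p z * kern z \<le> \<phi> z * (indicator (ball a r) (fst z) + indicator (ball a r) (snd z))" for z
  proof (cases "diff (tent a r) z = 0")
    case True
    have "0 \<le> \<phi> z" by (simp add: \<phi>_def radial_majorant_def)
    then show ?thesis using True by simp
  next
    case False
    define \<tau> where "\<tau> = norm (fst z - snd z)"
    have tau: "0 < \<tau>" using False by (auto simp: \<tau>_def diff_def)
    have d1: "\<bar>diff (tent a r) z\<bar> \<le> \<tau>" unfolding diff_def \<tau>_def by (rule tent_lipschitz)
    have d2: "\<bar>diff (tent a r) z\<bar> \<le> 1"
      using t1[of "fst z"] t1[of "snd z"] tent_bounds(1)[of a r "fst z"] tent_bounds(1)[of a r "snd z"] unfolding diff_def by linarith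
    have "fst z \<in> ball a r \<or> snd z \<in> ball a r" 
    proof (rule ccontr)
      assume "\<not> ?thesis"
      then have "tent a r (fst z) = 0" "tent a r (snd z) = 0" using tent_bounds(3) by blast+
      then show False using False by (simp add: diff_def)
    qed
    then have ge: "1 \<le> (indicator (ball a r) (fst z) + indicator (ball a r) (snd z) :: real)" by (auto simp: indicator_def)
    have "\<bar>diff (tent a r) z\<bar> powr p z * kern z \<le> \<phi> z"
    proof (cases "\<tau> \<le> 1")
      case True
      have "\<bar>diff (tent a r) z\<bar> powr p z * kern z \<le> \<tau> powr p z * (1 / \<tau> powr (?N + s * p z))"
        unfolding kern_def \<tau>_def[symmetric] using d1 p1[of z] by (intro mult_right_mono powr_mono2) auto
      also have "\<dots> = \<tau> powr ((1 - s) * p z - ?N)"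
        using tau by (simp add: powr_diff[symmetric] algebra_simps)
      also have "\<dots> \<le> \<tau> powr (1 - s - ?N)"
      proof (rule powr_mono')
        have "(1 - s) * 1 \<le> (1 - s) * p z" using s1 p1[of z] by (intro mult_left_mono) auto
        then show "1 - s - ?N \<le> (1 - s) * p z - ?N" by simp
      qed (use tau True in auto)
      finally show ?thesis using tau True by (simp add: \<phi>_def radial_majorant_def \<tau>_def[symmetric])
    next
      case False
      have "\<bar>diff (tent a r) z\<bar> powr p z * kern z \<le> 1 * (1 / \<tau> powr (?N + s * p z))"
        unfolding kern_def \<tau>_def[symmetric] using d2 p1[of z] by (intro mult_right_mono powr_le1) auto
      also have "\<dots> = \<tau> powr (- (?N + s * p z))" by (simp only: powr_minus_divide mult_1)
      also have "\<dots> \<le> \<tau> powr (- ?N - s)"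
      proof (rule powr_mono)
        have "s * 1 \<le> s * p z" using s p1[of z] by (intro mult_left_mono) auto
        then show "- (?N + s * p z) \<le> - ?N - s" by simp
      qed (use False in auto)
      finally show ?thesis using tau False by (simp add: \<phi>_def radial_majorant_def \<tau>_def[symmetric])
    qed
    also have "\<dots> = \<phi> z * 1" by simp
    also have "\<dots> \<le> \<phi> z * (indicator (ball a r) (fst z) + indicator (ball a r) (snd z))"
      using ge by (intro mult_left_mono) (auto simp: \<phi>_def radial_majorant_def)
    finally show ?thesis .
  qed
  have [measurable]: "(\<lambda>z. indicator (ball a r) (fst z) :: ennreal) \<in> borel_measurable ?P" "(\<lambda>z. indicator (ball a r) (snd z) :: ennreal) \<in> borel_measurable ?P"
    using B by (auto intro!: measurable_compose[OF measurable_fst] measurable_compose[OF measurable_snd] simp del: sets_completionI_sets)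
  have i1: "(\<integral>\<^sup>+z. ennreal (\<phi> z) * indicator (ball a r) (fst z) \<partial>?P) \<le> ennreal C * emeasure ?L (ball a r)"
  proof -
    have "(\<integral>\<^sup>+z. ennreal (\<phi> z) * indicator (ball a r) (fst z) \<partial>?P) = (\<integral>\<^sup>+x. \<integral>\<^sup>+y. ennreal (\<phi> (x, y)) * indicator (ball a r) x \<partial>?L \<partial>?L)"
      by (subst lebesgue.nn_integral_fst[symmetric]) auto
    also have "\<dots> \<le> (\<integral>\<^sup>+x. ennreal C * indicator (ball a r) x \<partial>?L)"
    proof (rule nn_integral_mono)
      fix x
      show "(\<integral>\<^sup>+y. ennreal (\<phi> (x, y)) * indicator (ball a r) x \<partial>?L) \<le> ennreal C * indicator (ball a r) x"
        using radial_majorant_integral[OF s s1, of x] by (cases "x \<in> ball a r") (auto simp: \<phi>_def C_def)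
    qed
    also have "\<dots> = ennreal C * emeasure ?L (ball a r)" by (rule nn_integral_cmult_indicator[OF B])
    finally show ?thesis .
  qed
  have i2: "(\<integral>\<^sup>+z. ennreal (\<phi> z) * indicator (ball a r) (snd z) \<partial>?P) \<le> ennreal C * emeasure ?L (ball a r)"
  proof -
    have "(\<integral>\<^sup>+z. ennreal (\<phi> z) * indicator (ball a r) (snd z) \<partial>?P) = (\<integral>\<^sup>+y. \<integral>\<^sup>+x. ennreal (\<phi> (x, y)) * indicator (ball a r) y \<partial>?L \<partial>?L)"
      by (subst lebesgue_pair.nn_integral_snd[symmetric]) auto
    also have "\<dots> \<le> (\<integral>\<^sup>+y. ennreal C * indicator (ball a r) y \<partial>?L)"
    proof (rule nn_integral_mono)
      fix y
      show "(\<integral>\<^sup>+x. ennreal (\<phi> (x, y)) * indicator (ball a r) y \<partial>?L) \<le> ennreal C * indicator (ball a r) y"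
        using radial_majorant_integral[OF s s1, of y] by (cases "y \<in> ball a r") (auto simp: \<phi>_def C_def norm_minus_commute)
    qed
    also have "\<dots> = ennreal C * emeasure ?L (ball a r)" by (rule nn_integral_cmult_indicator[OF B])
    finally show ?thesis .
  qed
  have "(\<integral>\<^sup>+z. ennreal (\<bar>diff (tent a r) z\<bar> powr p z * kern z) \<partial>?P)
    \<le> (\<integral>\<^sup>+z. ennreal (\<phi> z) * indicator (ball a r) (fst z) + ennreal (\<phi> z) * indicator (ball a r) (snd z) \<partial>?P)"
  proof (rule nn_integral_mono)
    fix z
    have "ennreal (\<bar>diff (tent a r) z\<bar> powr p z * kern z) \<le> ennreal (\<phi> z * (indicator (ball a r) (fst z) + indicator (ball a r) (snd z)))"
      by (rule ennreal_leI[OF pt])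
    also have "\<dots> = ennreal (\<phi> z) * indicator (ball a r) (fst z) + ennreal (\<phi> z) * indicator (ball a r) (snd z)"
      by (auto simp: indicator_def \<phi>_def radial_majorant_def ennreal_plus distrib_left simp flip: ennreal_plus)
    finally show "ennreal (\<bar>diff (tent a r) z\<bar> powr p z * kern z) \<le> ennreal (\<phi> z) * indicator (ball a r) (fst z) + ennreal (\<phi> z) * indicator (ball a r) (snd z)" .
  qed
  also have "\<dots> = (\<integral>\<^sup>+z. ennreal (\<phi> z) * indicator (ball a r) (fst z) \<partial>?P) + (\<integral>\<^sup>+z. ennreal (\<phi> z) * indicator (ball a r) (snd z) \<partial>?P)"
    by (rule nn_integral_add) measurable
  also have "\<dots> \<le> ennreal C * emeasure ?L (ball a r) + ennreal C * emeasure ?L (ball a r)"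
    by (intro add_mono i1 i2)
  also have "\<dots> < \<infinity>" using fB by (simp add: ennreal_mult_less_top)
  finally have fin: "(\<integral>\<^sup>+z. ennreal (\<bar>diff (tent a r) z\<bar> powr p z * kern z) \<partial>?P) < \<infinity>" .
  show "G.fin (diff (tent a r))"
    unfolding G.fin_def
  proof
    show "integrable ?P (\<lambda>z. \<bar>diff (tent a r) z\<bar> powr p z * kern z)"
      using fin by (intro integrableI_nonneg) (auto simp: kern_nonneg)
  qed measurable
qed

end

lemma disjoint_balls_in_open:
  fixes \<Omega> :: "(real^'n) set"
  assumes "open \<Omega>" "\<Omega> \<noteq> {}"
  shows "\<exists>a r. 0 < r \<and> r * real (Suc k) \<le> 1 \<and> (\<forall>i\<le>k. ball (a i) r \<subseteq> \<Omega>) \<and> (\<forall>i\<le>k. \<forall>j\<le>k. i \<noteq> j \<longrightarrow> ball (a i) r \<inter> ball (a j) r = {})"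
proof -
  obtain x0 where "x0 \<in> \<Omega>" using assms(2) by blast
  then obtain R where R: "0 < R" "ball x0 R \<subseteq> \<Omega>" using assms(1) by (meson open_contains_ball)
  define R' where "R' = min R 1"
  have R': "0 < R'" "R' \<le> 1" "ball x0 R' \<subseteq> \<Omega>" using R by (auto simp: R'_def)
  define r where "r = R' / (8 * real (Suc k))"
  have r: "0 < r" using R' by (simp add: r_def)
  have rk: "r * real (Suc k) = R' / 8" by (simp add: r_def del: of_nat_Suc)
  obtain e :: "real^'n" where e: "norm e = 1" using vector_choose_size[of 1] by auto
  define a where "a i = x0 + (4 * r * real i) *\<^sub>R e" for i :: nat
  have "ball (a i) r \<subseteq> \<Omega>" if "i \<le> k" for i
  proof -
    have "4 * r * real i \<le> 4 * r * real k" using that r by (intro mult_left_mono) auto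
    also have "\<dots> \<le> 4 * (r * real (Suc k))" using r by (simp add: algebra_simps)
    finally have "4 * r * real i \<le> R' / 2" unfolding rk by simp
    moreover have "dist (a i) x0 = 4 * r * real i" using r e by (simp add: a_def dist_norm)
    ultimately have "dist (a i) x0 \<le> R' / 2" by simp
    moreover have "r \<le> R' / 8"
    proof -
      have "r * 1 \<le> r * real (Suc k)" using r by (intro mult_left_mono) auto
      then show ?thesis unfolding rk by simp
    qed
    ultimately have "ball (a i) r \<subseteq> ball x0 R'" using R'(1) by (intro ball_subset_ball_iff[THEN iffD2]) linarith
    then show ?thesis using R'(3) by blast
  qed
  moreover have "ball (a i) r \<inter> ball (a j) r = {}" if "i \<noteq> j" for i j
  proof (rule disjoint_ballI)
    have "a i - a j = (4 * r * (real i - real j)) *\<^sub>R e" by (simp add: a_def algebra_simps)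
    then have dd: "dist (a i) (a j) = 4 * r * \<bar>real i - real j\<bar>" using e r by (simp add: dist_norm abs_mult)
    have "1 \<le> \<bar>real i - real j\<bar>" using that by linarith
    then have "4 * r * 1 \<le> 4 * r * \<bar>real i - real j\<bar>" by (intro mult_left_mono) (use r in auto)
    then have "4 * r * 1 \<le> dist (a i) (a j)" unfolding dd by simp
    then show "r + r \<le> dist (a i) (a j)" using r by linarith
  qed
  moreover have "r * real (Suc k) \<le> 1" unfolding rk using R' by simp
  ultimately show ?thesis using r by blast
qed

context truncated
begin

text \<open>The sphere is spanned by \<open>k + 1\<close> tents with disjoint supports and scaled by a small \<open>\<tau>\<close>. On it the energy is at most
  \<open>\<tau>\<close> to the power \<open>p\<^sup>-\<close> times a constant. A vector of the sphere has a coordinate of modulus at least \<open>1/(k+1)\<close>, so its combination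
  is bounded below where the corresponding tent exceeds half of its height, and \<open>Phi\<close> is at least an arbitrarily large multiple of the
  same power of \<open>\<tau>\<close>.\<close>

theorem negative_spheres:
  assumes s1: "s < 1" and ne: "\<Omega> \<noteq> {}"
    and superlin: "\<And>M. \<exists>\<delta>>0. AE x in lebesgue. x \<in> \<Omega> \<longrightarrow> (\<forall>t. \<bar>t\<bar> < \<delta> \<longrightarrow> M * \<bar>t\<bar> powr pl \<le> Gp x t)"
  shows "\<exists>b \<eta>. 0 < \<eta> \<and> (\<forall>i. b i \<in> X) \<and> (\<forall>y\<in>unit_sphere k. J (comb b (Suc k) y) \<le> - \<eta>)"
proof -
  obtain a r where ar: "0 < r \<and> r * real (Suc k) \<le> 1 \<and> (\<forall>i\<le>k. ball (a i) r \<subseteq> \<Omega>) \<and> (\<forall>i\<le>k. \<forall>j\<le>k. i \<noteq> j \<longrightarrow> ball (a i) r \<inter> ball (a j) r = {})"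
    using disjoint_balls_in_open[OF open_Omega ne, of k] by (elim exE)
  have r: "0 < r" "r * real (Suc k) \<le> 1" by (rule conjunct1[OF ar], rule conjunct1[OF conjunct2[OF ar]])
  have sub: "ball (a i) r \<subseteq> \<Omega>" if "i \<le> k" for i 
    using ar[THEN conjunct2, THEN conjunct2, THEN conjunct1, rule_format, OF that] .
  have disj: "ball (a i) r \<inter> ball (a j) r = {}" if "i \<le> k" "j \<le> k" "i \<noteq> j" for i j
    using ar[THEN conjunct2, THEN conjunct2, THEN conjunct2, rule_format, OF that] .
  have "r * 1 \<le> r * real (Suc k)" using r by (intro mult_left_mono) auto
  then have r1: "r \<le> 1" using r(2) by linarith
  define w where "w i = (if i \<le> k then tent (a i) r else (\<lambda>_. 0))" for i
  have wX: "w i \<in> X" for i using tent_X[OF s1 r(1) r1 sub] by (simp add: w_def)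
  let ?v = "\<lambda>y. comb w (Suc k) y"
  have vX: "?v y \<in> X" for y by (rule X_comb) (rule wX)
  have vb: "\<bar>?v y x\<bar> \<le> 1" if y: "y \<in> unit_sphere k" for y x
  proof -
    have "\<bar>?v y x\<bar> \<le> (\<Sum>i<Suc k. \<bar>y i * w i x\<bar>)" unfolding comb_def by (rule sum_abs)
    also have "\<dots> \<le> (\<Sum>i<Suc k. r)"
    proof (rule sum_mono)
      fix i assume "i \<in> {..<Suc k}"
      have "\<bar>w i x\<bar> \<le> r" using r(1) tent_bounds(1)[of "a i" r x] tent_bounds(2)[of r "a i" x] by (simp add: w_def)
      then have "\<bar>y i\<bar> * \<bar>w i x\<bar> \<le> 1 * r" using abs_unit_sphere_le[OF y] by (intro mult_mono) auto
      then show "\<bar>y i * w i x\<bar> \<le> r" by (simp add: abs_mult)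
    qed
    also have "\<dots> = r * real (Suc k)" by simp
    finally show ?thesis using r(2) by linarith
  qed
  obtain K where K: "\<And>y. y \<in> unit_sphere k \<Longrightarrow> E (?v y) \<le> K"
  proof -
    have "continuous_on (coords_below (Suc k)) (\<lambda>c. E (?v c))"
      by (rule seq_continuous_fun) (rule tendsto_E_comb(1)[OF wX])
    then have "continuous_on (unit_sphere k) (\<lambda>c. E (?v c))"
      by (rule continuous_on_subset) (auto simp: unit_sphere_def coords_below_def)
    then have "bounded ((\<lambda>c. E (?v c)) ` unit_sphere k)"
      by (intro compact_imp_bounded compact_continuous_image compact_unit_sphere)
    then obtain B where "\<forall>y\<in>unit_sphere k. \<bar>E (?v y)\<bar> \<le> B" by (auto simp: bounded_iff)
    then show thesis by (intro that[of B]) (auto simp: abs_le_iff)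
  qed
  define \<beta> where "\<beta> = unit_ball_vol (real CARD('n)) * (r / 2) ^ CARD('n)"
  have be: "0 < \<beta>" using r by (simp add: \<beta>_def)
  define h where "h = r / (2 * real (Suc k))"
  have h: "0 < h" using r by (simp add: h_def)
  define c0 where "c0 = h powr pl * \<beta>"
  have c0: "0 < c0" using h be by (simp add: c0_def)
  \<comment> \<open>\<open>c0\<close> measures what one half tent contributes to \<open>Phi\<close>; with this \<open>M\<close> the contribution exceeds the energy bound \<open>K\<close> by \<open>1\<close>\<close>
  define M where "M = (K + 1) / c0"
  obtain \<delta> where \<delta>: "0 < \<delta>" "AE x in lebesgue. x \<in> \<Omega> \<longrightarrow> (\<forall>t. \<bar>t\<bar> < \<delta> \<longrightarrow> max M 0 * \<bar>t\<bar> powr pl \<le> Gp x t)"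
    using superlin[of "max M 0"] by blast
  define \<tau> where "\<tau> = min 1 (\<delta> / 2)"
  have \<tau>: "0 < \<tau>" "\<tau> \<le> 1" "\<tau> < \<delta>" using \<delta>(1) by (auto simp: \<tau>_def)
  have main: "J (\<lambda>x. \<tau> * ?v y x) \<le> - (\<tau> powr pl)" if y: "y \<in> unit_sphere k" for y
  proof -
    have iv: "integrable lebesgue (\<lambda>x. \<tau> * ?v y x)" by (intro X_integrable X_scale vX)
    have "\<exists>i\<le>k. 1 / real (Suc k) \<le> \<bar>y i\<bar>"
    proof (rule ccontr)
      assume "\<not> ?thesis"
      then have *: "\<bar>y i\<bar> < 1 / real (Suc k)" if "i \<le> k" for i using that by force
      have "(\<Sum>i\<le>k. (y i)\<^sup>2) < (\<Sum>i\<le>k. 1 / real (Suc k))"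
      proof (intro sum_strict_mono)
        fix i assume "i \<in> {..k}"
        have "(y i)\<^sup>2 = \<bar>y i\<bar> * \<bar>y i\<bar>" by (simp add: power2_eq_square)
        also have "\<dots> \<le> 1 * \<bar>y i\<bar>" by (intro mult_right_mono abs_unit_sphere_le[OF y]) auto
        finally show "(y i)\<^sup>2 < 1 / real (Suc k)" using *[of i] \<open>i \<in> {..k}\<close> by simp
      qed auto
      then show False using y by (simp add: unit_sphere_def)
    qed
    then obtain i where i: "i \<le> k" "1 / real (Suc k) \<le> \<bar>y i\<bar>" by blast
    let ?B = "ball (a i) (r / 2)"
    have Bs: "?B \<in> sets lebesgue" by simp
    have mB: "measure lebesgue ?B = \<beta>" "emeasure lebesgue ?B < \<infinity>"
      using r emeasure_bounded_finite[of ?B] by (simp_all add: content_ball \<beta>_def)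
    have low: "h \<le> \<bar>?v y x\<bar>" if x: "x \<in> ?B" for x
    proof -
      have xi: "x \<in> ball (a i) r" using x r by auto
      have "w j x = 0" if "j \<in> {..<Suc k} - {i}" for j
      proof -
        have "x \<notin> ball (a j) r" using disj[of i j] i(1) that xi by auto
        then show ?thesis using tent_bounds(3) by (auto simp: w_def)
      qed
      then have "?v y x = y i * w i x"
        unfolding comb_def using i(1) by (subst sum.remove[of _ i]) auto
      moreover have "r / 2 \<le> w i x" using x i(1) by (auto simp: w_def tent_def dist_commute max_def)
      ultimately have "\<bar>?v y x\<bar> = \<bar>y i\<bar> * w i x" using r by (simp add: abs_mult)
      moreover have "h = 1 / real (Suc k) * (r / 2)" by (simp add: h_def)
      moreover have "1 / real (Suc k) * (r / 2) \<le> \<bar>y i\<bar> * w i x"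
        using i(2) \<open>r / 2 \<le> w i x\<close> r by (intro mult_mono) auto
      ultimately show ?thesis by simp
    qed
    have pt: "AE x in lebesgue. \<tau> powr pl * (max M 0 * h powr pl) * indicator ?B x \<le> Gp x (\<tau> * ?v y x)"
      using \<delta>(2)
    proof eventually_elim
      case (elim x)
      have "\<tau> * \<bar>?v y x\<bar> \<le> \<tau> * 1" using \<tau>(1) vb[OF y] by (intro mult_left_mono) auto
      moreover have "\<bar>\<tau> * ?v y x\<bar> = \<tau> * \<bar>?v y x\<bar>" using \<tau>(1) by (simp add: abs_mult)
      ultimately have lt: "\<bar>\<tau> * ?v y x\<bar> < \<delta>" using \<tau>(3) by linarith
      show ?case
      proof (cases "x \<in> \<Omega>")
        case True
        then have G: "max M 0 * \<bar>\<tau> * ?v y x\<bar> powr pl \<le> Gp x (\<tau> * ?v y x)" using elim lt by blast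
        have "\<tau> powr pl * (max M 0 * h powr pl) * indicator ?B x \<le> max M 0 * \<bar>\<tau> * ?v y x\<bar> powr pl"
        proof (cases "x \<in> ?B")
          case True
          have "h powr pl \<le> \<bar>?v y x\<bar> powr pl" using low[OF True] h pl by (intro powr_mono2) auto
          then have "(\<tau> powr pl * max M 0) * h powr pl \<le> (\<tau> powr pl * max M 0) * \<bar>?v y x\<bar> powr pl"
            by (intro mult_left_mono) auto
          then show ?thesis using True \<tau>(1) by (simp add: abs_mult powr_mult mult_ac)
        qed simp
        then show ?thesis using G by linarith
      next
        case False
        moreover have "?B \<subseteq> \<Omega>" using sub[OF i(1)] r(1) subset_ball[of "r/2" r "a i"] by auto
        ultimately show ?thesis by (auto simp: Gp_out indicator_def)
      qed
    qed
    have "\<tau> powr pl * (max M 0 * h powr pl) * \<beta> = (\<integral>x. \<tau> powr pl * (max M 0 * h powr pl) * indicator ?B x \<partial>lebesgue)"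
      using mB(1) by simp
    also have "\<dots> \<le> Phi (\<lambda>x. \<tau> * ?v y x)"
      unfolding Phi_def
    proof (rule integral_mono_AE)
      show "integrable lebesgue (\<lambda>x. \<tau> powr pl * (max M 0 * h powr pl) * indicator ?B x :: real)"
        using mB(2) by (intro integrable_mult_right) (simp add: integrable_indicator_iff)
    qed (use pt Gp_integrable[OF iv] in auto)
    finally have P: "\<tau> powr pl * (max M 0 * c0) \<le> Phi (\<lambda>x. \<tau> * ?v y x)" by (simp add: c0_def mult_ac)
    have "M * c0 = K + 1" using c0 by (simp add: M_def)
    moreover have "M * c0 \<le> max M 0 * c0" using c0 by (intro mult_right_mono) auto
    ultimately have "\<tau> powr pl * (K + 1) \<le> \<tau> powr pl * (max M 0 * c0)" by (intro mult_left_mono) auto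
    moreover have "E (\<lambda>x. \<tau> * ?v y x) \<le> \<tau> powr pl * K"
      using E_scale_le[OF vX, of \<tau> y] \<tau> K[OF y] by (smt (verit) mult_left_mono powr_ge_zero)
    ultimately show ?thesis using P by (simp add: J_def distrib_left)
  qed
  show ?thesis
  proof (intro exI[of _ "\<lambda>i x. \<tau> * w i x"] exI[of _ "\<tau> powr pl"] conjI allI ballI)
    show "0 < \<tau> powr pl" using \<tau> by simp
    show "(\<lambda>x. \<tau> * w i x) \<in> X" for i by (intro X_scale wX)
    fix y assume y: "y \<in> unit_sphere k"
    have "comb (\<lambda>i x. \<tau> * w i x) (Suc k) y = (\<lambda>x. \<tau> * ?v y x)"
      unfolding comb_def sum_distrib_left by (intro ext sum.cong) auto
    then show "J (comb (\<lambda>i x. \<tau> * w i x) (Suc k) y) \<le> - (\<tau> powr pl)" using main[OF y] by simp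
  qed
qed

end

section \<open>From the truncated problem to the original one\<close>

lemma nondecreasing_from_zero:
  fixes F f :: "real \<Rightarrow> real"
  assumes t: "0 \<le> t" and F: "\<And>r. (F has_real_derivative f r) (at r)" and f: "\<And>r. 0 < r \<Longrightarrow> r < t \<Longrightarrow> 0 \<le> f r"
  shows "F 0 \<le> F t"
proof (rule DERIV_nonneg_imp_increasing_open[OF t])
  show "\<exists>y. (F has_real_derivative y) (at r) \<and> 0 \<le> y" if "0 < r" "r < t" for r
    using F f that by blast
  show "continuous_on {0..t} F"
    by (intro continuous_at_imp_continuous_on ballI DERIV_isCont[OF F])
qed

definition cutoff :: "real \<Rightarrow> real \<Rightarrow> real" where
  "cutoff T t = max 0 (min 1 (2 - 2 * \<bar>t\<bar> / T))"

lemma cutoff_props: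
  assumes "0 < T"
  shows "0 \<le> cutoff T t" "cutoff T t \<le> 1" "cutoff T (- t) = cutoff T t"
    "\<bar>t\<bar> \<le> T / 2 \<Longrightarrow> cutoff T t = 1" "T \<le> \<bar>t\<bar> \<Longrightarrow> cutoff T t = 0"
    "\<bar>r\<bar> \<le> \<bar>t\<bar> \<Longrightarrow> cutoff T t \<le> cutoff T r" "\<bar>t\<bar> < T \<Longrightarrow> 0 < cutoff T t"
proof -
  show "\<bar>t\<bar> \<le> T / 2 \<Longrightarrow> cutoff T t = 1" "T \<le> \<bar>t\<bar> \<Longrightarrow> cutoff T t = 0" "\<bar>t\<bar> < T \<Longrightarrow> 0 < cutoff T t"
    using assms by (auto simp: cutoff_def field_simps max_def min_def)
  show "cutoff T t \<le> cutoff T r" if "\<bar>r\<bar> \<le> \<bar>t\<bar>"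
  proof -
    have "2 - 2 * \<bar>t\<bar> / T \<le> 2 - 2 * \<bar>r\<bar> / T" using that assms by (simp add: divide_right_mono)
    then show ?thesis unfolding cutoff_def by (intro max.mono min.mono) auto
  qed
qed (auto simp: cutoff_def)

lemma cutoff_continuous: "0 < T \<Longrightarrow> continuous_on UNIV (cutoff T)"
  unfolding cutoff_def by (intro continuous_intros) auto

text \<open>Supplies the value at \<open>0\<close>, about which oddness for \<open>0 < |t| < T\<close> is silent.\<close>

lemma odd_near_zero_imp_zero:
  fixes h :: "real \<Rightarrow> real"
  assumes c: "continuous_on UNIV h" and T: "0 < T" and odd: "\<And>t. 0 < \<bar>t\<bar> \<Longrightarrow> \<bar>t\<bar> < T \<Longrightarrow> h (- t) = - h t"
  shows "h 0 = 0"
proof -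
  have x: "(\<lambda>n. T / 2 * (1 / real (Suc n))) \<longlonglongrightarrow> T / 2 * 0" by (intro tendsto_intros LIMSEQ_Suc[OF lim_1_over_n])
  then have x: "(\<lambda>n. T / 2 * (1 / real (Suc n))) \<longlonglongrightarrow> 0" by simp
  have y: "(\<lambda>n. - (T / 2 * (1 / real (Suc n)))) \<longlonglongrightarrow> 0" using tendsto_minus[OF x] by simp
  have "(\<lambda>n. h (T / 2 * (1 / real (Suc n)))) \<longlonglongrightarrow> h 0" by (rule continuous_on_tendsto_compose[OF c x]) auto
  then have 1: "(\<lambda>n. - h (T / 2 * (1 / real (Suc n)))) \<longlonglongrightarrow> - h 0" by (rule tendsto_minus)
  have 2: "(\<lambda>n. h (- (T / 2 * (1 / real (Suc n))))) \<longlonglongrightarrow> h 0" by (rule continuous_on_tendsto_compose[OF c y]) auto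
  have "h (- (T / 2 * (1 / real (Suc n)))) = - h (T / 2 * (1 / real (Suc n)))" for n
  proof (rule odd)
    have "T / 2 * (1 / real (Suc n)) \<le> T / 2 * 1" using T by (intro mult_left_mono) auto
    moreover have "0 \<le> T / 2 * (1 / real (Suc n))" using T by simp
    ultimately show "\<bar>T / 2 * (1 / real (Suc n))\<bar> < T" using T by linarith
  qed (use T in auto)
  then have "h 0 = - h 0" using LIMSEQ_unique[OF 1] 2 by simp
  then show ?thesis by simp
qed

lemma even_primitive:
  assumes c: "continuous_on UNIV (g x)" and odd: "\<And>t. g x (- t) = - g x t"
  shows "primitive g x (- t) = primitive g x t"
proof -
  have d: "(primitive g x has_real_derivative g x t) (at t)" for t
    using primitive_deriv[where f = g and x = x, OF c] .
  have "((\<lambda>t. primitive g x (- t) - primitive g x t) has_real_derivative 0) (at t)" for t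
  proof -
    have "((\<lambda>t. primitive g x (- t)) has_real_derivative g x (- t) * (- 1)) (at t)"
      by (rule DERIV_chain2[OF d]) (auto intro!: derivative_eq_intros)
    from DERIV_diff[OF this d[of t]] show ?thesis by (simp add: odd)
  qed
  then have "primitive g x (- t) - primitive g x t = primitive g x (- 0) - primitive g x 0"
    by (rule DERIV_isconst_all[rule_format]) 
  then show ?thesis by simp
qed

text \<open>Monotonicity of the cutoff \<open>\<theta>\<close> and positivity of \<open>f\<close> give \<open>G(t) \<ge> \<theta>(t) F(t)\<close> for \<open>t > 0\<close>, which proves the claim where \<open>\<theta>(t) > 0\<close>.
  Where \<open>\<theta>(t) = 0\<close> also \<open>g(t) = 0\<close>, and \<open>G\<close> is positive there.\<close>

lemma truncated_subhomogeneous: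
  fixes f g :: "real^'n \<Rightarrow> real \<Rightarrow> real"
  assumes T: "0 < T" and pm: "0 < pm" and fc: "continuous_on UNIV (f x)"
    and g: "\<And>t. g x t = f x t * cutoff T t" and god: "\<And>t. g x (- t) = - g x t"
    and AR: "\<And>t. 0 < \<bar>t\<bar> \<Longrightarrow> \<bar>t\<bar> < T \<Longrightarrow> 0 < pm * primitive f x t - f x t * t"
    and pos: "\<And>t. 0 < t \<Longrightarrow> t < T \<Longrightarrow> 0 < f x t"
    and t: "t \<noteq> 0"
  shows "0 < pm * primitive g x t - g x t * t"
proof -
  have gc: "continuous_on UNIV (g x)"
    unfolding g by (intro continuous_intros fc cutoff_continuous T)
  have dg: "(primitive g x has_real_derivative g x t) (at t)" for t
    using primitive_deriv[where f = g and x = x, OF gc] .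
  have df: "(primitive f x has_real_derivative f x t) (at t)" for t
    using primitive_deriv[where f = f and x = x, OF fc] .
  have small: "0 < pm * primitive g x t - g x t * t" if t: "0 < t" "t < T" for t
  proof -
    have "primitive g x 0 - cutoff T t * primitive f x 0 \<le> primitive g x t - cutoff T t * primitive f x t"
    proof (rule nondecreasing_from_zero[where f = "\<lambda>r. g x r - cutoff T t * f x r"])
      show "((\<lambda>r. primitive g x r - cutoff T t * primitive f x r) has_real_derivative g x r - cutoff T t * f x r) (at r)" for r
        by (intro DERIV_diff DERIV_cmult dg df)
      show "0 \<le> g x r - cutoff T t * f x r" if "0 < r" "r < t" for r
      proof -
        have "cutoff T t \<le> cutoff T r" using that by (intro cutoff_props T) auto
        then have "f x r * cutoff T t \<le> f x r * cutoff T r" using pos[of r] that t by (intro mult_left_mono) auto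
        then show ?thesis by (simp add: g mult.commute)
      qed
    qed (use t in auto)
    then have "pm * (cutoff T t * primitive f x t) \<le> pm * primitive g x t" using pm by (intro mult_left_mono) auto
    moreover have "0 < cutoff T t * (pm * primitive f x t - f x t * t)"
      using t AR[of t] by (intro mult_pos_pos cutoff_props T) auto
    ultimately show ?thesis by (simp add: g algebra_simps)
  qed
  have large: "0 < pm * primitive g x t - g x t * t" if t: "T \<le> t" for t
  proof -
    have "0 < g x (T/2)" using pos[of "T/2"] T by (simp add: g cutoff_props)
    then have "0 < g x (T/2) * (T/2)" using T by simp
    then have "0 < pm * primitive g x (T/2)" using small[of "T/2"] T by simp
    then have h: "0 < primitive g x (T/2)" using pm by (simp add: zero_less_mult_iff)
    have "primitive g x (T/2 + 0) \<le> primitive g x (T/2 + (t - T/2))"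
    proof (rule nondecreasing_from_zero[where F = "\<lambda>r. primitive g x (T/2 + r)" and f = "\<lambda>r. g x (T/2 + r)"])
      fix r
      have "((\<lambda>r. primitive g x (T/2 + r)) has_real_derivative g x (T/2 + r) * 1) (at r)"
        by (rule DERIV_chain2[OF dg]) (auto intro!: derivative_eq_intros)
      then show "((\<lambda>r. primitive g x (T/2 + r)) has_real_derivative g x (T/2 + r)) (at r)" by simp
    next
      show "0 \<le> g x (T/2 + r)" if "0 < r" for r
        using pos[of "T/2 + r"] that T cutoff_props(1,5)[OF T, of "T/2 + r"] by (cases "T/2 + r < T") (auto simp: g)
    qed (use t T in auto)
    then have "0 < primitive g x t" using h by simp
    moreover have "g x t = 0" using t T cutoff_props(5)[OF T, of t] by (simp add: g)
    ultimately show ?thesis using pm by simp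
  qed
  have gpos: "0 < pm * primitive g x t - g x t * t" if "0 < t" for t
    using small[of t] large[of t] that by linarith
  show ?thesis
  proof (cases "0 < t")
    case True
    then show ?thesis by (rule gpos)
  next
    case False
    then have "0 < pm * primitive g x (- t) - g x (- t) * (- t)" using t by (intro gpos) simp
    then show ?thesis using even_primitive[where g = g and x = x, OF gc god, of t] god[of t] by simp
  qed
qed

lemma truncated_superlinear:
  fixes f g :: "real^'n \<Rightarrow> real \<Rightarrow> real"
  assumes T: "0 < T" and pm: "1 < pm" and gc: "continuous_on UNIV (g x)"
    and god: "\<And>t. g x (- t) = - g x t"
    and lower: "\<And>t. 0 < t \<Longrightarrow> t < \<delta> \<Longrightarrow> M * pm * t powr (pm - 1) \<le> g x t"
    and t: "\<bar>t\<bar> < \<delta>"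
  shows "M * \<bar>t\<bar> powr pm \<le> primitive g x t"
proof -
  have dg: "(primitive g x has_real_derivative g x t) (at t)" for t
    using primitive_deriv[where f = g and x = x, OF gc] .
  have *: "M * t powr pm \<le> primitive g x t" if t: "0 \<le> t" "t < \<delta>" for t
  proof -
    have "primitive g x 0 - M * 0 powr pm \<le> primitive g x t - M * t powr pm"
    proof (rule DERIV_nonneg_imp_increasing_open[OF t(1)])
      fix r assume r: "0 < r" "r < t"
      have "((\<lambda>r. primitive g x r - M * r powr pm) has_real_derivative g x r - M * (pm * r powr (pm - 1))) (at r)"
        by (intro DERIV_diff DERIV_cmult dg has_real_derivative_powr r)
      moreover have "0 \<le> g x r - M * (pm * r powr (pm - 1))" using lower[of r] r t by (simp add: mult.assoc)
      ultimately show "\<exists>y. ((\<lambda>r. primitive g x r - M * r powr pm) has_real_derivative y) (at r) \<and> 0 \<le> y" by blast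
    next
      have c1: "continuous_on {0..t} (primitive g x)"
        by (intro continuous_at_imp_continuous_on ballI DERIV_isCont[OF dg])
      have c2: "continuous_on {0..t} (\<lambda>r. r powr pm)" using pm by (intro continuous_on_powr' continuous_intros) auto
      show "continuous_on {0..t} (\<lambda>r. primitive g x r - M * r powr pm)"
        by (intro continuous_on_diff continuous_on_mult_left c1 c2)
    qed
    then show ?thesis by simp
  qed
  show ?thesis
  proof (cases "0 \<le> t")
    case True
    then show ?thesis using *[of t] t by simp
  next
    case False
    then show ?thesis using *[of "- t"] t even_primitive[where g = g and x = x, OF gc god, of t] by simp
  qed
qed

lemma exponent_bounds:
  fixes p :: "'z \<Rightarrow> real"
  assumes "1 < (INF z. ereal (p z))" "(SUP z. ereal (p z)) < ereal B"
  shows "1 < (INF z. p z)" "\<And>z. (INF z. p z) \<le> p z" "\<And>z. p z \<le> B"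
proof -
  obtain c where c: "1 < ereal c" "ereal c < (INF z. ereal (p z))" using ereal_dense2[OF assms(1)] by blast
  have pc: "c \<le> p z" for z
  proof -
    have "ereal c < ereal (p z)" by (rule less_le_trans[OF c(2)]) (rule INF_lower, simp)
    then show ?thesis by simp
  qed
  then have bdd: "bdd_below (range p)" by (intro bdd_belowI2[of _ c]) auto
  show "1 < (INF z. p z)" using c(1) cINF_greatest[of UNIV c p] pc by simp
  show "(INF z. p z) \<le> p z" for z by (intro cINF_lower bdd) simp
  show "p z \<le> B" for z
  proof -
    have "ereal (p z) < ereal B" by (rule le_less_trans[OF _ assms(2)]) (rule SUP_upper, simp)
    then show ?thesis by simp
  qed
qed

lemma C_plus_gt_1: "q \<in> C_plus S \<Longrightarrow> x \<in> S \<Longrightarrow> 1 < q x"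
proof -
  assume "q \<in> C_plus S" "x \<in> S"
  then have "1 < (INF x\<in>S. ereal (q x))" "(INF x\<in>S. ereal (q x)) \<le> ereal (q x)" by (auto simp: C_plus_def intro: INF_lower)
  then have "1 < ereal (q x)" by (rule less_le_trans)
  then show ?thesis by simp
qed

lemma Linf_norm_tendsto_0:
  fixes u :: "nat \<Rightarrow> real^'n \<Rightarrow> real"
  assumes \<Omega>: "open \<Omega>" "\<Omega> \<noteq> {}" and u: "\<And>n. u n \<in> borel_measurable lebesgue"
    and small: "\<And>\<epsilon>. 0 < \<epsilon> \<Longrightarrow> \<forall>\<^sub>F n in sequentially. AE x in lebesgue. \<bar>u n x\<bar> \<le> \<epsilon>"
  shows "(\<lambda>n. Linf_norm \<Omega> (u n)) \<longlonglongrightarrow> 0"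
proof (rule order_tendstoI)
  have [measurable]: "\<Omega> \<in> sets lebesgue" using \<Omega> by auto
  have m: "(\<lambda>x. ereal \<bar>u n x\<bar>) \<in> borel_measurable (lebesgue_on \<Omega>)" for n
    using u[of n] by (intro borel_measurable_ereal borel_measurable_abs measurable_restrict_space1)
  have pos: "0 \<le> Linf_norm \<Omega> (u n)" for n
  proof -
    have "emeasure lebesgue \<Omega> \<noteq> 0"
    proof
      assume "emeasure lebesgue \<Omega> = 0"
      then have "negligible \<Omega>" by (simp add: negligible_iff_null_sets null_sets_def)
      then show False using open_not_negligible[OF \<Omega>] by blast
    qed
    then have "emeasure (lebesgue_on \<Omega>) (space (lebesgue_on \<Omega>)) \<noteq> 0"
      by (simp add: emeasure_restrict_space space_restrict_space)
    then have "esssup (lebesgue_on \<Omega>) (\<lambda>x. 0 :: ereal) = 0" by (rule esssup_const)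
    moreover have "esssup (lebesgue_on \<Omega>) (\<lambda>x. 0 :: ereal) \<le> esssup (lebesgue_on \<Omega>) (\<lambda>x. ereal \<bar>u n x\<bar>)"
      by (rule esssup_mono) auto
    ultimately show ?thesis by (simp add: Linf_norm_def)
  qed
  fix a :: ereal
  show "\<forall>\<^sub>F n in sequentially. a < Linf_norm \<Omega> (u n)" if "a < 0"
    using that pos by (intro always_eventually allI) (rule less_le_trans)
  show "\<forall>\<^sub>F n in sequentially. Linf_norm \<Omega> (u n) < a" if a: "0 < a"
  proof -
    obtain e where e: "0 < ereal e" "ereal e < a" using ereal_dense2[OF a] by blast
    then have "0 < e" by simp
    from small[OF this] show ?thesis
    proof eventually_elim
      case (elim n)
      have "AE x in lebesgue_on \<Omega>. ereal \<bar>u n x\<bar> \<le> ereal e"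
        using elim by (subst AE_restrict_space_iff) (auto elim: eventually_mono)
      then have "Linf_norm \<Omega> (u n) \<le> ereal e" unfolding Linf_norm_def by (intro esssup_I m)
      then show ?case using e(2) by (rule le_less_trans)
    qed
  qed
qed

lemma borel_measurable_lebesgue_AE_eq:
  fixes f g :: "'a::euclidean_space \<Rightarrow> real"
  assumes g: "g \<in> borel_measurable lebesgue" and eq: "AE x in lebesgue. f x = g x"
  shows "f \<in> borel_measurable lebesgue"
proof (rule measurableI)
  fix B :: "real set" assume B: "B \<in> sets borel"
  obtain N where N: "N \<in> null_sets lebesgue" "{x \<in> space lebesgue. \<not> f x = g x} \<subseteq> N"
    using eq unfolding eventually_ae_filter by blast
  have "f -` B \<inter> space lebesgue = (g -` B \<inter> space lebesgue - N) \<union> (f -` B \<inter> N)"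
  proof -
    have fg: "f x = g x" if "x \<notin> N" for x using N(2) that by auto
    show ?thesis
    proof (rule Set.set_eqI)
      fix z show "z \<in> f -` B \<inter> space lebesgue \<longleftrightarrow> z \<in> (g -` B \<inter> space lebesgue - N) \<union> (f -` B \<inter> N)"
        by (cases "z \<in> N") (auto simp: fg)
    qed
  qed
  moreover have "g -` B \<inter> space lebesgue - N \<in> sets lebesgue"
    using measurable_sets[OF g B] N(1) by (intro sets.Diff) auto
  moreover have "f -` B \<inter> N \<in> sets lebesgue"
    using null_sets_completion_subset[of "f -` B \<inter> N" N lborel] N(1) by auto
  ultimately show "f -` B \<inter> space lebesgue \<in> sets lebesgue" by (metis sets.Un)
qed simp

context truncated
begin

text \<open>All integrands are determined almost everywhere by \<open>g\<close> and by the vanishing of \<open>v\<close> outside \<open>\<Omega>\<close>.\<close>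

lemma weak_solution_transfer:
  assumes u: "u \<in> X" and crit: "\<And>v. v \<in> X \<Longrightarrow> dE u v = dPhi u v"
    and agree: "AE x in lebesgue. x \<in> \<Omega> \<longrightarrow> f x (u x) = g x (u x)"
  shows "weak_solution \<Omega> s p f u"
  unfolding weak_solution_def X_eq_frac_sobolev0[symmetric]
proof (intro conjI ballI)
  have Os: "\<Omega> \<inter> space lebesgue \<in> sets lebesgue" using open_Omega by auto
  fix v assume v: "v \<in> X"
  have W: "weak_form_integrand s p u v = (\<lambda>z. signed_power (p z) (diff u z) * diff v z * kern z)"
    by (auto simp: weak_form_integrand_def signed_power_def diff_def kern_def fun_eq_iff)
  have l: "integrable lebesgue (\<lambda>x. \<bar>u x\<bar> powr (p (x, x) - 2) * u x * v x)"
    using L.integrable_dmodular[OF X_fin(2)[OF u] X_fin(2)[OF v]] by (simp add: signed_power_def)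
  have gi: "integrable lebesgue (\<lambda>x. g x (u x) * v x)" by (intro g_integrable XD u X_integrable v)
  have eq1: "AE x in lebesgue. indicator \<Omega> x *\<^sub>R (\<bar>u x\<bar> powr (p (x, x) - 2) * u x * v x) = \<bar>u x\<bar> powr (p (x, x) - 2) * u x * v x"
    using X_AE[OF v] by eventually_elim (auto simp: indicator_def)
  have eq2: "AE x in lebesgue. indicator \<Omega> x *\<^sub>R (f x (u x) * v x) = g x (u x) * v x"
    using agree by eventually_elim (auto simp: indicator_def g_out)
  have um: "(\<lambda>x. indicator \<Omega> x *\<^sub>R (\<bar>u x\<bar> powr (p (x, x) - 2) * u x * v x)) \<in> borel_measurable lebesgue"
    by (rule borel_measurable_lebesgue_AE_eq[OF borel_measurable_integrable[OF l] eq1])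
  have fm: "(\<lambda>x. indicator \<Omega> x *\<^sub>R (f x (u x) * v x)) \<in> borel_measurable lebesgue"
    by (rule borel_measurable_lebesgue_AE_eq[OF borel_measurable_integrable[OF gi] eq2])
  show "integrable (lebesgue \<Otimes>\<^sub>M lebesgue) (weak_form_integrand s p u v)"
    unfolding W by (intro G.integrable_dmodular X_fin u v)
  show "integrable (lebesgue_on \<Omega>) (\<lambda>x. \<bar>u x\<bar> powr (p (x, x) - 2) * u x * v x)"
    unfolding integrable_restrict_space[OF Os] by (rule integrable_cong_AE[OF um borel_measurable_integrable[OF l] eq1, THEN iffD2, OF l])
  show "integrable (lebesgue_on \<Omega>) (\<lambda>x. f x (u x) * v x)"
    unfolding integrable_restrict_space[OF Os] by (rule integrable_cong_AE[OF fm borel_measurable_integrable[OF gi] eq2, THEN iffD2, OF gi])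
  have "(\<integral>x. \<bar>u x\<bar> powr (p (x, x) - 2) * u x * v x \<partial>(lebesgue_on \<Omega>)) = L.dmodular u v"
    unfolding integral_restrict_space[OF Os] L.dmodular_def
    using integral_cong_AE[OF um borel_measurable_integrable[OF l] eq1] by (simp add: signed_power_def)
  moreover have "(\<integral>x. f x (u x) * v x \<partial>(lebesgue_on \<Omega>)) = dPhi u v"
    unfolding integral_restrict_space[OF Os] dPhi_def
    by (rule integral_cong_AE[OF fm borel_measurable_integrable[OF gi] eq2])
  moreover have "(\<integral>z. weak_form_integrand s p u v z \<partial>(lebesgue \<Otimes>\<^sub>M lebesgue)) = G.dmodular (diff u) (diff v)"
    unfolding W G.dmodular_def ..
  ultimately show "(\<integral>z. weak_form_integrand s p u v z \<partial>(lebesgue \<Otimes>\<^sub>M lebesgue))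
          + (\<integral>x. \<bar>u x\<bar> powr (p (x, x) - 2) * u x * v x \<partial>(lebesgue_on \<Omega>))
        = (\<integral>x. f x (u x) * v x \<partial>(lebesgue_on \<Omega>))"
    using crit[OF v] by (simp add: dE_def)
qed (rule u)

text \<open>Along the sequence of critical points the means tend to \<open>0\<close>, hence so do the suprema. After finitely many terms are dropped, all
  values lie in \<open>[-T/2, T/2]\<close>, where \<open>f\<close> and \<open>g\<close> agree. The negative level excludes \<open>u = 0\<close>.\<close>

theorem small_solutions:
  assumes s1: "s < 1" and ne: "\<Omega> \<noteq> {}"
    and superlin: "\<And>M. \<exists>\<delta>>0. AE x in lebesgue. x \<in> \<Omega> \<longrightarrow> (\<forall>t. \<bar>t\<bar> < \<delta> \<longrightarrow> M * \<bar>t\<bar> powr pl \<le> Gp x t)"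
    and AR: "AE x in lebesgue. x \<in> \<Omega> \<longrightarrow> (\<forall>t. t \<noteq> 0 \<longrightarrow> 0 < pl * Gp x t - g x t * t)"
    and agree: "AE x in lebesgue. x \<in> \<Omega> \<longrightarrow> (\<forall>t. \<bar>t\<bar> \<le> T / 2 \<longrightarrow> f x t = g x t)"
  shows "\<exists>u. (\<forall>n. weak_solution \<Omega> s p f (u n) \<and> \<not> (AE x in lebesgue. u n x = 0)) \<and>
      (\<lambda>n. Linf_norm \<Omega> (u n)) \<longlonglongrightarrow> 0"
proof -
  obtain U where U: "\<And>n. weakly_critical (U n)" "\<And>n. J (U n) < 0" "(\<lambda>n. \<integral>x. \<bar>U n x\<bar> \<partial>lebesgue) \<longlonglongrightarrow> 0"
    using vanishing_critical_sequence[OF negative_spheres[OF s1 ne superlin] AR] by blast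
  have UX: "U n \<in> X" for n using U(1) by (simp add: weakly_critical_def)
  have crit: "dE (U n) v = dPhi (U n) v" if "v \<in> X" for n v by (rule weakly_critical_equation[OF U(1) that])
  have small: "\<forall>\<^sub>F n in sequentially. AE x in lebesgue. \<bar>U n x\<bar> \<le> \<epsilon>" if "0 < \<epsilon>" for \<epsilon>
  proof -
    obtain \<theta> where th: "0 < \<theta>" "\<forall>u\<in>X. (\<forall>v\<in>X. dE u v = dPhi u v) \<longrightarrow> (\<integral>x. \<bar>u x\<bar> \<partial>lebesgue) \<le> \<theta> \<longrightarrow> (AE x in lebesgue. \<bar>u x\<bar> \<le> \<epsilon>)"
      using small_mean_small_abs[OF \<open>0 < \<epsilon>\<close>] by blast
    have "\<forall>\<^sub>F n in sequentially. (\<integral>x. \<bar>U n x\<bar> \<partial>lebesgue) < \<theta>" by (rule order_tendstoD(2)[OF U(3) th(1)])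
    then show ?thesis
      by eventually_elim (use th(2) UX crit in \<open>simp add: less_imp_le\<close>)
  qed
  obtain n0 where n0: "\<And>n. n0 \<le> n \<Longrightarrow> AE x in lebesgue. \<bar>U n x\<bar> \<le> T / 2"
    using small[of "T / 2"] T by (auto simp: eventually_sequentially)
  define u where "u n = U (n + n0)" for n
  have "weak_solution \<Omega> s p f (u n)" for n
  proof (rule weak_solution_transfer)
    show "u n \<in> X" "\<And>v. v \<in> X \<Longrightarrow> dE (u n) v = dPhi (u n) v" using UX crit by (simp_all add: u_def)
    have "AE x in lebesgue. \<bar>u n x\<bar> \<le> T / 2" unfolding u_def by (rule n0) simp
    then show "AE x in lebesgue. x \<in> \<Omega> \<longrightarrow> f x (u n x) = g x (u n x)"
      using agree by eventually_elim blast
  qed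
  moreover have "\<not> (AE x in lebesgue. u n x = 0)" for n
  proof
    assume "AE x in lebesgue. u n x = 0"
    then have "AE x in lebesgue. Gp x (u n x) = 0" by eventually_elim simp
    then have "Phi (u n) = 0" unfolding Phi_def by (rule integral_eq_zero_AE)
    then show False using U(2)[of "n + n0"] E_nonneg[of "u n"] by (simp add: J_def u_def)
  qed
  moreover have "(\<lambda>n. Linf_norm \<Omega> (u n)) \<longlonglongrightarrow> 0"
  proof (rule Linf_norm_tendsto_0[OF open_Omega ne])
    show "u n \<in> borel_measurable lebesgue" for n unfolding u_def by (rule XD[OF UX])
    show "\<forall>\<^sub>F n in sequentially. AE x in lebesgue. \<bar>u n x\<bar> \<le> \<epsilon>" if "0 < \<epsilon>" for \<epsilon>
      using small[OF that] unfolding u_def by (rule sequentially_offset)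
  qed
  ultimately show ?thesis by blast
qed

end

theorem theorem5p1:
  fixes \<Omega> :: "(real^'n) set"
    and s :: real
    and p :: "(real^'n) \<times> (real^'n) \<Rightarrow> real"
    and f :: "real^'n \<Rightarrow> real \<Rightarrow> real"
    and p_minus :: real
  assumes N: "CARD('n) \<ge> 2"
    and Omega: "bounded_lipschitz_domain \<Omega>"
    and s: "0 < s" "s < 1"
    and p_cont: "continuous_on UNIV p"
    and p_sym: "\<And>x y. p (x, y) = p (y, x)"
    and p_lower: "1 < (INF z. ereal (p z))"
    and p_upper: "(SUP z. ereal (p z)) < ereal (real CARD('n) / s)"
    and p_minus: "p_minus = (INF z. p z)"
    and p_log: "log_holder_cond p"
    and f_car: "caratheodory \<Omega> f"
    and F1: "\<exists>C>0. \<exists>q\<in>C_plus (closure \<Omega>).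
        (\<forall>x\<in>closure \<Omega>. q x < crit_exp s p x) \<and>
        (AE x in lebesgue_on \<Omega>. \<forall>t. \<bar>f x t\<bar> \<le> C * (1 + \<bar>t\<bar> powr (q x - 1)))"
    and F2: "\<exists>t\<^sub>0>0. AE x in lebesgue_on \<Omega>. \<forall>t. 0 < \<bar>t\<bar> \<and> \<bar>t\<bar> < t\<^sub>0 \<longrightarrow>
        f x (- t) = - f x t \<and> p_minus * primitive f x t - f x t * t > 0"
    and F3: "\<forall>M. \<exists>\<delta>>0. AE x in lebesgue_on \<Omega>. \<forall>t. 0 < \<bar>t\<bar> \<and> \<bar>t\<bar> < \<delta> \<longrightarrow>
        f x t / (\<bar>t\<bar> powr (p_minus - 2) * t) > M"
  shows "\<exists>u :: nat \<Rightarrow> real^'n \<Rightarrow> real.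
      (\<forall>n. weak_solution \<Omega> s p f (u n) \<and> \<not> (AE x in lebesgue. u n x = 0)) \<and>
      (\<lambda>n. Linf_norm \<Omega> (u n)) \<longlonglongrightarrow> 0"
proof -
  note s_less_1 = s(2)
  have O: "open \<Omega>" "bounded \<Omega>" "\<Omega> \<noteq> {}" using Omega by (auto simp: bounded_lipschitz_domain_def)
  have Os: "\<Omega> \<inter> space lebesgue \<in> sets lebesgue" using O(1) by auto
  note AE_on = AE_restrict_space_iff[OF Os]
  have pm: "1 < p_minus" "\<And>z. p_minus \<le> p z" "\<And>z. p z \<le> real CARD('n) / s"
    using exponent_bounds[OF p_lower p_upper] by (simp_all add: p_minus)
  obtain C q where C: "0 < C" "q \<in> C_plus (closure \<Omega>)"
    and f_bd: "AE x in lebesgue_on \<Omega>. \<forall>t. \<bar>f x t\<bar> \<le> C * (1 + \<bar>t\<bar> powr (q x - 1))" using F1 by blast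
  obtain t0 where t0: "0 < t0" and f2: "AE x in lebesgue_on \<Omega>. \<forall>t. 0 < \<bar>t\<bar> \<and> \<bar>t\<bar> < t0 \<longrightarrow>
        f x (- t) = - f x t \<and> p_minus * primitive f x t - f x t * t > 0" using F2 by blast
  obtain \<delta>1 where d1: "0 < \<delta>1" and f3: "AE x in lebesgue_on \<Omega>. \<forall>t. 0 < \<bar>t\<bar> \<and> \<bar>t\<bar> < \<delta>1 \<longrightarrow>
        f x t / (\<bar>t\<bar> powr (p_minus - 2) * t) > 0" using F3 by blast
  \<comment> \<open>the bound \<open>1\<close> makes the growth condition a plain bound, whatever the exponent\<close>
  define T where "T = min 1 (min t0 \<delta>1)"
  have T: "0 < T" "T \<le> 1" "T \<le> t0" "T \<le> \<delta>1" using t0 d1 by (auto simp: T_def)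
  note T_le = T(3)
  define good where "good x \<longleftrightarrow> continuous_on UNIV (f x)
    \<and> (\<forall>t. \<bar>f x t\<bar> \<le> C * (1 + \<bar>t\<bar> powr (q x - 1)))
    \<and> (\<forall>t. 0 < \<bar>t\<bar> \<and> \<bar>t\<bar> < t0 \<longrightarrow> f x (- t) = - f x t \<and> p_minus * primitive f x t - f x t * t > 0)
    \<and> (\<forall>t. 0 < \<bar>t\<bar> \<and> \<bar>t\<bar> < \<delta>1 \<longrightarrow> f x t / (\<bar>t\<bar> powr (p_minus - 2) * t) > 0)" for x
  have "AE x in lebesgue_on \<Omega>. continuous_on UNIV (f x)" using f_car by (simp add: caratheodory_def)
  then have "AE x in lebesgue_on \<Omega>. good x" using f_bd f2 f3 unfolding good_def by eventually_elim blast
  then have "AE x in lebesgue. x \<in> \<Omega> \<longrightarrow> good x" unfolding AE_on .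
  then obtain Z where Z: "Z \<in> null_sets lebesgue" "{x \<in> space lebesgue. \<not> (x \<in> \<Omega> \<longrightarrow> good x)} \<subseteq> Z"
    unfolding eventually_ae_filter by blast
  \<comment> \<open>the truncation is set to \<open>0\<close> outside \<open>S\<close>, so that it has all its properties at every point\<close>
  define S where "S = \<Omega> - Z"
  have S: "S \<in> sets lebesgue" unfolding S_def using O(1) Z(1) by auto
  have SO: "S \<subseteq> \<Omega>" by (auto simp: S_def)
  have Sg: "good x" if "x \<in> S" for x using that Z(2) by (auto simp: S_def)
  have AES: "AE x in lebesgue. x \<in> \<Omega> \<longrightarrow> x \<in> S"
    using AE_not_in[OF Z(1)] by eventually_elim (simp add: S_def)
  have fpos: "0 < f x t" if x: "x \<in> S" and t: "0 < t" "t < T" for x t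
  proof -
    have "0 < \<bar>t\<bar> \<and> \<bar>t\<bar> < \<delta>1" using t T by auto
    then have "f x t / (\<bar>t\<bar> powr (p_minus - 2) * t) > 0" using Sg[OF x] unfolding good_def by blast
    moreover have "0 < \<bar>t\<bar> powr (p_minus - 2) * t" using t by simp
    ultimately show ?thesis by (simp add: pos_less_divide_eq)
  qed
  have fodd: "f x (- t) = - f x t" if x: "x \<in> S" and t: "\<bar>t\<bar> < T" for x t
  proof (cases "t = 0")
    case True
    have "f x 0 = 0"
      by (rule odd_near_zero_imp_zero[of "f x" t0]) (use Sg[OF x] t0 in \<open>auto simp: good_def\<close>)
    then show ?thesis using True by simp
  next
    case False
    then have "0 < \<bar>t\<bar> \<and> \<bar>t\<bar> < t0" using t T by auto
    then show ?thesis using Sg[OF x] unfolding good_def by blast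
  qed
  define g where "g x t = (if x \<in> S then f x t * cutoff T t else 0)" for x t
  have gS: "g x = (\<lambda>t. f x t * cutoff T t)" if "x \<in> S" for x using that by (auto simp: g_def)
  have gc: "continuous_on UNIV (g x)" for x
  proof (cases "x \<in> S")
    case True
    then have "continuous_on UNIV (f x)" using Sg by (simp add: good_def)
    then show ?thesis unfolding gS[OF True] by (intro continuous_intros cutoff_continuous T)
  qed (simp add: g_def)
  have godd: "g x (- t) = - g x t" for x t
    using fodd[of x t] cutoff_props(3,5)[OF T(1), of t] by (cases "\<bar>t\<bar> < T") (auto simp: g_def)
  interpret truncated s p p_minus "real CARD('n) / s" \<Omega> g "2 * C" T
  proof
    show "(\<lambda>x. g x t) \<in> borel_measurable lebesgue" for t
    proof -
      have "(\<lambda>x. f x t) \<in> borel_measurable (lebesgue_on \<Omega>)" using f_car by (simp add: caratheodory_def)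
      then have "(\<lambda>x. indicator \<Omega> x *\<^sub>R f x t) \<in> borel_measurable lebesgue"
        by (subst (asm) borel_measurable_restrict_space_iff[OF Os])
      moreover have "(indicator S :: _ \<Rightarrow> real) \<in> borel_measurable lebesgue" using S by simp
      ultimately have "(\<lambda>x. indicator S x * (indicator \<Omega> x *\<^sub>R f x t) * cutoff T t) \<in> borel_measurable lebesgue"
        by (intro borel_measurable_times borel_measurable_const)
      also have "(\<lambda>x. indicator S x * (indicator \<Omega> x *\<^sub>R f x t) * cutoff T t) = (\<lambda>x. g x t)"
        using SO by (auto simp: g_def indicator_def fun_eq_iff)
      finally show ?thesis .
    qed
    show "\<bar>g x t\<bar> \<le> 2 * C" for x t
    proof (cases "x \<in> S \<and> \<bar>t\<bar> < T")
      case True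
      have "x \<in> closure \<Omega>" using True SO closure_subset by blast
      then have "1 < q x" by (rule C_plus_gt_1[OF C(2)])
      then have "\<bar>t\<bar> powr (q x - 1) \<le> 1" using True T by (intro powr_le1) auto
      then have "C * (1 + \<bar>t\<bar> powr (q x - 1)) \<le> C * 2" using C(1) by (intro mult_left_mono) auto
      moreover have "\<bar>f x t\<bar> \<le> C * (1 + \<bar>t\<bar> powr (q x - 1))" using True Sg unfolding good_def by blast
      ultimately have "\<bar>f x t\<bar> \<le> C * 2" by linarith
      then have "\<bar>f x t\<bar> * cutoff T t \<le> (C * 2) * 1" using C(1) cutoff_props[OF T(1), of t] by (intro mult_mono) auto
      then show ?thesis using True cutoff_props(1)[OF T(1), of t] by (simp add: g_def abs_mult)
    next
      case False
      then have "g x t = 0" using cutoff_props(5)[OF T(1), of t] by (auto simp: g_def)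
      then show ?thesis using C(1) by simp
    qed
    show "g x t = 0" if "T \<le> \<bar>t\<bar>" for x t using cutoff_props(5)[OF T(1) that] by (simp add: g_def)
    show "g x t = 0" if "x \<notin> \<Omega>" for x t using that SO by (auto simp: g_def)
  qed (use s p_cont pm O T gc godd in auto)
  show ?thesis
  proof (rule small_solutions[OF s_less_1 O(3)])
    fix M
    obtain \<delta>2 where d2: "0 < \<delta>2" and f3M: "AE x in lebesgue_on \<Omega>. \<forall>t. 0 < \<bar>t\<bar> \<and> \<bar>t\<bar> < \<delta>2 \<longrightarrow>
        f x t / (\<bar>t\<bar> powr (p_minus - 2) * t) > M * p_minus" using F3 by blast
    show "\<exists>\<delta>>0. AE x in lebesgue. x \<in> \<Omega> \<longrightarrow> (\<forall>t. \<bar>t\<bar> < \<delta> \<longrightarrow> M * \<bar>t\<bar> powr p_minus \<le> Gp x t)"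
    proof (intro exI[of _ "min \<delta>2 (T / 2)"] conjI)
      show "0 < min \<delta>2 (T / 2)" using d2 T by simp
      show "AE x in lebesgue. x \<in> \<Omega> \<longrightarrow> (\<forall>t. \<bar>t\<bar> < min \<delta>2 (T / 2) \<longrightarrow> M * \<bar>t\<bar> powr p_minus \<le> Gp x t)"
        using AES f3M[unfolded AE_on]
      proof eventually_elim
        case (elim x)
        show ?case
        proof (intro impI allI)
          fix t assume x: "x \<in> \<Omega>" and t: "\<bar>t\<bar> < min \<delta>2 (T / 2)"
          have xS: "x \<in> S" using elim(1) x by blast
          show "M * \<bar>t\<bar> powr p_minus \<le> Gp x t"
            unfolding Gp_def
          proof (rule truncated_superlinear[OF T(1) pm(1) gc godd _ t])
            fix r assume r: "0 < r" "r < min \<delta>2 (T / 2)"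
            have "0 < \<bar>r\<bar> \<and> \<bar>r\<bar> < \<delta>2" using r by auto
            then have "M * p_minus < f x r / (\<bar>r\<bar> powr (p_minus - 2) * r)" using elim(2) x by blast
            moreover have "\<bar>r\<bar> powr (p_minus - 2) * r = r powr (p_minus - 1)"
              using abs_signed_power[of p_minus r] r by (simp add: signed_power_def abs_mult)
            ultimately have "M * p_minus * r powr (p_minus - 1) < f x r" using r by (simp add: pos_less_divide_eq)
            then show "M * p_minus * r powr (p_minus - 1) \<le> g x r"
              using xS r cutoff_props(4)[OF T(1), of r] by (simp add: g_def)
          qed
        qed
      qed
    qed
  next
    show "AE x in lebesgue. x \<in> \<Omega> \<longrightarrow> (\<forall>t. t \<noteq> 0 \<longrightarrow> 0 < p_minus * Gp x t - g x t * t)"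
      using AES
    proof eventually_elim
      case (elim x)
      show ?case
      proof (intro impI allI)
        fix t :: real assume x: "x \<in> \<Omega>" and t: "t \<noteq> 0"
        have xS: "x \<in> S" using elim x by blast
        show "0 < p_minus * Gp x t - g x t * t"
          unfolding Gp_def
        proof (rule truncated_subhomogeneous[where f = f and g = g and x = x and T = T, OF T(1) _ _ _ godd _ _ t])
          show "0 < p_minus" using pm(1) by simp
          show "continuous_on UNIV (f x)" using Sg[OF xS] by (simp add: good_def)
          show "g x t = f x t * cutoff T t" for t using gS[OF xS] by simp
          show "0 < p_minus * primitive f x t - f x t * t" if t: "0 < \<bar>t\<bar>" "\<bar>t\<bar> < T" for t
          proof -
            have "0 < \<bar>t\<bar> \<and> \<bar>t\<bar> < t0" using t T_le by auto
            then show ?thesis using Sg[OF xS] unfolding good_def by blast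
          qed
          show "0 < f x t" if "0 < t" "t < T" for t by (rule fpos[OF xS that])
        qed
      qed
    qed
  next
    show "AE x in lebesgue. x \<in> \<Omega> \<longrightarrow> (\<forall>t. \<bar>t\<bar> \<le> T / 2 \<longrightarrow> f x t = g x t)"
      using AES by eventually_elim (auto simp: g_def cutoff_props(4)[OF T(1)])
  qed
qed

end
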